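(* Let $n\ge1$, let $p,q$ be positive integers, $N=p+q$, $\mu\in\mathbb{C}$, and let $V^\xi$ be a finite-dimensional irreducible $\mathfrak{gl}_N$-module such that $F_{n,p,\mu}(V^\xi)\neq0$. Then the image $F_{n,p,\mu}(V^\xi)$ of $V^\xi$ under the Etingof-Freund-Ma functor is an irreducible representation of $H_n(1,p-q-\mu N)$.
   Context: $H_n(\kappa_1,\kappa_2)$ is the $\mathbb{C}$-algebra generated by $s_1,\dots,s_{n-1},s_n=\gamma_n$ and $y_1,\dots,y_n$ with relations: $s_i^2=1$; $s_is_{i+1}s_i=s_{i+1}s_is_{i+1}$ for $1\le i\le n-2$; $s_{n-1}s_ns_{n-1}s_n=s_ns_{n-1}s_ns_{n-1}$; $s_is_j=s_js_i$ for $|i-j|>1$; $y_iy_j=y_jy_i$; $s_iy_j=y_js_i$ for $j\ne i,i+1$; $s_iy_i-y_{i+1}s_i=\kappa_1$ for $1\le i\le n-1$; $\gamma_ny_n+y_n\gamma_n=\kappa_2$. $V=\mathbb{C}^N$ is the vector representation of $\mathfrak{gl}_N$. $\mathfrak{t}=\mathfrak{gl}_p\times\mathfrak{gl}_q$ (block diagonal), $\mathfrak{t}_0\subset\mathfrak{t}$ the traceless elements, $\chi(\mathrm{diag}(S,T))=q\,\mathrm{tr}(S)-p\,\mathrm{tr}(T)$. For a $\mathfrak{gl}_N$-module $M$, the Etingof-Freund-Ma functor is $F_{n,p,\mu}(M)=\{v\in M\otimes V^{\otimes n}: Av=\mu\chi(A)v\ \forall A\in\mathfrak{t}_0\}$,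 a representation of $H_n(1,p-q-\mu N)$ via: $s_i$ ($1\le i\le n-1$) exchanges the $i$-th and $(i+1)$-th tensor factors ($M$ being the $0$-th factor); $\gamma_n$ multiplies the $n$-th factor by $J=\mathrm{diag}(I_p,-I_q)$ (and $\gamma_k$ multiplies the $k$-th factor by $J$); $$y_1=-\sum_{s|t}(E_s^t)_0\otimes(E_t^s)_1+\frac{p-q-\mu N}{2}\gamma_1+\frac12\sum_{l>1}s_{1,l}+\frac12\sum_{l>1}s_{1,l}\gamma_1\gamma_l,$$ with $E_s^t$ the matrix unit with $(s,t)$ entry $1$, subscripts indicating the tensor factor, $s_{1,l}$ exchanging factors $1$ and $l$, $\sum_{s|t}=\sum_{s=1}^p\sum_{t=p+1}^N+\sum_{t=1}^p\sum_{s=p+1}^N$; and $y_k=s_{k-1}y_{k-1}s_{k-1}-s_{k-1}$ for $k\ge2$. *)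

theory Defs
  imports
    "HOL-Library.Poly_Mapping"
    "HOL-Library.Function_Algebras"
    "HOL-Library.FuncSet"
    "HOL-Combinatorics.Transposition"
    "HOL-Algebra.QuotRing"
    "Jordan_Normal_Form.Matrix"
begin

section \<open>Algebras by generators and relations\<close>

text \<open>The free monoid on a set of letters, written additively so that \<^typ>\<open>'k \<Rightarrow>\<^sub>0 complex\<close>
  with its convolution product is the free (noncommutative) associative algebra.\<close>

datatype 'g fword = Word (letters: "'g list")

instantiation fword :: (type) monoid_add
begin

definition zero_fword_def: "0 = Word []"
definition plus_fword_def: "u + v = Word (letters u @ letters v)"

instance
  by standard (simp_all add: zero_fword_def plus_fword_def)

end

definition free_algebra :: "'g set \<Rightarrow> ('g fword \<Rightarrow>\<^sub>0 complex) ring" where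
  "free_algebra G =
     \<lparr>carrier = {f. \<forall>w \<in> Poly_Mapping.keys f. set (letters w) \<subseteq> G},
      monoid.mult = (*), one = 1, zero = 0, add = (+)\<rparr>"

definition letter :: "'g \<Rightarrow> 'g fword \<Rightarrow>\<^sub>0 complex" where
  "letter g = Poly_Mapping.single (Word [g]) 1"

definition const :: "complex \<Rightarrow> 'g fword \<Rightarrow>\<^sub>0 complex" where
  "const c = Poly_Mapping.single 0 c"

lemma ring_free_algebra: "ring (free_algebra G)"
proof -
  let ?C = "carrier (free_algebra G)"
  have add: "f + g \<in> ?C" if "f \<in> ?C" "g \<in> ?C" for f g
    using that Poly_Mapping.keys_add[of f g] unfolding free_algebra_def by fastforce
  have mult: "f * g \<in> ?C" if "f \<in> ?C" "g \<in> ?C" for f g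
    using that Poly_Mapping.keys_mult[of f g] unfolding free_algebra_def
    by (fastforce simp: plus_fword_def)
  have uminus: "- f \<in> ?C" if "f \<in> ?C" for f
    using that by (simp add: free_algebra_def in_keys_iff)
  have zero: "0 \<in> ?C" and one: "1 \<in> ?C"
    by (simp_all add: free_algebra_def zero_fword_def)
  have ops: "f \<oplus>\<^bsub>free_algebra G\<^esub> g = f + g" "f \<otimes>\<^bsub>free_algebra G\<^esub> g = f * g"
    "\<zero>\<^bsub>free_algebra G\<^esub> = 0" "\<one>\<^bsub>free_algebra G\<^esub> = 1" for f g
    by (simp_all add: free_algebra_def)
  show ?thesis
  proof (rule ringI)
    show "abelian_group (free_algebra G)"
    proof (rule abelian_groupI)
      fix f assume "f \<in> ?C"
      then have "- f \<in> ?C \<and> - f \<oplus>\<^bsub>free_algebra G\<^esub> f = \<zero>\<^bsub>free_algebra G\<^esub>"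
        using uminus by (simp add: ops)
      then show "\<exists>g \<in> ?C. g \<oplus>\<^bsub>free_algebra G\<^esub> f = \<zero>\<^bsub>free_algebra G\<^esub>"
        by blast
    qed (simp_all add: ops add zero add.assoc add.commute)
    show "monoid (free_algebra G)"
      by (rule monoidI) (simp_all add: ops mult one mult.assoc)
  qed (simp_all add: ops distrib_left distrib_right)
qed

section \<open>The algebra \<open>H\<^sub>n(\<kappa>\<^sub>1, \<kappa>\<^sub>2)\<close>\<close>

datatype daha_gen = GenS nat | GenY nat

definition daha_gens :: "nat \<Rightarrow> daha_gen set" where
  "daha_gens n = GenS ` {1..n} \<union> GenY ` {1..n}"

text \<open>A relation \<open>a = b\<close> is recorded as the element \<open>a - b\<close> of the free algebra.\<close>

definition daha_relations ::
  "nat \<Rightarrow> complex \<Rightarrow> complex \<Rightarrow> (daha_gen fword \<Rightarrow>\<^sub>0 complex) set" where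
  "daha_relations n \<kappa>1 \<kappa>2 =
    (let s = (\<lambda>i. letter (GenS i)); y = (\<lambda>i. letter (GenY i)) in
      {s i * s i - 1 | i. i \<in> {1..n}}
    \<union> {s i * s (i+1) * s i - s (i+1) * s i * s (i+1) | i. 1 \<le> i \<and> i + 2 \<le> n}
    \<union> (if 2 \<le> n then {s (n-1) * s n * s (n-1) * s n - s n * s (n-1) * s n * s (n-1)} else {})
    \<union> {s i * s j - s j * s i | i j. i \<in> {1..n} \<and> j \<in> {1..n} \<and> (i + 1 < j \<or> j + 1 < i)}
    \<union> {y i * y j - y j * y i | i j. i \<in> {1..n} \<and> j \<in> {1..n}}
    \<union> {s i * y j - y j * s i | i j. i \<in> {1..n} \<and> j \<in> {1..n} \<and> j \<noteq> i \<and> j \<noteq> i + 1}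
    \<union> {s i * y i - y (i+1) * s i - const \<kappa>1 | i. 1 \<le> i \<and> i + 1 \<le> n}
    \<union> {s n * y n + y n * s n - const \<kappa>2})"

definition daha :: "nat \<Rightarrow> complex \<Rightarrow> complex \<Rightarrow> (daha_gen fword \<Rightarrow>\<^sub>0 complex) set ring" where
  "daha n \<kappa>1 \<kappa>2 = free_algebra (daha_gens n) Quot
      (Idl\<^bsub>free_algebra (daha_gens n)\<^esub> (daha_relations n \<kappa>1 \<kappa>2))"

definition daha_class ::
  "nat \<Rightarrow> complex \<Rightarrow> complex \<Rightarrow> (daha_gen fword \<Rightarrow>\<^sub>0 complex) \<Rightarrow> (daha_gen fword \<Rightarrow>\<^sub>0 complex) set" where
  "daha_class n \<kappa>1 \<kappa>2 f =
     (Idl\<^bsub>free_algebra (daha_gens n)\<^esub> (daha_relations n \<kappa>1 \<kappa>2)) +>\<^bsub>free_algebra (daha_gens n)\<^esub> f"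

lemma daha_relations_closed:
  assumes "n \<ge> 1"
  shows "daha_relations n \<kappa>1 \<kappa>2 \<subseteq> carrier (free_algebra (daha_gens n))"
proof -
  let ?C = "carrier (free_algebra (daha_gens n))"
  interpret ring "free_algebra (daha_gens n)" by (rule ring_free_algebra)
  have add: "f + g \<in> ?C" if "f \<in> ?C" "g \<in> ?C" for f g
    using a_closed[OF that] by (simp add: free_algebra_def)
  have mult: "f * g \<in> ?C" if "f \<in> ?C" "g \<in> ?C" for f g
    using m_closed[OF that] by (simp add: free_algebra_def)
  have uminus: "- f \<in> ?C" if "f \<in> ?C" for f
    using that by (simp add: free_algebra_def in_keys_iff)
  have diff: "f - g \<in> ?C" if "f \<in> ?C" "g \<in> ?C" for f g
    using add[OF that(1) uminus[OF that(2)]] by simp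
  have one: "1 \<in> ?C" using one_closed by (simp add: free_algebra_def)
  have s: "letter (GenS i) \<in> ?C" and y: "letter (GenY i) \<in> ?C" if "1 \<le> i" "i \<le> n" for i
    using that by (auto simp: free_algebra_def letter_def daha_gens_def)
  have c: "const c \<in> ?C" for c
    by (simp add: free_algebra_def const_def zero_fword_def)
  show ?thesis
    unfolding daha_relations_def Let_def
    using assms by (auto intro!: diff add mult one s y c)
qed

lemma ring_daha: "n \<ge> 1 \<Longrightarrow> ring (daha n \<kappa>1 \<kappa>2)"
  unfolding daha_def
  by (intro ideal.quotient_is_ring ring.genideal_ideal ring_free_algebra daha_relations_closed)

section \<open>Modules\<close>

locale complex_vector_space = vector_space scale
  for scale :: "complex \<Rightarrow> 'v::ab_group_add \<Rightarrow> 'v"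

text \<open>Representation of a \<open>\<complex>\<close>-algebra on the subspace \<open>U\<close> of an ambient space; the
  \<open>\<complex>\<close>-algebra is a ring \<open>A\<close> with structure map \<open>\<iota>\<close> from \<open>\<complex>\<close>.\<close>

locale algebra_representation = complex_vector_space scale
  for scale :: "complex \<Rightarrow> 'v::ab_group_add \<Rightarrow> 'v" +
  fixes A :: "('a, 'r) ring_scheme" and \<iota> :: "complex \<Rightarrow> 'a"
    and U :: "'v set" and \<Phi> :: "'a \<Rightarrow> 'v \<Rightarrow> 'v"
  assumes subspace_U: "subspace U"
    and closed: "a \<in> carrier A \<Longrightarrow> v \<in> U \<Longrightarrow> \<Phi> a v \<in> U"
    and add_vector: "a \<in> carrier A \<Longrightarrow> v \<in> U \<Longrightarrow> w \<in> U \<Longrightarrow> \<Phi> a (v + w) = \<Phi> a v + \<Phi> a w"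
    and scale_vector: "a \<in> carrier A \<Longrightarrow> v \<in> U \<Longrightarrow> \<Phi> a (scale c v) = scale c (\<Phi> a v)"
    and add_algebra: "a \<in> carrier A \<Longrightarrow> b \<in> carrier A \<Longrightarrow> v \<in> U \<Longrightarrow>
          \<Phi> (a \<oplus>\<^bsub>A\<^esub> b) v = \<Phi> a v + \<Phi> b v"
    and mult_algebra: "a \<in> carrier A \<Longrightarrow> b \<in> carrier A \<Longrightarrow> v \<in> U \<Longrightarrow>
          \<Phi> (a \<otimes>\<^bsub>A\<^esub> b) v = \<Phi> a (\<Phi> b v)"
    and one_algebra: "v \<in> U \<Longrightarrow> \<Phi> \<one>\<^bsub>A\<^esub> v = v"
    and scalar_algebra: "v \<in> U \<Longrightarrow> \<Phi> (\<iota> c) v = scale c v"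

text \<open>The Lie algebra \<open>\<gg>\<ll>\<^sub>N\<close> is \<^term>\<open>carrier_mat N N\<close> with the commutator; the module is the
  whole type.\<close>

locale gl_module = complex_vector_space scale
  for N :: nat and scale :: "complex \<Rightarrow> 'm::ab_group_add \<Rightarrow> 'm" +
  fixes \<rho> :: "complex mat \<Rightarrow> 'm \<Rightarrow> 'm"
  assumes linear_vector: "A \<in> carrier_mat N N \<Longrightarrow> Vector_Spaces.linear scale scale (\<rho> A)"
    and add_matrix: "A \<in> carrier_mat N N \<Longrightarrow> B \<in> carrier_mat N N \<Longrightarrow>
          \<rho> (A + B) m = \<rho> A m + \<rho> B m"
    and scale_matrix: "A \<in> carrier_mat N N \<Longrightarrow> \<rho> (c \<cdot>\<^sub>m A) m = scale c (\<rho> A m)"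
    and bracket: "A \<in> carrier_mat N N \<Longrightarrow> B \<in> carrier_mat N N \<Longrightarrow>
          \<rho> (A * B - B * A) m = \<rho> A (\<rho> B m) - \<rho> B (\<rho> A m)"

text \<open>Irreducibility of the space \<open>U\<close> under a set of operators: in both uses the operators are
  those by which the whole algebra (resp. Lie algebra) acts.\<close>

definition irreducible_under ::
  "(complex \<Rightarrow> 'v::ab_group_add \<Rightarrow> 'v) \<Rightarrow> 'v set \<Rightarrow> ('v \<Rightarrow> 'v) set \<Rightarrow> bool" where
  "irreducible_under scale U T \<longleftrightarrow>
     U \<noteq> {0} \<and>
     (\<forall>W. module.subspace scale W \<and> W \<subseteq> U \<and> (\<forall>t \<in> T. t ` W \<subseteq> W) \<longrightarrow> W = {0} \<or> W = U)"

definition finite_dimensional :: "(complex \<Rightarrow> 'v::ab_group_add \<Rightarrow> 'v) \<Rightarrow> bool" where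
  "finite_dimensional scale \<longleftrightarrow> (\<exists>B. finite_dimensional_vector_space scale B)"

section \<open>The space \<open>M \<otimes> V\<^sup>\<otimes>\<^sup>n\<close>\<close>

text \<open>Let \<open>e\<^sub>0, e\<^sub>1, \<dots>\<close> be the standard basis of \<open>V = \<complex>\<^sup>N\<close> (matrix and vector indices start
  at \<open>0\<close>, tensor factors are numbered \<open>1, \<dots>, n\<close>). Every element of \<open>M \<otimes> V\<^sup>\<otimes>\<^sup>n\<close> is uniquely
  \<open>\<Sum>\<^sub>w f(w) \<otimes> e\<^bsub>w(1)\<^esub> \<otimes> \<dots> \<otimes> e\<^bsub>w(n)\<^esub>\<close> with \<open>w\<close> ranging over maps
  \<open>{1..n} \<rightarrow> {0..<N}\<close> and \<open>f(w) \<in> M\<close>; it is represented by the coefficient function \<open>f\<close>.\<close>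

type_synonym 'm tensor = "(nat \<Rightarrow> nat) \<Rightarrow> 'm"

definition multi_indices :: "nat \<Rightarrow> nat \<Rightarrow> (nat \<Rightarrow> nat) set" where
  "multi_indices N n = {1..n} \<rightarrow>\<^sub>E {..<N}"

definition tensor_space :: "nat \<Rightarrow> nat \<Rightarrow> 'm::zero tensor set" where
  "tensor_space N n = {f. \<forall>w. w \<notin> multi_indices N n \<longrightarrow> f w = 0}"

definition tscale :: "(complex \<Rightarrow> 'm \<Rightarrow> 'm) \<Rightarrow> complex \<Rightarrow> 'm tensor \<Rightarrow> 'm tensor" where
  "tscale scale c f = (\<lambda>w. scale c (f w))"

definition pure_tensor ::
  "nat \<Rightarrow> nat \<Rightarrow> (complex \<Rightarrow> 'm::zero \<Rightarrow> 'm) \<Rightarrow> 'm \<Rightarrow> (nat \<Rightarrow> complex vec) \<Rightarrow> 'm tensor" where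
  "pure_tensor N n scale m x =
     (\<lambda>w. if w \<in> multi_indices N n then scale (\<Prod>k\<in>{1..n}. x k $ w k) m else 0)"

definition on_zeroth :: "('m \<Rightarrow> 'm) \<Rightarrow> 'm tensor \<Rightarrow> 'm tensor" where
  "on_zeroth T f = (\<lambda>w. T (f w))"

definition on_factor ::
  "nat \<Rightarrow> nat \<Rightarrow> (complex \<Rightarrow> 'm::ab_group_add \<Rightarrow> 'm) \<Rightarrow> nat \<Rightarrow> complex mat \<Rightarrow> 'm tensor \<Rightarrow> 'm tensor" where
  "on_factor N n scale k A f =
     (\<lambda>w. if w \<in> multi_indices N n then \<Sum>j<N. scale (A $$ (w k, j)) (f (w(k := j))) else 0)"

definition exchange :: "nat \<Rightarrow> nat \<Rightarrow> 'm tensor \<Rightarrow> 'm tensor" where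
  "exchange k l f = (\<lambda>w. f (w \<circ> transpose k l))"

subsection \<open>These operators on pure tensors\<close>

lemma finite_multi_indices: "finite (multi_indices N n)"
  unfolding multi_indices_def by (intro finite_PiE) auto

lemma transpose_in_multi_indices:
  assumes "k \<in> {1..n}" "l \<in> {1..n}" "w \<in> multi_indices N n"
  shows "w \<circ> transpose k l \<in> multi_indices N n"
  using assms unfolding multi_indices_def
  by (auto simp: PiE_iff extensional_def transpose_def)

lemma transpose_in_multi_indices_iff:
  assumes "k \<in> {1..n}" "l \<in> {1..n}"
  shows "w \<circ> transpose k l \<in> multi_indices N n \<longleftrightarrow> w \<in> multi_indices N n"
  using transpose_in_multi_indices[OF assms, of w N]
    transpose_in_multi_indices[OF assms, of "w \<circ> transpose k l" N]
  by (auto simp: comp_assoc)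

context complex_vector_space
begin

lemma vector_space_tscale: "vector_space (tscale scale)"
  by standard (simp_all add: tscale_def fun_eq_iff scale_right_distrib scale_left_distrib)

lemma on_zeroth_pure_tensor:
  assumes "Vector_Spaces.linear scale scale T"
  shows "on_zeroth T (pure_tensor N n scale m x) = pure_tensor N n scale (T m) x"
proof -
  interpret Vector_Spaces.linear scale scale T by (rule assms)
  show ?thesis by (simp add: on_zeroth_def pure_tensor_def fun_eq_iff scale zero)
qed

lemma on_factor_pure_tensor:
  assumes A: "A \<in> carrier_mat N N" and k: "k \<in> {1..n}" and x: "x k \<in> carrier_vec N"
  shows "on_factor N n scale k A (pure_tensor N n scale m x) =
         pure_tensor N n scale m (x(k := A *\<^sub>v x k))"
proof
  fix w
  show "on_factor N n scale k A (pure_tensor N n scale m x) w =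
        pure_tensor N n scale m (x(k := A *\<^sub>v x k)) w"
  proof (cases "w \<in> multi_indices N n")
    case True
    let ?R = "{1..n} - {k}"
    have wk: "w k < N" using True k by (auto simp: multi_indices_def PiE_iff)
    have upd: "w(k := j) \<in> multi_indices N n" if "j < N" for j
      using True k that by (auto simp: multi_indices_def PiE_iff extensional_def)
    have split: "(\<Prod>i\<in>{1..n}. g i) = g k * (\<Prod>i\<in>?R. g i)" for g :: "nat \<Rightarrow> complex"
      using k by (simp add: prod.remove)
    have rest: "(\<Prod>i\<in>?R. x i $ (w(k := j)) i) = (\<Prod>i\<in>?R. x i $ w i)" for j
      by (rule prod.cong) auto
    have rest': "(\<Prod>i\<in>?R. (x(k := A *\<^sub>v x k)) i $ w i) = (\<Prod>i\<in>?R. x i $ w i)"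
      by (rule prod.cong) auto
    have ent: "(A *\<^sub>v x k) $ w k = (\<Sum>j<N. A $$ (w k, j) * x k $ j)"
      using A x wk by (simp add: scalar_prod_def atLeast0LessThan)
    have pt: "pure_tensor N n scale m x (w(k := j)) = scale (x k $ j * (\<Prod>i\<in>?R. x i $ w i)) m"
      if "j < N" for j
      unfolding pure_tensor_def split rest using upd[OF that] by simp
    have "on_factor N n scale k A (pure_tensor N n scale m x) w =
        (\<Sum>j<N. scale (A $$ (w k, j)) (scale (x k $ j * (\<Prod>i\<in>?R. x i $ w i)) m))"
      using True pt by (simp add: on_factor_def)
    also have "\<dots> = scale (\<Sum>j<N. A $$ (w k, j) * (x k $ j * (\<Prod>i\<in>?R. x i $ w i))) m"
      by (simp add: scale_sum_left)
    also have "\<dots> = scale ((A *\<^sub>v x k) $ w k * (\<Prod>i\<in>?R. x i $ w i)) m"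
      by (simp add: ent sum_distrib_right mult.assoc)
    also have "\<dots> = pure_tensor N n scale m (x(k := A *\<^sub>v x k)) w"
      unfolding pure_tensor_def split rest' using True by simp
    finally show ?thesis .
  qed (simp add: on_factor_def pure_tensor_def)
qed

lemma exchange_pure_tensor:
  assumes "k \<in> {1..n}" "l \<in> {1..n}"
  shows "exchange k l (pure_tensor N n scale m x) =
         pure_tensor N n scale m (x \<circ> transpose k l)"
proof
  fix w
  have "(\<Prod>i\<in>{1..n}. x i $ w (transpose k l i)) = (\<Prod>i\<in>{1..n}. x (transpose k l i) $ w i)"
    by (rule prod.reindex_bij_witness[of _ "transpose k l" "transpose k l"])
      (use assms in \<open>auto simp: transpose_def split: if_splits\<close>)
  then show "exchange k l (pure_tensor N n scale m x) w =
             pure_tensor N n scale m (x \<circ> transpose k l) w"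
    using transpose_in_multi_indices_iff[OF assms, of w N]
    by (simp add: exchange_def pure_tensor_def o_def)
qed

lemma tensor_expansion:
  assumes "f \<in> tensor_space N n"
  shows "f = (\<Sum>w\<in>multi_indices N n. pure_tensor N n scale (f w) (\<lambda>k. unit_vec N (w k)))"
proof
  fix u
  have "(\<Sum>w\<in>multi_indices N n. pure_tensor N n scale (f w) (\<lambda>k. unit_vec N (w k))) u =
        (\<Sum>w\<in>multi_indices N n. pure_tensor N n scale (f w) (\<lambda>k. unit_vec N (w k)) u)"
    using finite_multi_indices[of N n] by (induction rule: finite_induct) auto
  also have "\<dots> = (\<Sum>w\<in>multi_indices N n. if w = u then f u else 0)"
  proof (rule sum.cong)
    fix w assume w: "w \<in> multi_indices N n"
    show "pure_tensor N n scale (f w) (\<lambda>k. unit_vec N (w k)) u = (if w = u then f u else 0)"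
    proof (cases "u \<in> multi_indices N n")
      case True
      have lt: "w k < N" "u k < N" if "k \<in> {1..n}" for k
        using True w that by (auto simp: multi_indices_def PiE_iff)
      have eq: "unit_vec N (w k) $ u k = (if w k = u k then 1 else 0 :: complex)"
        if "k \<in> {1..n}" for k
        using lt[OF that] by auto
      have "(\<Prod>k\<in>{1..n}. unit_vec N (w k) $ u k :: complex) =
            (\<Prod>k\<in>{1..n}. if w k = u k then 1 else 0)"
        using eq by (rule prod.cong[OF refl])
      also have "\<dots> = (if w = u then 1 else 0)"
      proof (cases "w = u")
        case False
        then obtain k where "k \<in> {1..n}" "w k \<noteq> u k"
          using w True PiE_ext unfolding multi_indices_def by metis
        then show ?thesis using False by (auto intro!: prod_zero)
      qed simp
      finally show ?thesis using True by (simp add: pure_tensor_def)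
    next
      case False
      then show ?thesis using assms w by (auto simp: pure_tensor_def tensor_space_def)
    qed
  qed simp
  also have "\<dots> = f u"
    using assms finite_multi_indices[of N n] by (simp add: tensor_space_def)
  finally show "f u = (\<Sum>w\<in>multi_indices N n.
      pure_tensor N n scale (f w) (\<lambda>k. unit_vec N (w k))) u" ..
qed

end

section \<open>The Etingof-Freund-Ma functor\<close>

definition gl_action ::
  "nat \<Rightarrow> nat \<Rightarrow> (complex \<Rightarrow> 'm::ab_group_add \<Rightarrow> 'm) \<Rightarrow> (complex mat \<Rightarrow> 'm \<Rightarrow> 'm) \<Rightarrow>
   complex mat \<Rightarrow> 'm tensor \<Rightarrow> 'm tensor" where
  "gl_action N n scale \<rho> A v = on_zeroth (\<rho> A) v + (\<Sum>k\<in>{1..n}. on_factor N n scale k A v)"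

definition mtrace :: "complex mat \<Rightarrow> complex" where
  "mtrace A = (\<Sum>i<dim_row A. A $$ (i, i))"

definition block_diag :: "complex mat \<Rightarrow> complex mat \<Rightarrow> complex mat" where
  "block_diag S T = four_block_mat S (0\<^sub>m (dim_row S) (dim_col T)) (0\<^sub>m (dim_row T) (dim_col S)) T"

definition chi :: "nat \<Rightarrow> nat \<Rightarrow> complex mat \<Rightarrow> complex mat \<Rightarrow> complex" where
  "chi p q S T = of_nat q * mtrace S - of_nat p * mtrace T"

definition EFM ::
  "nat \<Rightarrow> nat \<Rightarrow> nat \<Rightarrow> complex \<Rightarrow> (complex \<Rightarrow> 'm::ab_group_add \<Rightarrow> 'm) \<Rightarrow>
   (complex mat \<Rightarrow> 'm \<Rightarrow> 'm) \<Rightarrow> 'm tensor set" where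
  "EFM n p q \<mu> scale \<rho> =
     {v \<in> tensor_space (p + q) n.
        \<forall>S \<in> carrier_mat p p. \<forall>T \<in> carrier_mat q q. mtrace (block_diag S T) = 0 \<longrightarrow>
          gl_action (p + q) n scale \<rho> (block_diag S T) v = tscale scale (\<mu> * chi p q S T) v}"

definition efm_kappa :: "nat \<Rightarrow> nat \<Rightarrow> complex \<Rightarrow> complex" where
  "efm_kappa p q \<mu> = of_nat p - of_nat q - \<mu> * of_nat (p + q)"

definition matrix_unit :: "nat \<Rightarrow> nat \<Rightarrow> nat \<Rightarrow> complex mat" where
  "matrix_unit N s t = mat N N (\<lambda>(i, j). if i = s \<and> j = t then 1 else 0)"

definition gamma_op ::
  "nat \<Rightarrow> nat \<Rightarrow> nat \<Rightarrow> (complex \<Rightarrow> 'm::ab_group_add \<Rightarrow> 'm) \<Rightarrow> nat \<Rightarrow> 'm tensor \<Rightarrow> 'm tensor" where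
  "gamma_op n p q scale k = on_factor (p + q) n scale k (block_diag (1\<^sub>m p) (- 1\<^sub>m q))"

definition s_op ::
  "nat \<Rightarrow> nat \<Rightarrow> nat \<Rightarrow> (complex \<Rightarrow> 'm::ab_group_add \<Rightarrow> 'm) \<Rightarrow> nat \<Rightarrow> 'm tensor \<Rightarrow> 'm tensor" where
  "s_op n p q scale i = (if i = n then gamma_op n p q scale n else exchange i (i + 1))"

definition y1_op ::
  "nat \<Rightarrow> nat \<Rightarrow> nat \<Rightarrow> complex \<Rightarrow> (complex \<Rightarrow> 'm::ab_group_add \<Rightarrow> 'm) \<Rightarrow>
   (complex mat \<Rightarrow> 'm \<Rightarrow> 'm) \<Rightarrow> 'm tensor \<Rightarrow> 'm tensor" where
  "y1_op n p q \<mu> scale \<rho> v =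
     - (\<Sum>(s, t) \<in> {..<p} \<times> {p..<p+q} \<union> {p..<p+q} \<times> {..<p}.
          on_zeroth (\<rho> (matrix_unit (p + q) s t))
            (on_factor (p + q) n scale 1 (matrix_unit (p + q) t s) v))
     + tscale scale (efm_kappa p q \<mu> / 2) (gamma_op n p q scale 1 v)
     + tscale scale (1/2) (\<Sum>l\<in>{2..n}. exchange 1 l v)
     + tscale scale (1/2) (\<Sum>l\<in>{2..n}.
          exchange 1 l (gamma_op n p q scale 1 (gamma_op n p q scale l v)))"

text \<open>Only the indices \<open>k \<in> {1..n}\<close> are meaningful.\<close>

fun y_op ::
  "nat \<Rightarrow> nat \<Rightarrow> nat \<Rightarrow> complex \<Rightarrow> (complex \<Rightarrow> 'm::ab_group_add \<Rightarrow> 'm) \<Rightarrow>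
   (complex mat \<Rightarrow> 'm \<Rightarrow> 'm) \<Rightarrow> nat \<Rightarrow> 'm tensor \<Rightarrow> 'm tensor" where
  "y_op n p q \<mu> scale \<rho> 0 v = 0"
| "y_op n p q \<mu> scale \<rho> (Suc 0) v = y1_op n p q \<mu> scale \<rho> v"
| "y_op n p q \<mu> scale \<rho> (Suc (Suc k)) v =
     s_op n p q scale (Suc k) (y_op n p q \<mu> scale \<rho> (Suc k) (s_op n p q scale (Suc k) v))
     - s_op n p q scale (Suc k) v"

text \<open>\<open>\<Phi>\<close> is the representation of \<open>H\<^sub>n(1, p - q - \<mu>N)\<close> on \<open>F\<^bsub>n,p,\<mu>\<^esub>(M)\<close>: it is determined on the
  algebra by the prescribed action of the generators.\<close>

definition EFM_representation ::
  "nat \<Rightarrow> nat \<Rightarrow> nat \<Rightarrow> complex \<Rightarrow> (complex \<Rightarrow> 'm::ab_group_add \<Rightarrow> 'm) \<Rightarrow>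
   (complex mat \<Rightarrow> 'm \<Rightarrow> 'm) \<Rightarrow>
   ((daha_gen fword \<Rightarrow>\<^sub>0 complex) set \<Rightarrow> 'm tensor \<Rightarrow> 'm tensor) \<Rightarrow> bool" where
  "EFM_representation n p q \<mu> scale \<rho> \<Phi> \<longleftrightarrow>
     algebra_representation (tscale scale)
       (daha n 1 (efm_kappa p q \<mu>)) (\<lambda>c. daha_class n 1 (efm_kappa p q \<mu>) (const c))
       (EFM n p q \<mu> scale \<rho>) \<Phi> \<and>
     (\<forall>i \<in> {1..n}. \<forall>v \<in> EFM n p q \<mu> scale \<rho>.
        \<Phi> (daha_class n 1 (efm_kappa p q \<mu>) (letter (GenS i))) v = s_op n p q scale i v \<and>
        \<Phi> (daha_class n 1 (efm_kappa p q \<mu>) (letter (GenY i))) v = y_op n p q \<mu> scale \<rho> i v)"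

end

theory Submission
  imports
    Defs
    "HOL-Computational_Algebra.Fundamental_Theorem_Algebra"
    "HOL-Combinatorics.Cycles"
begin

text \<open>After a scalar shift, \<open>F\<^bsub>n,p,\<mu>\<^esub>(M)\<close> is the space of tensors on which all of
  \<open>\<gg>\<ll>\<^sub>p \<times> \<gg>\<ll>\<^sub>q\<close> acts by one character. Let \<open>W\<close> be a stable subspace, \<open>0 \<noteq> g \<in> W\<close> and \<open>f\<close> another
  such tensor. Irreducibility of \<open>M\<close> gives \<open>f = X g\<close> with \<open>X\<close> in the algebra generated by
  \<open>U(\<gg>\<ll>\<^sub>N)\<close> and the endomorphisms of \<open>V\<^sup>\<otimes>\<^sup>n\<close>, and an orthogonal projection makes the coefficients of \<open>X\<close>
  invariant under \<open>\<gg>\<ll>\<^sub>p \<times> \<gg>\<ll>\<^sub>q\<close>. By the first fundamental theorem (from the double commutant theorem)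
  \<open>X\<close> is then a combination of words indexed by a permutation of the tensor factors and the letters
  of the word, together with a block label for each of these.

  Such a word preserves \<open>W\<close> by induction on its length. Reordering the letters costs shorter words.
  A letter whose two labels agree is absorbed by the character condition, and a letter connected to
  a tensor factor and changing the label is the off-diagonal sum in some \<open>y\<^sub>k\<close>. What remains are
  cycles of letters with alternating labels; both alternating labellings of a cycle agree up to
  shorter words, and the sum over all labellings is the trace of a power of the matrix of generators
  of \<open>\<gg>\<ll>\<^sub>N\<close>, a central element, which acts on \<open>M\<close> by a scalar.\<close>

section \<open>Schur's lemma\<close>

text \<open>The obstacle is that words have letters in a noncommutative algebra, so invariant theory
  does not apply to them directly. It is applied to scalar coefficient kernels, in which a letter
  \<open>E a b\<close> counts as one more position with output label \<open>a\<close> and input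
  label \<open>b\<close>; letters and tensor factors then transform by the same rule, provided an
  invariant tensor stands at the right end of the word. The kernel representing a tensor is far from
  unique, and averaging over a compact group is replaced by orthogonality: the adjoint of the
  commutator with a matrix unit is the commutator with the transposed unit.

  The shift makes the identity matrix act by 1, so that words of different lengths can be padded to
  a common length by inserting the sum of all \<open>E a a\<close>.

  That the prescribed operators satisfy the relations is part of the claim. The commuting of the y
  operators needs invariant tensors and fixes the parameter: the commutator of two off-diagonal sums
  leaves block diagonal letters, whose eigenvalues and block sizes add up to p - q - \<mu>N.\<close>

context complex_vector_space
begin

definition poly_apply :: "('v \<Rightarrow> 'v) \<Rightarrow> complex poly \<Rightarrow> 'v \<Rightarrow> 'v" where
  "poly_apply Z P m = (\<Sum>i\<le>degree P. scale (coeff P i) ((Z ^^ i) m))"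

lemma poly_apply_bound:
  assumes "degree P \<le> d"
  shows "poly_apply Z P m = (\<Sum>i\<le>d. scale (coeff P i) ((Z ^^ i) m))"
  unfolding poly_apply_def
  by (rule sum.mono_neutral_left) (use assms in \<open>auto simp: coeff_eq_0\<close>)

lemma poly_apply_linear_factor:
  assumes Z: "Vector_Spaces.linear scale scale Z"
  shows "poly_apply Z ([:-a, 1:] * P) m = Z (poly_apply Z P m) - scale a (poly_apply Z P m)"
proof -
  interpret Z: Vector_Spaces.linear scale scale Z by (rule Z)
  let ?d = "Suc (degree P)"
  have c: "coeff ([:-a, 1:] * P) i = coeff (pCons 0 P) i - a * coeff P i" for i
    by simp
  have "degree ([:-a, 1:] * P) \<le> ?d"
    by (rule order_trans[OF degree_mult_le]) simp
  then have "poly_apply Z ([:-a, 1:] * P) m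
      = (\<Sum>i\<le>?d. scale (coeff (pCons 0 P) i) ((Z ^^ i) m)) - (\<Sum>i\<le>?d. scale (a * coeff P i) ((Z ^^ i) m))"
    by (simp only: poly_apply_bound[of _ ?d] c scale_left_diff_distrib sum_subtractf)
  also have "(\<Sum>i\<le>?d. scale (coeff (pCons 0 P) i) ((Z ^^ i) m)) = Z (poly_apply Z P m)"
    by (simp add: sum.atMost_Suc_shift poly_apply_def Z.sum Z.scale del: sum.atMost_Suc)
  also have "(\<Sum>i\<le>?d. scale (a * coeff P i) ((Z ^^ i) m)) = scale a (poly_apply Z P m)"
    by (simp add: poly_apply_bound[of P ?d] scale_sum_right del: sum.atMost_Suc)
  finally show ?thesis .
qed

lemma annihilating_poly_exists:
  assumes "finite_dimensional scale"
  shows "\<exists>P. P \<noteq> 0 \<and> poly_apply Z P m = 0"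
proof -
  obtain B where "finite_dimensional_vector_space scale B"
    using assms unfolding finite_dimensional_def by blast
  then interpret fd: finite_dimensional_vector_space scale B .
  let ?d = "card B" and ?v = "\<lambda>i. (Z ^^ i) m"
  show ?thesis
  proof (cases "inj_on ?v {..?d}")
    \<comment> \<open>Two equal iterates give X^i - X^j directly; the set of iterates then has fewer
      than \<open>?d + 1\<close> elements and need not be dependent.\<close>
    case False
    then obtain i j where ij: "i \<noteq> j" "?v i = ?v j" by (auto simp: inj_on_def)
    let ?P = "monom (1::complex) i - monom 1 j"
    have "?P \<noteq> 0" using ij(1) by (metis coeff_monom eq_iff_diff_eq_0 zero_neq_one)
    moreover have "poly_apply Z ?P m = 0"
    proof -
      have "degree ?P \<le> i + j" by (intro degree_diff_le) (auto intro: order_trans[OF degree_monom_le])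
      then have "poly_apply Z ?P m = (\<Sum>k\<le>i+j. scale (coeff ?P k) (?v k))"
        by (rule poly_apply_bound)
      also have "\<dots> = (\<Sum>k\<le>i+j. if k = i then ?v i else 0) - (\<Sum>k\<le>i+j. if k = j then ?v j else 0)"
        unfolding sum_subtractf[symmetric] using ij(1) by (intro sum.cong) auto
      also have "\<dots> = 0" using ij(2) by simp
      finally show ?thesis .
    qed
    ultimately show ?thesis by blast
  next
    case True
    have "card (?v ` {..?d}) = Suc ?d" using True by (simp add: card_image)
    then have "dependent (?v ` {..?d})"
      using independent_span_bound[OF fd.finite_Basis, of "?v ` {..?d}"] fd.span_Basis by auto
    then obtain u where u: "(\<Sum>x\<in>?v ` {..?d}. scale (u x) x) = 0" and "\<exists>x\<in>?v ` {..?d}. u x \<noteq> 0"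
      using dependent_finite[of "?v ` {..?d}"] by auto
    then obtain i where i: "i \<le> ?d" "u (?v i) \<noteq> 0" by blast
    define P where "P = Poly (map (\<lambda>i. u (?v i)) [0..<Suc ?d])"
    have cP: "coeff P k = (if k \<le> ?d then u (?v k) else 0)" for k
      by (auto simp: P_def nth_default_def simp del: upt_Suc)
    have "P \<noteq> 0" using i by (metis cP coeff_0)
    moreover have "degree P \<le> ?d" by (rule degree_le) (simp add: cP)
    then have "poly_apply Z P m = (\<Sum>i\<le>?d. scale (u (?v i)) (?v i))"
      by (simp add: poly_apply_bound cP)
    then have "poly_apply Z P m = 0"
      using u True by (simp add: sum.reindex)
    ultimately show ?thesis by blast
  qed
qed

text \<open>A polynomial of least degree among those killing \<open>m\<close> is not constant, so it
  has a root \<open>a\<close>. Cancelling the factor X - a gives a polynomial of smaller degree,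
  which no longer kills \<open>m\<close> and so produces the eigenvector.\<close>

lemma eigenvector_exists:
  fixes m :: 'v
  assumes fd: "finite_dimensional scale" and Z: "Vector_Spaces.linear scale scale Z" and m: "m \<noteq> 0"
  shows "\<exists>c v. v \<noteq> 0 \<and> Z v = scale c v"
proof -
  define A where "A P \<longleftrightarrow> P \<noteq> 0 \<and> poly_apply Z P m = 0" for P
  have "\<exists>P. A P" using annihilating_poly_exists[OF fd] by (auto simp: A_def)
  then obtain P where P: "A P" and min: "\<And>Q. A Q \<Longrightarrow> degree P \<le> degree Q"
    using exists_least_iff[of "\<lambda>d. \<exists>P. A P \<and> degree P = d"] by (metis linorder_not_le)
  have "degree P \<noteq> 0"
  proof
    assume "degree P = 0"
    then have "poly_apply Z P m = scale (lead_coeff P) m" by (simp add: poly_apply_def)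
    with P m show False unfolding A_def by simp
  qed
  then obtain a where "poly P a = 0"
    using fundamental_theorem_of_algebra[of P] by (metis constant_degree)
  then obtain Q where Q: "P = [:-a, 1:] * Q" by (metis poly_eq_0_iff_dvd dvdE)
  have Q0: "Q \<noteq> 0" using P Q unfolding A_def by auto
  then have "degree P = Suc (degree Q)"
    unfolding Q by (subst degree_mult_eq) simp_all
  then have "poly_apply Z Q m \<noteq> 0" using min[of Q] Q0 unfolding A_def by force
  moreover have "Z (poly_apply Z Q m) = scale a (poly_apply Z Q m)"
    using P poly_apply_linear_factor[OF Z, of a Q m] unfolding A_def Q by simp
  ultimately show ?thesis by blast
qed

text \<open>An eigenspace of \<open>Z\<close> is stable under every operator commuting with
  \<open>Z\<close>, so irreducibility makes it the whole space.\<close>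

lemma schur:
  assumes fd: "finite_dimensional scale" and irr: "irreducible_under scale UNIV T"
    and T: "\<And>t. t \<in> T \<Longrightarrow> Vector_Spaces.linear scale scale t"
    and Z: "Vector_Spaces.linear scale scale Z"
    and comm: "\<And>t m. t \<in> T \<Longrightarrow> t (Z m) = Z (t m)"
  shows "\<exists>c. \<forall>m. Z m = scale c m"
proof -
  interpret Z: Vector_Spaces.linear scale scale Z by (rule Z)
  obtain m :: 'v where "m \<noteq> 0"
    using irr unfolding irreducible_under_def by auto
  then obtain c v where v: "v \<noteq> 0" "Z v = scale c v"
    using eigenvector_exists[OF fd Z] by blast
  let ?W = "{m. Z m = scale c m}"
  have "subspace ?W"
    by (rule subspaceI) (simp_all add: Z.zero Z.add Z.scale scale_right_distrib scale_left_commute)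
  moreover have "t ` ?W \<subseteq> ?W" if "t \<in> T" for t
  proof -
    interpret t: Vector_Spaces.linear scale scale t by (rule T[OF that])
    show ?thesis using comm[OF that] by (auto simp: t.scale simp flip: comm[OF that])
  qed
  ultimately have "?W = {0} \<or> ?W = UNIV" using irr unfolding irreducible_under_def by blast
  with v show ?thesis by blast
qed

end

section \<open>Orthogonal projection and the double commutant theorem\<close>

definition fscale :: "complex \<Rightarrow> ('k \<Rightarrow> complex) \<Rightarrow> 'k \<Rightarrow> complex" where
  "fscale a f = (\<lambda>x. a * f x)"

interpretation cfun: vector_space "fscale :: complex \<Rightarrow> ('k \<Rightarrow> complex) \<Rightarrow> _"
  by standard (simp_all add: fscale_def fun_eq_iff algebra_simps)

definition supported :: "'k set \<Rightarrow> ('k \<Rightarrow> 'b::zero) set" where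
  "supported D = {f. \<forall>x. x \<notin> D \<longrightarrow> f x = 0}"

text \<open>Hermitian and positive, but definite only on functions supported in \<open>D\<close>:
  values outside \<open>D\<close> are invisible.\<close>

definition ip :: "'k set \<Rightarrow> ('k \<Rightarrow> complex) \<Rightarrow> ('k \<Rightarrow> complex) \<Rightarrow> complex" where
  "ip D f g = (\<Sum>x\<in>D. f x * cnj (g x))"

lemma ip_simps:
  "ip D (f + f') g = ip D f g + ip D f' g" "ip D (f - f') g = ip D f g - ip D f' g"
  "ip D (fscale a f) g = a * ip D f g"
  "ip D g (f + f') = ip D g f + ip D g f'" "ip D g (f - f') = ip D g f - ip D g f'"
  "ip D g (fscale a f) = cnj a * ip D g f" "ip D g 0 = 0" "ip D 0 g = 0"
  by (simp_all add: ip_def fscale_def algebra_simps sum.distrib sum_subtractf sum_distrib_left)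

lemma ip_self_eq_0:
  assumes "finite D" "f \<in> supported D" "ip D f f = 0"
  shows "f = 0"
proof -
  have "(\<Sum>x\<in>D. (cmod (f x))\<^sup>2) = 0"
    using assms(3) unfolding ip_def complex_norm_square[symmetric]
    by (metis of_real_eq_0_iff of_real_sum)
  then have "f x = 0" if "x \<in> D" for x
    using assms(1) that by (simp add: sum_nonneg_eq_0_iff)
  with assms(2) show ?thesis by (auto simp: supported_def fun_eq_iff)
qed

text \<open>The indicator functions of the points of \<open>D\<close> span, which bounds the size of
  a basis of \<open>V\<close>.\<close>

lemma finite_spanning_set:
  assumes "finite D" "cfun.subspace V" "V \<subseteq> supported D"
  shows "\<exists>B. finite B \<and> B \<subseteq> V \<and> cfun.span B = V"
proof -
  let ?e = "\<lambda>x y. if y = x then 1 else (0::complex)"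
  have D: "f \<in> cfun.span (?e ` D)" if "f \<in> supported D" for f
  proof -
    have "f = (\<Sum>x\<in>D. fscale (f x) (?e x))"
    proof
      fix y
      have "(\<Sum>x\<in>D. fscale (f x) (?e x)) y = (\<Sum>x\<in>D. fscale (f x) (?e x) y)"
        using assms(1) by (induction rule: finite_induct) auto
      also have "\<dots> = (\<Sum>x\<in>D. if x = y then f y else 0)"
        by (rule sum.cong) (auto simp: fscale_def)
      also have "\<dots> = f y" using that assms(1) by (auto simp: supported_def)
      finally show "f y = (\<Sum>x\<in>D. fscale (f x) (?e x)) y" by simp
    qed
    moreover have "(\<Sum>x\<in>D. fscale (f x) (?e x)) \<in> cfun.span (?e ` D)"
      by (intro cfun.span_sum cfun.span_scale cfun.span_base) auto
    ultimately show ?thesis by simp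
  qed
  obtain B where B: "B \<subseteq> V" "cfun.independent B" "V \<subseteq> cfun.span B"
    using cfun.basis_exists by metis
  have "finite B"
    using cfun.independent_span_bound[of "?e ` D" B] B assms D by blast
  moreover have "cfun.span B = V"
    using B assms(2) by (metis cfun.span_minimal subset_antisym)
  ultimately show ?thesis using B(1) by blast
qed

lemma span_orthogonal:
  assumes "\<forall>b\<in>B. ip D f b = 0" "h \<in> cfun.span B"
  shows "ip D f h = 0"
  using assms(2)
proof (induction rule: cfun.span_induct_alt)
  case base
  show ?case by (simp only: ip_simps)
next
  case (step c x y)
  have "cnj c * ip D f x + ip D f y = 0" using step assms(1) by simp
  then show ?case by (simp only: ip_simps)
qed

text \<open>Gram-Schmidt, one spanning vector at a time: the projection to the old span is corrected
  along the part \<open>b - k\<close> of the new vector that is orthogonal to that span.\<close>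

lemma orthogonal_projection_span:
  assumes D: "finite D" and B: "finite B" "B \<subseteq> supported D"
  shows "\<exists>g\<in>cfun.span B. \<forall>h\<in>cfun.span B. ip D (f - g) h = 0"
  using B
proof (induction B arbitrary: f rule: finite_induct)
  case empty
  have "ip D (f - 0) 0 = 0" by (simp only: ip_simps)
  then show ?case by (simp only: cfun.span_empty) blast
next
  case (insert b B)
  let ?S = "cfun.span B" and ?S' = "cfun.span (insert b B)"
  have sub: "?S \<subseteq> ?S'" by (rule cfun.span_mono) auto
  have supp: "?S' \<subseteq> supported D"
    by (rule cfun.span_minimal) (use insert.prems in \<open>auto simp: supported_def fscale_def intro!: cfun.subspaceI\<close>)
  obtain g where g: "g \<in> ?S" "\<forall>h\<in>?S. ip D (f - g) h = 0" using insert.IH[of f] insert.prems by blast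
  obtain k where k: "k \<in> ?S" "\<forall>h\<in>?S. ip D (b - k) h = 0" using insert.IH[of b] insert.prems by blast
  have bS: "b - k \<in> ?S'"
    using k(1) sub by (intro cfun.span_diff) (auto intro: cfun.span_base)
  \<comment> \<open>If \<open>b\<close> already lies in the old span, \<open>b - k\<close> vanishes
    and the quotient is 0 by the convention for division by zero.\<close>
  define t where "t = ip D (f - g) (b - k) / ip D (b - k) (b - k)"
  let ?g = "g + fscale t (b - k)"
  have gS: "?g \<in> ?S'"
    using g(1) sub bS by (intro cfun.span_add cfun.span_scale) auto
  have 1: "ip D (f - ?g) h = 0" if "h \<in> ?S" for h
  proof -
    have "ip D (f - ?g) h = ip D (f - g) h - t * ip D (b - k) h"
      by (simp only: ip_simps) (simp add: algebra_simps)
    then show ?thesis using g k that by simp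
  qed
  have "ip D (f - ?g) (b - k) = ip D (f - g) (b - k) - t * ip D (b - k) (b - k)"
    by (simp only: ip_simps) (simp add: algebra_simps)
  also have "\<dots> = 0"
  proof (cases "ip D (b - k) (b - k) = 0")
    case True
    then have "b - k = 0" using ip_self_eq_0[OF D, of "b - k"] bS supp by blast
    then show ?thesis by (simp only: ip_simps) simp
  qed (simp add: t_def)
  finally have "ip D (f - ?g) b = 0"
    using 1[OF k(1)] by (simp only: ip_simps) simp
  then have "\<forall>h\<in>insert b B. ip D (f - ?g) h = 0"
    using 1 cfun.span_base by blast
  then have "ip D (f - ?g) h = 0" if "h \<in> ?S'" for h
    using span_orthogonal that by blast
  with gS show ?case by blast
qed

lemma orthogonal_projection:
  assumes "finite D" "cfun.subspace V" "V \<subseteq> supported D"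
  shows "\<exists>g\<in>V. \<forall>h\<in>V. ip D (f - g) h = 0"
proof -
  obtain B where B: "finite B" "B \<subseteq> V" "cfun.span B = V" using finite_spanning_set[OF assms] by blast
  have "B \<subseteq> supported D" using B(2) assms(3) by blast
  from orthogonal_projection_span[OF assms(1) B(1) this] show ?thesis unfolding B(3) .
qed

section \<open>Matrices as kernels and their double commutant\<close>

definition ker_mult :: "'i set \<Rightarrow> ('i \<times> 'i \<Rightarrow> complex) \<Rightarrow> ('i \<times> 'i \<Rightarrow> complex) \<Rightarrow> 'i \<times> 'i \<Rightarrow> complex" where
  "ker_mult I a b = (\<lambda>(i, j). \<Sum>k\<in>I. a (i, k) * b (k, j))"

definition ker_one :: "'i set \<Rightarrow> 'i \<times> 'i \<Rightarrow> complex" where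
  "ker_one I = (\<lambda>(i, j). if i \<in> I \<and> j = i then 1 else 0)"

definition ker_adj :: "('i \<times> 'i \<Rightarrow> complex) \<Rightarrow> 'i \<times> 'i \<Rightarrow> complex" where
  "ker_adj a = (\<lambda>(i, j). cnj (a (j, i)))"

lemma sum_pairs: "(\<Sum>x\<in>A \<times> B. f x) = (\<Sum>i\<in>A. \<Sum>j\<in>B. f (i, j))"
  using sum.cartesian_product[of "\<lambda>i j. f (i, j)" B A] by simp

lemma ker_mult_adjoint:
  "ip (I \<times> I) (ker_mult I a x) y = ip (I \<times> I) x (ker_mult I (ker_adj a) y)"
proof -
  have "ip (I \<times> I) (ker_mult I a x) y = (\<Sum>i\<in>I. \<Sum>j\<in>I. \<Sum>k\<in>I. a (i, k) * x (k, j) * cnj (y (i, j)))"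
    by (simp add: ip_def ker_mult_def sum_pairs sum_distrib_right)
  also have "\<dots> = (\<Sum>k\<in>I. \<Sum>j\<in>I. \<Sum>i\<in>I. a (i, k) * x (k, j) * cnj (y (i, j)))"
    by (subst (2) sum.swap, subst sum.swap, subst (2) sum.swap) simp
  also have "\<dots> = ip (I \<times> I) x (ker_mult I (ker_adj a) y)"
    by (simp add: ip_def ker_mult_def ker_adj_def sum_pairs sum_distrib_left algebra_simps)
  finally show ?thesis .
qed

lemma ker_mult_supported:
  assumes "a \<in> supported (I \<times> I)" "b \<in> supported (I \<times> I)"
  shows "ker_mult I a b \<in> supported (I \<times> I)"
  using assms by (auto simp: supported_def ker_mult_def)

lemma ker_mult_linear:
  "ker_mult I a (b + c) = ker_mult I a b + ker_mult I a c"
  "ker_mult I a (b - c) = ker_mult I a b - ker_mult I a c"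
  "ker_mult I a (fscale t b) = fscale t (ker_mult I a b)"
  by (auto simp: ker_mult_def fscale_def fun_eq_iff algebra_simps sum.distrib sum_subtractf sum_distrib_left)

lemma ker_mult_one:
  assumes "finite I" "a \<in> supported (I \<times> I)"
  shows "ker_mult I a (ker_one I) = a"
proof
  fix x :: "'a \<times> 'a"
  obtain i j where x: "x = (i, j)" by force
  have "ker_mult I a (ker_one I) x = (\<Sum>k\<in>I. if k = j then a (i, j) else 0)"
    unfolding x ker_mult_def ker_one_def by (auto intro!: sum.cong)
  then show "ker_mult I a (ker_one I) x = a x"
    using assms x by (auto simp: supported_def)
qed

text \<open>The orthogonal projection \<open>P\<close> onto a *-closed algebra \<open>B\<close> commutes with left multiplication by \<open>B\<close>,
  so its blocks lie in the commutant of \<open>B\<close>. Hence \<open>c = c P(1) = P(c)\<close> for \<open>c\<close> in the double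
  commutant.\<close>

theorem double_commutant:
  fixes I :: "'i set"
  assumes I: "finite I" and sub: "cfun.subspace B" and supp: "B \<subseteq> supported (I \<times> I)"
    and one: "ker_one I \<in> B" and mult: "\<And>a b. a \<in> B \<Longrightarrow> b \<in> B \<Longrightarrow> ker_mult I a b \<in> B"
    and adj: "\<And>a. a \<in> B \<Longrightarrow> ker_adj a \<in> B"
    and c: "c \<in> supported (I \<times> I)"
    and comm: "\<And>t. t \<in> supported (I \<times> I) \<Longrightarrow> (\<And>b. b \<in> B \<Longrightarrow> ker_mult I b t = ker_mult I t b) \<Longrightarrow>
      ker_mult I c t = ker_mult I t c"
  shows "c \<in> B"
proof -
  let ?D = "I \<times> I"
  have D: "finite ?D" using I by simp
  define P where "P f = (SOME g. g \<in> B \<and> (\<forall>h\<in>B. ip ?D (f - g) h = 0))" for f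
  have P: "P f \<in> B" "\<And>h. h \<in> B \<Longrightarrow> ip ?D (f - P f) h = 0" for f
    using someI_ex[of "\<lambda>g. g \<in> B \<and> (\<forall>h\<in>B. ip ?D (f - g) h = 0)"] orthogonal_projection[OF D sub supp, of f]
    unfolding P_def by blast+
  have uniq: "P f = g" if "g \<in> B" "\<And>h. h \<in> B \<Longrightarrow> ip ?D (f - g) h = 0" for f g
  proof -
    have "P f - g \<in> B" using that P(1) sub by (simp add: cfun.subspace_diff)
    then have "ip ?D (f - g) (P f - g) = 0" "ip ?D (f - P f) (P f - g) = 0"
      using that P(2) by auto
    moreover have "ip ?D (P f - g) (P f - g) = ip ?D (f - g) (P f - g) - ip ?D (f - P f) (P f - g)"
      by (simp only: ip_simps) (simp add: algebra_simps)
    ultimately have "ip ?D (P f - g) (P f - g) = 0" by simp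
    then show ?thesis using ip_self_eq_0[OF D] \<open>P f - g \<in> B\<close> supp by fastforce
  qed
  have P_add: "P (f + g) = P f + P g" for f g
  proof (rule uniq)
    show "P f + P g \<in> B" using P(1) sub by (simp add: cfun.subspace_add)
    fix h assume "h \<in> B"
    then have "ip ?D (f - P f) h + ip ?D (g - P g) h = 0" by (simp only: P(2)) simp
    then show "ip ?D (f + g - (P f + P g)) h = 0" by (simp only: ip_simps) (simp add: algebra_simps)
  qed
  have P_scale: "P (fscale a f) = fscale a (P f)" for a f
  proof (rule uniq)
    show "fscale a (P f) \<in> B" using P(1) sub by (simp add: cfun.subspace_scale)
    fix h assume "h \<in> B"
    then have "a * ip ?D (f - P f) h = 0" by (simp only: P(2)) simp
    then show "ip ?D (fscale a f - fscale a (P f)) h = 0"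
      by (simp only: ip_simps) (simp add: algebra_simps)
  qed
  have P_zero: "P 0 = 0"
  proof (rule uniq)
    show "0 \<in> B" using sub by (simp add: cfun.subspace_0)
    show "ip ?D (0 - 0) h = 0" for h by (simp add: ip_def)
  qed
  have P_sum: "P (sum F X) = (\<Sum>x\<in>X. P (F x))" for F :: "'i \<Rightarrow> _" and X
    by (induction X rule: infinite_finite_induct)
      (simp_all only: sum.infinite sum.empty sum.insert P_zero P_add if_False not_False_eq_True)
  \<comment> \<open>The adjoint of \<open>b\<close> carries the orthogonality condition back to
    \<open>f\<close>; this is where closure of \<open>B\<close> under adjoints enters.\<close>
  have P_mult: "P (ker_mult I b f) = ker_mult I b (P f)" if "b \<in> B" for b f
  proof (rule uniq)
    show "ker_mult I b (P f) \<in> B" using that P(1) mult by blast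
    fix h assume "h \<in> B"
    then have "ker_mult I (ker_adj b) h \<in> B" using that mult adj by blast
    then show "ip ?D (ker_mult I b f - ker_mult I b (P f)) h = 0"
      by (simp only: ker_mult_linear(2)[symmetric] ker_mult_adjoint P(2))
  qed
  have P_fix: "P b = b" if "b \<in> B" for b
    by (rule uniq[OF that]) (simp add: ip_def)
  define e :: "'i \<Rightarrow> 'i \<Rightarrow> 'i \<times> 'i \<Rightarrow> complex" where "e i j = (\<lambda>x. if x = (i, j) then 1 else 0)" for i j
  have mult_e: "ker_mult I a (e k j) = (\<Sum>i\<in>I. fscale (a (i, k)) (e i j))"
    if "a \<in> supported ?D" "k \<in> I" for a k j
  proof
    fix x :: "'i \<times> 'i"
    obtain i' j' where x: "x = (i', j')" by force
    have "ker_mult I a (e k j) x = (\<Sum>l\<in>I. if l = k then (if j' = j then a (i', k) else 0) else 0)"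
      unfolding x ker_mult_def e_def by (auto intro!: sum.cong)
    also have "\<dots> = (if j' = j then a (i', k) else 0)" using I that by simp
    also have "\<dots> = (\<Sum>i\<in>I. if i = i' then (if j' = j then a (i', k) else 0) else 0)"
      using I that by (auto simp: supported_def)
    also have "\<dots> = (\<Sum>i\<in>I. fscale (a (i, k)) (e i j) x)"
      unfolding x by (rule sum.cong) (auto simp: e_def fscale_def)
    also have "\<dots> = (\<Sum>i\<in>I. fscale (a (i, k)) (e i j)) x"
      using I by (induction rule: finite_induct) auto
    finally show "ker_mult I a (e k j) x = (\<Sum>i\<in>I. fscale (a (i, k)) (e i j)) x" .
  qed
  \<comment> \<open>Writing \<open>P\<close> as a matrix of blocks indexed by pairs of columns,
    \<open>T j' j\<close> is the block sending column \<open>j'\<close> of the argument to column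
    \<open>j\<close> of the result. Left multiplication acts on all columns alike, so each block
    commutes with \<open>B\<close>.\<close>
  define T where "T j' j = (\<lambda>(i, i'). if i \<in> I \<and> i' \<in> I then P (e i' j') (i, j) else 0)" for j' j
  have T_supp: "T j' j \<in> supported ?D" for j' j by (auto simp: T_def supported_def)
  have mult_T: "ker_mult I a (T j' j) (i, i') = ker_mult I a (P (e i' j')) (i, j)"
    if "i' \<in> I" for a i i' j j'
    using that by (auto simp: ker_mult_def T_def intro!: sum.cong)
  have T_mult: "ker_mult I (T j' j) a (i, i') = P (ker_mult I a (e i' j')) (i, j)"
    if "a \<in> supported ?D" "i \<in> I" "i' \<in> I" for a i i' j j'
  proof -
    have "P (ker_mult I a (e i' j')) (i, j) = (\<Sum>k\<in>I. fscale (a (k, i')) (P (e k j'))) (i, j)"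
      by (simp add: mult_e[OF that(1,3)] P_sum P_scale)
    also have "\<dots> = (\<Sum>k\<in>I. a (k, i') * P (e k j') (i, j))"
      using I by (induction rule: finite_induct) (auto simp: fscale_def)
    finally show ?thesis using that by (simp add: ker_mult_def T_def mult.commute)
  qed
  have T_comm: "ker_mult I b (T j' j) = ker_mult I (T j' j) b" if "b \<in> B" for b j j'
  proof
    fix x :: "'i \<times> 'i"
    obtain i i' where x: "x = (i, i')" by force
    have b: "b \<in> supported ?D" using that supp by blast
    show "ker_mult I b (T j' j) x = ker_mult I (T j' j) b x"
    proof (cases "i \<in> I \<and> i' \<in> I")
      case True
      then show ?thesis using that b by (simp add: x mult_T T_mult P_mult)
    next
      case False
      then show ?thesis
        using ker_mult_supported[OF b T_supp] ker_mult_supported[OF T_supp b] x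
        by (auto simp: supported_def)
    qed
  qed
  have "ker_mult I c (T j' j) = ker_mult I (T j' j) c" for j j'
    by (rule comm[OF T_supp T_comm])
  \<comment> \<open>Although \<open>c\<close> is not yet known to lie in \<open>B\<close>, it
    commutes with the blocks of \<open>P\<close> and hence passes through \<open>P\<close> on matrix
    units.\<close>
  then have ce: "ker_mult I c (P (e i' j')) (i, j) = P (ker_mult I c (e i' j')) (i, j)"
    if "i \<in> I" "i' \<in> I" for i i' j j'
    using mult_T[OF that(2), of c j' j i] T_mult[OF c that, of j' j] by simp
  have one_e: "ker_one I = (\<Sum>i\<in>I. e i i)"
  proof
    fix x :: "'i \<times> 'i"
    have "(\<Sum>i\<in>I. e i i) x = (\<Sum>i\<in>I. e i i x)"
      using I by (induction rule: finite_induct) auto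
    also have "\<dots> = (\<Sum>i\<in>I. if i = fst x then (if snd x = fst x then 1 else 0) else 0)"
      by (rule sum.cong) (auto simp: e_def prod_eq_iff)
    finally show "ker_one I x = (\<Sum>i\<in>I. e i i) x" using I by (cases x) (auto simp: ker_one_def)
  qed
  have mult_sum: "ker_mult I c (sum F X) = (\<Sum>x\<in>X. ker_mult I c (F x))" for F :: "'i \<Rightarrow> _" and X
  proof (induction X rule: infinite_finite_induct)
    case (insert x X)
    then show ?case by (simp only: sum.insert ker_mult_linear if_False not_False_eq_True)
  qed (simp_all add: ker_mult_def fun_eq_iff)
  have "c x = P c x" for x
  proof -
    obtain i j where x: "x = (i, j)" by force
    have sumx: "(\<Sum>k\<in>I. F k) x = (\<Sum>k\<in>I. F k x)" for F :: "'i \<Rightarrow> 'i \<times> 'i \<Rightarrow> complex"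
      using I by (induction rule: finite_induct) auto
    show ?thesis
    proof (cases "i \<in> I")
      case True
      have "c x = ker_mult I c (P (ker_one I)) x"
        using P_fix[OF one] ker_mult_one[OF I c] by simp
      also have "\<dots> = (\<Sum>k\<in>I. ker_mult I c (P (e k k)) x)"
        by (simp add: one_e P_sum mult_sum sumx)
      also have "\<dots> = (\<Sum>k\<in>I. P (ker_mult I c (e k k)) x)"
        unfolding x by (rule sum.cong) (use ce True in auto)
      also have "\<dots> = P (ker_mult I c (ker_one I)) x"
        by (simp add: one_e P_sum mult_sum sumx)
      finally show ?thesis by (simp add: ker_mult_one[OF I c])
    next
      case False
      then show ?thesis using P(1)[of c] c supp x by (auto simp: supported_def subset_iff)
    qed
  qed
  then have "c = P c" by (rule ext)
  then show ?thesis using P(1)[of c] by simp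
qed

section \<open>Invariants of block diagonal matrices in mixed tensors\<close>

text \<open>Labellings of an arbitrary set of positions. Extensionality makes two of them equal once
  they agree on \<open>S\<close>, so they can serve as matrix indices.\<close>

definition index_set :: "nat \<Rightarrow> 'k set \<Rightarrow> ('k \<Rightarrow> nat) set" where
  "index_set N S = S \<rightarrow>\<^sub>E {..<N}"

lemma finite_index_set: "finite S \<Longrightarrow> finite (index_set N S)"
  unfolding index_set_def by (intro finite_PiE) auto

lemma index_set_upd: "u \<in> index_set N S \<Longrightarrow> k \<in> S \<Longrightarrow> a < N \<Longrightarrow> u(k := a) \<in> index_set N S"
  by (auto simp: index_set_def PiE_iff extensional_def)

lemma index_set_upd_iff:
  assumes "k \<in> S" "a < N" "u k < N"
  shows "u(k := a) \<in> index_set N S \<longleftrightarrow> u \<in> index_set N S"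
  using index_set_upd[of "u(k := a)" N S k "u k"] index_set_upd[of u N S k a] assms by auto

lemma index_set_comp_permutes:
  assumes "u \<in> index_set N S" "\<sigma> permutes S"
  shows "u \<circ> \<sigma> \<in> index_set N S"
  using assms by (auto simp: index_set_def PiE_iff extensional_def permutes_in_image permutes_not_in)

lemma index_set_comp_permutes_iff:
  assumes "\<sigma> permutes S"
  shows "u \<circ> \<sigma> \<in> index_set N S \<longleftrightarrow> u \<in> index_set N S"
  using index_set_comp_permutes[OF _ assms, of u N]
    index_set_comp_permutes[OF _ permutes_inv[OF assms], of "u \<circ> \<sigma>" N] permutes_inv_o[OF assms]
  by (auto simp: comp_assoc)

lemma index_set_ext:
  "u \<in> index_set N S \<Longrightarrow> v \<in> index_set N S \<Longrightarrow> (\<And>k. k \<in> S \<Longrightarrow> u k = v k) \<Longrightarrow> u = v"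
  unfolding index_set_def by (rule PiE_ext)

lemma index_set_lt: "u \<in> index_set N S \<Longrightarrow> k \<in> S \<Longrightarrow> u k < N"
  by (auto simp: index_set_def)

lemma ball_permutes: "\<sigma> permutes S \<Longrightarrow> (\<forall>k\<in>S. Q (\<sigma> k)) \<longleftrightarrow> (\<forall>k\<in>S. Q k)"
  using ball_simps(9)[of \<sigma> S Q] by (simp add: permutes_image)

text \<open>Relabelling position \<open>k\<close> is a bijection between the labellings with value
  \<open>a\<close> there and those with value \<open>b\<close>. Under a sum it moves a matrix unit
  from one argument to the other.\<close>

lemma sum_index_set_upd:
  assumes "k \<in> S" "a < N" "b < N"
  shows "(\<Sum>l\<in>index_set N S. if l k = a then H l (l(k := b)) else 0) =
         (\<Sum>l\<in>index_set N S. if l k = b then H (l(k := a)) l else (0 :: 'c::comm_monoid_add))"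
proof (cases "finite (index_set N S)")
  case True
  have "(\<Sum>l\<in>{l\<in>index_set N S. l k = a}. H l (l(k := b))) =
        (\<Sum>l\<in>{l\<in>index_set N S. l k = b}. H (l(k := a)) l)"
    by (rule sum.reindex_bij_witness[of _ "\<lambda>l. l(k := a)" "\<lambda>l. l(k := b)"])
      (use assms in \<open>auto simp: index_set_upd\<close>)
  with True show ?thesis by (simp add: sum.inter_filter)
qed simp

lemma sum_index_set_insert:
  assumes "z \<notin> S"
  shows "(\<Sum>u\<in>index_set N (insert z S). h u) = (\<Sum>u\<in>index_set N S. \<Sum>x<N. h (u(z := x)))"
proof -
  have "(\<Sum>u\<in>index_set N (insert z S). h u) = (\<Sum>(x, u)\<in>{..<N} \<times> index_set N S. h (u(z := x)))"
    by (rule sum.reindex_bij_witness[of _ "\<lambda>(x, u). u(z := x)" "\<lambda>u. (u z, u(z := undefined))"])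
      (use assms in \<open>auto simp: index_set_def PiE_iff extensional_def\<close>)
  also have "\<dots> = (\<Sum>u\<in>index_set N S. \<Sum>x<N. h (u(z := x)))"
    by (subst sum.swap) (simp add: sum.cartesian_product)
  finally show ?thesis .
qed

section \<open>Permutation kernels and the first fundamental theorem\<close>

locale position_set =
  fixes N :: nat and blk :: "nat \<Rightarrow> bool" and S :: "'k set"
  assumes finite_S: "finite S"
begin

abbreviation "X \<equiv> index_set N S"

lemma finite_X: "finite X" by (rule finite_index_set[OF finite_S])

text \<open>The matrix of the operator that permutes the factors by \<open>\<sigma>\<close> and then
  projects to the output labels whose block at position \<open>k\<close> is
  \<open>\<epsilon> k\<close>.\<close>

definition perm_ker :: "('k \<Rightarrow> 'k) \<Rightarrow> ('k \<Rightarrow> bool) \<Rightarrow> ('k \<Rightarrow> nat) \<times> ('k \<Rightarrow> nat) \<Rightarrow> complex" where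
  "perm_ker \<sigma> \<epsilon> = (\<lambda>(u, l). if u \<in> X \<and> (\<forall>k\<in>S. blk (u k) = \<epsilon> k) \<and> l = u \<circ> \<sigma> then 1 else 0)"

text \<open>The commutator of \<open>c\<close> with the diagonal action of the matrix unit \<open>(a, b)\<close>.\<close>

definition gl_deriv ::
  "nat \<Rightarrow> nat \<Rightarrow> (('k \<Rightarrow> nat) \<times> ('k \<Rightarrow> nat) \<Rightarrow> complex) \<Rightarrow> ('k \<Rightarrow> nat) \<times> ('k \<Rightarrow> nat) \<Rightarrow> complex" where
  "gl_deriv a b c = (\<lambda>(u, l). (\<Sum>k\<in>S. if u k = a then c (u(k := b), l) else 0)
                            - (\<Sum>k\<in>S. if l k = b then c (u, l(k := a)) else 0))"

definition diag_op :: "nat \<Rightarrow> nat \<Rightarrow> (('k \<Rightarrow> nat) \<Rightarrow> complex) \<Rightarrow> ('k \<Rightarrow> nat) \<Rightarrow> complex" where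
  "diag_op a b \<phi> x = (\<Sum>k\<in>S. if x k = a then \<phi> (x(k := b)) else 0)"

definition ker_apply :: "(('k \<Rightarrow> nat) \<times> ('k \<Rightarrow> nat) \<Rightarrow> complex) \<Rightarrow> (('k \<Rightarrow> nat) \<Rightarrow> complex) \<Rightarrow> ('k \<Rightarrow> nat) \<Rightarrow> complex" where
  "ker_apply c \<phi> u = (\<Sum>l\<in>X. c (u, l) * \<phi> l)"

text \<open>Summation over relabelled positions moves the matrix unit from the argument into the
  kernel, producing the second sum of \<open>gl_deriv\<close>; the hypothesis exchanges it for the
  first.\<close>

lemma ker_apply_diag_op:
  assumes ab: "a < N" "b < N" and c: "gl_deriv a b c = 0"
  shows "ker_apply c (diag_op a b \<phi>) u = diag_op a b (ker_apply c \<phi>) u"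
proof -
  have c': "(\<Sum>k\<in>S. if l k = b then c (u, l(k := a)) else 0) = (\<Sum>k\<in>S. if u k = a then c (u(k := b), l) else 0)" for l
    using fun_cong[OF c, of "(u, l)"] by (simp add: gl_deriv_def)
  have "ker_apply c (diag_op a b \<phi>) u = (\<Sum>l\<in>X. \<Sum>k\<in>S. if l k = a then c (u, l) * \<phi> (l(k := b)) else 0)"
    unfolding ker_apply_def diag_op_def sum_distrib_left by (intro sum.cong) auto
  also have "\<dots> = (\<Sum>k\<in>S. \<Sum>l\<in>X. if l k = a then c (u, l) * \<phi> (l(k := b)) else 0)"
    by (rule sum.swap)
  also have "\<dots> = (\<Sum>k\<in>S. \<Sum>l\<in>X. if l k = b then c (u, l(k := a)) * \<phi> l else 0)"
    by (intro sum.cong refl sum_index_set_upd[where H = "\<lambda>l l'. c (u, l) * \<phi> l'"] ab)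
  also have "\<dots> = (\<Sum>l\<in>X. \<Sum>k\<in>S. (if l k = b then c (u, l(k := a)) else 0) * \<phi> l)"
    by (subst sum.swap) (intro sum.cong, auto)
  also have "\<dots> = (\<Sum>l\<in>X. \<Sum>k\<in>S. (if u k = a then c (u(k := b), l) else 0) * \<phi> l)"
    by (simp only: sum_distrib_right[symmetric] c')
  also have "\<dots> = (\<Sum>k\<in>S. \<Sum>l\<in>X. (if u k = a then c (u(k := b), l) else 0) * \<phi> l)"
    by (rule sum.swap)
  also have "\<dots> = diag_op a b (ker_apply c \<phi>) u"
    unfolding ker_apply_def diag_op_def by (intro sum.cong) auto
  finally show ?thesis .
qed

text \<open>\<open>place A ps\<close> applies the matrix units of the list \<open>ps\<close> in pairwise different positions outside
  \<open>A\<close>, summed over all choices of positions.\<close>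

fun place :: "'k set \<Rightarrow> (nat \<times> nat) list \<Rightarrow> (('k \<Rightarrow> nat) \<Rightarrow> complex) \<Rightarrow> ('k \<Rightarrow> nat) \<Rightarrow> complex" where
  "place A [] \<phi> x = \<phi> x"
| "place A ((a, b) # ps) \<phi> x = (\<Sum>k\<in>S - A. if x k = a then place (insert k A) ps \<phi> (x(k := b)) else 0)"

definition remove_nth :: "nat \<Rightarrow> 'c list \<Rightarrow> 'c list" where
  "remove_nth i ps = take i ps @ drop (Suc i) ps"

text \<open>Separates the placements that use position \<open>k\<close> from those avoiding it. In
  the former, the unit placed at \<open>k\<close> meets the label \<open>b\<close>, so its row index
  must be \<open>b\<close>; it is used up and leaves its column index at \<open>k\<close>.\<close>

lemma place_avoid:
  assumes "k \<in> S - A"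
  shows "place A ps \<phi> (x(k := b)) = place (insert k A) ps \<phi> (x(k := b))
    + (\<Sum>i<length ps. if b = fst (ps ! i) then place (insert k A) (remove_nth i ps) \<phi> (x(k := snd (ps ! i))) else 0)"
  using assms
proof (induction ps arbitrary: A x)
  case (Cons p ps)
  obtain a1 b1 where p: "p = (a1, b1)" by force
  have fin: "finite (S - A)" using finite_S by auto
  let ?T = "S - insert k A"
  have T: "S - A - {k} = ?T" by auto
  have "place A (p # ps) \<phi> (x(k := b)) = (if b = a1 then place (insert k A) ps \<phi> (x(k := b1)) else 0)
     + (\<Sum>j\<in>?T. if (x(k := b)) j = a1 then place (insert j A) ps \<phi> ((x(k := b))(j := b1)) else 0)"
    unfolding p place.simps by (subst sum.remove[OF fin Cons.prems]) (simp add: T)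
  also have "(\<Sum>j\<in>?T. if (x(k := b)) j = a1 then place (insert j A) ps \<phi> ((x(k := b))(j := b1)) else 0)
     = (\<Sum>j\<in>?T. (if x j = a1 then place (insert j (insert k A)) ps \<phi> (x(k := b, j := b1)) else 0)
        + (\<Sum>i<length ps. if x j = a1 \<and> b = fst (ps ! i)
             then place (insert j (insert k A)) (remove_nth i ps) \<phi> (x(k := snd (ps ! i), j := b1)) else 0))"
  proof (rule sum.cong[OF refl])
    fix j assume j: "j \<in> ?T"
    have "place (insert j A) ps \<phi> ((x(j := b1))(k := b)) = place (insert j (insert k A)) ps \<phi> (x(k := b, j := b1))
        + (\<Sum>i<length ps. if b = fst (ps ! i) then place (insert j (insert k A)) (remove_nth i ps) \<phi> (x(k := snd (ps ! i), j := b1)) else 0)"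
      using j Cons.prems by (subst Cons.IH) (auto simp: insert_commute fun_upd_twist[of j k] intro!: sum.cong)
    then show "(if (x(k := b)) j = a1 then place (insert j A) ps \<phi> ((x(k := b))(j := b1)) else 0) =
       (if x j = a1 then place (insert j (insert k A)) ps \<phi> (x(k := b, j := b1)) else 0)
        + (\<Sum>i<length ps. if x j = a1 \<and> b = fst (ps ! i)
             then place (insert j (insert k A)) (remove_nth i ps) \<phi> (x(k := snd (ps ! i), j := b1)) else 0)"
      using j by (auto simp: fun_upd_twist)
  qed
  also have "\<dots> = place (insert k A) (p # ps) \<phi> (x(k := b)) +
      (\<Sum>i<length ps. if b = fst (ps ! i) then place (insert k A) (p # remove_nth i ps) \<phi> (x(k := snd (ps ! i))) else 0)"
  proof -
    have 1: "(\<Sum>j\<in>?T. if x j = a1 then place (insert j (insert k A)) ps \<phi> (x(k := b, j := b1)) else 0)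
       = place (insert k A) (p # ps) \<phi> (x(k := b))"
      unfolding p place.simps by (intro sum.cong) auto
    have 2: "(\<Sum>j\<in>?T. if x j = a1 \<and> b = fst (ps ! i)
             then place (insert j (insert k A)) (remove_nth i ps) \<phi> (x(k := snd (ps ! i), j := b1)) else 0)
        = (if b = fst (ps ! i) then place (insert k A) (p # remove_nth i ps) \<phi> (x(k := snd (ps ! i))) else 0)" for i
      unfolding p place.simps by (cases "b = fst (ps ! i)") (auto intro!: sum.cong)
    show ?thesis unfolding sum.distrib 1 by (subst sum.swap) (simp only: 2)
  qed
  finally show ?case
    by (simp only: length_Cons sum.lessThan_Suc_shift)
      (simp add: p remove_nth_def algebra_simps del: place.simps fun_upd_apply cong: if_cong)
qed simp

text \<open>A matrix unit summed over all positions falls either on a fresh position or on an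
  occupied one, where E_ab E_bc = E_ac merges it with the unit already there.\<close>

lemma diag_op_place:
  "diag_op a b (place {} ps \<phi>) x = place {} ((a, b) # ps) \<phi> x
    + (\<Sum>i<length ps. if b = fst (ps ! i) then place {} ((a, snd (ps ! i)) # remove_nth i ps) \<phi> x else 0)"
proof -
  have "diag_op a b (place {} ps \<phi>) x = (\<Sum>k\<in>S. (if x k = a then place {k} ps \<phi> (x(k := b)) else 0)
      + (\<Sum>i<length ps. if b = fst (ps ! i) \<and> x k = a then place {k} (remove_nth i ps) \<phi> (x(k := snd (ps ! i))) else 0))"
    unfolding diag_op_def by (rule sum.cong) (auto simp: place_avoid)
  also have "\<dots> = place {} ((a, b) # ps) \<phi> x + (\<Sum>i<length ps. \<Sum>k\<in>S.
        if b = fst (ps ! i) \<and> x k = a then place {k} (remove_nth i ps) \<phi> (x(k := snd (ps ! i))) else 0)"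
    unfolding sum.distrib by (subst (2) sum.swap) simp
  also have "(\<Sum>i<length ps. \<Sum>k\<in>S.
        if b = fst (ps ! i) \<and> x k = a then place {k} (remove_nth i ps) \<phi> (x(k := snd (ps ! i))) else 0)
     = (\<Sum>i<length ps. if b = fst (ps ! i) then place {} ((a, snd (ps ! i)) # remove_nth i ps) \<phi> x else 0)"
    by (rule sum.cong) auto
  finally show ?thesis .
qed

lemma ker_apply_linear:
  "ker_apply c (\<lambda>x. f x - g x) u = ker_apply c f u - ker_apply c g u"
  "ker_apply c (\<lambda>x. \<Sum>i\<in>J. h i x) u = (\<Sum>i\<in>J. ker_apply c (h i) u)"
  "ker_apply c (\<lambda>x. t * f x) u = t * ker_apply c f u"
  by (simp_all add: ker_apply_def algebra_simps sum_subtractf sum_distrib_left) (rule sum.swap)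

text \<open>Solving \<open>diag_op_place\<close> for its longest term expresses \<open>place\<close>
  through \<open>diag_op\<close> and shorter lists. Units merged along a common index stay within
  one block, so the induction stays among block diagonal units.\<close>

lemma ker_apply_place:
  assumes c: "\<And>a b. a < N \<Longrightarrow> b < N \<Longrightarrow> blk a = blk b \<Longrightarrow> gl_deriv a b c = 0"
    and "\<forall>(a, b)\<in>set ps. a < N \<and> b < N \<and> blk a = blk b"
  shows "ker_apply c (place {} ps \<phi>) = place {} ps (ker_apply c \<phi>)"
  using assms(2)
proof (induction "length ps" arbitrary: ps)
  case (Suc m)
  then obtain a b qs where ps: "ps = (a, b) # qs" by (cases ps) auto
  have ab: "a < N" "b < N" "blk a = blk b" using Suc.prems by (auto simp: ps)
  have qs: "ker_apply c (place {} qs \<phi>) = place {} qs (ker_apply c \<phi>)"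
    using Suc by (auto simp: ps)
  have rm: "ker_apply c (place {} ((a, snd (qs ! i)) # remove_nth i qs) \<phi>)
          = place {} ((a, snd (qs ! i)) # remove_nth i qs) (ker_apply c \<phi>)"
    if "i < length qs" "b = fst (qs ! i)" for i
  proof (rule Suc.hyps(1))
    show "m = length ((a, snd (qs ! i)) # remove_nth i qs)"
      using that Suc.hyps(2) by (simp add: ps remove_nth_def)
    have "qs ! i \<in> set qs" using that by simp
    then have "snd (qs ! i) < N \<and> blk (fst (qs ! i)) = blk (snd (qs ! i))"
      using Suc.prems unfolding ps by (auto simp: case_prod_beta)
    then show "\<forall>(a, b)\<in>set ((a, snd (qs ! i)) # remove_nth i qs). a < N \<and> b < N \<and> blk a = blk b"
      using Suc.prems that ab unfolding ps remove_nth_def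
      by (auto dest!: in_set_takeD in_set_dropD)
  qed
  have eq: "place {} ((a, b) # qs) \<psi> = (\<lambda>x. diag_op a b (place {} qs \<psi>) x
     - (\<Sum>i<length qs. if b = fst (qs ! i) then place {} ((a, snd (qs ! i)) # remove_nth i qs) \<psi> x else 0))" for \<psi>
    using diag_op_place by (simp add: fun_eq_iff)
  have if_out: "ker_apply c (\<lambda>x. if B then h x else 0) u = (if B then ker_apply c h u else 0)" for B h u
    by (simp add: ker_apply_def)
  show ?case
  proof
    fix u
    have "ker_apply c (place {} ps \<phi>) u = diag_op a b (place {} qs (ker_apply c \<phi>)) u
     - (\<Sum>i<length qs. if b = fst (qs ! i) then ker_apply c (place {} ((a, snd (qs ! i)) # remove_nth i qs) \<phi>) u else 0)"
      unfolding ps eq ker_apply_linear if_out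
      by (simp only: qs ker_apply_diag_op[OF ab(1,2) c[OF ab]] cong: if_cong)
    also have "\<dots> = place {} ps (ker_apply c \<phi>) u"
      unfolding ps eq using rm by (auto intro!: sum.cong)
    finally show "ker_apply c (place {} ps \<phi>) u = place {} ps (ker_apply c \<phi>) u" .
  qed
qed (simp add: fun_eq_iff ker_apply_def)

definition injections :: "'k set \<Rightarrow> 'k set \<Rightarrow> ('k \<Rightarrow> 'k) set" where
  "injections K T = {f \<in> K \<rightarrow>\<^sub>E T. inj_on f K}"

lemma sum_injections_insert:
  assumes k: "k \<notin> K" and fin: "finite T" "finite K"
  shows "(\<Sum>f\<in>injections (insert k K) T. h f) = (\<Sum>j\<in>T. \<Sum>f\<in>injections K (T - {j}). h (f(k := j)))"
proof -
  have fin': "finite (injections K (T - {j}))" for j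
    unfolding injections_def using fin by (auto intro: finite_subset[OF _ finite_PiE[of K "\<lambda>_. T - {j}"]])
  have "(\<Sum>f\<in>injections (insert k K) T. h f) = (\<Sum>(j, f)\<in>(SIGMA j:T. injections K (T - {j})). h (f(k := j)))"
  proof (rule sum.reindex_bij_witness[of _ "\<lambda>(j, f). f(k := j)" "\<lambda>f. (f k, f(k := undefined))"], goal_cases)
    case (2 f)
    have "inj_on (f(k := undefined)) K"
      by (rule inj_on_cong[THEN iffD1, of _ f]) (use 2 k in \<open>auto simp: injections_def intro: inj_on_subset\<close>)
    then show ?case using 2 k unfolding injections_def PiE_iff extensional_def
      by (auto simp: image_iff)
  next
    case (4 x)
    obtain j f where x: "x = (j, f)" "j \<in> T" "f \<in> injections K (T - {j})" using 4 by auto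
    have "inj_on (f(k := j)) K"
      by (rule inj_on_cong[THEN iffD1, of _ f]) (use x k in \<open>auto simp: injections_def\<close>)
    then have "inj_on (f(k := j)) (insert k K)"
      using x k unfolding inj_on_insert by (auto simp: injections_def PiE_iff)
    then show ?case using x k unfolding injections_def PiE_iff extensional_def by auto
  qed (use k in \<open>auto simp: injections_def PiE_iff extensional_def\<close>)
  also have "\<dots> = (\<Sum>j\<in>T. \<Sum>f\<in>injections K (T - {j}). h (f(k := j)))"
    using fin fin' by (subst sum.Sigma) auto
  finally show ?thesis .
qed

text \<open>An assignment of the listed units to pairwise different positions is an injection
  \<open>f\<close>, with unit \<open>k\<close> applied at \<open>f k\<close>. The inner sum over
  \<open>y\<close> encodes the resulting labelling by equations.\<close>

lemma place_closed_form:
  assumes "distinct ks" "x \<in> X" "\<forall>k\<in>set ks. v k < N"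
  shows "place A (map (\<lambda>k. (u k, v k)) ks) \<phi> x =
    (\<Sum>f\<in>injections (set ks) (S - A). \<Sum>y\<in>X. if (\<forall>k\<in>set ks. x (f k) = u k \<and> y (f k) = v k) \<and>
       (\<forall>j\<in>S - f ` set ks. y j = x j) then \<phi> y else 0)"
  using assms
proof (induction ks arbitrary: A x)
  case Nil
  have "injections {} (S - A) = {\<lambda>_. undefined}" by (auto simp: injections_def)
  moreover have "(\<Sum>y\<in>X. if \<forall>j\<in>S. y j = x j then \<phi> y else 0) = (\<Sum>y\<in>X. if y = x then \<phi> y else 0)"
    by (rule sum.cong) (use Nil in \<open>auto intro: index_set_ext\<close>)
  ultimately show ?case using Nil finite_X by simp
next
  case (Cons k ks)
  have T: "S - insert j A = S - A - {j}" for j by auto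
  have "(if x j = u k then place (insert j A) (map (\<lambda>k. (u k, v k)) ks) \<phi> (x(j := v k)) else 0) =
    (\<Sum>f\<in>injections (set ks) (S - A - {j}). \<Sum>y\<in>X.
       if (\<forall>k'\<in>set (k # ks). x ((f(k := j)) k') = u k' \<and> y ((f(k := j)) k') = v k') \<and>
       (\<forall>j'\<in>S - (f(k := j)) ` set (k # ks). y j' = x j') then \<phi> y else 0)" if j: "j \<in> S - A" for j
  proof (cases "x j = u k")
    case True
    have up: "x(j := v k) \<in> X" using j Cons.prems by (auto intro: index_set_upd)
    show ?thesis
      unfolding if_P[OF True] T[symmetric]
      apply (subst Cons.IH)
      using Cons.prems up apply (auto)[3]
    proof (intro sum.cong refl if_cong, goal_cases)
      case (1 f y)
      have fj: "f k' \<noteq> j" if "k' \<in> set ks" for k' using 1(1) that by (auto simp: injections_def)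
      have im: "(f(k := j)) ` set (k # ks) = insert j (f ` set ks)" using Cons.prems by auto
      have jn: "j \<notin> f ` set ks" using fj by auto
      have "(\<forall>k'\<in>set ks. x ((f(k := j)) k') = u k' \<and> y ((f(k := j)) k') = v k')
        \<longleftrightarrow> (\<forall>k'\<in>set ks. (x(j := v k)) (f k') = u k' \<and> y (f k') = v k')"
        using fj Cons.prems(1) by (intro ball_cong) auto
      moreover have "(\<forall>j'\<in>S - f ` set ks. y j' = (x(j := v k)) j') \<longleftrightarrow>
          y j = v k \<and> (\<forall>j'\<in>S - insert j (f ` set ks). y j' = x j')"
        using j jn by auto
      ultimately show ?case unfolding im using True by auto
    qed
  qed simp
  then show ?case
    using Cons.prems(1) using finite_S by (simp add: sum_injections_insert cong: if_cong)
qed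

text \<open>With one unit for each position the injections are the permutations of \<open>S\<close>,
  and equivariance makes all of them contribute equally, whence the factor counting them. Read from
  right to left, it writes an equivariant kernel as a combination of \<open>place\<close>
  operators.\<close>

lemma equivariant_ker_apply:
  assumes t: "\<And>\<sigma> u l. \<sigma> permutes S \<Longrightarrow> u \<in> X \<Longrightarrow> l \<in> X \<Longrightarrow> t (u \<circ> \<sigma>, l \<circ> \<sigma>) = t (u, l)"
    and ks: "set ks = S" "distinct ks" and x: "x \<in> X"
  shows "(\<Sum>u\<in>X. \<Sum>v\<in>X. t (u, v) * place {} (map (\<lambda>k. (u k, v k)) ks) \<phi> x)
       = of_nat (card (injections S S)) * ker_apply t \<phi> x"
proof -
  have *: "(\<Sum>u\<in>X. \<Sum>v\<in>X. if (\<forall>k\<in>S. x (f k) = u k \<and> y (f k) = v k) then t (u, v) * \<phi> y else 0) = t (x, y) * \<phi> y"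
    if f: "f \<in> injections S S" and y: "y \<in> X" for f y
  proof -
    define \<sigma> where "\<sigma> = (\<lambda>k. if k \<in> S then f k else k)"
    have "f ` S = S"
      using f finite_S by (intro endo_inj_surj) (auto simp: injections_def)
    then have "bij_betw f S S" using f by (auto simp: injections_def bij_betw_def)
    then have "bij_betw \<sigma> S S" by (rule bij_betw_cong[THEN iffD1, rotated]) (simp add: \<sigma>_def)
    then have \<sigma>: "\<sigma> permutes S" by (rule bij_imp_permutes) (simp add: \<sigma>_def)
    have X: "x \<circ> \<sigma> \<in> X" "y \<circ> \<sigma> \<in> X" using x y \<sigma> by (auto intro: index_set_comp_permutes)
    have "(\<forall>k\<in>S. x (f k) = u k \<and> y (f k) = v k) \<longleftrightarrow> u = x \<circ> \<sigma> \<and> v = y \<circ> \<sigma>" if "u \<in> X" "v \<in> X" for u v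
      using index_set_ext[OF that(1) X(1)] index_set_ext[OF that(2) X(2)] by (auto simp: \<sigma>_def)
    then have "(\<Sum>u\<in>X. \<Sum>v\<in>X. if (\<forall>k\<in>S. x (f k) = u k \<and> y (f k) = v k) then t (u, v) * \<phi> y else 0)
      = (\<Sum>u\<in>X. \<Sum>v\<in>X. if v = y \<circ> \<sigma> then if u = x \<circ> \<sigma> then t (u, v) * \<phi> y else 0 else 0)"
      by (intro sum.cong refl) auto
    also have "\<dots> = t (x \<circ> \<sigma>, y \<circ> \<sigma>) * \<phi> y" using X finite_X by simp
    finally show ?thesis using t[OF \<sigma> x y] by simp
  qed
  have "(\<Sum>u\<in>X. \<Sum>v\<in>X. t (u, v) * place {} (map (\<lambda>k. (u k, v k)) ks) \<phi> x)
    = (\<Sum>u\<in>X. \<Sum>v\<in>X. \<Sum>f\<in>injections S S. \<Sum>y\<in>X. if (\<forall>k\<in>S. x (f k) = u k \<and> y (f k) = v k) then t (u, v) * \<phi> y else 0)"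
  proof (intro sum.cong refl)
    fix u v assume "u \<in> X" "v \<in> X"
    then have "\<forall>k\<in>set ks. v k < N" using ks by (auto intro: index_set_lt)
    moreover have "f ` S = S" if "f \<in> injections S S" for f
      using that finite_S by (intro endo_inj_surj) (auto simp: injections_def)
    ultimately show "t (u, v) * place {} (map (\<lambda>k. (u k, v k)) ks) \<phi> x =
      (\<Sum>f\<in>injections S S. \<Sum>y\<in>X. if (\<forall>k\<in>S. x (f k) = u k \<and> y (f k) = v k) then t (u, v) * \<phi> y else 0)"
      using place_closed_form[OF ks(2) x, of v "{}" u \<phi>]
      by (auto simp: ks(1) sum_distrib_left intro!: sum.cong)
  qed
  also have "\<dots> = (\<Sum>f\<in>injections S S. \<Sum>y\<in>X. \<Sum>u\<in>X. \<Sum>v\<in>X. if (\<forall>k\<in>S. x (f k) = u k \<and> y (f k) = v k) then t (u, v) * \<phi> y else 0)"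
    unfolding sum.swap[of _ "injections S S" X] by (subst (3) sum.swap) (subst (2) sum.swap, rule refl)
  also have "\<dots> = of_nat (card (injections S S)) * ker_apply t \<phi> x"
    by (simp add: * ker_apply_def)
  finally show ?thesis .
qed

lemma subspace_supported: "cfun.subspace (supported D)"
  by (rule cfun.subspaceI) (simp_all add: supported_def fscale_def)

definition perm_kers :: "(('k \<Rightarrow> nat) \<times> ('k \<Rightarrow> nat) \<Rightarrow> complex) set" where
  "perm_kers = {perm_ker \<sigma> \<epsilon> | \<sigma> \<epsilon>. \<sigma> permutes S}"

lemma perm_ker_supported: "\<sigma> permutes S \<Longrightarrow> perm_ker \<sigma> \<epsilon> \<in> supported (X \<times> X)"
  by (auto simp: perm_ker_def supported_def index_set_comp_permutes)

lemma ker_mult_perm_ker_left: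
  assumes "\<sigma> permutes S" "u \<in> X"
  shows "ker_mult X (perm_ker \<sigma> \<epsilon>) t (u, l) = (if \<forall>k\<in>S. blk (u k) = \<epsilon> k then t (u \<circ> \<sigma>, l) else 0)"
proof -
  have "ker_mult X (perm_ker \<sigma> \<epsilon>) t (u, l)
      = (\<Sum>k\<in>X. if k = u \<circ> \<sigma> then if \<forall>k\<in>S. blk (u k) = \<epsilon> k then t (u \<circ> \<sigma>, l) else 0 else 0)"
    unfolding ker_mult_def prod.case using assms by (intro sum.cong) (auto simp: perm_ker_def)
  then show ?thesis using index_set_comp_permutes[OF assms(2,1)] finite_X by simp
qed

lemma ker_mult_perm_ker_right:
  assumes "\<sigma> permutes S" "l \<in> X"
  shows "ker_mult X t (perm_ker \<sigma> \<epsilon>) (u, l \<circ> \<sigma>) = (if \<forall>k\<in>S. blk (l k) = \<epsilon> k then t (u, l) else 0)"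
proof -
  have "l = v" if "l \<circ> \<sigma> = v \<circ> \<sigma>" for v
    using that permutes_inv_o(1)[OF assms(1)] by (metis comp_assoc comp_id)
  then have "ker_mult X t (perm_ker \<sigma> \<epsilon>) (u, l \<circ> \<sigma>)
      = (\<Sum>k\<in>X. if k = l then if \<forall>k\<in>S. blk (l k) = \<epsilon> k then t (u, l) else 0 else 0)"
    unfolding ker_mult_def prod.case by (intro sum.cong) (auto simp: perm_ker_def)
  then show ?thesis using assms finite_X by simp
qed

text \<open>The labels between the two factors are \<open>u \<circ> \<sigma>\<close>, so the pattern
  \<open>\<eta>\<close> is transported by the inverse of \<open>\<sigma>\<close> before it is
  compared with \<open>\<epsilon>\<close>.\<close>

lemma perm_ker_mult:
  assumes "\<sigma> permutes S" "\<tau> permutes S"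
  shows "ker_mult X (perm_ker \<sigma> \<epsilon>) (perm_ker \<tau> \<eta>) = (if \<forall>k\<in>S. \<eta> (inv_into UNIV \<sigma> k) = \<epsilon> k then perm_ker (\<sigma> \<circ> \<tau>) \<epsilon> else 0)"
proof
  fix x :: "('k \<Rightarrow> nat) \<times> ('k \<Rightarrow> nat)"
  obtain u l where x: "x = (u, l)" by force
  have eq: "(\<forall>k\<in>S. blk (u (\<sigma> k)) = \<eta> k) \<longleftrightarrow> (\<forall>k\<in>S. blk (u k) = \<eta> (inv_into UNIV \<sigma> k))"
    using ball_permutes[OF assms(1), of "\<lambda>k. blk (u k) = \<eta> (inv_into UNIV \<sigma> k)"]
    by (simp add: permutes_inverses[OF assms(1)])
  show "ker_mult X (perm_ker \<sigma> \<epsilon>) (perm_ker \<tau> \<eta>) x = (if \<forall>k\<in>S. \<eta> (inv_into UNIV \<sigma> k) = \<epsilon> k then perm_ker (\<sigma> \<circ> \<tau>) \<epsilon> else 0) x"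
  proof (cases "u \<in> X")
    case True
    have L: "ker_mult X (perm_ker \<sigma> \<epsilon>) (perm_ker \<tau> \<eta>) x =
        (if \<forall>k\<in>S. blk (u k) = \<epsilon> k then perm_ker \<tau> \<eta> (u \<circ> \<sigma>, l) else 0)"
      unfolding x by (rule ker_mult_perm_ker_left[OF assms(1) True])
    have M: "perm_ker \<tau> \<eta> (u \<circ> \<sigma>, l) =
        (if (\<forall>k\<in>S. blk (u k) = \<eta> (inv_into UNIV \<sigma> k)) \<and> l = u \<circ> (\<sigma> \<circ> \<tau>) then 1 else 0)"
      using index_set_comp_permutes[OF True assms(1)] unfolding perm_ker_def prod.case comp_assoc eq[symmetric] by simp
    show ?thesis
    proof (cases "\<forall>k\<in>S. blk (u k) = \<epsilon> k")
      case b: True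
      then have "(\<forall>k\<in>S. blk (u k) = \<eta> (inv_into UNIV \<sigma> k)) \<longleftrightarrow> (\<forall>k\<in>S. \<eta> (inv_into UNIV \<sigma> k) = \<epsilon> k)"
        by (metis (full_types))
      with b True show ?thesis unfolding L M by (simp add: x perm_ker_def)
    next
      case False
      then have z: "perm_ker (\<sigma> \<circ> \<tau>) \<epsilon> x = 0" by (simp only: x perm_ker_def prod.case if_False simp_thms)
      show ?thesis unfolding L if_not_P[OF False]
        by (rule if_split[of "\<lambda>f. 0 = f x", THEN iffD2]) (simp only: z zero_fun_def simp_thms)
    qed
  qed (simp add: x ker_mult_def perm_ker_def)
qed

lemma ker_adj_perm_ker:
  assumes "\<sigma> permutes S"
  shows "ker_adj (perm_ker \<sigma> \<epsilon>) = perm_ker (inv_into UNIV \<sigma>) (\<epsilon> \<circ> \<sigma>)"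
proof
  fix x :: "('k \<Rightarrow> nat) \<times> ('k \<Rightarrow> nat)"
  obtain u l where x: "x = (u, l)" by force
  have eq: "u = l \<circ> \<sigma> \<longleftrightarrow> l = u \<circ> inv_into UNIV \<sigma>"
    using permutes_inv_o[OF assms] by (metis comp_assoc comp_id)
  show "ker_adj (perm_ker \<sigma> \<epsilon>) x = perm_ker (inv_into UNIV \<sigma>) (\<epsilon> \<circ> \<sigma>) x"
  proof (cases "u = l \<circ> \<sigma>")
    case True
    then have e: "l = u \<circ> inv_into UNIV \<sigma>" using eq by blast
    have "ker_adj (perm_ker \<sigma> \<epsilon>) x = (if l \<in> X \<and> (\<forall>k\<in>S. blk (l k) = \<epsilon> k) then 1 else 0)"
      using True by (simp add: x ker_adj_def perm_ker_def)
    also have "\<dots> = (if u \<in> X \<and> (\<forall>k\<in>S. blk (u k) = (\<epsilon> \<circ> \<sigma>) k) then 1 else 0)"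
      unfolding True comp_apply ball_permutes[OF assms, of "\<lambda>k. blk (l k) = \<epsilon> k"] index_set_comp_permutes_iff[OF assms] ..
    also have "\<dots> = perm_ker (inv_into UNIV \<sigma>) (\<epsilon> \<circ> \<sigma>) x"
      unfolding x perm_ker_def prod.case using e by (simp only: simp_thms)
    finally show ?thesis .
  next
    case False
    then have "l \<noteq> u \<circ> inv_into UNIV \<sigma>" using eq by blast
    then show ?thesis using False by (auto simp: x ker_adj_def perm_ker_def)
  qed
qed

text \<open>The projections to all block patterns sum to the identity.\<close>

lemma ker_one_in_span: "ker_one X \<in> cfun.span perm_kers"
proof -
  let ?E = "S \<rightarrow>\<^sub>E (UNIV :: bool set)"
  have finE: "finite ?E" using finite_S by (intro finite_PiE) auto
  have "ker_one X = (\<Sum>\<epsilon>\<in>?E. perm_ker id \<epsilon>)"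
  proof
    fix x :: "('k \<Rightarrow> nat) \<times> ('k \<Rightarrow> nat)"
    obtain u l where x: "x = (u, l)" by force
    have "(\<Sum>\<epsilon>\<in>?E. perm_ker id \<epsilon>) x = (\<Sum>\<epsilon>\<in>?E. perm_ker id \<epsilon> x)"
      using finE by (induction rule: finite_induct) auto
    also have "\<dots> = (\<Sum>\<epsilon>\<in>?E. if \<epsilon> = restrict (blk \<circ> u) S then if u \<in> X \<and> l = u then 1 else 0 else 0)"
    proof (rule sum.cong[OF refl])
      fix \<epsilon> :: "'k \<Rightarrow> bool" assume e: "\<epsilon> \<in> ?E"
      then have "(\<forall>k\<in>S. blk (u k) = \<epsilon> k) \<longleftrightarrow> \<epsilon> = restrict (blk \<circ> u) S"
        by (auto simp: fun_eq_iff PiE_iff extensional_def)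
      then show "perm_ker id \<epsilon> x = (if \<epsilon> = restrict (blk \<circ> u) S then if u \<in> X \<and> l = u then 1 else 0 else 0)"
        by (auto simp: x perm_ker_def)
    qed
    also have "\<dots> = ker_one X x" using finE by (auto simp: x ker_one_def)
    finally show "ker_one X x = (\<Sum>\<epsilon>\<in>?E. perm_ker id \<epsilon>) x" ..
  qed
  also have "\<dots> \<in> cfun.span perm_kers"
    by (intro cfun.span_sum cfun.span_base) (auto simp: perm_kers_def permutes_id)
  finally show ?thesis .
qed

lemma ker_mult_linear_left:
  "ker_mult I (a + b) c = ker_mult I a c + ker_mult I b c"
  "ker_mult I (fscale t a) c = fscale t (ker_mult I a c)"
  "ker_mult I 0 c = 0" "ker_mult I c 0 = 0"
  by (auto simp: ker_mult_def fscale_def fun_eq_iff algebra_simps sum.distrib sum_distrib_left)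

lemma ker_mult_in_span:
  assumes "a \<in> cfun.span perm_kers" "b \<in> cfun.span perm_kers"
  shows "ker_mult X a b \<in> cfun.span perm_kers"
  using assms(1)
proof (induction rule: cfun.span_induct_alt)
  case base
  show ?case by (simp only: ker_mult_linear_left cfun.span_zero)
next
  case (step s x y)
  have "ker_mult X x b \<in> cfun.span perm_kers"
    using assms(2)
  proof (induction rule: cfun.span_induct_alt)
    case base
    show ?case by (simp only: ker_mult_linear_left cfun.span_zero)
  next
    case (step s' x' y')
    obtain \<sigma> \<epsilon> \<tau> \<eta> where x: "x = perm_ker \<sigma> \<epsilon>" "\<sigma> permutes S" "x' = perm_ker \<tau> \<eta>" "\<tau> permutes S"
      using \<open>x \<in> perm_kers\<close> \<open>x' \<in> perm_kers\<close> unfolding perm_kers_def by blast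
    then have k: "perm_ker (\<sigma> \<circ> \<tau>) \<epsilon> \<in> perm_kers"
      unfolding perm_kers_def using permutes_compose by blast
    have "ker_mult X x x' \<in> cfun.span perm_kers"
      unfolding x(1,3) perm_ker_mult[OF x(2,4)]
      by (rule if_split[of "\<lambda>f. f \<in> _", THEN iffD2]) (simp only: cfun.span_base[OF k] cfun.span_zero simp_thms)
    then show ?case using step by (simp only: ker_mult_linear cfun.span_add cfun.span_scale)
  qed
  then show ?case using step by (simp only: ker_mult_linear_left cfun.span_add cfun.span_scale)
qed

lemma ker_adj_in_span:
  assumes "a \<in> cfun.span perm_kers"
  shows "ker_adj a \<in> cfun.span perm_kers"
  using assms
proof (induction rule: cfun.span_induct_alt)
  case base
  have "ker_adj (0 :: ('k \<Rightarrow> nat) \<times> ('k \<Rightarrow> nat) \<Rightarrow> complex) = 0" by (auto simp: ker_adj_def)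
  then show ?case by (simp only: cfun.span_zero)
next
  case (step s x y)
  have "ker_adj x \<in> perm_kers"
    using step(1) ker_adj_perm_ker permutes_inv unfolding perm_kers_def by blast
  moreover have "ker_adj (fscale s x + y) = fscale (cnj s) (ker_adj x) + ker_adj y"
    by (auto simp: ker_adj_def fscale_def)
  ultimately show ?case using step by (simp only: cfun.span_add cfun.span_scale cfun.span_base)
qed

text \<open>First fundamental theorem for a product of two general linear groups: the commutant of the
  permutation kernels consists of permutation-equivariant kernels, which by
  \<open>equivariant_ker_apply\<close> are combinations of the operators \<open>place\<close>, and those are
  polynomials in the diagonal action.\<close>

theorem invariant_in_span:
  assumes c: "c \<in> supported (X \<times> X)"
    and inv: "\<And>a b. a < N \<Longrightarrow> b < N \<Longrightarrow> blk a = blk b \<Longrightarrow> gl_deriv a b c = 0"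
  shows "c \<in> cfun.span perm_kers"
proof -
  have "perm_kers \<subseteq> supported (X \<times> X)"
  proof
    fix x assume "x \<in> perm_kers"
    then obtain \<sigma> \<epsilon> where "x = perm_ker \<sigma> \<epsilon>" "\<sigma> permutes S" unfolding perm_kers_def by blast
    then show "x \<in> supported (X \<times> X)" using perm_ker_supported[of \<sigma> \<epsilon>] by simp
  qed
  then have supp: "cfun.span perm_kers \<subseteq> supported (X \<times> X)"
    by (rule cfun.span_minimal[OF _ subspace_supported])
  have main: "ker_mult X c t = ker_mult X t c"
    if t: "t \<in> supported (X \<times> X)" and span_comm: "\<And>b. b \<in> cfun.span perm_kers \<Longrightarrow> ker_mult X b t = ker_mult X t b"
    for t :: "('k \<Rightarrow> nat) \<times> ('k \<Rightarrow> nat) \<Rightarrow> complex"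
  proof -
  have comm: "ker_mult X (perm_ker \<sigma> \<epsilon>) t = ker_mult X t (perm_ker \<sigma> \<epsilon>)" if "\<sigma> permutes S" for \<sigma> \<epsilon>
  proof -
    have "perm_ker \<sigma> \<epsilon> \<in> perm_kers" using that unfolding perm_kers_def by blast
    then show ?thesis by (intro span_comm cfun.span_base)
  qed
  \<comment> \<open>Entry \<open>(u, l \<circ> \<sigma>)\<close> of the commutation relation. For
    the identity permutation it says that \<open>t\<close> preserves block patterns, and then for
    any \<open>\<sigma>\<close> that \<open>t\<close> is equivariant.\<close>
  have comm': "(if \<forall>k\<in>S. blk (u k) = \<epsilon> k then t (u \<circ> \<sigma>, l \<circ> \<sigma>) else 0) = (if \<forall>k\<in>S. blk (l k) = \<epsilon> k then t (u, l) else 0)"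
    if "\<sigma> permutes S" "u \<in> X" "l \<in> X" for \<sigma> \<epsilon> u l
    using fun_cong[OF comm[OF that(1), of \<epsilon>], of "(u, l \<circ> \<sigma>)"]
    unfolding ker_mult_perm_ker_left[OF that(1,2)] ker_mult_perm_ker_right[OF that(1,3)] .
  have t_blk: "\<forall>k\<in>S. blk (u k) = blk (l k)" if "u \<in> X" "l \<in> X" "t (u, l) \<noteq> 0" for u l
  proof (rule ccontr)
    assume "\<not> ?thesis"
    then have n: "\<not> (\<forall>k\<in>S. blk (l k) = (blk \<circ> u) k)" by (metis comp_apply)
    have "t (u, l) = 0"
      using comm'[OF permutes_id that(1,2), of "blk \<circ> u"] unfolding if_not_P[OF n] by simp
    with that(3) show False by simp
  qed
  have t_perm: "t (u \<circ> \<sigma>, l \<circ> \<sigma>) = t (u, l)" if "\<sigma> permutes S" "u \<in> X" "l \<in> X" for \<sigma> u l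
  proof (cases "\<forall>k\<in>S. blk (u k) = blk (l k)")
    case True
    then show ?thesis using comm'[OF that, of "blk \<circ> u"] by auto
  next
    case False
    then have "t (u, l) = 0" using t_blk that by blast
    moreover have "\<not> (\<forall>k\<in>S. blk ((u \<circ> \<sigma>) k) = blk ((l \<circ> \<sigma>) k))"
      using False ball_permutes[OF that(1), of "\<lambda>k. blk (u k) = blk (l k)"] by simp
    then have "t (u \<circ> \<sigma>, l \<circ> \<sigma>) = 0"
      using t_blk[OF index_set_comp_permutes[OF that(2,1)] index_set_comp_permutes[OF that(3,1)]] by blast
    ultimately show ?thesis by simp
  qed
  obtain ks where ks: "set ks = S" "distinct ks" using finite_distinct_list[OF finite_S] by blast
  let ?C = "of_nat (card (injections S S)) :: complex"
  have "restrict id S \<in> injections S S"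
    by (auto simp: injections_def inj_on_def)
  moreover have "finite (injections S S)"
    unfolding injections_def using finite_S by (auto intro: finite_subset[OF _ finite_PiE[of S "\<lambda>_. S"]])
  ultimately have C: "?C \<noteq> 0" by (metis card_0_eq empty_iff of_nat_eq_0_iff)
  \<comment> \<open>Both sides carry the number of permutations, which is nonzero. Each
    \<open>place\<close> operator with nonzero coefficient is built from block diagonal units and so
    commutes with \<open>c\<close>.\<close>
  have app: "?C * ker_apply c (ker_apply t \<phi>) u = ?C * ker_apply t (ker_apply c \<phi>) u" if u: "u \<in> X" for \<phi> u
  proof -
    let ?p = "\<lambda>u v. place {} (map (\<lambda>k. (u k, v k)) ks)"
    have comm_p: "t (v, w) * ker_apply c (?p v w \<phi>) u = t (v, w) * ?p v w (ker_apply c \<phi>) u" if "v \<in> X" "w \<in> X" for v w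
    proof (cases "t (v, w) = 0")
      case False
      then have ps: "\<forall>(a, b)\<in>set (map (\<lambda>k. (v k, w k)) ks). a < N \<and> b < N \<and> blk a = blk b"
        using t_blk[OF that] that ks by (auto intro: index_set_lt)
      have "ker_apply c (?p v w \<phi>) = ?p v w (ker_apply c \<phi>)"
        by (rule ker_apply_place[OF _ ps]) (rule inv)
      then show ?thesis by simp
    qed simp
    have "?C * ker_apply c (ker_apply t \<phi>) u = ker_apply c (\<lambda>x. ?C * ker_apply t \<phi> x) u"
      by (simp add: ker_apply_linear)
    also have "\<dots> = ker_apply c (\<lambda>x. \<Sum>v\<in>X. \<Sum>w\<in>X. t (v, w) * ?p v w \<phi> x) u"
      unfolding ker_apply_def[of c] by (rule sum.cong[OF refl]) (simp add: equivariant_ker_apply[OF t_perm ks])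
    also have "\<dots> = (\<Sum>v\<in>X. \<Sum>w\<in>X. t (v, w) * ker_apply c (?p v w \<phi>) u)"
      by (simp add: ker_apply_linear)
    also have "\<dots> = (\<Sum>v\<in>X. \<Sum>w\<in>X. t (v, w) * ?p v w (ker_apply c \<phi>) u)"
      by (intro sum.cong refl comm_p)
    also have "\<dots> = ?C * ker_apply t (ker_apply c \<phi>) u"
      by (rule equivariant_ker_apply[OF t_perm ks u])
    finally show ?thesis .
  qed
  show ?thesis
  proof
    fix x :: "('k \<Rightarrow> nat) \<times> ('k \<Rightarrow> nat)"
    obtain u l where x: "x = (u, l)" by force
    show "ker_mult X c t x = ker_mult X t c x"
    proof (cases "u \<in> X \<and> l \<in> X")
      case True
      \<comment> \<open>Applying kernels to the indicator of \<open>l\<close> reads off their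
        entries.\<close>
      define e :: "('k \<Rightarrow> nat) \<Rightarrow> complex" where "e = (\<lambda>v. if v = l then 1 else 0)"
      have e: "ker_apply d e = (\<lambda>v. d (v, l))" for d
      proof
        fix v
        have "ker_apply d e v = (\<Sum>k\<in>X. if k = l then d (v, l) else 0)"
          unfolding ker_apply_def e_def by (rule sum.cong) auto
        then show "ker_apply d e v = d (v, l)" using True finite_X by simp
      qed
      show ?thesis
        using app[of u e] True C unfolding e by (simp add: x ker_mult_def ker_apply_def)
    next
      case False
      then show ?thesis
        using ker_mult_supported[OF c t] ker_mult_supported[OF t c] by (auto simp: x supported_def)
    qed
  qed
qed
  show ?thesis
    by (rule double_commutant[OF finite_X cfun.subspace_span supp ker_one_in_span ker_mult_in_span ker_adj_in_span c main])
qed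

end

lemma sum_swap3: "(\<Sum>a\<in>A. \<Sum>b\<in>B. \<Sum>c\<in>C. f a b c) = (\<Sum>b\<in>B. \<Sum>c\<in>C. \<Sum>a\<in>A. f a b c)"
  by (subst sum.swap, rule sum.cong[OF refl], rule sum.swap)

lemma (in position_set) gl_deriv_supported:
  assumes "a < N" "b < N" "c \<in> supported (X \<times> X)"
  shows "gl_deriv a b c \<in> supported (X \<times> X)"
proof -
  have "c (u(k := b), l) = 0" if "(u, l) \<notin> X \<times> X" "k \<in> S" "u k = a" for u l k
    using assms that index_set_upd_iff[of k S b N u] unfolding supported_def by auto
  moreover have "c (u, l(k := a)) = 0" if "(u, l) \<notin> X \<times> X" "k \<in> S" "l k = b" for u l k
    using assms that index_set_upd_iff[of k S a N l] unfolding supported_def by auto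
  ultimately have "gl_deriv a b c (u, l) = 0" if "(u, l) \<notin> X \<times> X" for u l
    using that unfolding gl_deriv_def prod.case by (subst (1 2) sum.neutral) auto
  then show ?thesis unfolding supported_def by auto
qed

text \<open>The adjoint of a matrix unit is its transpose. Hence the orthogonal complement of a
  stable space of kernels is stable, the substitute for averaging over the unitary group.\<close>

lemma (in position_set) gl_deriv_adjoint:
  assumes ab: "a < N" "b < N"
  shows "ip (X \<times> X) (gl_deriv a b c) d = ip (X \<times> X) c (gl_deriv b a d)"
proof -
  have 1: "(\<Sum>u\<in>X. \<Sum>l\<in>X. \<Sum>k\<in>S. if u k = a then c (u(k := b), l) * cnj (d (u, l)) else 0)
     = (\<Sum>u\<in>X. \<Sum>l\<in>X. \<Sum>k\<in>S. if u k = b then c (u, l) * cnj (d (u(k := a), l)) else 0)"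
  proof -
    have "(\<Sum>u\<in>X. \<Sum>l\<in>X. \<Sum>k\<in>S. if u k = a then c (u(k := b), l) * cnj (d (u, l)) else 0)
        = (\<Sum>l\<in>X. \<Sum>k\<in>S. \<Sum>u\<in>X. if u k = a then c (u(k := b), l) * cnj (d (u, l)) else 0)"
      by (subst sum.swap) (intro sum.cong refl sum.swap)
    also have "\<dots> = (\<Sum>l\<in>X. \<Sum>k\<in>S. \<Sum>u\<in>X. if u k = b then c (u, l) * cnj (d (u(k := a), l)) else 0)"
      by (intro sum.cong refl sum_index_set_upd[where H = "\<lambda>u u'. c (u', _) * cnj (d (u, _))"] ab)
    also have "\<dots> = (\<Sum>u\<in>X. \<Sum>l\<in>X. \<Sum>k\<in>S. if u k = b then c (u, l) * cnj (d (u(k := a), l)) else 0)"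
      by (subst (2) sum.swap) (intro sum.cong refl sum.swap)
    finally show ?thesis .
  qed
  have 2: "(\<Sum>u\<in>X. \<Sum>l\<in>X. \<Sum>k\<in>S. if l k = b then c (u, l(k := a)) * cnj (d (u, l)) else 0)
     = (\<Sum>u\<in>X. \<Sum>l\<in>X. \<Sum>k\<in>S. if l k = a then c (u, l) * cnj (d (u, l(k := b))) else 0)"
  proof -
    have "(\<Sum>u\<in>X. \<Sum>l\<in>X. \<Sum>k\<in>S. if l k = b then c (u, l(k := a)) * cnj (d (u, l)) else 0)
        = (\<Sum>u\<in>X. \<Sum>k\<in>S. \<Sum>l\<in>X. if l k = b then c (u, l(k := a)) * cnj (d (u, l)) else 0)"
      by (intro sum.cong refl sum.swap)
    also have "\<dots> = (\<Sum>u\<in>X. \<Sum>k\<in>S. \<Sum>l\<in>X. if l k = a then c (u, l) * cnj (d (u, l(k := b))) else 0)"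
      by (intro sum.cong refl sum_index_set_upd[where H = "\<lambda>l l'. c (_, l') * cnj (d (_, l))"] ab)
    also have "\<dots> = (\<Sum>u\<in>X. \<Sum>l\<in>X. \<Sum>k\<in>S. if l k = a then c (u, l) * cnj (d (u, l(k := b))) else 0)"
      by (intro sum.cong refl sum.swap)
    finally show ?thesis .
  qed
  have L: "ip (X \<times> X) (gl_deriv a b c) d =
      (\<Sum>u\<in>X. \<Sum>l\<in>X. \<Sum>k\<in>S. if u k = a then c (u(k := b), l) * cnj (d (u, l)) else 0)
    - (\<Sum>u\<in>X. \<Sum>l\<in>X. \<Sum>k\<in>S. if l k = b then c (u, l(k := a)) * cnj (d (u, l)) else 0)"
    unfolding ip_def sum_pairs gl_deriv_def prod.case sum_subtractf[symmetric] left_diff_distrib sum_distrib_right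
    by (intro sum.cong arg_cong2[where f = minus] refl) auto
  have R: "ip (X \<times> X) c (gl_deriv b a d) =
      (\<Sum>u\<in>X. \<Sum>l\<in>X. \<Sum>k\<in>S. if u k = b then c (u, l) * cnj (d (u(k := a), l)) else 0)
    - (\<Sum>u\<in>X. \<Sum>l\<in>X. \<Sum>k\<in>S. if l k = a then c (u, l) * cnj (d (u, l(k := b))) else 0)"
    unfolding ip_def sum_pairs gl_deriv_def prod.case complex_cnj_diff cnj_sum right_diff_distrib sum_distrib_left
      sum_subtractf[symmetric]
    by (intro sum.cong arg_cong2[where f = minus] refl) auto
  show ?thesis unfolding L R 1 2 ..
qed

section \<open>Operators on tensors built from a \<open>gl\<^sub>N\<close>-action\<close>

text \<open>\<open>E a b\<close> is the action of a matrix unit; \<open>blk\<close> tells the two diagonal blocks apart and \<open>cst\<close>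
  gives the values of a character of the block diagonal subalgebra.\<close>

locale gl_family = complex_vector_space scale
  for scale :: "complex \<Rightarrow> 'm::ab_group_add \<Rightarrow> 'm" +
  fixes N n :: nat and blk :: "nat \<Rightarrow> bool" and E :: "nat \<Rightarrow> nat \<Rightarrow> 'm \<Rightarrow> 'm" and cst :: "bool \<Rightarrow> complex"
  assumes E_linear: "a < N \<Longrightarrow> b < N \<Longrightarrow> Vector_Spaces.linear scale scale (E a b)"
    and E_comm: "a < N \<Longrightarrow> b < N \<Longrightarrow> c < N \<Longrightarrow> d < N \<Longrightarrow>
      E a b (E c d m) - E c d (E a b m) = (if b = c then E a d m else 0) - (if d = a then E c b m else 0)"
begin

definition "V = {1..n}"

lemma finite_V: "finite V" by (simp add: V_def)

abbreviation "MI \<equiv> index_set N V"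

text \<open>The equation for the total action of \<open>E a b\<close> on module and tensor factors,
  solved for its action on the coefficient \<open>f w\<close>. In this form it removes a block
  diagonal letter standing next to an invariant tensor.\<close>

definition invariants :: "'m tensor set" where
  "invariants = {f \<in> supported MI. \<forall>a<N. \<forall>b<N. blk a = blk b \<longrightarrow> (\<forall>w\<in>MI.
     E a b (f w) = (if a = b then scale (cst (blk a)) (f w) else 0) - (\<Sum>k\<in>V. if w k = a then f (w(k := b)) else 0))}"

lemma E_add: "a < N \<Longrightarrow> b < N \<Longrightarrow> E a b (x + y) = E a b x + E a b y"
  using E_linear[of a b] by (simp add: Vector_Spaces.linear_iff)

lemma E_scale: "a < N \<Longrightarrow> b < N \<Longrightarrow> E a b (scale t x) = scale t (E a b x)"
  using E_linear[of a b] by (simp add: Vector_Spaces.linear_iff)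

lemma E_zero: "a < N \<Longrightarrow> b < N \<Longrightarrow> E a b 0 = 0"
  using E_scale[of a b 0 0] by simp

lemma E_diff: "a < N \<Longrightarrow> b < N \<Longrightarrow> E a b (x - y) = E a b x - E a b y"
  using E_add[of a b "x - y" y] by simp

lemma E_sum: "a < N \<Longrightarrow> b < N \<Longrightarrow> E a b (sum f A) = (\<Sum>x\<in>A. E a b (f x))"
  by (induction A rule: infinite_finite_induct) (simp_all add: E_zero E_add)

fun chain :: "nat list \<Rightarrow> (nat \<Rightarrow> nat) \<Rightarrow> (nat \<Rightarrow> nat) \<Rightarrow> 'm \<Rightarrow> 'm" where
  "chain [] u l m = m"
| "chain (k # ks) u l m = E (u k) (l k) (chain ks u l m)"

lemma chain_append: "chain (ks @ ks') u l m = chain ks u l (chain ks' u l m)"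
  by (induction ks) auto

lemma chain_cong:
  "(\<And>k. k \<in> set K \<Longrightarrow> u k = u' k) \<Longrightarrow> (\<And>k. k \<in> set K \<Longrightarrow> l k = l' k) \<Longrightarrow> chain K u l m = chain K u' l' m"
  by (induction K) auto

definition bounded_on :: "nat set \<Rightarrow> (nat \<Rightarrow> nat) \<Rightarrow> bool" where
  "bounded_on K u \<longleftrightarrow> (\<forall>k\<in>K. u k < N)"

lemma chain_linear:
  assumes "bounded_on (set K) u" "bounded_on (set K) l"
  shows "chain K u l (x + y) = chain K u l x + chain K u l y" "chain K u l (scale t x) = scale t (chain K u l x)"
    "chain K u l 0 = 0" "chain K u l (x - y) = chain K u l x - chain K u l y"
    "chain K u l (sum f A) = (\<Sum>x\<in>A. chain K u l (f x))"
proof -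
  show add: "chain K u l (x + y) = chain K u l x + chain K u l y" for x y
    using assms by (induction K) (auto simp: E_add bounded_on_def)
  show "chain K u l (scale t x) = scale t (chain K u l x)"
    using assms by (induction K) (auto simp: E_scale bounded_on_def)
  show 0: "chain K u l 0 = 0"
    using assms by (induction K) (auto simp: E_zero bounded_on_def)
  show "chain K u l (x - y) = chain K u l x - chain K u l y"
    using assms by (induction K) (auto simp: E_diff bounded_on_def)
  show "chain K u l (sum f A) = (\<Sum>x\<in>A. chain K u l (f x))"
    by (induction A rule: infinite_finite_induct) (simp_all add: 0 add)
qed

text \<open>Commuting with \<open>E a b\<close> is a derivation on words; on a single letter it
  replaces the output label \<open>b\<close> by \<open>a\<close> or, with a minus sign, the input
  label \<open>a\<close> by \<open>b\<close>.\<close>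

lemma chain_comm:
  assumes "distinct K" "bounded_on (set K) u" "bounded_on (set K) l" and ab: "a < N" "b < N"
  shows "E a b (chain K u l m) = chain K u l (E a b m)
      + (\<Sum>k\<in>set K. if u k = b then chain K (u(k := a)) l m else 0)
      - (\<Sum>k\<in>set K. if l k = a then chain K u (l(k := b)) m else 0)"
  using assms(1-3)
proof (induction K)
  case (Cons k ks)
  let ?x = "chain ks u l m"
  have b: "u k < N" "l k < N" "bounded_on (set ks) u" "bounded_on (set ks) l"
    using Cons.prems by (auto simp: bounded_on_def)
  have k: "k \<notin> set ks" "distinct ks" using Cons.prems by auto
  have E1: "E a b (E (u k) (l k) ?x) = E (u k) (l k) (E a b ?x)
       + (if b = u k then E a (l k) ?x else 0) - (if l k = a then E (u k) b ?x else 0)"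
    using E_comm[OF ab b(1,2), of ?x] by (simp add: algebra_simps split: if_splits)
  have ifE: "E (u k) (l k) (if P then y else 0) = (if P then E (u k) (l k) y else 0)" for P y
    using b by (simp add: E_zero)
  have u: "chain ks (u(k := a)) l m = ?x" "chain ks u (l(k := b)) m = ?x"
    using k by (auto intro: chain_cong)
  have s1: "(\<Sum>j\<in>set (k # ks). if u j = b then chain (k # ks) (u(j := a)) l m else 0) =
     (if b = u k then E a (l k) ?x else 0) + (\<Sum>j\<in>set ks. if u j = b then E (u k) (l k) (chain ks (u(j := a)) l m) else 0)"
    using k u by (auto intro!: arg_cong2[where f = plus] sum.cong)
  have s2: "(\<Sum>j\<in>set (k # ks). if l j = a then chain (k # ks) u (l(j := b)) m else 0) =
     (if l k = a then E (u k) b ?x else 0) + (\<Sum>j\<in>set ks. if l j = a then E (u k) (l k) (chain ks u (l(j := b)) m) else 0)"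
    using k u by (auto intro!: arg_cong2[where f = plus] sum.cong)
  show ?case
    unfolding s1 s2 by (simp add: E1 Cons.IH[OF k(2) b(3,4)] E_add E_diff E_sum b ifE algebra_simps)
qed simp

text \<open>Positions \<open>1, \<dots>, n\<close> are the tensor factors; every further position \<open>k\<close>, listed in \<open>K\<close>, stands
  for one application \<open>E (u k) (l k)\<close> of the Lie algebra to the module. A kernel in the labels \<open>u\<close>
  (output) and \<open>l\<close> (input) of all positions thus defines an operator on tensors.\<close>

definition pos :: "nat list \<Rightarrow> nat set" where
  "pos K = V \<union> set K"

definition positions :: "nat list \<Rightarrow> bool" where
  "positions K \<longleftrightarrow> distinct K \<and> set K \<inter> V = {}"

sublocale ps: position_set N blk "pos K" for K
  by standard (simp add: pos_def finite_V)

definition ker_op :: "nat list \<Rightarrow> ((nat \<Rightarrow> nat) \<times> (nat \<Rightarrow> nat) \<Rightarrow> complex) \<Rightarrow> 'm tensor \<Rightarrow> 'm tensor" where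
  "ker_op K c f w = (\<Sum>u\<in>index_set N (pos K). if restrict u V = w
     then \<Sum>l\<in>index_set N (pos K). scale (c (u, l)) (chain K u l (f (restrict l V))) else 0)"

lemma restrict_V: "u \<in> index_set N (pos K) \<Longrightarrow> restrict u V \<in> MI"
  by (auto simp: index_set_def pos_def)

lemma bounded_on_pos: "u \<in> index_set N (pos K) \<Longrightarrow> bounded_on (set K) u"
  by (auto simp: index_set_def pos_def bounded_on_def)

lemma ker_op_supported: "ker_op K c f \<in> supported MI"
  unfolding supported_def ker_op_def using restrict_V by (auto intro!: sum.neutral)

lemma ker_op_linear:
  "ker_op K (c + d) f = ker_op K c f + ker_op K d f"
  "ker_op K (c - d) f = ker_op K c f - ker_op K d f"
  "ker_op K (fscale t c) f = tscale scale t (ker_op K c f)"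
  "ker_op K 0 f = 0"
proof -
  show "ker_op K (c + d) f = ker_op K c f + ker_op K d f"
    by (rule ext) (auto simp: ker_op_def scale_left_distrib sum.distrib[symmetric] intro!: sum.cong)
  show "ker_op K (c - d) f = ker_op K c f - ker_op K d f"
    by (rule ext) (auto simp: ker_op_def scale_left_diff_distrib sum_subtractf[symmetric] intro!: sum.cong)
  show "ker_op K (fscale t c) f = tscale scale t (ker_op K c f)"
    by (rule ext) (auto simp: ker_op_def fscale_def tscale_def scale_sum_right intro!: sum.cong)
  show "ker_op K 0 f = 0"
    by (rule ext) (simp add: ker_op_def zero_fun_def cong: if_cong)
qed

text \<open>Moving \<open>E a b\<close> through the word changes labels of letters; when it reaches
  the tensor, invariance changes the input labels of the factors in the same way. The two kinds of
  input labels unite to one sum over \<open>pos K\<close>.\<close>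

lemma E_chain_invariants:
  assumes K: "positions K" and ab: "a < N" "b < N" "blk a = blk b" and g: "g \<in> invariants"
    and u: "u \<in> index_set N (pos K)" and l: "l \<in> index_set N (pos K)"
  shows "E a b (chain K u l (g (restrict l V))) = (if a = b then scale (cst (blk a)) (chain K u l (g (restrict l V))) else 0)
     + (\<Sum>k\<in>set K. if u k = b then chain K (u(k := a)) l (g (restrict l V)) else 0)
     - (\<Sum>k\<in>pos K. if l k = a then chain K u (l(k := b)) (g (restrict (l(k := b)) V)) else 0)"
proof -
  have b: "bounded_on (set K) u" "bounded_on (set K) l" using u l bounded_on_pos by auto
  have KV: "k \<notin> V" if "k \<in> set K" for k using K that by (auto simp: positions_def)
  have g1: "E a b (g (restrict l V)) = (if a = b then scale (cst (blk a)) (g (restrict l V)) else 0)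
      - (\<Sum>k\<in>V. if l k = a then g (restrict (l(k := b)) V) else 0)"
  proof -
    have "(\<Sum>k\<in>V. if restrict l V k = a then g ((restrict l V)(k := b)) else 0)
        = (\<Sum>k\<in>V. if l k = a then g (restrict (l(k := b)) V) else 0)"
      by (rule sum.cong) (auto intro!: arg_cong[where f = g] simp: fun_eq_iff)
    moreover have "E a b (g (restrict l V)) = (if a = b then scale (cst (blk a)) (g (restrict l V)) else 0)
      - (\<Sum>k\<in>V. if restrict l V k = a then g ((restrict l V)(k := b)) else 0)"
      using g ab restrict_V[OF l] unfolding invariants_def by blast
    ultimately show ?thesis by simp
  qed
  have g2: "chain K u l (E a b (g (restrict l V))) = (if a = b then scale (cst (blk a)) (chain K u l (g (restrict l V))) else 0)
      - (\<Sum>k\<in>V. if l k = a then chain K u (l(k := b)) (g (restrict (l(k := b)) V)) else 0)"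
  proof -
    have "chain K u l (if l k = a then g (restrict (l(k := b)) V) else 0) =
        (if l k = a then chain K u (l(k := b)) (g (restrict (l(k := b)) V)) else 0)" if "k \<in> V" for k
      using KV that b by (auto simp: chain_linear intro!: chain_cong)
    then show ?thesis unfolding g1 using b by (auto simp: chain_linear)
  qed
  have r: "restrict (l(k := b)) V = restrict l V" if "k \<in> set K" for k
    using KV[OF that] by (auto simp: fun_eq_iff)
  have s: "(\<Sum>k\<in>pos K. if l k = a then chain K u (l(k := b)) (g (restrict (l(k := b)) V)) else 0) =
    (\<Sum>k\<in>V. if l k = a then chain K u (l(k := b)) (g (restrict (l(k := b)) V)) else 0)
    + (\<Sum>k\<in>set K. if l k = a then chain K u (l(k := b)) (g (restrict l V)) else 0)"
    unfolding pos_def using K r by (subst sum.union_disjoint) (auto simp: positions_def finite_V intro!: sum.cong)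
  show ?thesis
    unfolding s chain_comm[OF _ b ab(1,2), OF conjunct1[OF K[unfolded positions_def]]] g2
    by (simp add: algebra_simps)
qed

text \<open>The left side is the failure of \<open>ker_op K c g\<close> to be invariant. It comes
  from the derivative of the kernel, so passing from kernels to tensors is equivariant.\<close>

lemma ker_op_equivariant:
  assumes K: "positions K" and ab: "a < N" "b < N" "blk a = blk b" and g: "g \<in> invariants" and w: "w \<in> MI"
  shows "E a b (ker_op K c g w) - (if a = b then scale (cst (blk a)) (ker_op K c g w) else 0)
      + (\<Sum>k\<in>V. if w k = a then ker_op K c g (w(k := b)) else 0) = ker_op K (ps.gl_deriv K a b c) g w"
proof -
  let ?S = "pos K" and ?X = "index_set N (pos K)"
  define H where "H u l = chain K u l (g (restrict l V))" for u l
  define R where "R u x = (if restrict u V = w then x else (0::'m))" for u x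
  have KV: "k \<notin> V" if "k \<in> set K" for k using K that by (auto simp: positions_def)
  have kop: "ker_op K d g w = (\<Sum>u\<in>?X. \<Sum>l\<in>?X. R u (scale (d (u, l)) (H u l)))" for d
    unfolding ker_op_def R_def H_def by (intro sum.cong refl) auto
  have R_lin: "R u (x + y) = R u x + R u y" "R u (x - y) = R u x - R u y" "R u 0 = 0"
    "R u (sum F A) = (\<Sum>i\<in>A. R u (F i))" "R u (if P then x else 0) = (if P then R u x else 0)" for u x y F A P
    by (auto simp: R_def)
  have EH: "E a b (H u l) = (if a = b then scale (cst (blk a)) (H u l) else 0)
     + (\<Sum>k\<in>set K. if u k = b then H (u(k := a)) l else 0) - (\<Sum>k\<in>?S. if l k = a then H u (l(k := b)) else 0)"
    if "u \<in> ?X" "l \<in> ?X" for u l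
    using E_chain_invariants[OF K ab g that] unfolding H_def .
  have "E a b (ker_op K c g w) = (\<Sum>u\<in>?X. \<Sum>l\<in>?X. R u (scale (c (u, l)) (E a b (H u l))))"
    unfolding kop R_def by (auto simp: E_sum E_scale E_zero ab if_distrib intro!: sum.cong)
  also have "\<dots> = (\<Sum>u\<in>?X. \<Sum>l\<in>?X. R u (scale (c (u, l)) (if a = b then scale (cst (blk a)) (H u l) else 0))
      + (\<Sum>k\<in>set K. if u k = b then R u (scale (c (u, l)) (H (u(k := a)) l)) else 0)
      - (\<Sum>k\<in>?S. if l k = a then R u (scale (c (u, l)) (H u (l(k := b)))) else 0))"
    by (intro sum.cong refl)
      (simp add: EH scale_right_distrib scale_right_diff_distrib scale_sum_right R_lin if_distrib[of "scale _"] cong: if_cong)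
  also have "\<dots> = (if a = b then scale (cst (blk a)) (ker_op K c g w) else 0)
      + (\<Sum>u\<in>?X. \<Sum>l\<in>?X. \<Sum>k\<in>set K. if u k = b then R u (scale (c (u, l)) (H (u(k := a)) l)) else 0)
      - (\<Sum>u\<in>?X. \<Sum>l\<in>?X. \<Sum>k\<in>?S. if l k = a then R u (scale (c (u, l)) (H u (l(k := b)))) else 0)"
    unfolding sum.distrib sum_subtractf kop
    by (cases "a = b") (auto simp: R_def scale_sum_right scale_left_commute intro!: sum.cong)
  \<comment> \<open>Relabelling shifts the change of labels from the word to the kernel. A letter
    has no share in the output index \<open>w\<close>, so the restriction on \<open>u\<close> is
    unaffected.\<close>
  also have "(\<Sum>u\<in>?X. \<Sum>l\<in>?X. \<Sum>k\<in>set K. if u k = b then R u (scale (c (u, l)) (H (u(k := a)) l)) else 0)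
     = (\<Sum>u\<in>?X. \<Sum>l\<in>?X. \<Sum>k\<in>set K. if u k = a then R u (scale (c (u(k := b), l)) (H u l)) else 0)"
  proof -
    have swap_u: "(\<Sum>u\<in>?X. if u k = b then R u (scale (c (u, l)) (H (u(k := a)) l)) else 0) =
        (\<Sum>u\<in>?X. if u k = a then R u (scale (c (u(k := b), l)) (H u l)) else 0)" if k: "k \<in> set K" for k l
    proof -
      have "(\<Sum>u\<in>?X. if u k = b then R u (scale (c (u, l)) (H (u(k := a)) l)) else 0) =
        (\<Sum>u\<in>?X. if u k = a then R (u(k := b)) (scale (c (u(k := b), l)) (H u l)) else 0)"
        by (rule sum_index_set_upd[where H = "\<lambda>u u'. R u (scale (c (u, l)) (H u' l))"])
           (use k ab in \<open>auto simp: pos_def\<close>)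
      moreover have "R (u(k := b)) x = R u x" for u x
      proof -
        have "restrict (u(k := b)) V = restrict u V" using KV[OF k] by (auto simp: fun_eq_iff)
        then show ?thesis unfolding R_def by simp
      qed
      ultimately show ?thesis by (simp cong: if_cong)
    qed
    have eq: "(\<Sum>l\<in>?X. \<Sum>k\<in>set K. \<Sum>u\<in>?X. if u k = b then R u (scale (c (u, l)) (H (u(k := a)) l)) else 0)
     = (\<Sum>l\<in>?X. \<Sum>k\<in>set K. \<Sum>u\<in>?X. if u k = a then R u (scale (c (u(k := b), l)) (H u l)) else 0)"
      by (rule sum.cong[OF refl], rule sum.cong[OF refl], rule swap_u)
    show ?thesis by (rule trans[OF sum_swap3 trans[OF eq sum_swap3[symmetric]]])
  qed
  also have "(\<Sum>u\<in>?X. \<Sum>l\<in>?X. \<Sum>k\<in>?S. if l k = a then R u (scale (c (u, l)) (H u (l(k := b)))) else 0)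
     = (\<Sum>u\<in>?X. \<Sum>l\<in>?X. \<Sum>k\<in>?S. if l k = b then R u (scale (c (u, l(k := a))) (H u l)) else 0)"
  proof -
    have swap_l: "(\<Sum>l\<in>?X. if l k = a then R u (scale (c (u, l)) (H u (l(k := b)))) else 0)
      = (\<Sum>l\<in>?X. if l k = b then R u (scale (c (u, l(k := a))) (H u l)) else 0)" if "k \<in> ?S" for k u
      by (rule sum_index_set_upd[where H = "\<lambda>l l'. R u (scale (c (u, l)) (H u l'))"]) (use that ab in auto)
    have "(\<Sum>u\<in>?X. \<Sum>k\<in>?S. \<Sum>l\<in>?X. if l k = a then R u (scale (c (u, l)) (H u (l(k := b)))) else 0)
      = (\<Sum>u\<in>?X. \<Sum>k\<in>?S. \<Sum>l\<in>?X. if l k = b then R u (scale (c (u, l(k := a))) (H u l)) else 0)"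
      by (rule sum.cong[OF refl], rule sum.cong[OF refl], rule swap_l)
    then show ?thesis by (simp only: sum.swap[of _ ?S ?X])
  qed
  finally have 1: "E a b (ker_op K c g w) = (if a = b then scale (cst (blk a)) (ker_op K c g w) else 0)
      + (\<Sum>u\<in>?X. \<Sum>l\<in>?X. \<Sum>k\<in>set K. if u k = a then R u (scale (c (u(k := b), l)) (H u l)) else 0)
      - (\<Sum>u\<in>?X. \<Sum>l\<in>?X. \<Sum>k\<in>?S. if l k = b then R u (scale (c (u, l(k := a))) (H u l)) else 0)" .
  \<comment> \<open>For a tensor factor the relabelling changes the output index instead, which
    accounts for the terms at \<open>w(k := b)\<close>.\<close>
  have 2: "(\<Sum>k\<in>V. if w k = a then ker_op K c g (w(k := b)) else 0)
      = (\<Sum>u\<in>?X. \<Sum>l\<in>?X. \<Sum>k\<in>V. if u k = a then R u (scale (c (u(k := b), l)) (H u l)) else 0)"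
  proof -
    have "(if w k = a then ker_op K c g (w(k := b)) else 0) =
      (\<Sum>u\<in>?X. \<Sum>l\<in>?X. if u k = a then R u (scale (c (u(k := b), l)) (H u l)) else 0)" if k: "k \<in> V" for k
    proof -
      have kS: "k \<in> ?S" using k by (simp add: pos_def)
      have kK: "k \<notin> set K" using k KV by auto
      have iff: "restrict u V = w(k := b) \<and> w k = a \<longleftrightarrow> u k = b \<and> restrict (u(k := a)) V = w" for u
        using k by (auto simp: fun_eq_iff restrict_def split: if_splits)
      have "(if w k = a then ker_op K c g (w(k := b)) else 0)
          = (\<Sum>u\<in>?X. if restrict u V = w(k := b) \<and> w k = a then \<Sum>l\<in>?X. scale (c (u, l)) (H u l) else 0)"
        unfolding ker_op_def H_def by (auto intro!: sum.cong)
      also have "\<dots> = (\<Sum>u\<in>?X. if u k = b then (if restrict (u(k := a)) V = w then \<Sum>l\<in>?X. scale (c (u, l)) (H (u(k := a)) l) else 0) else 0)"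
      proof -
        have "H (u(k := a)) l = H u l" for u l
          unfolding H_def using kK by (intro chain_cong) auto
        then show ?thesis unfolding iff by (auto intro!: sum.cong)
      qed
      also have "\<dots> = (\<Sum>u\<in>?X. if u k = a then (if restrict u V = w then \<Sum>l\<in>?X. scale (c (u(k := b), l)) (H u l) else 0) else 0)"
        by (rule sum_index_set_upd[where H = "\<lambda>u u'. if restrict u' V = w then \<Sum>l\<in>?X. scale (c (u, l)) (H u' l) else 0"])
          (use kS ab in auto)
      also have "\<dots> = (\<Sum>u\<in>?X. \<Sum>l\<in>?X. if u k = a then R u (scale (c (u(k := b), l)) (H u l)) else 0)"
        unfolding R_def by (auto intro!: sum.cong)
      finally show ?thesis .
    qed
    then have "(\<Sum>k\<in>V. if w k = a then ker_op K c g (w(k := b)) else 0) =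
       (\<Sum>k\<in>V. \<Sum>u\<in>?X. \<Sum>l\<in>?X. if u k = a then R u (scale (c (u(k := b), l)) (H u l)) else 0)"
      by (rule sum.cong[OF refl])
    then show ?thesis by (simp only: sum.swap[of _ ?X V])
  qed
  have 3: "ker_op K (ps.gl_deriv K a b c) g w =
     (\<Sum>u\<in>?X. \<Sum>l\<in>?X. \<Sum>k\<in>?S. if u k = a then R u (scale (c (u(k := b), l)) (H u l)) else 0)
     - (\<Sum>u\<in>?X. \<Sum>l\<in>?X. \<Sum>k\<in>?S. if l k = b then R u (scale (c (u, l(k := a))) (H u l)) else 0)"
    unfolding kop ps.gl_deriv_def prod.case scale_left_diff_distrib scale_sum_left R_lin sum_subtractf
    by (intro arg_cong2[where f = minus] sum.cong refl) (auto simp: R_lin)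
  have 4: "(\<Sum>u\<in>?X. \<Sum>l\<in>?X. \<Sum>k\<in>?S. if u k = a then R u (scale (c (u(k := b), l)) (H u l)) else 0)
    = (\<Sum>u\<in>?X. \<Sum>l\<in>?X. \<Sum>k\<in>V. if u k = a then R u (scale (c (u(k := b), l)) (H u l)) else 0)
    + (\<Sum>u\<in>?X. \<Sum>l\<in>?X. \<Sum>k\<in>set K. if u k = a then R u (scale (c (u(k := b), l)) (H u l)) else 0)"
    unfolding sum.distrib[symmetric] using K
    by (intro sum.cong refl) (auto simp: pos_def positions_def finite_V intro!: sum.union_disjoint)
  show ?thesis unfolding 1 2 3 4 by (simp add: algebra_simps)
qed

end

section \<open>Tensors reachable by words from one nonzero tensor\<close>

locale irreducible_gl_family = gl_family +
  assumes E_trace: "(\<Sum>a<N. E a a m) = m"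
    and irreducible: "subspace W \<Longrightarrow> (\<And>a b m. a < N \<Longrightarrow> b < N \<Longrightarrow> m \<in> W \<Longrightarrow> E a b m \<in> W) \<Longrightarrow>
      W = {0} \<or> W = UNIV"
    \<comment> \<open>Schur's lemma, in the form in which it is applied to traces of powers.\<close>
    and central_scalar: "Vector_Spaces.linear scale scale Z \<Longrightarrow>
      (\<And>a b m. a < N \<Longrightarrow> b < N \<Longrightarrow> E a b (Z m) = Z (E a b m)) \<Longrightarrow> \<exists>c. \<forall>m. Z m = scale c m"
begin

text \<open>Prepending a fresh position whose coefficient factors off multiplies the operator on the
  left by a combination of the \<open>E a b\<close>.\<close>

lemma ker_op_Cons:
  assumes k: "k \<notin> pos K"
  shows "ker_op (k # K) (\<lambda>(u, l). t (u k, l k) * c (restrict u (pos K), restrict l (pos K))) f w =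
    (\<Sum>a<N. \<Sum>b<N. scale (t (a, b)) (E a b (ker_op K c f w)))"
proof -
  let ?X = "index_set N (pos K)"
  have pos: "pos (k # K) = insert k (pos K)" by (auto simp: pos_def)
  have kV: "k \<notin> V" and kK: "k \<notin> set K" using k by (auto simp: pos_def)
  have r1: "restrict (u(k := x)) (pos K) = u" if "u \<in> ?X" for u x
    using that k by (auto simp: fun_eq_iff index_set_def PiE_iff extensional_def)
  have r2: "restrict (u(k := x)) V = restrict u V" for u :: "nat \<Rightarrow> nat" and x
    using kV by (auto simp: fun_eq_iff)
  have ch: "chain (k # K) (u(k := a)) (l(k := b)) m = E a b (chain K u l m)" for u l a b m
    using kK by (auto intro!: arg_cong[where f = "E a b"] chain_cong)
  define T where "T u l a b = scale (t (a, b)) (E a b (scale (c (u, l)) (chain K u l (f (restrict l V)))))" for u l a b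
  have "ker_op (k # K) (\<lambda>(u, l). t (u k, l k) * c (restrict u (pos K), restrict l (pos K))) f w
      = (\<Sum>u\<in>?X. \<Sum>a<N. if restrict u V = w then \<Sum>l\<in>?X. \<Sum>b<N. T u l a b else 0)"
    unfolding ker_op_def pos sum_index_set_insert[OF k] r2
    by (intro sum.cong refl if_cong) (simp add: r1 ch E_scale T_def del: chain.simps)
  also have "\<dots> = (\<Sum>a<N. \<Sum>u\<in>?X. \<Sum>b<N. if restrict u V = w then \<Sum>l\<in>?X. T u l a b else 0)"
    by (subst sum.swap) (intro sum.cong refl, auto simp: sum.swap[of _ "{..<N}" ?X])
  also have "\<dots> = (\<Sum>a<N. \<Sum>b<N. \<Sum>u\<in>?X. if restrict u V = w then \<Sum>l\<in>?X. T u l a b else 0)"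
    by (rule sum.cong[OF refl], rule sum.swap)
  also have "\<dots> = (\<Sum>a<N. \<Sum>b<N. scale (t (a, b)) (E a b (ker_op K c f w)))"
  proof (intro sum.cong refl)
    fix a b assume "a \<in> {..<N}" "b \<in> {..<N}"
    then show "(\<Sum>u\<in>?X. if restrict u V = w then \<Sum>l\<in>?X. T u l a b else 0) = scale (t (a, b)) (E a b (ker_op K c f w))"
      unfolding ker_op_def T_def by (auto simp: E_sum E_zero scale_sum_right intro!: sum.cong)
  qed
  finally show ?thesis .
qed

text \<open>The tensor factors occupy 1 to n, so d letters are numbered n + d down to n + 1, and a
  new letter at the left end gets a fresh number.\<close>

definition edges :: "nat \<Rightarrow> nat list" where
  "edges d = map (\<lambda>i. Suc (n + i)) (rev [0..<d])"

lemma edges_Suc: "edges (Suc d) = Suc (n + d) # edges d"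
  by (simp add: edges_def)

lemma fresh_edge: "Suc (n + d) \<notin> pos (edges d)"
  by (auto simp: pos_def edges_def V_def)

lemma positions_edges: "positions (edges d)"
  by (auto simp: positions_def edges_def V_def distinct_map inj_on_def)

text \<open>The kernels are arbitrary, so all endomorphisms of the tensor factors are included
  besides the words of length \<open>d\<close>.\<close>

definition reach :: "'a tensor \<Rightarrow> nat \<Rightarrow> 'a tensor set" where
  "reach g d = range (\<lambda>c. ker_op (edges d) c g)"

lemma reachI: "ker_op (edges d) c g \<in> reach g d"
  by (simp add: reach_def)

text \<open>The sum of the \<open>E a a\<close> is the identity, so inserting it as an extra letter
  lengthens a word without changing the operator. Tensors reached by words of different lengths can
  thus be added.\<close>

lemma reach_Suc: "f \<in> reach g d \<Longrightarrow> f \<in> reach g (Suc d)"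
proof -
  assume "f \<in> reach g d"
  then obtain c where f: "f = ker_op (edges d) c g" unfolding reach_def by blast
  let ?t = "\<lambda>(a, b). if a = b then 1 else 0 :: complex" and ?k = "Suc (n + d)" and ?P = "pos (edges d)"
  have "ker_op (edges (Suc d)) (\<lambda>(u, l). ?t (u ?k, l ?k) * c (restrict u ?P, restrict l ?P)) g = f"
  proof
    fix w
    have "(\<Sum>b<N. scale (?t (a, b)) (E a b (f w))) = E a a (f w)" if "a < N" for a
    proof -
      have "(\<Sum>b<N. scale (?t (a, b)) (E a b (f w))) = (\<Sum>b<N. if b = a then E a b (f w) else 0)"
        by (rule sum.cong) auto
      then show ?thesis using that by simp
    qed
    then show "ker_op (edges (Suc d)) (\<lambda>(u, l). ?t (u ?k, l ?k) * c (restrict u ?P, restrict l ?P)) g w = f w"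
      unfolding edges_Suc ker_op_Cons[OF fresh_edge] f[symmetric] using E_trace by simp
  qed
  then show "f \<in> reach g (Suc d)" unfolding reach_def by blast
qed

lemma reach_mono: "d \<le> d' \<Longrightarrow> f \<in> reach g d \<Longrightarrow> f \<in> reach g d'"
  by (induction d' rule: dec_induct) (auto intro: reach_Suc)

lemma reach_E:
  assumes "f \<in> reach g d" "a < N" "b < N"
  shows "(\<lambda>w. E a b (f w)) \<in> reach g (Suc d)"
proof -
  obtain c where f: "f = ker_op (edges d) c g" using assms unfolding reach_def by blast
  let ?t = "\<lambda>(x, y). if x = a \<and> y = b then 1 else 0 :: complex" and ?k = "Suc (n + d)" and ?P = "pos (edges d)"
  have eq: "ker_op (edges (Suc d)) (\<lambda>(u, l). ?t (u ?k, l ?k) * c (restrict u ?P, restrict l ?P)) g = (\<lambda>w. E a b (f w))"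
  proof
    fix w
    have "(\<Sum>x<N. \<Sum>y<N. scale (?t (x, y)) (E x y (f w))) = (\<Sum>x<N. \<Sum>y<N. if y = b then (if x = a then E a b (f w) else 0) else 0)"
      by (intro sum.cong refl) auto
    also have "\<dots> = E a b (f w)" using assms by simp
    finally show "ker_op (edges (Suc d)) (\<lambda>(u, l). ?t (u ?k, l ?k) * c (restrict u ?P, restrict l ?P)) g w = E a b (f w)"
      unfolding edges_Suc ker_op_Cons[OF fresh_edge] f[symmetric] .
  qed
  show ?thesis by (subst eq[symmetric]) (rule reachI)
qed

lemma reach_linear:
  shows "f \<in> reach g d \<Longrightarrow> f' \<in> reach g d \<Longrightarrow> f + f' \<in> reach g d"
    and "f \<in> reach g d \<Longrightarrow> tscale scale t f \<in> reach g d"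
proof -
  assume "f \<in> reach g d" "f' \<in> reach g d"
  then obtain c c' where "f = ker_op (edges d) c g" "f' = ker_op (edges d) c' g" unfolding reach_def by blast
  then have "f + f' = ker_op (edges d) (c + c') g" by (simp only: ker_op_linear)
  then show "f + f' \<in> reach g d" by (simp only: reachI)
next
  assume "f \<in> reach g d"
  then obtain c where "f = ker_op (edges d) c g" unfolding reach_def by blast
  then have "tscale scale t f = ker_op (edges d) (fscale t c) g" by (simp only: ker_op_linear)
  then show "tscale scale t f \<in> reach g d" by (simp only: reachI)
qed

definition delta :: "(nat \<Rightarrow> nat) \<Rightarrow> 'a \<Rightarrow> 'a tensor" where
  "delta w m = (\<lambda>v. if v = w then m else 0)"

text \<open>A matrix unit on the tensor factors moves the coefficient \<open>g v\<close> to index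
  \<open>w\<close>. The coefficients reachable at \<open>w\<close> form a submodule, which is
  nonzero and hence everything.\<close>

lemma delta_reachable:
  assumes g: "g v \<noteq> 0" "g \<in> supported MI" and w: "w \<in> MI"
  shows "\<exists>d. delta w m \<in> reach g d"
proof -
  let ?W = "{m. \<exists>d. delta w m \<in> reach g d}"
  have v: "v \<in> MI" using g by (auto simp: supported_def)
  have "delta w (g v) = ker_op (edges 0) (\<lambda>(u, l). if u = w \<and> l = v then 1 else 0) g"
  proof
    fix x
    have r: "restrict u V = u" if "u \<in> MI" for u
      using that by (auto simp: index_set_def PiE_iff extensional_def fun_eq_iff)
    have e: "edges 0 = []" "pos [] = V" by (auto simp: edges_def pos_def)
    have "ker_op (edges 0) (\<lambda>(u, l). if u = w \<and> l = v then 1 else 0) g x =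
       (\<Sum>u\<in>MI. if u = x then \<Sum>l\<in>MI. if l = v then (if u = w then g v else 0) else 0 else 0)"
      unfolding ker_op_def e by (intro sum.cong refl if_cong) (auto simp: r)
    also have "\<dots> = (if x \<in> MI then \<Sum>l\<in>MI. if l = v then (if x = w then g v else 0) else 0 else 0)"
      by (simp add: finite_index_set finite_V)
    also have "\<dots> = delta w (g v) x"
      using v w by (auto simp: finite_index_set finite_V delta_def)
    finally show "delta w (g v) x = ker_op (edges 0) (\<lambda>(u, l). if u = w \<and> l = v then 1 else 0) g x" ..
  qed
  then have gv: "g v \<in> ?W" unfolding reach_def by blast
  have "subspace ?W"
  proof (rule subspaceI)
    have "delta w 0 = ker_op (edges 0) 0 g" by (simp only: ker_op_linear) (simp add: delta_def fun_eq_iff zero_fun_def)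
    then show "0 \<in> ?W" unfolding reach_def by blast
    fix x y assume "x \<in> ?W" "y \<in> ?W"
    then obtain d d' where "delta w x \<in> reach g d" "delta w y \<in> reach g d'" by blast
    then have "delta w x + delta w y \<in> reach g (max d d')"
      by (intro reach_linear) (auto intro: reach_mono[of d "max d d'"] reach_mono[of d' "max d d'"])
    moreover have "delta w x + delta w y = delta w (x + y)" by (auto simp: delta_def)
    ultimately show "x + y \<in> ?W" by auto
  next
    fix t x assume "x \<in> ?W"
    then obtain d where "delta w x \<in> reach g d" by blast
    then have "tscale scale t (delta w x) \<in> reach g d" by (rule reach_linear)
    moreover have "tscale scale t (delta w x) = delta w (scale t x)" by (auto simp: delta_def tscale_def)
    ultimately show "scale t x \<in> ?W" by auto
  qed
  moreover have "E a b x \<in> ?W" if ab: "a < N" "b < N" and x: "x \<in> ?W" for a b x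
  proof -
    obtain d where "delta w x \<in> reach g d" using x by blast
    from reach_E[OF this ab] have "(\<lambda>v. E a b (delta w x v)) \<in> reach g (Suc d)" .
    moreover have "(\<lambda>v. E a b (delta w x v)) = delta w (E a b x)" using ab by (auto simp: delta_def E_zero)
    ultimately show ?thesis by auto
  qed
  ultimately have "?W = {0} \<or> ?W = UNIV" by (rule irreducible)
  with gv g(1) show ?thesis by blast
qed

lemma reach_all:
  assumes g: "g \<noteq> 0" "g \<in> supported MI" and f: "f \<in> supported MI"
  shows "\<exists>d. f \<in> reach g d"
proof -
  obtain v where v: "g v \<noteq> 0" using g(1) by (auto simp: fun_eq_iff zero_fun_def)
  have fin: "finite MI" by (simp add: finite_index_set finite_V)
  have "\<exists>d. (\<Sum>w\<in>A. delta w (f w)) \<in> reach g d" if "finite A" "A \<subseteq> MI" for A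
    using that
  proof (induction A rule: finite_induct)
    case empty
    have "(0 :: 'a tensor) = ker_op (edges 0) 0 g" by (simp only: ker_op_linear)
    then show ?case unfolding reach_def by (simp only: sum.empty) blast
  next
    case (insert w A)
    then obtain d d' where "(\<Sum>w\<in>A. delta w (f w)) \<in> reach g d" "delta w (f w) \<in> reach g d'"
      using delta_reachable[OF v g(2), of w "f w"] by blast
    then have "delta w (f w) + (\<Sum>w\<in>A. delta w (f w)) \<in> reach g (max d d')"
      by (intro reach_linear) (auto intro: reach_mono[of d "max d d'"] reach_mono[of d' "max d d'"])
    then show ?case using insert.hyps by (simp only: sum.insert if_False not_False_eq_True) blast
  qed
  from this[OF fin] obtain d where d: "(\<Sum>w\<in>MI. delta w (f w)) \<in> reach g d" by blast
  have "(\<Sum>w\<in>MI. delta w (f w)) = f"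
  proof
    fix x
    have "(\<Sum>w\<in>MI. delta w (f w)) x = (\<Sum>w\<in>MI. delta w (f w) x)"
      using fin by (induction rule: finite_induct) auto
    also have "\<dots> = (\<Sum>w\<in>MI. if w = x then f x else 0)"
      by (rule sum.cong) (auto simp: delta_def)
    also have "\<dots> = f x" using fin f by (auto simp: supported_def)
    finally show "(\<Sum>w\<in>MI. delta w (f w)) x = f x" .
  qed
  with d show ?thesis by auto
qed

text \<open>The kernels annihilating \<open>g\<close> form a subspace stable under the block diagonal action, hence so is
  its orthogonal complement; a representing kernel chosen in the complement is itself invariant.\<close>

theorem invariants_reached_by_invariant_kernel:
  assumes g: "g \<in> invariants" "g \<noteq> 0" and f: "f \<in> invariants"
  shows "\<exists>d. \<exists>c\<in>cfun.span (ps.perm_kers (edges d)). f = ker_op (edges d) c g"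
proof -
  have "g \<in> supported MI" "f \<in> supported MI" using g f by (auto simp: invariants_def)
  then obtain d c0 where c0: "f = ker_op (edges d) c0 g"
    using reach_all[OF g(2)] unfolding reach_def by blast
  define K where "K = edges d"
  let ?X = "index_set N (pos K)"
  let ?D = "?X \<times> ?X"
  have K: "positions K" by (simp add: K_def positions_edges)
  have fin: "finite ?D" by (simp add: ps.finite_X)
  \<comment> \<open>Values off the label set do not affect the operator, but the orthogonality
    argument needs a supported kernel.\<close>
  define c1 where "c1 = (\<lambda>x. if x \<in> ?D then c0 x else 0)"
  have c1: "c1 \<in> supported ?D" by (simp add: c1_def supported_def)
  have f1: "f = ker_op K c1 g"
    unfolding c0 K_def[symmetric] by (rule ext) (auto simp: ker_op_def c1_def intro!: sum.cong)
  define Nl where "Nl = {c \<in> supported ?D. ker_op K c g = 0}"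
  have sub: "cfun.subspace Nl"
  proof (rule cfun.subspaceI)
    show "0 \<in> Nl" unfolding Nl_def by (simp only: mem_Collect_eq ker_op_linear) (simp add: supported_def)
    fix c c' assume "c \<in> Nl" "c' \<in> Nl"
    then show "c + c' \<in> Nl" unfolding Nl_def
      by (simp only: mem_Collect_eq ker_op_linear) (simp add: supported_def)
  next
    fix t c assume "c \<in> Nl"
    then show "fscale t c \<in> Nl" unfolding Nl_def
      by (simp only: mem_Collect_eq ker_op_linear) (simp add: supported_def tscale_def fscale_def fun_eq_iff)
  qed
  have deriv_ker: "ker_op K (ps.gl_deriv K a b c) g = 0"
    if ab: "a < N" "b < N" "blk a = blk b" and inv: "ker_op K c g \<in> invariants" for a b c
  proof
    fix w
    show "ker_op K (ps.gl_deriv K a b c) g w = 0 w"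
    proof (cases "w \<in> MI")
      case True
      have "E a b (ker_op K c g w) = (if a = b then scale (cst (blk a)) (ker_op K c g w) else 0)
          - (\<Sum>k\<in>V. if w k = a then ker_op K c g (w(k := b)) else 0)"
        using inv ab True unfolding invariants_def by blast
      then show ?thesis
        using ker_op_equivariant[OF K ab g(1) True, of c] by (simp add: zero_fun_def)
    next
      case False
      then show ?thesis using ker_op_supported[of K "ps.gl_deriv K a b c" g] by (simp add: supported_def zero_fun_def)
    qed
  qed
  have inv0: "0 \<in> invariants" by (auto simp: invariants_def supported_def E_zero zero_fun_def)
  have deriv_Nl: "ps.gl_deriv K a b c \<in> Nl"
    if "a < N" "b < N" "blk a = blk b" "c \<in> supported ?D" "ker_op K c g \<in> invariants" for a b c
    using deriv_ker[of a b c] that ps.gl_deriv_supported[of a b c K] by (simp add: Nl_def)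
  obtain c2 where c2: "c2 \<in> Nl" "\<And>h. h \<in> Nl \<Longrightarrow> ip ?D (c1 - c2) h = 0"
    using orthogonal_projection[OF fin sub, of c1] by (auto simp: Nl_def)
  define c where "c = c1 - c2"
  have cs: "c \<in> supported ?D" using c1 c2(1) by (auto simp: c_def Nl_def supported_def)
  have fc: "f = ker_op K c g"
  proof -
    have "ker_op K c g = ker_op K c1 g - ker_op K c2 g" unfolding c_def by (rule ker_op_linear)
    also have "ker_op K c2 g = 0" using c2(1) by (simp add: Nl_def)
    finally show ?thesis using f1 by simp
  qed
  have "ps.gl_deriv K a b c = 0" if ab: "a < N" "b < N" "blk a = blk b" for a b
  proof -
    \<comment> \<open>The derivative of \<open>c\<close> lies in \<open>Nl\<close> because
      \<open>f\<close> is invariant. It is orthogonal to itself: by adjointness its norm pairs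
      \<open>c\<close> with a second derivative, which lies in \<open>Nl\<close> again.\<close>
    have D: "ps.gl_deriv K a b c \<in> Nl" using deriv_Nl[OF ab cs] fc f by simp
    then have "ps.gl_deriv K b a (ps.gl_deriv K a b c) \<in> Nl"
      using deriv_Nl[of b a "ps.gl_deriv K a b c"] ab inv0 by (simp add: Nl_def)
    then have "ip ?D (ps.gl_deriv K a b c) (ps.gl_deriv K a b c) = 0"
      unfolding ps.gl_deriv_adjoint[OF ab(1,2)] using c2(2) by (simp add: c_def)
    then show ?thesis using ip_self_eq_0[OF fin] D by (simp add: Nl_def)
  qed
  then have "c \<in> cfun.span (ps.perm_kers K)" using ps.invariant_in_span[OF cs] by blast
  with fc show ?thesis unfolding K_def by blast
qed

end

text \<open>Bubble sort. The multiset condition lets the exchange step assume that the list is a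
  rearrangement of \<open>xs\<close>.\<close>

lemma adjacent_swaps:
  assumes swap: "\<And>as k k' bs. mset (as @ k # k' # bs) = mset xs \<Longrightarrow> Q (as @ k # k' # bs) \<Longrightarrow> Q (as @ k' # k # bs)"
    and "mset ys = mset xs" "Q xs"
  shows "Q ys"
proof -
  have bubble: "Q (as @ y # a @ b)" if "mset (as @ a @ y # b) = mset xs" "Q (as @ a @ y # b)" for as a y b
    using that
  proof (induction a arbitrary: b rule: rev_induct)
    case (snoc x a)
    have "Q ((as @ a) @ y # x # b)"
      by (rule swap) (use snoc.prems in auto)
    then have "Q (as @ a @ y # x # b)" by simp
    then show ?case using snoc.IH[of "x # b"] snoc.prems by (simp add: add_mset_commute)
  qed simp
  have "Q (as @ ys)" if "mset (as @ zs) = mset xs" "mset ys = mset zs" "Q (as @ zs)" for as zs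
    using that
  proof (induction ys arbitrary: as zs)
    case (Cons y ys)
    then have "y \<in> set zs" by (metis list.set_intros(1) mset_eq_setD)
    then obtain a b where zs: "zs = a @ y # b" by (meson split_list)
    have "Q (as @ y # a @ b)" by (rule bubble) (use Cons.prems zs in auto)
    then have "Q ((as @ [y]) @ ys)"
      by (intro Cons.IH[where zs = "a @ b"]) (use Cons.prems zs in auto)
    then show ?case by simp
  qed simp
  from this[of "[]" xs] assms show ?thesis by simp
qed

lemma sum_index_set_union:
  assumes "S \<inter> C = {}"
  shows "(\<Sum>u\<in>index_set N (S \<union> C). h u)
    = (\<Sum>u\<in>index_set N S. \<Sum>v\<in>index_set N C. h (\<lambda>k. if k \<in> C then v k else u k))"
proof -
  have "(\<Sum>u\<in>index_set N (S \<union> C). h u)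
     = (\<Sum>x\<in>index_set N S \<times> index_set N C. h (\<lambda>k. if k \<in> C then snd x k else fst x k))"
    by (rule sum.reindex_bij_witness[of _ "\<lambda>x k. if k \<in> C then snd x k else fst x k" "\<lambda>u. (restrict u S, restrict u C)"])
      (use assms in \<open>auto simp: index_set_def PiE_iff extensional_def fun_eq_iff intro!: arg_cong[where f = h]\<close>)
  then show ?thesis by (simp only: sum_pairs fst_conv snd_conv)
qed

text \<open>The permutation induced on the remaining positions when position \<open>z\<close> is traced out.\<close>

definition bypass :: "nat \<Rightarrow> (nat \<Rightarrow> nat) \<Rightarrow> nat \<Rightarrow> nat" where
  "bypass z \<sigma> = transpose z (\<sigma> z) \<circ> \<sigma>"

lemma bypass_permutes: "\<sigma> permutes insert z S \<Longrightarrow> bypass z \<sigma> permutes S"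
  unfolding bypass_def by (rule permutes_insert_lemma)

lemma bypass_apply:
  assumes "\<sigma> permutes S" "k \<noteq> z"
  shows "bypass z \<sigma> k = (if \<sigma> k = z then \<sigma> z else \<sigma> k)"
  using permutes_inj[OF assms(1)] assms(2) by (auto simp: bypass_def transpose_def inj_eq)

section \<open>Words indexed by a permutation and block labels\<close>

context gl_family
begin

text \<open>The input label of position \<open>k\<close> is the output label of position
  \<open>\<sigma> k\<close>. Thus \<open>\<sigma>\<close> records how letters and factors are
  joined: its cycles among the letters are closed chains, its other cycles pass through tensor
  factors.\<close>

definition perm_op :: "nat list \<Rightarrow> (nat \<Rightarrow> nat) \<Rightarrow> (nat \<Rightarrow> bool) \<Rightarrow> 'm tensor \<Rightarrow> 'm tensor" where
  "perm_op K \<sigma> \<epsilon> f w = (\<Sum>u\<in>index_set N (pos K). if restrict u V = w \<and> (\<forall>k\<in>pos K. blk (u k) = \<epsilon> k)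
     then chain K u (u \<circ> \<sigma>) (f (restrict (u \<circ> \<sigma>) V)) else 0)"

lemma ker_op_perm_ker:
  assumes "\<sigma> permutes pos K"
  shows "ker_op K (ps.perm_ker K \<sigma> \<epsilon>) f = perm_op K \<sigma> \<epsilon> f"
proof
  fix w
  let ?X = "index_set N (pos K)"
  show "ker_op K (ps.perm_ker K \<sigma> \<epsilon>) f w = perm_op K \<sigma> \<epsilon> f w"
    unfolding ker_op_def perm_op_def
  proof (rule sum.cong[OF refl])
    fix u assume u: "u \<in> ?X"
    have "(\<Sum>l\<in>?X. scale (ps.perm_ker K \<sigma> \<epsilon> (u, l)) (chain K u l (f (restrict l V)))) =
       (\<Sum>l\<in>?X. if l = u \<circ> \<sigma> then if \<forall>k\<in>pos K. blk (u k) = \<epsilon> k then chain K u l (f (restrict l V)) else 0 else 0)"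
      by (rule sum.cong) (auto simp: ps.perm_ker_def u)
    also have "\<dots> = (if \<forall>k\<in>pos K. blk (u k) = \<epsilon> k then chain K u (u \<circ> \<sigma>) (f (restrict (u \<circ> \<sigma>) V)) else 0)"
      using index_set_comp_permutes[OF u assms] ps.finite_X by simp
    finally show "(if restrict u V = w then \<Sum>l\<in>?X. scale (ps.perm_ker K \<sigma> \<epsilon> (u, l)) (chain K u l (f (restrict l V))) else 0) =
      (if restrict u V = w \<and> (\<forall>k\<in>pos K. blk (u k) = \<epsilon> k) then chain K u (u \<circ> \<sigma>) (f (restrict (u \<circ> \<sigma>) V)) else 0)"
      by presburger
  qed
qed

lemma perm_op_cong: "(\<And>k. k \<in> pos K \<Longrightarrow> \<epsilon> k = \<epsilon>' k) \<Longrightarrow> perm_op K \<sigma> \<epsilon> f = perm_op K \<sigma> \<epsilon>' f"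
  unfolding perm_op_def by (intro ext sum.cong if_cong) auto

text \<open>A position fixed by \<open>\<sigma>\<close> carries a free label and contributes the
  size of its block; otherwise its label is that of \<open>\<sigma> z\<close>, and the two
  prescribed blocks must agree.\<close>

definition loop_factor :: "nat \<Rightarrow> (nat \<Rightarrow> nat) \<Rightarrow> (nat \<Rightarrow> bool) \<Rightarrow> complex" where
  "loop_factor z \<sigma> \<epsilon> = (if \<sigma> z = z then of_nat (card {a. a < N \<and> blk a = \<epsilon> z}) else if \<epsilon> (\<sigma> z) = \<epsilon> z then 1 else 0)"

text \<open>The word has no letter at \<open>z\<close>, and the extra condition identifies the label
  there with that at \<open>\<sigma> z\<close>. Summing over it joins the neighbours of
  \<open>z\<close>, which gives \<open>bypass\<close>.\<close>

lemma trace_out: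
  assumes z: "z \<notin> pos K" and \<sigma>: "\<sigma> permutes insert z (pos K)"
  shows "(\<Sum>u\<in>index_set N (insert z (pos K)).
      if restrict u V = w \<and> (\<forall>k\<in>insert z (pos K). blk (u k) = \<epsilon> k) \<and> u (\<sigma> z) = u z
      then chain K u (u \<circ> \<sigma>) (f (restrict (u \<circ> \<sigma>) V)) else 0)
    = scale (loop_factor z \<sigma> \<epsilon>) (perm_op K (bypass z \<sigma>) \<epsilon> f w)"
proof -
  let ?S = "pos K" and ?\<tau> = "bypass z \<sigma>"
  define T where "T u = chain K u (u \<circ> ?\<tau>) (f (restrict (u \<circ> ?\<tau>) V))" for u
  define B where "B u \<longleftrightarrow> restrict u V = w \<and> (\<forall>k\<in>?S. blk (u k) = \<epsilon> k)" for u :: "nat \<Rightarrow> nat"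
  have zV: "z \<notin> V" and zK: "z \<notin> set K" using z by (auto simp: pos_def)
  have r: "restrict (u(z := x)) V = restrict u V" for u :: "nat \<Rightarrow> nat" and x
    using zV by (auto simp: fun_eq_iff)
  have B: "(restrict (u(z := x)) V = w \<and> (\<forall>k\<in>insert z ?S. blk ((u(z := x)) k) = \<epsilon> k) \<and> (u(z := x)) (\<sigma> z) = (u(z := x)) z)
      \<longleftrightarrow> B u \<and> blk x = \<epsilon> z \<and> (\<sigma> z = z \<or> u (\<sigma> z) = x)" for u x
    unfolding r B_def using z by auto
  have T: "chain K (u(z := x)) (u(z := x) \<circ> \<sigma>) (f (restrict (u(z := x) \<circ> \<sigma>) V)) = T u"
    if "\<sigma> z = z \<or> u (\<sigma> z) = x" for u x
  proof -
    have *: "(u(z := x) \<circ> \<sigma>) k = (u \<circ> ?\<tau>) k" if "k \<noteq> z" for k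
      using bypass_apply[OF \<sigma> that] \<open>\<sigma> z = z \<or> u (\<sigma> z) = x\<close> that permutes_inj[OF \<sigma>] by (auto simp: inj_eq)
    have "restrict (u(z := x) \<circ> \<sigma>) V = restrict (u \<circ> ?\<tau>) V"
      by (intro restrict_ext *) (use zV in auto)
    moreover have "chain K (u(z := x)) (u(z := x) \<circ> \<sigma>) m = chain K u (u \<circ> ?\<tau>) m" for m
    proof (rule chain_cong)
      fix k assume "k \<in> set K"
      then have "k \<noteq> z" using zK by auto
      then show "(u(z := x)) k = u k" "(u(z := x) \<circ> \<sigma>) k = (u \<circ> ?\<tau>) k" using * by simp_all
    qed
    ultimately show ?thesis unfolding T_def by simp
  qed
  have "(\<Sum>u\<in>index_set N (insert z ?S).
      if restrict u V = w \<and> (\<forall>k\<in>insert z ?S. blk (u k) = \<epsilon> k) \<and> u (\<sigma> z) = u z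
      then chain K u (u \<circ> \<sigma>) (f (restrict (u \<circ> \<sigma>) V)) else 0)
    = (\<Sum>u\<in>index_set N ?S. \<Sum>x<N. if B u \<and> blk x = \<epsilon> z \<and> (\<sigma> z = z \<or> u (\<sigma> z) = x) then T u else 0)"
    unfolding sum_index_set_insert[OF z] B using T by (intro sum.cong refl if_cong) auto
  also have "\<dots> = (\<Sum>u\<in>index_set N ?S. scale (loop_factor z \<sigma> \<epsilon>) (if B u then T u else 0))"
  proof (rule sum.cong[OF refl])
    fix u assume u: "u \<in> index_set N ?S"
    show "(\<Sum>x<N. if B u \<and> blk x = \<epsilon> z \<and> (\<sigma> z = z \<or> u (\<sigma> z) = x) then T u else 0) = scale (loop_factor z \<sigma> \<epsilon>) (if B u then T u else 0)"
    proof (cases "B u")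
      case True
      show ?thesis
      proof (cases "\<sigma> z = z")
        case loop: True
        have "(\<Sum>x<N. if blk x = \<epsilon> z then T u else 0) = (\<Sum>x\<in>{x \<in> {..<N}. blk x = \<epsilon> z}. T u)"
          by (rule sum.inter_filter[symmetric]) simp
        also have "\<dots> = scale (of_nat (card {x \<in> {..<N}. blk x = \<epsilon> z})) (T u)"
          by (rule sum_constant_scale)
        finally show ?thesis using True loop by (simp add: loop_factor_def)
      next
        case False
        then have y: "\<sigma> z \<in> ?S" using \<sigma> by (metis insertE insertI1 permutes_in_image)
        have "(\<Sum>x<N. if B u \<and> blk x = \<epsilon> z \<and> (\<sigma> z = z \<or> u (\<sigma> z) = x) then T u else 0)
            = (\<Sum>x<N. if x = u (\<sigma> z) then if blk (u (\<sigma> z)) = \<epsilon> z then T u else 0 else 0)"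
          using True False by (intro sum.cong refl) auto
        also have "\<dots> = (if blk (u (\<sigma> z)) = \<epsilon> z then T u else 0)"
          using index_set_lt[OF u y] by simp
        also have "\<dots> = scale (loop_factor z \<sigma> \<epsilon>) (T u)"
          using True y False by (simp add: B_def loop_factor_def)
        finally show ?thesis using True by simp
      qed
    qed simp
  qed
  also have "\<dots> = scale (loop_factor z \<sigma> \<epsilon>) (perm_op K ?\<tau> \<epsilon> f w)"
    unfolding perm_op_def T_def B_def by (simp only: scale_sum_right)
  finally show ?thesis .
qed

lemma comp_transpose_permutes: "\<sigma> permutes S \<Longrightarrow> k \<in> S \<Longrightarrow> k' \<in> S \<Longrightarrow> \<sigma> \<circ> transpose k k' permutes S"
  by (intro permutes_compose permutes_swap_id)

text \<open>Each Kronecker delta in the commutator of two letters equates the input label of one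
  with the output label of the other. After composing \<open>\<sigma>\<close> with the transposition
  of the two positions this is a contraction at one of them, and the other carries the merged
  letter.\<close>

lemma perm_op_swap:
  assumes P: "positions (as @ k # k' # bs)" and \<sigma>: "\<sigma> permutes pos (as @ k # k' # bs)"
    and K1: "K1 = as @ k # bs" and K2: "K2 = as @ k' # bs" and \<tau>: "\<tau> = \<sigma> \<circ> transpose k k'"
  shows "perm_op (as @ k # k' # bs) \<sigma> \<epsilon> f w - perm_op (as @ k' # k # bs) \<sigma> \<epsilon> f w =
     scale (loop_factor k' \<tau> \<epsilon>) (perm_op K1 (bypass k' \<tau>) \<epsilon> f w) - scale (loop_factor k \<tau> \<epsilon>) (perm_op K2 (bypass k \<tau>) \<epsilon> f w)"
proof -
  let ?K = "as @ k # k' # bs"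
  let ?S = "pos ?K"
  have kk: "k \<noteq> k'" "k \<notin> V" "k' \<notin> V" "k \<notin> set as" "k' \<notin> set as" "k \<notin> set bs" "k' \<notin> set bs"
    using P by (auto simp: positions_def)
  have S1: "insert k' (pos K1) = ?S" "k' \<notin> pos K1" using kk by (auto simp: pos_def K1)
  have S2: "insert k (pos K2) = ?S" "k \<notin> pos K2" using kk by (auto simp: pos_def K2)
  have S3: "pos (as @ k' # k # bs) = ?S" by (auto simp: pos_def)
  have \<tau>p: "\<tau> permutes ?S" unfolding \<tau> by (rule comp_transpose_permutes[OF \<sigma>]) (auto simp: pos_def)
  define B where "B u \<longleftrightarrow> restrict u V = w \<and> (\<forall>k\<in>?S. blk (u k) = \<epsilon> k)" for u :: "nat \<Rightarrow> nat"
  define m where "m u = f (restrict (u \<circ> \<sigma>) V)" for u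
  have "chain ?K u (u \<circ> \<sigma>) (m u) - chain (as @ k' # k # bs) u (u \<circ> \<sigma>) (m u) =
     (if u (\<tau> k') = u k' then chain K1 u (u \<circ> \<tau>) (f (restrict (u \<circ> \<tau>) V)) else 0)
     - (if u (\<tau> k) = u k then chain K2 u (u \<circ> \<tau>) (f (restrict (u \<circ> \<tau>) V)) else 0)"
    if u: "u \<in> index_set N ?S" for u
  proof -
    let ?l = "u \<circ> \<sigma>" and ?y = "chain bs u (u \<circ> \<sigma>) (m u)"
    have l: "?l \<in> index_set N ?S" by (rule index_set_comp_permutes[OF u \<sigma>])
    have lt: "u k < N" "u k' < N" "?l k < N" "?l k' < N"
      using index_set_lt[OF u] index_set_lt[OF l] by (auto simp: pos_def)
    have b: "bounded_on (set as) u" "bounded_on (set as) ?l"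
      using bounded_on_pos[OF u] bounded_on_pos[OF l] by (auto simp: bounded_on_def)
    have t: "(u \<circ> \<tau>) j = (if j = k then ?l k' else if j = k' then ?l k else ?l j)" for j
      by (auto simp: \<tau> transpose_def)
    have r: "restrict (u \<circ> \<tau>) V = restrict ?l V" using kk by (auto simp: fun_eq_iff restrict_def t simp del: comp_apply)
    have c: "chain as u (u \<circ> \<tau>) x = chain as u ?l x" "chain bs u (u \<circ> \<tau>) x = chain bs u ?l x" for x
      using kk by (auto intro!: chain_cong simp: t simp del: comp_apply)
    have "chain ?K u ?l (m u) - chain (as @ k' # k # bs) u ?l (m u) =
      chain as u ?l (E (u k) (?l k) (E (u k') (?l k') ?y) - E (u k') (?l k') (E (u k) (?l k) ?y))"
      by (simp add: chain_append chain_linear[OF b])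
    also have "\<dots> = chain as u ?l ((if ?l k = u k' then E (u k) (?l k') ?y else 0) - (if ?l k' = u k then E (u k') (?l k) ?y else 0))"
      using E_comm[OF lt(1,3,2,4)] by simp
    also have "\<dots> = (if ?l k = u k' then chain as u ?l (E (u k) (?l k') ?y) else 0)
       - (if ?l k' = u k then chain as u ?l (E (u k') (?l k) ?y) else 0)"
      by (simp add: chain_linear[OF b])
    also have "\<dots> = (if (u \<circ> \<tau>) k' = u k' then chain K1 u (u \<circ> \<tau>) (f (restrict (u \<circ> \<tau>) V)) else 0)
     - (if (u \<circ> \<tau>) k = u k then chain K2 u (u \<circ> \<tau>) (f (restrict (u \<circ> \<tau>) V)) else 0)"
      using kk by (simp add: K1 K2 chain_append c r m_def t del: comp_apply)
    finally show ?thesis by simp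
  qed
  note termwise = this
  have "perm_op ?K \<sigma> \<epsilon> f w - perm_op (as @ k' # k # bs) \<sigma> \<epsilon> f w =
     (\<Sum>u\<in>index_set N ?S. if B u then chain ?K u (u \<circ> \<sigma>) (m u) - chain (as @ k' # k # bs) u (u \<circ> \<sigma>) (m u) else 0)"
    unfolding perm_op_def S3 sum_subtractf[symmetric] by (rule sum.cong) (auto simp: B_def m_def)
  also have "\<dots> = (\<Sum>u\<in>index_set N ?S. (if B u \<and> u (\<tau> k') = u k' then chain K1 u (u \<circ> \<tau>) (f (restrict (u \<circ> \<tau>) V)) else 0)
     - (if B u \<and> u (\<tau> k) = u k then chain K2 u (u \<circ> \<tau>) (f (restrict (u \<circ> \<tau>) V)) else 0))"
    by (rule sum.cong) (auto simp: termwise)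
  also have "\<dots> = scale (loop_factor k' \<tau> \<epsilon>) (perm_op K1 (bypass k' \<tau>) \<epsilon> f w) - scale (loop_factor k \<tau> \<epsilon>) (perm_op K2 (bypass k \<tau>) \<epsilon> f w)"
    unfolding sum_subtractf
    using trace_out[OF S1(2), of \<tau> w \<epsilon> f] trace_out[OF S2(2), of \<tau> w \<epsilon> f] \<tau>p
    unfolding S1(1) S2(1) B_def by (simp only: conj_assoc)
  finally show ?thesis .
qed

text \<open>The last letter acts first, directly on the invariant tensor, and equal block labels
  make it block diagonal. Invariance replaces it by its eigenvalue, when its indices agree, and by
  an exchange of labels with each factor \<open>r\<close>; both are contractions at
  \<open>z\<close>.\<close>

lemma perm_op_diagonal_edge:
  assumes P: "positions (K @ [z])" and \<sigma>: "\<sigma> permutes pos (K @ [z])" and \<epsilon>: "\<epsilon> z = \<epsilon> (\<sigma> z)"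
    and f: "f \<in> invariants"
  shows "perm_op (K @ [z]) \<sigma> \<epsilon> f w = scale (cst (\<epsilon> z)) (scale (loop_factor z \<sigma> \<epsilon>) (perm_op K (bypass z \<sigma>) \<epsilon> f w))
    - (\<Sum>r\<in>V. scale (loop_factor z (\<sigma> \<circ> transpose r z) \<epsilon>) (perm_op K (bypass z (\<sigma> \<circ> transpose r z)) \<epsilon> f w))"
proof -
  let ?S = "pos (K @ [z])"
  have zz: "z \<notin> V" "z \<notin> set K" and KV: "set K \<inter> V = {}" using P by (auto simp: positions_def)
  have S: "insert z (pos K) = ?S" "z \<notin> pos K" using zz by (auto simp: pos_def)
  define B where "B u \<longleftrightarrow> restrict u V = w \<and> (\<forall>k\<in>?S. blk (u k) = \<epsilon> k)" for u :: "nat \<Rightarrow> nat"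
  define T where "T \<tau> u = (if u (\<tau> z) = u z then chain K u (u \<circ> \<tau>) (f (restrict (u \<circ> \<tau>) V)) else 0)" for \<tau> u
  have termwise: "chain (K @ [z]) u (u \<circ> \<sigma>) (f (restrict (u \<circ> \<sigma>) V)) =
     scale (cst (\<epsilon> z)) (T \<sigma> u) - (\<Sum>r\<in>V. T (\<sigma> \<circ> transpose r z) u)"
    if u: "u \<in> index_set N ?S" and B: "B u" for u
  proof -
    let ?l = "u \<circ> \<sigma>"
    let ?v = "restrict ?l V"
    have l: "?l \<in> index_set N ?S" by (rule index_set_comp_permutes[OF u \<sigma>])
    have zS: "z \<in> ?S" by (simp add: pos_def)
    have lt: "u z < N" "?l z < N" using index_set_lt[OF u zS] index_set_lt[OF l zS] by auto
    have "\<sigma> z \<in> ?S" using zS \<sigma> by (simp add: permutes_in_image)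
    then have bl: "blk (u z) = blk (?l z)" "blk (u z) = \<epsilon> z" using B zS \<epsilon> by (auto simp: B_def)
    have bd: "bounded_on (set K) u" "bounded_on (set K) ?l"
      using bounded_on_pos[OF u] bounded_on_pos[OF l] by (auto simp: bounded_on_def)
    have "E (u z) (?l z) (f ?v) = (if u z = ?l z then scale (cst (blk (u z))) (f ?v) else 0)
       - (\<Sum>r\<in>V. if ?v r = u z then f (?v(r := ?l z)) else 0)"
      using f lt bl(1) restrict_V[OF l] unfolding invariants_def by blast
    then have "chain (K @ [z]) u ?l (f ?v) = chain K u ?l (if u z = ?l z then scale (cst (\<epsilon> z)) (f ?v) else 0)
       - (\<Sum>r\<in>V. chain K u ?l (if ?v r = u z then f (?v(r := ?l z)) else 0))"
      unfolding bl(2) by (simp add: chain_append chain_linear[OF bd])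
    also have "chain K u ?l (if u z = ?l z then scale (cst (\<epsilon> z)) (f ?v) else 0) = scale (cst (\<epsilon> z)) (T \<sigma> u)"
      by (auto simp: T_def chain_linear[OF bd])
    also have "(\<Sum>r\<in>V. chain K u ?l (if ?v r = u z then f (?v(r := ?l z)) else 0)) = (\<Sum>r\<in>V. T (\<sigma> \<circ> transpose r z) u)"
    proof (rule sum.cong[OF refl])
      fix r assume r: "r \<in> V"
      let ?\<tau> = "\<sigma> \<circ> transpose r z"
      have t: "(u \<circ> ?\<tau>) j = (if j = r then ?l z else if j = z then ?l r else ?l j)" for j
        by (auto simp: transpose_def)
      have rK: "r \<notin> set K" using KV r by auto
      have "restrict (u \<circ> ?\<tau>) V = ?v(r := ?l z)"
        using zz r by (auto simp: fun_eq_iff restrict_def t simp del: comp_apply)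
      moreover have "chain K u (u \<circ> ?\<tau>) x = chain K u ?l x" for x
        using zz rK by (intro chain_cong) (auto simp: t simp del: comp_apply)
      ultimately show "chain K u ?l (if ?v r = u z then f (?v(r := ?l z)) else 0) = T ?\<tau> u"
        using r t[of z] zz by (auto simp: T_def chain_linear[OF bd])
    qed
    finally show ?thesis .
  qed
  have tr: "(\<Sum>u\<in>index_set N ?S. if B u then T \<tau> u else 0) = scale (loop_factor z \<tau> \<epsilon>) (perm_op K (bypass z \<tau>) \<epsilon> f w)"
    if "\<tau> permutes ?S" for \<tau>
  proof -
    have "(\<Sum>u\<in>index_set N ?S. if B u then T \<tau> u else 0) = (\<Sum>u\<in>index_set N ?S.
      if restrict u V = w \<and> (\<forall>k\<in>?S. blk (u k) = \<epsilon> k) \<and> u (\<tau> z) = u z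
      then chain K u (u \<circ> \<tau>) (f (restrict (u \<circ> \<tau>) V)) else 0)"
      by (rule sum.cong) (auto simp: B_def T_def)
    then show ?thesis using trace_out[OF S(2), of \<tau> w \<epsilon> f] that unfolding S(1) by simp
  qed
  have "perm_op (K @ [z]) \<sigma> \<epsilon> f w = (\<Sum>u\<in>index_set N ?S. scale (cst (\<epsilon> z)) (if B u then T \<sigma> u else 0)
      - (\<Sum>r\<in>V. if B u then T (\<sigma> \<circ> transpose r z) u else 0))"
    unfolding perm_op_def B_def[symmetric] by (rule sum.cong[OF refl]) (simp add: termwise)
  also have "\<dots> = scale (cst (\<epsilon> z)) (\<Sum>u\<in>index_set N ?S. if B u then T \<sigma> u else 0)
      - (\<Sum>r\<in>V. \<Sum>u\<in>index_set N ?S. if B u then T (\<sigma> \<circ> transpose r z) u else 0)"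
    unfolding sum_subtractf scale_sum_right by (subst sum.swap) (rule refl)
  also have "(\<Sum>r\<in>V. \<Sum>u\<in>index_set N ?S. if B u then T (\<sigma> \<circ> transpose r z) u else 0)
     = (\<Sum>r\<in>V. scale (loop_factor z (\<sigma> \<circ> transpose r z) \<epsilon>) (perm_op K (bypass z (\<sigma> \<circ> transpose r z)) \<epsilon> f w))"
    by (rule sum.cong[OF refl], rule tr, rule comp_transpose_permutes[OF \<sigma>]) (auto simp: pos_def)
  finally show ?thesis unfolding tr[OF \<sigma>] .
qed

text \<open>In coordinates, the sum over s|t of E_s^t on the module and E_t^s on factor
  \<open>r\<close>, the part of a y operator that involves the module.\<close>

definition hop :: "nat \<Rightarrow> 'm tensor \<Rightarrow> 'm tensor" where
  "hop r f w = (if w \<in> MI then \<Sum>s<N. if blk s \<noteq> blk (w r) then E s (w r) (f (w(r := s))) else 0 else 0)"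

text \<open>Since \<open>\<sigma> r = z\<close>, the tensor is evaluated with the output label of
  the last letter at factor \<open>r\<close>. That label ranges over the block opposite to the input
  label of the letter, so summing over it yields \<open>hop r\<close>.\<close>

lemma perm_op_hop:
  assumes P: "positions (K @ [z])" and \<sigma>: "\<sigma> permutes pos (K @ [z])" and \<epsilon>: "\<epsilon> z \<noteq> \<epsilon> (\<sigma> z)"
    and r: "r \<in> V" "\<sigma> r = z"
  shows "perm_op (K @ [z]) \<sigma> \<epsilon> f w = perm_op K (bypass z \<sigma>) \<epsilon> (hop r f) w"
proof -
  let ?\<tau> = "bypass z \<sigma>" and ?y = "\<sigma> z"
  have zz: "z \<notin> V" "z \<notin> set K" and rK: "r \<notin> set K" "r \<noteq> z" using P r by (auto simp: positions_def)
  have S: "pos (K @ [z]) = insert z (pos K)" "z \<notin> pos K" using zz by (auto simp: pos_def)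
  have \<sigma>': "\<sigma> permutes insert z (pos K)" using \<sigma> S by simp
  have \<tau>: "?\<tau> permutes pos K" by (rule bypass_permutes[OF \<sigma>'])
  have y: "?y \<noteq> z" using \<epsilon> by auto
  then have yS: "?y \<in> pos K" using \<sigma>' by (metis insertE insertI1 permutes_in_image)
  have ne: "\<sigma> k \<noteq> z" if "k \<noteq> r" for k using that r permutes_inj[OF \<sigma>] by (metis injD)
  have \<tau>r: "?\<tau> r = ?y" using bypass_apply[OF \<sigma> rK(2)] r by simp
  have "perm_op (K @ [z]) \<sigma> \<epsilon> f w = (\<Sum>u\<in>index_set N (pos K). \<Sum>x<N.
     if restrict (u(z := x)) V = w \<and> (\<forall>k\<in>insert z (pos K). blk ((u(z := x)) k) = \<epsilon> k)
     then chain (K @ [z]) (u(z := x)) (u(z := x) \<circ> \<sigma>) (f (restrict (u(z := x) \<circ> \<sigma>) V)) else 0)"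
    unfolding perm_op_def S(1) sum_index_set_insert[OF S(2)] ..
  also have "\<dots> = perm_op K ?\<tau> \<epsilon> (hop r f) w"
    unfolding perm_op_def
  proof (rule sum.cong[OF refl])
    fix u assume u: "u \<in> index_set N (pos K)"
    let ?v = "restrict (u \<circ> ?\<tau>) V"
    let ?B = "restrict u V = w \<and> (\<forall>k\<in>pos K. blk (u k) = \<epsilon> k)"
    have rr: "restrict (u(z := x)) V = restrict u V" for x using zz by (auto simp: fun_eq_iff)
    have l: "u \<circ> ?\<tau> \<in> index_set N (pos K)" by (rule index_set_comp_permutes[OF u \<tau>])
    have bd: "bounded_on (set K) u" "bounded_on (set K) (u \<circ> ?\<tau>)" using bounded_on_pos u l by auto
    have t: "(u(z := x) \<circ> \<sigma>) k = (if k = r then x else (u \<circ> ?\<tau>) k)" if "k \<noteq> z" for k x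
      using ne[of k] r bypass_apply[OF \<sigma> that] by auto
    have v: "restrict (u(z := x) \<circ> \<sigma>) V = ?v(r := x)" for x
    proof
      fix k
      show "restrict (u(z := x) \<circ> \<sigma>) V k = (?v(r := x)) k"
      proof (cases "k \<in> V")
        case True
        then have "k \<noteq> z" using zz by auto
        from t[OF this] True show ?thesis by (simp del: comp_apply)
      qed (use r(1) in auto)
    qed
    have ch: "chain (K @ [z]) (u(z := x)) (u(z := x) \<circ> \<sigma>) m = chain K u (u \<circ> ?\<tau>) (E x (u ?y) m)" for x m
    proof -
      have "chain K (u(z := x)) (u(z := x) \<circ> \<sigma>) m' = chain K u (u \<circ> ?\<tau>) m'" for m'
      proof (rule chain_cong)
        fix k assume "k \<in> set K"
        then have "k \<noteq> z" "k \<noteq> r" using zz rK by auto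
        then show "(u(z := x)) k = u k" "(u(z := x) \<circ> \<sigma>) k = (u \<circ> ?\<tau>) k" using t[of k x] by simp_all
      qed
      then show ?thesis using y by (simp add: chain_append)
    qed
    show "(\<Sum>x<N. if restrict (u(z := x)) V = w \<and> (\<forall>k\<in>insert z (pos K). blk ((u(z := x)) k) = \<epsilon> k)
       then chain (K @ [z]) (u(z := x)) (u(z := x) \<circ> \<sigma>) (f (restrict (u(z := x) \<circ> \<sigma>) V)) else 0) =
      (if ?B then chain K u (u \<circ> ?\<tau>) (hop r f ?v) else 0)"
    proof (cases ?B)
      case True
      have "hop r f ?v = (\<Sum>x<N. if blk x = \<epsilon> z then E x (u ?y) (f (?v(r := x))) else 0)"
      proof -
        have vr: "?v r = u ?y" using r \<tau>r by simp
        have bu: "blk (u ?y) = \<epsilon> ?y" using True yS by blast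
        have "(blk x \<noteq> \<epsilon> ?y) = (blk x = \<epsilon> z)" for x using \<epsilon> by blast
        then show ?thesis
          unfolding hop_def if_P[OF restrict_V[OF l]] vr bu by (simp only:)
      qed
      then have "chain K u (u \<circ> ?\<tau>) (hop r f ?v) = (\<Sum>x<N. if blk x = \<epsilon> z then chain K u (u \<circ> ?\<tau>) (E x (u ?y) (f (?v(r := x)))) else 0)"
        by (auto simp: chain_linear[OF bd] intro!: sum.cong)
      moreover have "(restrict (u(z := x)) V = w \<and> (\<forall>k\<in>insert z (pos K). blk ((u(z := x)) k) = \<epsilon> k)) \<longleftrightarrow> blk x = \<epsilon> z" for x
        using True S(2) unfolding rr by auto
      ultimately show ?thesis unfolding ch v using True by simp
    next
      case False
      then have "\<not> (restrict (u(z := x)) V = w \<and> (\<forall>k\<in>insert z (pos K). blk ((u(z := x)) k) = \<epsilon> k))" for x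
        unfolding rr using S(2) by auto
      then show ?thesis using False by (simp only: if_False) simp
    qed
  qed
  finally show ?thesis .
qed

lemma chain_map: "chain (map \<pi> K) u l m = chain K (u \<circ> \<pi>) (l \<circ> \<pi>) m"
  by (induction K) auto

text \<open>Substituting \<open>u \<circ> \<pi>\<close> for the labels renames the letters; as
  \<open>\<pi>\<close> commutes with \<open>\<sigma>\<close>, the joining pattern is unchanged and
  only the block labels move.\<close>

lemma perm_op_rename:
  assumes \<pi>: "\<pi> permutes set K" and KV: "set K \<inter> V = {}" and comm: "\<pi> \<circ> \<sigma> = \<sigma> \<circ> \<pi>"
  shows "perm_op (map \<pi> K) \<sigma> \<epsilon> f w = perm_op K \<sigma> (\<epsilon> \<circ> \<pi>) f w"
proof -
  have pos: "pos (map \<pi> K) = pos K" by (simp add: pos_def permutes_image[OF \<pi>])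
  have \<pi>': "\<pi> permutes pos K" by (rule permutes_subset[OF \<pi>]) (auto simp: pos_def)
  have fix_V: "\<pi> k = k" if "k \<in> V" for k using that KV permutes_not_in[OF \<pi>] by blast
  have r: "restrict (u \<circ> \<pi>) V = restrict u V" for u :: "nat \<Rightarrow> nat" using fix_V by (auto simp: restrict_def fun_eq_iff)
  have "perm_op K \<sigma> (\<epsilon> \<circ> \<pi>) f w = (\<Sum>u\<in>index_set N (pos K). if restrict (u \<circ> \<pi>) V = w \<and> (\<forall>k\<in>pos K. blk (u (\<pi> k)) = \<epsilon> (\<pi> k))
     then chain K (u \<circ> \<pi>) (u \<circ> \<pi> \<circ> \<sigma>) (f (restrict (u \<circ> \<pi> \<circ> \<sigma>) V)) else 0)"
    unfolding perm_op_def
  proof (rule sum.reindex_bij_witness[of _ "\<lambda>u. u \<circ> \<pi>" "\<lambda>u. u \<circ> inv_into UNIV \<pi>"], goal_cases)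
    case (1 u)
    then show ?case using permutes_inv_o[OF \<pi>'] by (simp add: comp_assoc)
  next
    case (2 u)
    then show ?case by (rule index_set_comp_permutes[OF _ permutes_inv[OF \<pi>']])
  next
    case (3 u)
    then show ?case using permutes_inv_o[OF \<pi>'] by (simp add: comp_assoc)
  next
    case (4 u)
    then show ?case by (rule index_set_comp_permutes[OF _ \<pi>'])
  next
    case (5 u)
    have "u \<circ> inv_into UNIV \<pi> \<circ> \<pi> = u" using permutes_inv_o[OF \<pi>'] by (simp add: comp_assoc)
    then have e: "u (inv_into UNIV \<pi> (\<pi> x)) = u x" for x by (metis comp_apply)
    show ?case using e by (simp add: comp_def)
  qed
  also have "\<dots> = perm_op (map \<pi> K) \<sigma> \<epsilon> f w"
    unfolding perm_op_def pos r chain_map ball_permutes[OF \<pi>', of "\<lambda>k. blk (_ k) = \<epsilon> k"]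
    by (simp only: comp_assoc comm) (simp only: comp_assoc[symmetric] r)
  finally show ?thesis ..
qed

text \<open>Entry \<open>(a, b)\<close> of the power \<open>i + 1\<close> of the matrix whose
  entries are the operators \<open>E a b\<close>.\<close>

fun E_power :: "nat \<Rightarrow> nat \<Rightarrow> nat \<Rightarrow> 'm \<Rightarrow> 'm" where
  "E_power 0 a b m = E a b m"
| "E_power (Suc i) a b m = (\<Sum>s<N. E a s (E_power i s b m))"

text \<open>Entries of a power transform under commutators like the generators themselves; in the
  inductive step the two terms meeting the intermediate index cancel.\<close>

lemma E_power_comm:
  assumes "c < N" "d < N" "a < N" "b < N"
  shows "E c d (E_power i a b m) = E_power i a b (E c d m) + (if d = a then E_power i c b m else 0)
      - (if b = c then E_power i a d m else 0)"
  using assms(3,4)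
proof (induction i arbitrary: a)
  case 0
  show ?case using E_comm[of c d a b m] 0 assms by (simp add: algebra_simps split: if_splits)
next
  case (Suc i)
  have "E c d (E a s (E_power i s b m)) = E a s (E_power i s b (E c d m)) + (if s = d then E a d (E_power i c b m) else 0)
      - (if b = c then E a s (E_power i s d m) else 0) + (if d = a then E c s (E_power i s b m) else 0)
      - (if s = c then E a d (E_power i c b m) else 0)" if s: "s < N" for s
  proof -
    have "E c d (E a s (E_power i s b m)) = E a s (E c d (E_power i s b m))
       + ((if d = a then E c s (E_power i s b m) else 0) - (if s = c then E a d (E_power i s b m) else 0))"
      using E_comm[of c d a s "E_power i s b m"] assms Suc.prems s by (simp add: algebra_simps split: if_splits)
    then show ?thesis using Suc.IH[OF s Suc.prems(2)] Suc.prems s by (auto simp: E_add E_diff E_zero)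
  qed
  then have "E c d (E_power (Suc i) a b m) = (\<Sum>s<N. E a s (E_power i s b (E c d m)) + (if s = d then E a d (E_power i c b m) else 0)
      - (if b = c then E a s (E_power i s d m) else 0) + (if d = a then E c s (E_power i s b m) else 0)
      - (if s = c then E a d (E_power i c b m) else 0))"
    using assms by (simp add: E_sum)
  also have "\<dots> = E_power (Suc i) a b (E c d m) + (if d = a then E_power (Suc i) c b m else 0)
      - (if b = c then E_power (Suc i) a d m else 0)"
    unfolding sum.distrib sum_subtractf using assms by auto
  finally show ?case .
qed

lemma E_power_linear:
  assumes "a < N" "b < N"
  shows "E_power i a b (x + y) = E_power i a b x + E_power i a b y" "E_power i a b (scale t x) = scale t (E_power i a b x)"
  using assms by (induction i arbitrary: a) (auto simp: E_add E_scale sum.distrib scale_sum_right)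

text \<open>The Gelfand invariants of gl_N.\<close>

definition E_power_trace :: "nat \<Rightarrow> 'm \<Rightarrow> 'm" where
  "E_power_trace i m = (\<Sum>a<N. E_power i a a m)"

lemma E_power_trace_central:
  assumes "c < N" "d < N"
  shows "E c d (E_power_trace i m) = E_power_trace i (E c d m)"
proof -
  have "E c d (E_power_trace i m) = (\<Sum>a<N. E_power i a a (E c d m) + (if a = d then E_power i c d m else 0)
      - (if a = c then E_power i c d m else 0))"
    unfolding E_power_trace_def E_sum[OF assms] by (rule sum.cong) (use assms E_power_comm in auto)
  then show ?thesis using assms by (simp add: sum.distrib sum_subtractf E_power_trace_def)
qed

lemma E_power_trace_linear: "Vector_Spaces.linear scale scale (E_power_trace i)"
  unfolding Vector_Spaces.linear_iff
  by (simp add: E_power_trace_def E_power_linear sum.distrib scale_sum_right vector_space_axioms)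

text \<open>A word whose letters are joined in a row, with \<open>b\<close> the input label of the
  last. Taking for \<open>b\<close> the output label of the first closes the row to a cycle.\<close>

fun path :: "nat list \<Rightarrow> (nat \<Rightarrow> nat) \<Rightarrow> nat \<Rightarrow> 'm \<Rightarrow> 'm" where
  "path [] u b m = m"
| "path [k] u b m = E (u k) b m"
| "path (k # k' # ks) u b m = E (u k) (u k') (path (k' # ks) u b m)"

lemma path_cong: "(\<And>k. k \<in> set K \<Longrightarrow> u k = u' k) \<Longrightarrow> path K u b m = path K u' b m"
  by (induction K u b m rule: path.induct) auto

lemma chain_eq_path:
  assumes "\<And>i. Suc i < length K \<Longrightarrow> l (K ! i) = u (K ! Suc i)" "K \<noteq> [] \<Longrightarrow> l (last K) = b"
  shows "chain K u l m = path K u b m"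
  using assms
proof (induction K u b m rule: path.induct)
  case (3 k k' ks u b m)
  have "chain (k' # ks) u l m = path (k' # ks) u b m"
    by (rule 3(1)) (use "3.prems"(1)[of "Suc _"] "3.prems"(2) in auto)
  then show ?case using "3.prems"(1)[of 0] by simp
qed auto

text \<open>Summing over the inner labels of a row is matrix multiplication.\<close>

lemma sum_path:
  assumes "distinct (k # ks)" "a < N" "b < N"
  shows "(\<Sum>v\<in>index_set N (set ks). path (k # ks) (v(k := a)) b m) = E_power (length ks) a b m"
  using assms
proof (induction ks arbitrary: k a)
  case Nil
  then show ?case by (simp add: index_set_def)
next
  case (Cons k' ks)
  have k: "k \<noteq> k'" "k' \<notin> set ks" "k \<notin> set ks" using Cons.prems by auto
  have "(\<Sum>v\<in>index_set N (set (k' # ks)). path (k # k' # ks) (v(k := a)) b m)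
     = (\<Sum>v\<in>index_set N (set ks). \<Sum>x<N. E a x (path (k' # ks) (v(k' := x)) b m))"
  proof -
    have "path (k' # ks) (v(k' := x, k := a)) b m = path (k' # ks) (v(k' := x)) b m" for v x
      by (rule path_cong) (use k in auto)
    then show ?thesis unfolding list.set(2) sum_index_set_insert[OF k(2)] using k by (simp cong: sum.cong)
  qed
  also have "\<dots> = (\<Sum>x<N. E a x (\<Sum>v\<in>index_set N (set ks). path (k' # ks) (v(k' := x)) b m))"
    using Cons.prems by (subst sum.swap) (simp add: E_sum)
  also have "\<dots> = E_power (length (k' # ks)) a b m"
  proof -
    have "(\<Sum>v\<in>index_set N (set ks). path (k' # ks) (v(k' := x)) b m) = E_power (length ks) x b m" if "x < N" for x
      by (rule Cons.IH) (use that Cons.prems in auto)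
    then show ?thesis by (simp del: fun_upd_apply path.simps)
  qed
  finally show ?case .
qed

end

section \<open>Absorption of words in a stable subspace\<close>

locale stable_subspace = irreducible_gl_family +
  fixes W
  assumes W_subspace: "module.subspace (tscale scale) W"
    and W_invariants: "W \<subseteq> invariants"
    and W_perm: "f \<in> W \<Longrightarrow> \<sigma> permutes V \<Longrightarrow> (\<lambda>w. f (w \<circ> \<sigma>)) \<in> W"
    and W_blk: "f \<in> W \<Longrightarrow> (\<lambda>w. if \<forall>k\<in>V. blk (w k) = \<epsilon> k then f w else 0) \<in> W"
    and W_hop: "f \<in> W \<Longrightarrow> r \<in> V \<Longrightarrow> hop r f \<in> W"
begin

sublocale tensors: vector_space "tscale scale"
  by (rule vector_space_tscale)

lemmas W_simps = tensors.subspace_add[OF W_subspace] tensors.subspace_diff[OF W_subspace]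
  tensors.subspace_scale[OF W_subspace] tensors.subspace_0[OF W_subspace] tensors.subspace_sum[OF W_subspace]

text \<open>Permutation, block labels and tensor are all quantified, since the induction on the
  length of the word changes each of them.\<close>

definition absorbed :: "nat list \<Rightarrow> bool" where
  "absorbed K \<longleftrightarrow> positions K \<longrightarrow> (\<forall>\<sigma> \<epsilon>. \<forall>f\<in>W. \<sigma> permutes pos K \<longrightarrow> perm_op K \<sigma> \<epsilon> f \<in> W)"

lemma absorbedD:
  "absorbed K \<Longrightarrow> positions K \<Longrightarrow> f \<in> W \<Longrightarrow> \<sigma> permutes pos K \<Longrightarrow> perm_op K \<sigma> \<epsilon> f \<in> W"
  by (simp add: absorbed_def)

lemma positions_mset: "mset L = mset K \<Longrightarrow> positions K \<Longrightarrow> positions L"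
  unfolding positions_def by (metis mset_eq_imp_distinct_iff mset_eq_setD)

lemma pos_mset: "mset L = mset K \<Longrightarrow> pos L = pos K"
  unfolding pos_def by (metis mset_eq_setD)

text \<open>By \<open>perm_op_swap\<close>, exchanging neighbouring letters costs two words with one
  letter fewer, both in \<open>W\<close> by induction. Modulo \<open>W\<close> the order of the
  letters is immaterial.\<close>

lemma perm_op_reorder:
  assumes IH: "\<And>L. length L < length K \<Longrightarrow> absorbed L" and K: "positions K"
    and \<sigma>: "\<sigma> permutes pos K" and f: "f \<in> W" and L: "mset L = mset K"
  shows "perm_op L \<sigma> \<epsilon> f - perm_op K \<sigma> \<epsilon> f \<in> W"
proof (rule adjacent_swaps[where xs = K and Q = "\<lambda>L. perm_op L \<sigma> \<epsilon> f - perm_op K \<sigma> \<epsilon> f \<in> W"])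
  show "mset L = mset K" by (rule L)
  show "perm_op K \<sigma> \<epsilon> f - perm_op K \<sigma> \<epsilon> f \<in> W" using W_simps by simp
  fix as k k' bs
  assume m: "mset (as @ k # k' # bs) = mset K" and Q: "perm_op (as @ k # k' # bs) \<sigma> \<epsilon> f - perm_op K \<sigma> \<epsilon> f \<in> W"
  let ?L = "as @ k # k' # bs" and ?K1 = "as @ k # bs" and ?K2 = "as @ k' # bs"
  let ?\<tau> = "\<sigma> \<circ> transpose k k'"
  have P: "positions ?L" by (rule positions_mset[OF m K])
  have \<sigma>': "\<sigma> permutes pos ?L" using \<sigma> pos_mset[OF m] by simp
  have \<tau>: "?\<tau> permutes pos ?L" by (rule comp_transpose_permutes[OF \<sigma>']) (auto simp: pos_def)
  have "length K = length ?L" using m by (metis size_mset)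
  then have A: "absorbed ?K1" "absorbed ?K2" by (auto intro!: IH)
  have P': "positions ?K1" "positions ?K2" using P by (auto simp: positions_def)
  have pos: "pos ?L = insert k' (pos ?K1)" "pos ?L = insert k (pos ?K2)" by (auto simp: pos_def)
  have W1: "perm_op ?K1 (bypass k' ?\<tau>) \<epsilon> f \<in> W"
    by (rule absorbedD[OF A(1) P'(1) f], rule bypass_permutes) (use \<tau> pos(1) in simp)
  have W2: "perm_op ?K2 (bypass k ?\<tau>) \<epsilon> f \<in> W"
    by (rule absorbedD[OF A(2) P'(2) f], rule bypass_permutes) (use \<tau> pos(2) in simp)
  have eq: "perm_op ?L \<sigma> \<epsilon> f - perm_op (as @ k' # k # bs) \<sigma> \<epsilon> f =
     tscale scale (loop_factor k' ?\<tau> \<epsilon>) (perm_op ?K1 (bypass k' ?\<tau>) \<epsilon> f) - tscale scale (loop_factor k ?\<tau> \<epsilon>) (perm_op ?K2 (bypass k ?\<tau>) \<epsilon> f)"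
  proof
    fix w
    show "(perm_op ?L \<sigma> \<epsilon> f - perm_op (as @ k' # k # bs) \<sigma> \<epsilon> f) w =
     (tscale scale (loop_factor k' ?\<tau> \<epsilon>) (perm_op ?K1 (bypass k' ?\<tau>) \<epsilon> f) - tscale scale (loop_factor k ?\<tau> \<epsilon>) (perm_op ?K2 (bypass k ?\<tau>) \<epsilon> f)) w"
      using perm_op_swap[OF P \<sigma>' refl refl refl, of \<epsilon> f w] by (simp add: tscale_def)
  qed
  have "perm_op ?L \<sigma> \<epsilon> f - perm_op (as @ k' # k # bs) \<sigma> \<epsilon> f \<in> W"
    unfolding eq by (intro W_simps W1 W2)
  from W_simps(2)[OF Q this] show "perm_op (as @ k' # k # bs) \<sigma> \<epsilon> f - perm_op K \<sigma> \<epsilon> f \<in> W"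
    by (simp add: algebra_simps)
qed

lemma perm_op_reorder_iff:
  assumes "\<And>L. length L < length K \<Longrightarrow> absorbed L" "positions K" "\<sigma> permutes pos K" "f \<in> W" "mset L = mset K"
    "perm_op L \<sigma> \<epsilon> f \<in> W"
  shows "perm_op K \<sigma> \<epsilon> f \<in> W"
proof -
  have d: "perm_op L \<sigma> \<epsilon> f - perm_op K \<sigma> \<epsilon> f \<in> W" by (rule perm_op_reorder[OF assms(1-5)])
  have "perm_op K \<sigma> \<epsilon> f = perm_op L \<sigma> \<epsilon> f - (perm_op L \<sigma> \<epsilon> f - perm_op K \<sigma> \<epsilon> f)" by simp
  then show ?thesis using W_simps(2)[OF assms(6) d] by metis
qed

text \<open>The letter \<open>z\<close> is moved to the right end, where it acts directly on the
  invariant tensor and is eliminated.\<close>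

lemma perm_op_diagonal_absorbed:
  assumes IH: "\<And>L. length L < length K \<Longrightarrow> absorbed L" and K: "positions K"
    and \<sigma>: "\<sigma> permutes pos K" and f: "f \<in> W" and z: "z \<in> set K" "\<epsilon> z = \<epsilon> (\<sigma> z)"
  shows "perm_op K \<sigma> \<epsilon> f \<in> W"
proof (rule perm_op_reorder_iff[OF IH K \<sigma> f])
  let ?K = "remove1 z K"
  show m: "mset (?K @ [z]) = mset K" using z by simp
  have P: "positions (?K @ [z])" by (rule positions_mset[OF m K])
  then have P': "positions ?K" by (auto simp: positions_def)
  have \<sigma>': "\<sigma> permutes pos (?K @ [z])" using \<sigma> pos_mset[OF m] by simp
  have len: "length ?K < length K" using length_pos_if_in_set[OF z(1)] z(1) by (simp add: length_remove1)
  have pos: "pos (?K @ [z]) = insert z (pos ?K)" by (auto simp: pos_def)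
  have *: "perm_op ?K (bypass z \<tau>) \<epsilon> f \<in> W" if "\<tau> permutes pos (?K @ [z])" for \<tau>
    by (rule absorbedD[OF IH[OF len] P' f], rule bypass_permutes) (use that pos in simp)
  have eq: "perm_op (?K @ [z]) \<sigma> \<epsilon> f = tscale scale (cst (\<epsilon> z)) (tscale scale (loop_factor z \<sigma> \<epsilon>) (perm_op ?K (bypass z \<sigma>) \<epsilon> f))
    - (\<Sum>r\<in>V. tscale scale (loop_factor z (\<sigma> \<circ> transpose r z) \<epsilon>) (perm_op ?K (bypass z (\<sigma> \<circ> transpose r z)) \<epsilon> f))"
  proof
    fix w
    have s: "(\<Sum>r\<in>V. F r) w = (\<Sum>r\<in>V. F r w)" for F :: "nat \<Rightarrow> 'a tensor"
      using finite_V by (induction rule: finite_induct) auto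
    show "perm_op (?K @ [z]) \<sigma> \<epsilon> f w = (tscale scale (cst (\<epsilon> z)) (tscale scale (loop_factor z \<sigma> \<epsilon>) (perm_op ?K (bypass z \<sigma>) \<epsilon> f))
    - (\<Sum>r\<in>V. tscale scale (loop_factor z (\<sigma> \<circ> transpose r z) \<epsilon>) (perm_op ?K (bypass z (\<sigma> \<circ> transpose r z)) \<epsilon> f))) w"
      using perm_op_diagonal_edge[OF P \<sigma>' z(2), of f w] f W_invariants by (auto simp: s tscale_def)
  qed
  show "perm_op (?K @ [z]) \<sigma> \<epsilon> f \<in> W"
    unfolding eq
  proof (intro W_simps * \<sigma>')
    fix r assume "r \<in> V"
    show "\<sigma> \<circ> transpose r z permutes pos (?K @ [z])"
      by (rule comp_transpose_permutes[OF \<sigma>']) (use \<open>r \<in> V\<close> in \<open>auto simp: pos_def\<close>)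
  qed
qed

text \<open>The letter joined to factor \<open>r\<close> is moved to the right end and becomes
  \<open>hop r\<close>, under which \<open>W\<close> is stable.\<close>

lemma perm_op_path_absorbed:
  assumes IH: "\<And>L. length L < length K \<Longrightarrow> absorbed L" and K: "positions K"
    and \<sigma>: "\<sigma> permutes pos K" and f: "f \<in> W" and r: "r \<in> V" "\<sigma> r \<in> set K" "\<epsilon> (\<sigma> r) \<noteq> \<epsilon> (\<sigma> (\<sigma> r))"
  shows "perm_op K \<sigma> \<epsilon> f \<in> W"
proof (rule perm_op_reorder_iff[OF IH K \<sigma> f])
  let ?z = "\<sigma> r"
  let ?K = "remove1 ?z K"
  show m: "mset (?K @ [?z]) = mset K" using r by simp
  have P: "positions (?K @ [?z])" by (rule positions_mset[OF m K])
  then have P': "positions ?K" by (auto simp: positions_def)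
  have \<sigma>': "\<sigma> permutes pos (?K @ [?z])" using \<sigma> pos_mset[OF m] by simp
  have len: "length ?K < length K" using length_pos_if_in_set[OF r(2)] r(2) by (simp add: length_remove1)
  have pos: "pos (?K @ [?z]) = insert ?z (pos ?K)" by (auto simp: pos_def)
  have "perm_op (?K @ [?z]) \<sigma> \<epsilon> f = perm_op ?K (bypass ?z \<sigma>) \<epsilon> (hop r f)"
    by (rule ext) (rule perm_op_hop[OF P \<sigma>' r(3) r(1) refl])
  also have "\<dots> \<in> W"
    by (rule absorbedD[OF IH[OF len] P' W_hop[OF f r(1)]], rule bypass_permutes) (use \<sigma>' pos in simp)
  finally show "perm_op (?K @ [?z]) \<sigma> \<epsilon> f \<in> W" .
qed

text \<open>Summing over all block labels on a cycle of \<open>\<sigma>\<close> closes it up to a power trace, which acts on the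
  irreducible module by a scalar.\<close>

lemma sum_labels_cycle:
  assumes P: "positions (K @ C)" and \<sigma>: "\<sigma> permutes pos (K @ C)" and C: "C \<noteq> []"
    and cyc: "\<And>i. Suc i < length C \<Longrightarrow> \<sigma> (C ! i) = C ! Suc i" "\<sigma> (last C) = hd C"
  shows "\<exists>c. \<forall>\<epsilon> f. (\<Sum>\<eta>\<in>set C \<rightarrow>\<^sub>E UNIV. perm_op (K @ C) \<sigma> (\<lambda>k. if k \<in> set C then \<eta> k else \<epsilon> k) f)
    = tscale scale c (perm_op K (\<lambda>k. if k \<in> set C then k else \<sigma> k) \<epsilon> f)"
proof -
  let ?S = "pos (K @ C)" and ?\<tau> = "\<lambda>k. if k \<in> set C then k else \<sigma> k"
  \<comment> \<open>The cycle closes to the trace of the power \<open>length C\<close>;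
    \<open>E_power\<close> starts at the first power, hence \<open>tl\<close>.\<close>
  obtain c where c: "\<And>m. E_power_trace (length (tl C)) m = scale c m"
    using central_scalar[OF E_power_trace_linear E_power_trace_central] by blast
  have dis: "distinct C" "set K \<inter> set C = {}" "V \<inter> set C = {}" using P by (auto simp: positions_def)
  have pos: "?S = pos K \<union> set C" "pos K \<inter> set C = {}" using dis by (auto simp: pos_def)
  have \<sigma>C: "\<sigma> k \<in> set C" if k: "k \<in> set C" for k
  proof -
    obtain i where i: "i < length C" "k = C ! i" using k by (metis in_set_conv_nth)
    show ?thesis
    proof (cases "Suc i < length C")
      case True
      then show ?thesis using cyc(1)[OF True] i by simp
    next
      case False
      then have "i = length C - 1" using i by simp
      then have "k = last C" using i C by (simp add: last_conv_nth)
      then show ?thesis using cyc(2) C by simp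
    qed
  qed
  have "\<sigma> ` set C = set C"
    using \<sigma>C permutes_inj[OF \<sigma>] by (intro endo_inj_surj) (auto intro: inj_on_subset)
  then have \<sigma>nC: "\<sigma> k \<notin> set C" if "k \<notin> set C" for k
    using that permutes_inj[OF \<sigma>] by (metis imageE injD)
  have sumC: "(\<Sum>v\<in>index_set N (set C). chain C v (v \<circ> \<sigma>) m) = scale c m" for m
  proof -
    obtain z D where CD: "C = z # D" using C by (cases C) auto
    have zD: "z \<notin> set D" using dis CD by simp
    have ch: "chain (z # D) v (v \<circ> \<sigma>) m = path (z # D) v (v z) m" for v
      by (rule chain_eq_path) (use cyc CD in auto)
    have "(\<Sum>v\<in>index_set N (set C). chain C v (v \<circ> \<sigma>) m) = (\<Sum>v\<in>index_set N (set D). \<Sum>x<N. path (z # D) (v(z := x)) x m)"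
      unfolding CD list.set(2) sum_index_set_insert[OF zD] by (simp only: ch fun_upd_same)
    also have "\<dots> = (\<Sum>x<N. E_power (length D) x x m)"
      by (subst sum.swap) (use dis CD in \<open>intro sum.cong refl sum_path, auto\<close>)
    also have "\<dots> = scale c m" using c CD by (simp add: E_power_trace_def)
    finally show ?thesis .
  qed
  show ?thesis
  proof (intro exI allI)
    fix \<epsilon> f
    let ?H = "set C \<rightarrow>\<^sub>E (UNIV :: bool set)"
    have finH: "finite ?H" by (intro finite_PiE) auto
    show "(\<Sum>\<eta>\<in>?H. perm_op (K @ C) \<sigma> (\<lambda>k. if k \<in> set C then \<eta> k else \<epsilon> k) f) = tscale scale c (perm_op K ?\<tau> \<epsilon> f)"
    proof
      fix w
      define B where "B u \<longleftrightarrow> restrict u V = w \<and> (\<forall>k\<in>pos K. blk (u k) = \<epsilon> k)" for u :: "nat \<Rightarrow> nat"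
      define T where "T u = chain (K @ C) u (u \<circ> \<sigma>) (f (restrict (u \<circ> \<sigma>) V))" for u
      have "(\<Sum>\<eta>\<in>?H. perm_op (K @ C) \<sigma> (\<lambda>k. if k \<in> set C then \<eta> k else \<epsilon> k) f) w
        = (\<Sum>\<eta>\<in>?H. perm_op (K @ C) \<sigma> (\<lambda>k. if k \<in> set C then \<eta> k else \<epsilon> k) f w)"
        using finH by (induction rule: finite_induct) auto
      also have "\<dots> = (\<Sum>\<eta>\<in>?H. \<Sum>u\<in>index_set N ?S. if \<eta> = restrict (blk \<circ> u) (set C) then if B u then T u else 0 else 0)"
      proof (rule sum.cong[OF refl])
        fix \<eta> assume \<eta>: "\<eta> \<in> ?H"
        have "(restrict u V = w \<and> (\<forall>k\<in>?S. blk (u k) = (if k \<in> set C then \<eta> k else \<epsilon> k))) \<longleftrightarrow>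
            \<eta> = restrict (blk \<circ> u) (set C) \<and> B u" for u
        proof -
          have "(\<forall>k\<in>?S. blk (u k) = (if k \<in> set C then \<eta> k else \<epsilon> k)) \<longleftrightarrow>
             (\<forall>k\<in>set C. blk (u k) = \<eta> k) \<and> (\<forall>k\<in>pos K. blk (u k) = \<epsilon> k)"
          proof -
            have "(\<forall>k\<in>pos K. blk (u k) = (if k \<in> set C then \<eta> k else \<epsilon> k)) \<longleftrightarrow> (\<forall>k\<in>pos K. blk (u k) = \<epsilon> k)"
              by (rule ball_cong[OF refl]) (use pos(2) in auto)
            moreover have "(\<forall>k\<in>set C. blk (u k) = (if k \<in> set C then \<eta> k else \<epsilon> k)) \<longleftrightarrow> (\<forall>k\<in>set C. blk (u k) = \<eta> k)"
              by (rule ball_cong[OF refl]) simp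
            ultimately show ?thesis unfolding pos(1) ball_Un by (simp only: conj_commute)
          qed
          moreover have "(\<forall>k\<in>set C. blk (u k) = \<eta> k) \<longleftrightarrow> \<eta> = restrict (blk \<circ> u) (set C)"
            using \<eta> by (auto simp: fun_eq_iff PiE_iff extensional_def)
          ultimately show ?thesis unfolding B_def by blast
        qed
        then show "perm_op (K @ C) \<sigma> (\<lambda>k. if k \<in> set C then \<eta> k else \<epsilon> k) f w
           = (\<Sum>u\<in>index_set N ?S. if \<eta> = restrict (blk \<circ> u) (set C) then if B u then T u else 0 else 0)"
          unfolding perm_op_def T_def by (simp only:) (rule sum.cong[OF refl], auto)
      qed
      also have "\<dots> = (\<Sum>u\<in>index_set N ?S. if B u then T u else 0)"
        by (subst sum.swap) (rule sum.cong[OF refl], use finH in simp)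
      \<comment> \<open>As \<open>\<sigma>\<close> preserves \<open>C\<close> and its complement,
        the two parts of the word depend on disjoint sets of labels.\<close>
      also have "\<dots> = (\<Sum>u\<in>index_set N (pos K). \<Sum>v\<in>index_set N (set C).
          if B u then chain K u (u \<circ> ?\<tau>) (chain C v (v \<circ> \<sigma>) (f (restrict (u \<circ> ?\<tau>) V))) else 0)"
        unfolding pos(1) sum_index_set_union[OF pos(2)]
      proof (rule sum.cong[OF refl], rule sum.cong[OF refl])
        fix u v :: "nat \<Rightarrow> nat"
        let ?u = "\<lambda>k. if k \<in> set C then v k else u k"
        have V: "k \<notin> set C" if "k \<in> V \<or> k \<in> set K \<or> k \<in> pos K" for k using that dis pos by auto
        have "B ?u \<longleftrightarrow> B u"
          unfolding B_def using V by (auto simp: restrict_def fun_eq_iff)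
        moreover have "T ?u = chain K u (u \<circ> ?\<tau>) (chain C v (v \<circ> \<sigma>) (f (restrict (u \<circ> ?\<tau>) V)))"
        proof -
          have 1: "restrict (?u \<circ> \<sigma>) V = restrict (u \<circ> ?\<tau>) V"
            by (intro restrict_ext) (use V \<sigma>nC in auto)
          have 2: "chain K ?u (?u \<circ> \<sigma>) m = chain K u (u \<circ> ?\<tau>) m" for m
            by (rule chain_cong) (use V \<sigma>nC in auto)
          have 3: "chain C ?u (?u \<circ> \<sigma>) m = chain C v (v \<circ> \<sigma>) m" for m
            by (rule chain_cong) (use \<sigma>C in auto)
          show ?thesis unfolding T_def chain_append 1 2 3 ..
        qed
        ultimately show "(if B ?u then T ?u else 0) =
          (if B u then chain K u (u \<circ> ?\<tau>) (chain C v (v \<circ> \<sigma>) (f (restrict (u \<circ> ?\<tau>) V))) else 0)" by simp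
      qed
      also have "\<dots> = (\<Sum>u\<in>index_set N (pos K). scale c (if B u then chain K u (u \<circ> ?\<tau>) (f (restrict (u \<circ> ?\<tau>) V)) else 0))"
      proof (rule sum.cong[OF refl])
        fix u assume u: "u \<in> index_set N (pos K)"
        have "bounded_on (set K) (u \<circ> ?\<tau>)"
          unfolding bounded_on_def
        proof
          fix k assume k: "k \<in> set K"
          then have nC: "k \<notin> set C" using dis by auto
          have "\<sigma> k \<in> ?S" using k permutes_in_image[OF \<sigma>] by (simp add: pos_def)
          then have "\<sigma> k \<in> pos K" using \<sigma>nC[OF nC] pos by auto
          then show "(u \<circ> ?\<tau>) k < N" using nC index_set_lt[OF u] by simp
        qed
        then show "(\<Sum>v\<in>index_set N (set C). if B u then chain K u (u \<circ> ?\<tau>) (chain C v (v \<circ> \<sigma>) (f (restrict (u \<circ> ?\<tau>) V))) else 0)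
          = scale c (if B u then chain K u (u \<circ> ?\<tau>) (f (restrict (u \<circ> ?\<tau>) V)) else 0)"
          using bounded_on_pos[OF u] sumC by (cases "B u") (simp_all flip: chain_linear(2,5))
      qed
      also have "\<dots> = tscale scale c (perm_op K ?\<tau> \<epsilon> f) w"
        unfolding tscale_def perm_op_def B_def by (simp only: scale_sum_right)
      finally show "(\<Sum>\<eta>\<in>?H. perm_op (K @ C) \<sigma> (\<lambda>k. if k \<in> set C then \<eta> k else \<epsilon> k) f) w = tscale scale c (perm_op K ?\<tau> \<epsilon> f) w" .
    qed
  qed
qed

end

context stable_subspace
begin

lemma double_in_W: "f + f \<in> W \<Longrightarrow> f \<in> W"
proof -
  assume "f + f \<in> W"
  then have "tscale scale (1/2) (f + f) \<in> W" by (rule W_simps)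
  moreover have "tscale scale (1/2) (f + f) = f"
    by (simp add: tscale_def fun_eq_iff scale_right_distrib flip: scale_left_distrib)
  ultimately show "f \<in> W" by simp
qed

text \<open>One cycle \<open>C\<close> of letters is moved to the right end. A labelling of
  \<open>C\<close> other than the two alternating ones contains a block diagonal letter. Rotating
  the cycle by one step exchanges the alternating ones and only reorders letters, so their
  difference lies in \<open>W\<close>, as does their sum.\<close>

lemma perm_op_cycle_absorbed:
  assumes IH: "\<And>L. length L < length K \<Longrightarrow> absorbed L" and K: "positions K"
    and \<sigma>: "\<sigma> permutes pos K" and f: "f \<in> W" and KV: "\<sigma> ` V \<subseteq> V" and ne: "K \<noteq> []"
    and alt: "\<And>k. k \<in> set K \<Longrightarrow> \<epsilon> (\<sigma> k) \<noteq> \<epsilon> k"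
  shows "perm_op K \<sigma> \<epsilon> f \<in> W"
proof -
  have finS: "finite (pos K)" by (simp add: pos_def finite_V)
  have perm: "permutation \<sigma>" using \<sigma> finS permutation_permutes by blast
  have inj: "inj \<sigma>" by (rule permutes_inj[OF \<sigma>])
  have "\<sigma> ` V = V" using KV finite_V inj by (intro endo_inj_surj) (auto intro: inj_on_subset)
  have \<sigma>K: "\<sigma> k \<in> set K" if k: "k \<in> set K" for k
  proof -
    have "k \<notin> V" using K k by (auto simp: positions_def)
    then have "\<sigma> k \<notin> V" using \<open>\<sigma> ` V = V\<close> inj by (metis imageE injD)
    moreover have "\<sigma> k \<in> pos K" using k permutes_in_image[OF \<sigma>] by (simp add: pos_def)
    ultimately show ?thesis by (simp add: pos_def)
  qed
  define z where "z = hd K"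
  have z: "z \<in> set K" using ne by (simp add: z_def)
  define m where "m = least_power \<sigma> z"
  have m: "(\<sigma> ^^ m) z = z" "m > 0" unfolding m_def using least_power_of_permutation[OF perm] by auto
  define C where "C = support \<sigma> z"
  have C: "distinct C" "length C = m" "\<And>i. i < m \<Longrightarrow> C ! i = (\<sigma> ^^ i) z"
    using cycle_of_permutation[OF perm, of z] by (simp_all add: C_def m_def)
  have setC: "set C = range (\<lambda>i. (\<sigma> ^^ i) z)" unfolding C_def by (rule support_set[OF perm])
  have CK: "set C \<subseteq> set K"
  proof -
    have "(\<sigma> ^^ i) z \<in> set K" for i by (induction i) (use z \<sigma>K in auto)
    then show ?thesis unfolding setC by auto
  qed
  have \<sigma>C: "\<sigma> k \<in> set C" if "k \<in> set C" for k
  proof -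
    have "\<sigma> ((\<sigma> ^^ i) z) = (\<sigma> ^^ Suc i) z" for i by simp
    then show ?thesis using that unfolding setC by blast
  qed
  have C_ne: "C \<noteq> []" using C(2) m(2) by auto
  have cyc1: "\<sigma> (C ! i) = C ! Suc i" if "Suc i < length C" for i using that C by simp
  have cyc2: "\<sigma> (last C) = hd C"
  proof -
    have "last C = (\<sigma> ^^ (m - 1)) z" using C C_ne m by (simp add: last_conv_nth)
    then have "\<sigma> (last C) = (\<sigma> ^^ (Suc (m - 1))) z" by simp
    also have "\<dots> = hd C" using C C_ne m by (simp add: hd_conv_nth)
    finally show ?thesis .
  qed
  define K0 where "K0 = filter (\<lambda>k. k \<notin> set C) K"
  have mK: "mset (K0 @ C) = mset K"
  proof -
    have "distinct (K0 @ C)" using K C(1) by (auto simp: K0_def positions_def)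
    moreover have "set (K0 @ C) = set K" using CK by (auto simp: K0_def)
    ultimately show ?thesis using K set_eq_iff_mset_eq_distinct[of "K0 @ C" K] by (simp add: positions_def)
  qed
  let ?L = "K0 @ C"
  have P: "positions ?L" by (rule positions_mset[OF mK K])
  have pos: "pos ?L = pos K" by (rule pos_mset[OF mK])
  have \<sigma>L: "\<sigma> permutes pos ?L" using \<sigma> pos by simp
  have len: "length ?L = length K" using mK by (metis size_mset)
  have IHL: "absorbed L" if "length L < length ?L" for L using that len IH by simp
  have len0: "length K0 < length K" using len C_ne by (cases C) auto
  have P0: "positions K0" using P by (auto simp: positions_def)
  have dis: "set K0 \<inter> set C = {}" "V \<inter> set C = {}" "set K = set K0 \<union> set C"
    using K CK by (auto simp: K0_def positions_def)
  have \<sigma>nC: "\<sigma> k \<notin> set C" if "k \<notin> set C" for k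
  proof -
    have "\<sigma> ` set C = set C"
      using \<sigma>C inj by (intro endo_inj_surj) (auto intro: inj_on_subset)
    then show ?thesis using that inj by (metis imageE injD)
  qed
  let ?ov = "\<lambda>\<eta> k. if k \<in> set C then \<eta> k else \<epsilon> k"
  let ?\<tau> = "\<lambda>k. if k \<in> set C then k else \<sigma> k"
  have \<tau>: "?\<tau> permutes pos K0"
  proof (rule bij_imp_permutes)
    have sub: "?\<tau> ` pos K0 \<subseteq> pos K0"
    proof
      fix y assume "y \<in> ?\<tau> ` pos K0"
      then obtain x where x: "x \<in> pos K0" "y = ?\<tau> x" by blast
      then have "x \<notin> set C" using dis by (auto simp: pos_def)
      then have "y \<notin> set C" "y = \<sigma> x" using x \<sigma>nC by auto
      moreover have "x \<in> pos K" using x(1) dis by (auto simp: pos_def)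
      then have "\<sigma> x \<in> pos K" using permutes_in_image[OF \<sigma>] by blast
      ultimately show "y \<in> pos K0" using dis by (auto simp: pos_def)
    qed
    have inj\<tau>: "inj_on ?\<tau> (pos K0)"
    proof (rule inj_onI)
      fix x y assume xy: "x \<in> pos K0" "y \<in> pos K0" "?\<tau> x = ?\<tau> y"
      then have "x \<notin> set C" "y \<notin> set C" using dis by (auto simp: pos_def)
      with xy(3) have "\<sigma> x = \<sigma> y" by simp
      then show "x = y" by (rule injD[OF inj])
    qed
    show "bij_betw ?\<tau> (pos K0) (pos K0)"
      unfolding bij_betw_def using inj\<tau> endo_inj_surj[OF _ sub inj\<tau>] by (simp add: pos_def finite_V)
    show "?\<tau> x = x" if "x \<notin> pos K0" for x
      using that permutes_not_in[OF \<sigma>, of x] dis by (auto simp: pos_def)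
  qed
  obtain c where c: "\<And>\<epsilon> f. (\<Sum>\<eta>\<in>set C \<rightarrow>\<^sub>E UNIV. perm_op ?L \<sigma> (\<lambda>k. if k \<in> set C then \<eta> k else \<epsilon> k) f)
    = tscale scale c (perm_op K0 ?\<tau> \<epsilon> f)"
    using sum_labels_cycle[OF P \<sigma>L C_ne cyc1 cyc2] by blast
  let ?H = "set C \<rightarrow>\<^sub>E (UNIV :: bool set)"
  let ?F = "\<lambda>\<eta>. perm_op ?L \<sigma> (?ov \<eta>) f"
  \<comment> \<open>The given labelling of the cycle; \<open>e2\<close> is its opposite.\<close>
  define e1 where "e1 = restrict \<epsilon> (set C)"
  define e2 where "e2 = restrict (\<lambda>k. \<not> \<epsilon> k) (set C)"
  have finH: "finite ?H" by (intro finite_PiE) auto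
  have total: "(\<Sum>\<eta>\<in>?H. ?F \<eta>) \<in> W"
    unfolding c by (intro W_simps absorbedD[OF IH[OF len0] P0 f \<tau>])
  have other: "?F \<eta> \<in> W" if \<eta>: "\<eta> \<in> ?H" "\<eta> \<noteq> e1" "\<eta> \<noteq> e2" for \<eta>
  proof -
    have "\<exists>k\<in>set C. \<eta> k = \<eta> (\<sigma> k)"
    proof (rule ccontr)
      assume "\<not> ?thesis"
      then have flip: "\<eta> (\<sigma> k) = (\<not> \<eta> k)" if "k \<in> set C" for k using that by blast
      \<comment> \<open>Both labellings flip at every step along the cycle, so agreement or
        disagreement at \<open>z\<close> spreads to all of \<open>C\<close>.\<close>
      have same: "(\<eta> ((\<sigma> ^^ i) z) = \<epsilon> ((\<sigma> ^^ i) z)) = (\<eta> z = \<epsilon> z)" for i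
      proof (induction i)
        case (Suc i)
        have "(\<sigma> ^^ i) z \<in> set C" unfolding setC by blast
        then have "\<eta> (\<sigma> ((\<sigma> ^^ i) z)) = (\<not> \<eta> ((\<sigma> ^^ i) z))" "\<epsilon> (\<sigma> ((\<sigma> ^^ i) z)) = (\<not> \<epsilon> ((\<sigma> ^^ i) z))"
          using flip alt CK by blast+
        with Suc show ?case by auto
      qed simp
      have all: "(\<eta> k = \<epsilon> k) = (\<eta> z = \<epsilon> z)" if "k \<in> set C" for k
        using that same unfolding setC by auto
      have "\<eta> = e1 \<or> \<eta> = e2"
      proof (cases "\<eta> z = \<epsilon> z")
        case True
        then have "\<eta> = e1" unfolding e1_def using all \<eta>(1) by (intro ext) (auto simp: PiE_iff extensional_def)
        then show ?thesis ..
      next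
        case False
        then have "\<eta> = e2" unfolding e2_def using all \<eta>(1) by (intro ext) (auto simp: PiE_iff extensional_def)
        then show ?thesis ..
      qed
      with \<eta> show False by blast
    qed
    then obtain k where k: "k \<in> set C" "\<eta> k = \<eta> (\<sigma> k)" by blast
    show ?thesis
      by (rule perm_op_diagonal_absorbed[OF IHL P \<sigma>L f, of k]) (use k \<sigma>C in auto)
  qed
  have e12: "e1 \<in> ?H" "e2 \<in> ?H" "e1 \<noteq> e2"
  proof -
    show "e1 \<in> ?H" "e2 \<in> ?H" by (auto simp: e1_def e2_def)
    have "z \<in> set C" unfolding setC by (rule range_eqI[of _ _ 0]) simp
    then have "e1 z \<noteq> e2 z" by (simp add: e1_def e2_def)
    then show "e1 \<noteq> e2" by metis
  qed
  have split: "(\<Sum>\<eta>\<in>?H. ?F \<eta>) = ?F e1 + (?F e2 + (\<Sum>\<eta>\<in>?H - {e1} - {e2}. ?F \<eta>))"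
  proof -
    have "(\<Sum>\<eta>\<in>?H. ?F \<eta>) = ?F e1 + (\<Sum>\<eta>\<in>?H - {e1}. ?F \<eta>)" by (rule sum.remove[OF finH e12(1)])
    also have "(\<Sum>\<eta>\<in>?H - {e1}. ?F \<eta>) = ?F e2 + (\<Sum>\<eta>\<in>?H - {e1} - {e2}. ?F \<eta>)"
      by (rule sum.remove) (use finH e12 in auto)
    finally show ?thesis .
  qed
  have rest: "(\<Sum>\<eta>\<in>?H - {e1} - {e2}. ?F \<eta>) \<in> W" by (intro W_simps other) auto
  have F1: "?F e1 = perm_op ?L \<sigma> \<epsilon> f" by (rule perm_op_cong) (simp add: e1_def)
  \<comment> \<open>The rotation of \<open>C\<close>, extended by the identity. It commutes with
    \<open>\<sigma>\<close> and, the labels being alternating, turns the opposite labelling into the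
    given one.\<close>
  define \<pi> where "\<pi> = (\<lambda>k. if k \<in> set C then \<sigma> k else k)"
  have \<pi>: "\<pi> permutes set C"
  proof (rule bij_imp_permutes)
    have "inj_on \<pi> (set C)"
    proof (rule inj_onI)
      fix x y assume "x \<in> set C" "y \<in> set C" "\<pi> x = \<pi> y"
      then have "\<sigma> x = \<sigma> y" by (simp add: \<pi>_def)
      then show "x = y" by (rule injD[OF inj])
    qed
    moreover have "\<pi> ` set C \<subseteq> set C" using \<sigma>C by (auto simp: \<pi>_def)
    ultimately show "bij_betw \<pi> (set C) (set C)"
      unfolding bij_betw_def using endo_inj_surj[of "set C" \<pi>] by simp
  qed (simp add: \<pi>_def)
  have \<pi>L: "\<pi> permutes set ?L" by (rule permutes_subset[OF \<pi>]) auto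
  have comm: "\<pi> \<circ> \<sigma> = \<sigma> \<circ> \<pi>" using \<sigma>C \<sigma>nC by (auto simp: \<pi>_def fun_eq_iff)
  have "perm_op (map \<pi> ?L) \<sigma> (?ov e2) f = perm_op ?L \<sigma> (?ov e2 \<circ> \<pi>) f"
    by (rule ext) (rule perm_op_rename[OF \<pi>L _ comm], use P in \<open>simp add: positions_def\<close>)
  also have "\<dots> = perm_op ?L \<sigma> \<epsilon> f"
  proof (rule perm_op_cong)
    fix k
    show "(?ov e2 \<circ> \<pi>) k = \<epsilon> k"
    proof (cases "k \<in> set C")
      case True
      then have "\<epsilon> (\<sigma> k) = (\<not> \<epsilon> k)" using alt CK by blast
      then show ?thesis using True \<sigma>C[OF True] by (simp add: \<pi>_def e2_def)
    qed (simp add: \<pi>_def)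
  qed
  finally have ren: "perm_op (map \<pi> ?L) \<sigma> (?ov e2) f = perm_op ?L \<sigma> \<epsilon> f" .
  have "mset (map \<pi> ?L) = mset ?L"
  proof -
    have dL: "distinct ?L" using P by (simp only: positions_def)
    then have "distinct (map \<pi> ?L)" using permutes_inj_on[OF \<pi>L] by (simp only: distinct_map)
    moreover have "set (map \<pi> ?L) = set ?L" using permutes_image[OF \<pi>L] by (simp only: set_map)
    ultimately show ?thesis using set_eq_iff_mset_eq_distinct[OF _ dL] by blast
  qed
  from perm_op_reorder[OF IHL P \<sigma>L f this, of "?ov e2"]
  have d: "perm_op ?L \<sigma> \<epsilon> f - ?F e2 \<in> W" unfolding ren .
  have "?F e1 + ?F e2 = (\<Sum>\<eta>\<in>?H. ?F \<eta>) - (\<Sum>\<eta>\<in>?H - {e1} - {e2}. ?F \<eta>)"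
    unfolding split by (simp only: algebra_simps)
  then have "?F e1 + ?F e2 \<in> W" using W_simps(2)[OF total rest] by simp
  then have s: "perm_op ?L \<sigma> \<epsilon> f + ?F e2 \<in> W" unfolding F1 .
  \<comment> \<open>Adding the sum and the difference of the two alternating words leaves twice one
    of them.\<close>
  have AB: "A + B + (A - B) = A + A" for A B :: "'a tensor" by simp
  have "perm_op ?L \<sigma> \<epsilon> f + perm_op ?L \<sigma> \<epsilon> f \<in> W"
    using W_simps(1)[OF s d] unfolding AB .
  then have fin: "perm_op ?L \<sigma> \<epsilon> f \<in> W" by (rule double_in_W)
  show ?thesis by (rule perm_op_reorder_iff[OF IH K \<sigma> f mK fin])
qed

text \<open>Without letters a word is a permutation of the factors followed by a block
  projection.\<close>

lemma absorbed_Nil: "absorbed []"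
  unfolding absorbed_def
proof (intro impI allI ballI)
  fix \<sigma> \<epsilon> f assume f: "f \<in> W" and \<sigma>: "\<sigma> permutes pos []"
  have pos: "pos [] = V" by (simp add: pos_def)
  have s: "f \<in> supported MI" using f W_invariants by (auto simp: invariants_def)
  have "perm_op [] \<sigma> \<epsilon> f = (\<lambda>w. if \<forall>k\<in>V. blk (w k) = \<epsilon> k then f (w \<circ> \<sigma>) else 0)"
  proof
    fix w
    have r: "restrict u V = u" if "u \<in> MI" for u
      using that by (auto simp: index_set_def PiE_iff extensional_def fun_eq_iff)
    have \<sigma>V: "\<sigma> permutes V" using \<sigma> pos by simp
    have "perm_op [] \<sigma> \<epsilon> f w = (\<Sum>u\<in>MI. if u = w then if \<forall>k\<in>V. blk (w k) = \<epsilon> k then f (w \<circ> \<sigma>) else 0 else 0)"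
      unfolding perm_op_def pos using r index_set_comp_permutes[OF _ \<sigma>V] by (intro sum.cong refl) auto
    also have "\<dots> = (if w \<in> MI then if \<forall>k\<in>V. blk (w k) = \<epsilon> k then f (w \<circ> \<sigma>) else 0 else 0)"
      by (simp add: finite_index_set finite_V)
    also have "\<dots> = (if \<forall>k\<in>V. blk (w k) = \<epsilon> k then f (w \<circ> \<sigma>) else 0)"
      using s index_set_comp_permutes_iff[OF \<sigma>V, of w N] by (auto simp: supported_def)
    finally show "perm_op [] \<sigma> \<epsilon> f w = (if \<forall>k\<in>V. blk (w k) = \<epsilon> k then f (w \<circ> \<sigma>) else 0)" .
  qed
  also have "\<dots> \<in> W" using W_blk[OF W_perm[OF f, of \<sigma>], of \<epsilon>] \<sigma> pos by simp
  finally show "perm_op [] \<sigma> \<epsilon> f \<in> W" .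
qed

text \<open>Once every letter changes its block label and no factor leads into a letter,
  \<open>\<sigma>\<close> maps the factors to themselves, so the letters form closed cycles.\<close>

theorem absorbed_all: "absorbed K"
proof (induction K rule: length_induct)
  case (1 K)
  then have IH: "absorbed L" if "length L < length K" for L using that by blast
  show ?case
  proof (cases "K = []")
    case True
    then show ?thesis using absorbed_Nil by simp
  next
    case ne: False
    show ?thesis
      unfolding absorbed_def
    proof (intro impI allI ballI)
      fix \<sigma> \<epsilon> f assume K: "positions K" and f: "f \<in> W" and \<sigma>: "\<sigma> permutes pos K"
      show "perm_op K \<sigma> \<epsilon> f \<in> W"
      proof (cases "\<exists>k\<in>set K. \<epsilon> k = \<epsilon> (\<sigma> k)")
        case True
        then show ?thesis using perm_op_diagonal_absorbed[OF IH K \<sigma> f] by blast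
      next
        case alt: False
        show ?thesis
        proof (cases "\<exists>r\<in>V. \<sigma> r \<in> set K")
          case True
          then show ?thesis using perm_op_path_absorbed[OF IH K \<sigma> f] alt by blast
        next
          case False
          have "\<sigma> ` V \<subseteq> V"
          proof
            fix y assume "y \<in> \<sigma> ` V"
            then obtain r where r: "r \<in> V" "y = \<sigma> r" by blast
            then have "y \<in> pos K" using permutes_in_image[OF \<sigma>] by (simp add: pos_def)
            then show "y \<in> V" using False r by (auto simp: pos_def)
          qed
          moreover have "\<epsilon> (\<sigma> k) \<noteq> \<epsilon> k" if "k \<in> set K" for k using alt that by metis
          ultimately show ?thesis by (intro perm_op_cycle_absorbed[OF IH K \<sigma> f _ ne])
        qed
      qed
    qed
  qed
qed

theorem stable_subspace_trivial: "W = {0} \<or> W = invariants"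
proof (rule disjCI)
  assume "W \<noteq> invariants"
  show "W = {0}"
  proof (rule ccontr)
    assume "W \<noteq> {0}"
    then obtain g where g: "g \<in> W" "g \<noteq> 0" using W_simps(4) by blast
    have "f \<in> W" if f: "f \<in> invariants" for f
    proof -
      obtain d c where c: "c \<in> cfun.span (ps.perm_kers (edges d))" "f = ker_op (edges d) c g"
        using invariants_reached_by_invariant_kernel[of g f] g f W_invariants by blast
      have "ker_op (edges d) c g \<in> W"
        using c(1)
      proof (induction rule: cfun.span_induct_alt)
        case base
        show ?case by (simp only: ker_op_linear W_simps)
      next
        case (step t x y)
        obtain \<sigma> \<epsilon> where x: "x = ps.perm_ker (edges d) \<sigma> \<epsilon>" "\<sigma> permutes pos (edges d)"
          using step(1) unfolding ps.perm_kers_def by blast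
        have "ker_op (edges d) x g \<in> W"
          unfolding x(1) ker_op_perm_ker[OF x(2)] by (rule absorbedD[OF absorbed_all positions_edges g(1) x(2)])
        then show ?case using step(2) by (simp only: ker_op_linear W_simps)
      qed
      then show ?thesis unfolding c(2) .
    qed
    with W_invariants \<open>W \<noteq> invariants\<close> show False by blast
  qed
qed

end

section \<open>The relations of the degenerate affine Hecke algebra of type BC\<close>

context gl_family
begin

definition sg :: "bool \<Rightarrow> complex" where "sg b = (if b then 1 else - 1)"

definition permute :: "(nat \<Rightarrow> nat) \<Rightarrow> 'm tensor \<Rightarrow> 'm tensor" where
  "permute \<sigma> f = (\<lambda>w. f (w \<circ> \<sigma>))"

definition weight :: "((nat \<Rightarrow> bool) \<Rightarrow> complex) \<Rightarrow> 'm tensor \<Rightarrow> 'm tensor" where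
  "weight q f = (\<lambda>w. scale (q (\<lambda>k. blk (w k))) (f w))"

definition gam :: "nat \<Rightarrow> 'm tensor \<Rightarrow> 'm tensor" where
  "gam j = weight (\<lambda>e. sg (e j))"

text \<open>With s_jl the exchange, \<open>same_swap\<close> is s_jl (1 + gamma_j gamma_l)/2 and
  \<open>opp_swap\<close> is s_jl (1 - gamma_j gamma_l)/2.\<close>

definition same_swap :: "nat \<Rightarrow> nat \<Rightarrow> 'm tensor \<Rightarrow> 'm tensor" where
  "same_swap j l f = (\<lambda>w. if blk (w j) = blk (w l) then f (w \<circ> transpose j l) else 0)"

definition opp_swap :: "nat \<Rightarrow> nat \<Rightarrow> 'm tensor \<Rightarrow> 'm tensor" where
  "opp_swap j l f = (\<lambda>w. if blk (w j) \<noteq> blk (w l) then f (w \<circ> transpose j l) else 0)"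

text \<open>Closed form of y_j. In y_1 the two sums over l combine to \<open>same_swap\<close>; each
  conjugation by s_i followed by subtraction of s_i turns one \<open>same_swap\<close> into the
  negative of an \<open>opp_swap\<close>, whence the terms with l < j.\<close>

definition Y :: "complex \<Rightarrow> nat \<Rightarrow> 'm tensor \<Rightarrow> 'm tensor" where
  "Y \<kappa> j f = (\<lambda>w. - hop j f w + scale (\<kappa> / 2) (gam j f w)
     + (\<Sum>l\<in>{j<..n}. same_swap j l f w) - (\<Sum>l\<in>{1..<j}. opp_swap j l f w))"

lemma in_V: "k \<in> V \<longleftrightarrow> 1 \<le> k \<and> k \<le> n" by (auto simp: V_def)

lemma MI_lt: "w \<in> MI \<Longrightarrow> k \<in> V \<Longrightarrow> w k < N" by (rule index_set_lt)

lemma MI_transpose_iff: "j \<in> V \<Longrightarrow> l \<in> V \<Longrightarrow> w \<circ> transpose j l \<in> MI \<longleftrightarrow> w \<in> MI"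
  by (rule index_set_comp_permutes_iff) (rule permutes_swap_id)

lemma hop_outside: "w \<notin> MI \<Longrightarrow> hop r f w = 0" by (simp add: hop_def)

lemma hop_permute:
  assumes "\<sigma> permutes V"
  shows "hop r f (w \<circ> \<sigma>) = hop (\<sigma> r) (permute \<sigma> f) w"
proof -
  have "(w \<circ> \<sigma>)(r := s) = w(\<sigma> r := s) \<circ> \<sigma>" for s
    using permutes_inj[OF assms] by (auto simp: fun_eq_iff inj_eq)
  then show ?thesis
    using index_set_comp_permutes_iff[OF assms, of w N] by (simp add: hop_def permute_def cong: if_cong)
qed

text \<open>\<open>hop r\<close> changes the block label of factor \<open>r\<close> and of no other,
  so a weight passes through it with that one label negated.\<close>

lemma hop_weight:
  assumes "r \<in> V"
  shows "hop r (weight q f) = weight (\<lambda>e. q (e(r := \<not> e r))) (hop r f)"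
proof
  fix w
  show "hop r (weight q f) w = weight (\<lambda>e. q (e(r := \<not> e r))) (hop r f) w"
  proof (cases "w \<in> MI")
    case True
    have wr: "w r < N" using True assms by (rule MI_lt)
    have "(if blk s \<noteq> blk (w r) then E s (w r) (weight q f (w(r := s))) else 0) =
       scale (q ((\<lambda>k. blk (w k))(r := \<not> blk (w r)))) (if blk s \<noteq> blk (w r) then E s (w r) (f (w(r := s))) else 0)"
      if "s < N" for s
    proof (cases "blk s \<noteq> blk (w r)")
      case b: True
      then have "(\<lambda>k. blk ((w(r := s)) k)) = (\<lambda>k. blk (w k))(r := \<not> blk (w r))"
        by (auto simp: fun_eq_iff)
      with b wr \<open>s < N\<close> show ?thesis by (simp add: weight_def E_scale)
    qed simp
    then show ?thesis using True unfolding hop_def weight_def scale_sum_right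
      by (simp add: scale_sum_right)
  qed (simp add: hop_outside weight_def)
qed

text \<open>Linearity in the exact shape of \<open>Y\<close>, so that a product of two
  \<open>Y\<close> expands by rewriting. The lemmas for the swaps and \<open>gam\<close> have the
  same shape for this reason.\<close>

lemma hop_combination:
  assumes "r \<in> V"
  shows "hop r (\<lambda>w. - a w + scale t (b w) + (\<Sum>l\<in>L. c l w) - (\<Sum>l\<in>L'. d l w)) w
    = - hop r a w + scale t (hop r b w) + (\<Sum>l\<in>L. hop r (c l) w) - (\<Sum>l\<in>L'. hop r (d l) w)"
proof (cases "w \<in> MI")
  case True
  have wr: "w r < N" using True assms by (rule MI_lt)
  have E_minus: "E s (w r) (- x) = - E s (w r) x" if "s < N" for s x
    using E_diff[OF that wr, of 0 x] E_zero[OF that wr] by simp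
  let ?P = "\<lambda>s x. if blk s \<noteq> blk (w r) then E s (w r) x else 0"
  have "hop r (\<lambda>w. - a w + scale t (b w) + (\<Sum>l\<in>L. c l w) - (\<Sum>l\<in>L'. d l w)) w =
    (\<Sum>s<N. - ?P s (a (w(r := s))) + scale t (?P s (b (w(r := s)))) + (\<Sum>l\<in>L. ?P s (c l (w(r := s)))) - (\<Sum>l\<in>L'. ?P s (d l (w(r := s)))))"
    unfolding hop_def using True by (auto simp: E_add E_diff E_minus E_scale E_sum wr intro!: sum.cong)
  then show ?thesis using True
    by (simp add: hop_def sum.distrib sum_subtractf sum_negf scale_sum_right sum.swap[of _ "{..<N}"])
qed (simp add: hop_outside)

lemma same_swap_combination:
  "same_swap i k (\<lambda>w. - a w + scale t (b w) + (\<Sum>l\<in>L. c l w) - (\<Sum>l\<in>L'. d l w)) w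
    = - same_swap i k a w + scale t (same_swap i k b w) + (\<Sum>l\<in>L. same_swap i k (c l) w) - (\<Sum>l\<in>L'. same_swap i k (d l) w)"
  by (simp add: same_swap_def)

lemma opp_swap_combination:
  "opp_swap i k (\<lambda>w. - a w + scale t (b w) + (\<Sum>l\<in>L. c l w) - (\<Sum>l\<in>L'. d l w)) w
    = - opp_swap i k a w + scale t (opp_swap i k b w) + (\<Sum>l\<in>L. opp_swap i k (c l) w) - (\<Sum>l\<in>L'. opp_swap i k (d l) w)"
  by (simp add: opp_swap_def)

lemma gam_combination:
  "gam i (\<lambda>w. - a w + scale t (b w) + (\<Sum>l\<in>L. c l w) - (\<Sum>l\<in>L'. d l w)) w
    = - gam i a w + scale t (gam i b w) + (\<Sum>l\<in>L. gam i (c l) w) - (\<Sum>l\<in>L'. gam i (d l) w)"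
  by (simp add: gam_def weight_def scale_right_distrib scale_right_diff_distrib scale_sum_right scale_left_commute)

lemma hop_gam: "r \<in> V \<Longrightarrow> hop r (gam j f) w = (if j = r then - gam j (hop r f) w else gam j (hop r f) w)"
  unfolding gam_def hop_weight by (simp add: weight_def sg_def)

lemma same_swap_eq: "same_swap j l f = weight (\<lambda>e. if e j = e l then 1 else 0) (permute (transpose j l) f)"
  by (auto simp: same_swap_def weight_def permute_def fun_eq_iff)

lemma opp_swap_eq: "opp_swap j l f = weight (\<lambda>e. if e j \<noteq> e l then 1 else 0) (permute (transpose j l) f)"
  by (auto simp: opp_swap_def weight_def permute_def fun_eq_iff)

lemma hop_permute_transpose:
  assumes "j \<in> V" "l \<in> V"
  shows "hop r (permute (transpose j l) f) = permute (transpose j l) (hop (transpose j l r) f)"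
  using hop_permute[OF permutes_swap_id[OF assms], of "transpose j l r" f] by (simp add: permute_def fun_eq_iff)

lemma hop_same_swap:
  assumes "r \<in> V" "j \<in> V" "l \<in> V" "r \<noteq> j" "r \<noteq> l"
  shows "hop r (same_swap j l f) = same_swap j l (hop r f)"
  using assms by (simp add: same_swap_eq hop_weight hop_permute_transpose)

text \<open>The swap carries \<open>hop\<close> from one factor to the other, and the change of one
  block label interchanges the conditions of equal and of different blocks.\<close>

lemma hop_opp_swap:
  assumes "j \<in> V" "l \<in> V" "j \<noteq> l"
  shows "hop j (opp_swap j l f) = same_swap j l (hop l f)" "hop l (same_swap j l f) = opp_swap j l (hop j f)"
  using assms by (simp_all add: same_swap_eq opp_swap_eq hop_weight hop_permute_transpose)

lemma Y_outside: "f \<in> supported MI \<Longrightarrow> j \<in> V \<Longrightarrow> w \<notin> MI \<Longrightarrow> Y \<kappa> j f w = 0"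
proof -
  assume f: "f \<in> supported MI" and j: "j \<in> V" and w: "w \<notin> MI"
  have f0: "f (w \<circ> transpose j l) = 0" if "l \<in> V" for l
    using f w MI_transpose_iff[OF j that] by (auto simp: supported_def)
  have "(\<Sum>l\<in>{j<..n}. same_swap j l f w) = 0" "(\<Sum>l\<in>{1..<j}. opp_swap j l f w) = 0"
    using f0 j by (auto simp: same_swap_def opp_swap_def in_V intro!: sum.neutral)
  then show ?thesis using f w by (simp add: Y_def hop_outside gam_def weight_def supported_def)
qed

lemma invariants_supported: "f \<in> invariants \<Longrightarrow> f \<in> supported MI"
  by (simp add: invariants_def)

lemma invariantsD:
  "f \<in> invariants \<Longrightarrow> a < N \<Longrightarrow> b < N \<Longrightarrow> blk a = blk b \<Longrightarrow> w \<in> MI \<Longrightarrow>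
    E a b (f w) = (if a = b then scale (cst (blk a)) (f w) else 0) - (\<Sum>k\<in>V. if w k = a then f (w(k := b)) else 0)"
  by (simp add: invariants_def)

lemma card_blk: "(\<Sum>s<N. if blk s = \<beta> then x else 0) = scale (of_nat (card {a. a < N \<and> blk a = \<beta>})) x"
proof -
  have "(\<Sum>s<N. if blk s = \<beta> then x else 0) = (\<Sum>s\<in>{s \<in> {..<N}. blk s = \<beta>}. x)"
    by (rule sum.inter_filter[symmetric]) simp
  then show ?thesis by (simp add: sum_constant_scale)
qed

text \<open>The product of two adjacent hops differs from the reverse product by the action of block
  diagonal matrix units, which invariance turns into swaps of tensor factors.\<close>

lemma hop_commutator:
  assumes f: "f \<in> invariants" and w: "w \<in> MI" and n: "2 \<le> n"
    and \<kappa>: "\<kappa> = cst False - cst True + of_nat (card {a. a < N \<and> blk a = True}) - of_nat (card {a. a < N \<and> blk a = False})"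
  shows "hop 1 (hop 2 f) w - hop 2 (hop 1 f) w = scale \<kappa> (gam 1 (opp_swap 1 2 f) w)
     - (\<Sum>k\<in>{3..n}. opp_swap 1 2 (same_swap 1 k f) w - same_swap 1 k (opp_swap 1 2 f) w)"
proof -
  note One_nat_def [simp del]
  let ?w1 = "w 1" and ?w2 = "w 2"
  let ?t = "w \<circ> transpose 1 2"
  have V12: "1 \<in> V" "2 \<in> V" using n by (auto simp: V_def)
  have lt: "?w1 < N" "?w2 < N" using w V12 by (auto intro: MI_lt)
  define g where "g s t = f (w(1 := s, 2 := t))" for s t
  have upd: "w(1 := s, 2 := t) \<in> MI" if "s < N" "t < N" for s t
    using w V12 that by (intro index_set_upd)
  have ifE: "E s a (if P then x else 0) = (if P then E s a x else 0)" if "s < N" "a < N" for s a P x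
    using that by (simp add: E_zero)
  have h12: "hop 1 (hop 2 f) w = (\<Sum>s<N. \<Sum>t<N. if blk s \<noteq> blk ?w1 \<and> blk t \<noteq> blk ?w2 then E s ?w1 (E t ?w2 (g s t)) else 0)"
  proof -
    have "hop 2 f (w(1 := s)) = (\<Sum>t<N. if blk t \<noteq> blk ?w2 then E t ?w2 (g s t) else 0)" if "s < N" for s
      using w V12 that index_set_upd[OF w V12(1) that] by (simp add: hop_def g_def cong: if_cong)
    then show ?thesis unfolding hop_def[of 1] if_P[OF w]
      by (intro sum.cong refl, case_tac "blk x \<noteq> blk ?w1") (use lt in \<open>simp_all add: E_sum ifE cong: if_cong\<close>)
  qed
  have h21: "hop 2 (hop 1 f) w = (\<Sum>s<N. \<Sum>t<N. if blk s \<noteq> blk ?w1 \<and> blk t \<noteq> blk ?w2 then E t ?w2 (E s ?w1 (g s t)) else 0)"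
  proof -
    have "hop 1 f (w(2 := t)) = (\<Sum>s<N. if blk s \<noteq> blk ?w1 then E s ?w1 (g s t) else 0)" if "t < N" for t
      using w V12 that index_set_upd[OF w V12(2) that] by (simp add: hop_def g_def fun_upd_twist[of 1 2] cong: if_cong)
    then have "hop 2 (hop 1 f) w = (\<Sum>t<N. \<Sum>s<N. if blk s \<noteq> blk ?w1 \<and> blk t \<noteq> blk ?w2 then E t ?w2 (E s ?w1 (g s t)) else 0)"
      unfolding hop_def[of 2] if_P[OF w]
      by (intro sum.cong refl, case_tac "blk x \<noteq> blk ?w2") (use lt in \<open>simp_all add: E_sum ifE cong: if_cong\<close>)
    then show ?thesis by (subst sum.swap)
  qed
  have comm: "hop 1 (hop 2 f) w - hop 2 (hop 1 f) w =
     (\<Sum>s<N. \<Sum>t<N. if blk s \<noteq> blk ?w1 \<and> blk t \<noteq> blk ?w2 then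
        (if ?w1 = t then E s ?w2 (g s t) else 0) - (if ?w2 = s then E t ?w1 (g s t) else 0) else 0)"
    unfolding h12 h21 sum_subtractf[symmetric]
    by (intro sum.cong refl) (use lt E_comm in auto)
  show ?thesis
  \<comment> \<open>For equal blocks the Kronecker deltas contradict the block conditions, and all
    swap terms vanish as well.\<close>
  proof (cases "blk ?w1 = blk ?w2")
    case True
    have "hop 1 (hop 2 f) w - hop 2 (hop 1 f) w = 0"
      unfolding comm using True by (intro sum.neutral ballI) auto
    moreover have "opp_swap 1 2 h w = 0" for h using True by (simp add: opp_swap_def)
    moreover have "same_swap 1 k (opp_swap 1 2 f) w = 0" if k: "k \<in> {3..n}" for k
      using True k by (auto simp: opp_swap_def same_swap_def transpose_def)
    ultimately show ?thesis by (simp add: gam_def weight_def)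
  next
    case opp: False
    have c1: "hop 1 (hop 2 f) w - hop 2 (hop 1 f) w =
      (\<Sum>s<N. if blk s = blk ?w2 then E s ?w2 (g s ?w1) else 0) - (\<Sum>t<N. if blk t = blk ?w1 then E t ?w1 (g ?w2 t) else 0)"
    proof -
      have "hop 1 (hop 2 f) w - hop 2 (hop 1 f) w =
        (\<Sum>s<N. \<Sum>t<N. if t = ?w1 then if blk s = blk ?w2 then E s ?w2 (g s ?w1) else 0 else 0)
        - (\<Sum>s<N. \<Sum>t<N. if s = ?w2 then if blk t = blk ?w1 then E t ?w1 (g ?w2 t) else 0 else 0)"
        unfolding comm sum_subtractf[symmetric] by (intro sum.cong refl) (use opp in auto)
      then show ?thesis using lt by (simp add: sum.swap[of "\<lambda>s t. if s = ?w2 then _ t else 0"])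
    qed
    have t: "?t = w(1 := ?w2, 2 := ?w1)" by (auto simp: fun_eq_iff transpose_def)
    \<comment> \<open>A block diagonal letter acting on an invariant tensor: the eigenvalue comes
      from equal indices, \<open>- f ?t\<close> from factor 1, the sum from the factors beyond
      2.\<close>
    have F1: "E s ?w2 (g s ?w1) = (if s = ?w2 then scale (cst (blk ?w2)) (f ?t) else 0) - f ?t
        - (\<Sum>k\<in>{3..n}. if w k = s then f (w(1 := w k, 2 := ?w1, k := ?w2)) else 0)"
      if s: "s < N" "blk s = blk ?w2" for s
    proof -
      let ?v = "w(1 := s, 2 := ?w1)"
      have V3: "V = insert 1 (insert 2 {3..n})" using n by (auto simp: V_def)
      have "(\<Sum>k\<in>V. if ?v k = s then f (?v(k := ?w2)) else 0) = f ?t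
        + (\<Sum>k\<in>{3..n}. if w k = s then f (w(1 := w k, 2 := ?w1, k := ?w2)) else 0)"
      proof -
        have "?w1 \<noteq> s" using s opp by auto
        moreover have "?v(1 := ?w2) = ?t" unfolding t by (auto simp: fun_eq_iff)
        moreover have "(\<Sum>k\<in>{3..n}. if ?v k = s then f (?v(k := ?w2)) else 0) =
           (\<Sum>k\<in>{3..n}. if w k = s then f (w(1 := w k, 2 := ?w1, k := ?w2)) else 0)"
          by (rule sum.cong) auto
        ultimately show ?thesis unfolding V3 by simp
      qed
      moreover have "E s ?w2 (f ?v) = (if s = ?w2 then scale (cst (blk s)) (f ?v) else 0)
          - (\<Sum>k\<in>V. if ?v k = s then f (?v(k := ?w2)) else 0)"
        by (rule invariantsD[OF f s(1) lt(2) s(2) upd[OF s(1) lt(1)]])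
      ultimately show ?thesis unfolding g_def t by auto
    qed
    have F2: "E s ?w1 (g ?w2 s) = (if s = ?w1 then scale (cst (blk ?w1)) (f ?t) else 0) - f ?t
        - (\<Sum>k\<in>{3..n}. if w k = s then f (w(1 := ?w2, 2 := w k, k := ?w1)) else 0)"
      if s: "s < N" "blk s = blk ?w1" for s
    proof -
      let ?v = "w(1 := ?w2, 2 := s)"
      have V3: "V = insert 1 (insert 2 {3..n})" using n by (auto simp: V_def)
      have "(\<Sum>k\<in>V. if ?v k = s then f (?v(k := ?w1)) else 0) = f ?t
        + (\<Sum>k\<in>{3..n}. if w k = s then f (w(1 := ?w2, 2 := w k, k := ?w1)) else 0)"
      proof -
        have "?w2 \<noteq> s" using s opp by auto
        moreover have "?v(2 := ?w1) = ?t" unfolding t by (auto simp: fun_eq_iff)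
        moreover have "(\<Sum>k\<in>{3..n}. if ?v k = s then f (?v(k := ?w1)) else 0) =
           (\<Sum>k\<in>{3..n}. if w k = s then f (w(1 := ?w2, 2 := w k, k := ?w1)) else 0)"
          by (rule sum.cong) auto
        ultimately show ?thesis unfolding V3 by simp
      qed
      moreover have "E s ?w1 (f ?v) = (if s = ?w1 then scale (cst (blk s)) (f ?v) else 0)
          - (\<Sum>k\<in>V. if ?v k = s then f (?v(k := ?w1)) else 0)"
        by (rule invariantsD[OF f s(1) lt(1) s(2) upd[OF lt(2) s(1)]])
      ultimately show ?thesis unfolding g_def t by auto
    qed
    have wk: "w k < N" if "k \<in> {3..n}" for k using w that by (intro MI_lt) (auto simp: in_V)
    \<comment> \<open>Summed over a block, the term \<open>z\<close> is counted once for each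
      element of the block; this is how block sizes enter \<open>\<kappa>\<close>.\<close>
    have agg: "(\<Sum>s<N. if blk s = \<beta> then (if s = x then y else 0) - z - (\<Sum>k\<in>{3..n}. if w k = s then h k else 0) else 0)
       = y - scale (of_nat (card {a. a < N \<and> blk a = \<beta>})) z - (\<Sum>k\<in>{3..n}. if blk (w k) = \<beta> then h k else 0)"
      if "x < N" "blk x = \<beta>" for \<beta> x y z and h :: "nat \<Rightarrow> 'm"
    proof -
      have "(\<Sum>s<N. if blk s = \<beta> then (if s = x then y else 0) - z - (\<Sum>k\<in>{3..n}. if w k = s then h k else 0) else 0)
        = (\<Sum>s<N. (if s = x then y else 0) - (if blk s = \<beta> then z else 0) - (\<Sum>k\<in>{3..n}. if s = w k then if blk (w k) = \<beta> then h k else 0 else 0))"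
      proof (rule sum.cong[OF refl])
        fix s
        have *: "(\<Sum>k\<in>{3..n}. if s = w k then if blk (w k) = \<beta> then h k else 0 else 0) =
            (if blk s = \<beta> then \<Sum>k\<in>{3..n}. if w k = s then h k else 0 else 0)"
        proof (cases "blk s = \<beta>")
          case False
          then have "(if s = w k then if blk (w k) = \<beta> then h k else 0 else 0) = 0" for k by (cases "s = w k") simp_all
          with False show ?thesis by simp
        qed (auto intro!: sum.cong)
        have "s \<noteq> x" if "blk s \<noteq> \<beta>" using that \<open>blk x = \<beta>\<close> by auto
        then show "(if blk s = \<beta> then (if s = x then y else 0) - z - (\<Sum>k\<in>{3..n}. if w k = s then h k else 0) else 0) =
          (if s = x then y else 0) - (if blk s = \<beta> then z else 0)
          - (\<Sum>k\<in>{3..n}. if s = w k then if blk (w k) = \<beta> then h k else 0 else 0)"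
          unfolding * by (cases "blk s = \<beta>") simp_all
      qed
      also have "\<dots> = y - scale (of_nat (card {a. a < N \<and> blk a = \<beta>})) z
          - (\<Sum>k\<in>{3..n}. \<Sum>s<N. if s = w k then if blk (w k) = \<beta> then h k else 0 else 0)"
        unfolding sum_subtractf card_blk using that by (subst sum.swap) simp
      also have "(\<Sum>k\<in>{3..n}. \<Sum>s<N. if s = w k then if blk (w k) = \<beta> then h k else 0 else 0)
          = (\<Sum>k\<in>{3..n}. if blk (w k) = \<beta> then h k else 0)"
        by (rule sum.cong) (use wk in auto)
      finally show ?thesis .
    qed
    have A1: "(\<Sum>s<N. if blk s = blk ?w2 then E s ?w2 (g s ?w1) else 0) = scale (cst (blk ?w2)) (f ?t)
      - scale (of_nat (card {a. a < N \<and> blk a = blk ?w2})) (f ?t)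
      - (\<Sum>k\<in>{3..n}. if blk (w k) = blk ?w2 then f (w(1 := w k, 2 := ?w1, k := ?w2)) else 0)"
      unfolding agg[OF lt(2) refl, symmetric] by (rule sum.cong[OF refl]) (simp add: F1 cong: if_cong)
    have A2: "(\<Sum>s<N. if blk s = blk ?w1 then E s ?w1 (g ?w2 s) else 0) = scale (cst (blk ?w1)) (f ?t)
      - scale (of_nat (card {a. a < N \<and> blk a = blk ?w1})) (f ?t)
      - (\<Sum>k\<in>{3..n}. if blk (w k) = blk ?w1 then f (w(1 := ?w2, 2 := w k, k := ?w1)) else 0)"
      unfolding agg[OF lt(1) refl, symmetric] by (rule sum.cong[OF refl]) (simp add: F2 cong: if_cong)
    have B: "opp_swap 1 2 (same_swap 1 k f) w - same_swap 1 k (opp_swap 1 2 f) w =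
       (if blk (w k) = blk ?w2 then f (w(1 := w k, 2 := ?w1, k := ?w2)) else 0)
       - (if blk (w k) = blk ?w1 then f (w(1 := ?w2, 2 := w k, k := ?w1)) else 0)" if k: "k \<in> {3..n}" for k
    proof -
      have "w \<circ> transpose 1 2 \<circ> transpose 1 k = w(1 := w k, 2 := ?w1, k := ?w2)"
        "w \<circ> transpose 1 k \<circ> transpose 1 2 = w(1 := ?w2, 2 := w k, k := ?w1)"
        using k by (auto simp: fun_eq_iff transpose_def)
      moreover have "(w \<circ> transpose 1 2) 1 = ?w2" "(w \<circ> transpose 1 2) k = w k"
        "(w \<circ> transpose 1 k) 1 = w k" "(w \<circ> transpose 1 k) 2 = ?w2"
        using k by (auto simp: transpose_def)
      ultimately show ?thesis using opp unfolding opp_swap_def same_swap_def by auto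
    qed
    \<comment> \<open>The difference of the constants of the two blocks changes sign when the blocks
      are exchanged, which is the sign carried by \<open>gam 1\<close>.\<close>
    have K: "scale (cst (blk ?w2)) x - scale (of_nat (card {a. a < N \<and> blk a = blk ?w2})) x
        - (scale (cst (blk ?w1)) x - scale (of_nat (card {a. a < N \<and> blk a = blk ?w1})) x) = scale (\<kappa> * sg (blk ?w1)) x" for x
    proof -
      have "cst (blk ?w2) - of_nat (card {a. a < N \<and> blk a = blk ?w2}) - (cst (blk ?w1) - of_nat (card {a. a < N \<and> blk a = blk ?w1})) = \<kappa> * sg (blk ?w1)"
        using opp by (cases "blk ?w1"; cases "blk ?w2") (auto simp: \<kappa> sg_def)
      then show ?thesis unfolding scale_left_diff_distrib[symmetric] by simp
    qed
    have "gam 1 (opp_swap 1 2 f) w = scale (sg (blk ?w1)) (f ?t)"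
      using opp by (simp add: gam_def weight_def opp_swap_def)
    then have G: "scale \<kappa> (gam 1 (opp_swap 1 2 f) w) = scale (\<kappa> * sg (blk ?w1)) (f ?t)" by simp
    have S: "(\<Sum>k\<in>{3..n}. opp_swap 1 2 (same_swap 1 k f) w - same_swap 1 k (opp_swap 1 2 f) w) =
      (\<Sum>k\<in>{3..n}. if blk (w k) = blk ?w2 then f (w(1 := w k, 2 := ?w1, k := ?w2)) else 0)
      - (\<Sum>k\<in>{3..n}. if blk (w k) = blk ?w1 then f (w(1 := ?w2, 2 := w k, k := ?w1)) else 0)"
      unfolding sum_subtractf[symmetric] by (rule sum.cong[OF refl B])
    show ?thesis unfolding c1 A1 A2 G S K[symmetric] by (simp add: algebra_simps)
  qed
qed

end

section \<open>Stability of the invariant tensors and commutativity of the closed forms\<close>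

context gl_family
begin

text \<open>The coefficient left over in \<open>hop_commutator\<close>; with this value
  \<open>Y 1\<close> and \<open>Y 2\<close> commute.\<close>

definition kappa :: complex where
  "kappa = cst False - cst True + of_nat (card {a. a < N \<and> blk a = True}) - of_nat (card {a. a < N \<and> blk a = False})"

lemma invariantsI:
  assumes "f \<in> supported MI"
    and "\<And>a b w. a < N \<Longrightarrow> b < N \<Longrightarrow> blk a = blk b \<Longrightarrow> w \<in> MI \<Longrightarrow>
      E a b (f w) = (if a = b then scale (cst (blk a)) (f w) else 0) - (\<Sum>k\<in>V. if w k = a then f (w(k := b)) else 0)"
  shows "f \<in> invariants"
  using assms unfolding invariants_def by blast

lemma zero_invariant: "(\<lambda>w. 0) \<in> invariants"
  by (simp add: invariants_def supported_def E_zero)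

lemma add_invariant:
  assumes f: "f \<in> invariants" and g: "g \<in> invariants"
  shows "(\<lambda>w. f w + g w) \<in> invariants"
proof -
  have "(\<Sum>k\<in>V. if w k = a then f (w(k := b)) + g (w(k := b)) else 0) =
     (\<Sum>k\<in>V. if w k = a then f (w(k := b)) else 0) + (\<Sum>k\<in>V. if w k = a then g (w(k := b)) else 0)" for a b w
    unfolding sum.distrib[symmetric] by (rule sum.cong) auto
  then show ?thesis using f g by (auto simp: invariants_def supported_def E_add scale_right_distrib)
qed

text \<open>Block diagonal matrix units do not change the block labels.\<close>

lemma weight_invariant:
  assumes f: "f \<in> invariants"
  shows "weight q f \<in> invariants"
proof -
  have "E a b (weight q f w) = (if a = b then scale (cst (blk a)) (weight q f w) else 0)
      - (\<Sum>k\<in>V. if w k = a then weight q f (w(k := b)) else 0)"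
    if ab: "a < N" "b < N" "blk a = blk b" and w: "w \<in> MI" for a b w
  proof -
    let ?q = "q (\<lambda>k. blk (w k))"
    have "(\<lambda>j. blk ((w(k := b)) j)) = (\<lambda>j. blk (w j))" if "w k = a" for k
      using that ab(3) by (auto simp: fun_eq_iff)
    then have "(\<Sum>k\<in>V. if w k = a then weight q f (w(k := b)) else 0) = scale ?q (\<Sum>k\<in>V. if w k = a then f (w(k := b)) else 0)"
      unfolding scale_sum_right by (intro sum.cong) (auto simp: weight_def)
    moreover have "E a b (weight q f w) = scale ?q (E a b (f w))"
      using ab by (simp add: weight_def E_scale)
    ultimately show ?thesis
      unfolding invariantsD[OF f ab w] by (simp add: weight_def scale_right_diff_distrib scale_left_commute)
  qed
  moreover have "weight q f \<in> supported MI"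
    using invariants_supported[OF f] by (auto simp: supported_def weight_def)
  ultimately show ?thesis by (intro invariantsI)
qed

lemma permute_invariant:
  assumes f: "f \<in> invariants" and \<sigma>: "\<sigma> permutes V"
  shows "permute \<sigma> f \<in> invariants"
proof -
  have "E a b (permute \<sigma> f w) = (if a = b then scale (cst (blk a)) (permute \<sigma> f w) else 0)
      - (\<Sum>k\<in>V. if w k = a then permute \<sigma> f (w(k := b)) else 0)"
    if ab: "a < N" "b < N" "blk a = blk b" and w: "w \<in> MI" for a b w
  proof -
    have "(\<Sum>k\<in>V. if w k = a then permute \<sigma> f (w(k := b)) else 0) = (\<Sum>k\<in>V. if w (\<sigma> k) = a then permute \<sigma> f (w(\<sigma> k := b)) else 0)"
      by (rule sum.permute[OF \<sigma>, unfolded comp_def])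
    also have "\<dots> = (\<Sum>k\<in>V. if (w \<circ> \<sigma>) k = a then f ((w \<circ> \<sigma>)(k := b)) else 0)"
    proof -
      have "w(\<sigma> k := b) \<circ> \<sigma> = (w \<circ> \<sigma>)(k := b)" for k
        using permutes_inj[OF \<sigma>] by (auto simp: fun_eq_iff inj_eq)
      then show ?thesis by (simp add: permute_def cong: if_cong)
    qed
    finally show ?thesis
      using invariantsD[OF f ab index_set_comp_permutes[OF w \<sigma>]] by (simp add: permute_def)
  qed
  moreover have "permute \<sigma> f \<in> supported MI"
    using invariants_supported[OF f] index_set_comp_permutes_iff[OF \<sigma>] by (auto simp: supported_def permute_def)
  ultimately show ?thesis by (intro invariantsI)
qed

text \<open>The off-diagonal sum commutes with the block diagonal subalgebra: the two terms in which
  the summation index meets \<open>a\<close> or \<open>b\<close> cancel because these lie in one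
  block, and the term with \<open>w r = a\<close> supplies the missing summand at
  \<open>k = r\<close>.\<close>

lemma hop_invariant:
  assumes f: "f \<in> invariants" and r: "r \<in> V"
  shows "hop r f \<in> invariants"
proof -
  have "E a b (hop r f w) = (if a = b then scale (cst (blk a)) (hop r f w) else 0)
      - (\<Sum>k\<in>V. if w k = a then hop r f (w(k := b)) else 0)"
    if ab: "a < N" "b < N" "blk a = blk b" and w: "w \<in> MI" for a b w
  proof -
    let ?x = "w r" and ?R = "V - {r}"
    have x: "?x < N" using w r by (rule MI_lt)
    let ?P = "\<lambda>s. blk s \<noteq> blk ?x"
    have hop_term: "E a b (E s ?x (f (w(r := s)))) = (if a = b then scale (cst (blk a)) (E s ?x (f (w(r := s)))) else 0)
        - (\<Sum>k\<in>?R. if w k = a then E s ?x (f (w(k := b, r := s))) else 0)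
        - (if s = a then E a ?x (f (w(r := b))) else 0)
        + (if s = b then E a ?x (f (w(r := b))) else 0) - (if ?x = a then E s b (f (w(r := s))) else 0)"
      if s: "s < N" for s
    proof -
      have ws: "w(r := s) \<in> MI" using w r s by (rule index_set_upd)
      have "(\<Sum>k\<in>V. if (w(r := s)) k = a then f ((w(r := s))(k := b)) else 0) =
          (if s = a then f (w(r := b)) else 0) + (\<Sum>k\<in>?R. if w k = a then f (w(k := b, r := s)) else 0)"
      proof -
        have "(\<Sum>k\<in>?R. if (w(r := s)) k = a then f ((w(r := s))(k := b)) else 0) = (\<Sum>k\<in>?R. if w k = a then f (w(k := b, r := s)) else 0)"
          by (rule sum.cong) (auto simp: fun_upd_twist)
        then show ?thesis by (simp add: sum.remove[OF finite_V r])
      qed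
      then have "E a b (f (w(r := s))) = (if a = b then scale (cst (blk a)) (f (w(r := s))) else 0)
         - ((if s = a then f (w(r := b)) else 0) + (\<Sum>k\<in>?R. if w k = a then f (w(k := b, r := s)) else 0))"
        using invariantsD[OF f ab ws] by simp
      then have "E s ?x (E a b (f (w(r := s)))) = (if a = b then scale (cst (blk a)) (E s ?x (f (w(r := s)))) else 0)
         - ((if s = a then E s ?x (f (w(r := b))) else 0) + (\<Sum>k\<in>?R. if w k = a then E s ?x (f (w(k := b, r := s))) else 0))"
        using s x by (auto simp: E_diff E_add E_sum E_scale E_zero if_distrib[of "E s ?x"] cong: if_cong)
      moreover have "E a b (E s ?x (f (w(r := s)))) = E s ?x (E a b (f (w(r := s))))
          + ((if b = s then E a ?x (f (w(r := s))) else 0) - (if ?x = a then E s b (f (w(r := s))) else 0))"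
        using E_comm[OF ab(1,2) s x, of "f (w(r := s))"] by (metis add.commute diff_add_cancel)
      moreover have "(if b = s then E a ?x (f (w(r := s))) else 0) = (if s = b then E a ?x (f (w(r := b))) else 0)"
        "(if s = a then E s ?x (f (w(r := b))) else 0) = (if s = a then E a ?x (f (w(r := b))) else 0)"
        by auto
      moreover have "x = a - (b' + c) \<Longrightarrow> y = x + (d' - e) \<Longrightarrow> d' = d \<Longrightarrow> b' = b \<Longrightarrow> y = a - c - b + d - e"
        for x y a b b' c d d' e :: 'm by (simp add: algebra_simps)
      ultimately show ?thesis by blast
    qed
    have "E a b (hop r f w) = (\<Sum>s<N. if ?P s then E a b (E s ?x (f (w(r := s)))) else 0)"
      unfolding hop_def if_P[OF w] using ab by (auto simp: E_sum E_zero intro!: sum.cong)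
    also have "\<dots> = (\<Sum>s<N. (if a = b then scale (cst (blk a)) (if ?P s then E s ?x (f (w(r := s))) else 0) else 0)
        - (\<Sum>k\<in>?R. if w k = a then if ?P s then E s ?x (f (w(k := b, r := s))) else 0 else 0)
        - (if s = a then if ?P a then E a ?x (f (w(r := b))) else 0 else 0)
        + (if s = b then if ?P b then E a ?x (f (w(r := b))) else 0 else 0)
        - (if ?x = a then if ?P s then E s b (f (w(r := s))) else 0 else 0))"
    proof (rule sum.cong[OF refl])
      fix s assume "s \<in> {..<N}"
      then have s: "s < N" by simp
      show "(if ?P s then E a b (E s ?x (f (w(r := s)))) else 0) = (if a = b then scale (cst (blk a)) (if ?P s then E s ?x (f (w(r := s))) else 0) else 0)
        - (\<Sum>k\<in>?R. if w k = a then if ?P s then E s ?x (f (w(k := b, r := s))) else 0 else 0)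
        - (if s = a then if ?P a then E a ?x (f (w(r := b))) else 0 else 0)
        + (if s = b then if ?P b then E a ?x (f (w(r := b))) else 0 else 0)
        - (if ?x = a then if ?P s then E s b (f (w(r := s))) else 0 else 0)"
      proof (cases "?P s")
        case True
        then have "(if s = d then if ?P d then z else 0 else 0) = (if s = d then z else 0)" for d and z :: 'm by auto
        then show ?thesis unfolding if_P[OF True] by (simp only: hop_term[OF s])
      next
        case False
        then have "(if s = d then if ?P d then z else 0 else 0) = 0" for d and z :: 'm by auto
        then show ?thesis unfolding if_not_P[OF False] by simp
      qed
    qed
    also have "\<dots> = (if a = b then scale (cst (blk a)) (hop r f w) else 0)
        - (\<Sum>k\<in>?R. if w k = a then hop r f (w(k := b)) else 0)
        - (if ?P a then E a ?x (f (w(r := b))) else 0) + (if ?P b then E a ?x (f (w(r := b))) else 0)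
        - (if ?x = a then hop r f (w(r := b)) else 0)"
    proof -
      have 1: "(\<Sum>s<N. if a = b then scale (cst (blk a)) (if ?P s then E s ?x (f (w(r := s))) else 0) else 0)
         = (if a = b then scale (cst (blk a)) (hop r f w) else 0)"
        using w by (simp add: hop_def scale_sum_right)
      have 2: "(\<Sum>s<N. \<Sum>k\<in>?R. if w k = a then if ?P s then E s ?x (f (w(k := b, r := s))) else 0 else 0)
         = (\<Sum>k\<in>?R. if w k = a then hop r f (w(k := b)) else 0)"
      proof -
        have "(\<Sum>s<N. if w k = a then if ?P s then E s ?x (f (w(k := b, r := s))) else 0 else 0)
          = (if w k = a then hop r f (w(k := b)) else 0)" if k: "k \<in> ?R" for k
        proof -
          have "w(k := b) \<in> MI" using w k ab by (intro index_set_upd) auto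
          then show ?thesis using k by (simp add: hop_def cong: if_cong)
        qed
        then show ?thesis by (subst sum.swap) (rule sum.cong[OF refl])
      qed
      have 3: "(\<Sum>s<N. if ?x = a then if ?P s then E s b (f (w(r := s))) else 0 else 0) = (if ?x = a then hop r f (w(r := b)) else 0)"
      proof -
        have "w(r := b) \<in> MI" using w r ab by (intro index_set_upd)
        then show ?thesis using ab by (simp add: hop_def cong: if_cong)
      qed
      show ?thesis unfolding sum.distrib sum_subtractf 1 2 3 using ab by simp
    qed
    also have "\<dots> = (if a = b then scale (cst (blk a)) (hop r f w) else 0)
        - (\<Sum>k\<in>V. if w k = a then hop r f (w(k := b)) else 0)"
      using ab(3) by (simp add: sum.remove[OF finite_V r])
    finally show ?thesis .
  qed
  moreover have "hop r f \<in> supported MI" by (auto simp: supported_def hop_outside)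
  ultimately show ?thesis by (intro invariantsI)
qed

lemma gam_invariant: "f \<in> invariants \<Longrightarrow> gam j f \<in> invariants"
  unfolding gam_def by (rule weight_invariant)

lemma same_swap_invariant: "f \<in> invariants \<Longrightarrow> j \<in> V \<Longrightarrow> l \<in> V \<Longrightarrow> same_swap j l f \<in> invariants"
  unfolding same_swap_eq by (intro weight_invariant permute_invariant permutes_swap_id)

lemma opp_swap_invariant: "f \<in> invariants \<Longrightarrow> j \<in> V \<Longrightarrow> l \<in> V \<Longrightarrow> opp_swap j l f \<in> invariants"
  unfolding opp_swap_eq by (intro weight_invariant permute_invariant permutes_swap_id)

lemma scale_invariant: "f \<in> invariants \<Longrightarrow> (\<lambda>w. scale t (f w)) \<in> invariants"
  using weight_invariant[of f "\<lambda>_. t"] by (simp add: weight_def)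

lemma minus_invariant: "f \<in> invariants \<Longrightarrow> (\<lambda>w. - f w) \<in> invariants"
  using scale_invariant[of f "-1"] by simp

lemma sum_invariant: "(\<And>l. l \<in> L \<Longrightarrow> F l \<in> invariants) \<Longrightarrow> (\<lambda>w. \<Sum>l\<in>L. F l w) \<in> invariants"
  by (induction L rule: infinite_finite_induct) (simp_all add: zero_invariant add_invariant)

lemma diff_invariant: "f \<in> invariants \<Longrightarrow> g \<in> invariants \<Longrightarrow> (\<lambda>w. f w - g w) \<in> invariants"
  using add_invariant[OF _ minus_invariant, of f g] by simp

lemma Y_invariant: "f \<in> invariants \<Longrightarrow> j \<in> V \<Longrightarrow> Y \<kappa> j f \<in> invariants"
  unfolding Y_def
  by (intro diff_invariant add_invariant minus_invariant scale_invariant sum_invariant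
      hop_invariant gam_invariant same_swap_invariant opp_swap_invariant) (auto simp: in_V)

lemma Y_linear:
  assumes j: "j \<in> V"
  shows "Y \<kappa> j (\<lambda>w. f w + g w) w = Y \<kappa> j f w + Y \<kappa> j g w"
    and "Y \<kappa> j (\<lambda>w. scale t (f w)) w = scale t (Y \<kappa> j f w)"
    and "Y \<kappa> j (\<lambda>w. f w - g w) w = Y \<kappa> j f w - Y \<kappa> j g w"
proof -
  have h0: "hop j (\<lambda>_. 0) w = 0"
    using MI_lt[OF _ j] by (auto simp: hop_def E_zero intro!: sum.neutral)
  have hm: "hop j (\<lambda>w. - f w) w = - hop j f w" for f
    using hop_combination[OF j, of f 0 f "\<lambda>_ _. 0" "{}" "\<lambda>_ _. 0" "{}" w] by simp
  have h: "hop j (\<lambda>w. f w + g w) w = hop j f w + hop j g w" for f g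
    using hop_combination[OF j, of "\<lambda>w. - f w" 1 g "\<lambda>_ _. 0" "{}" "\<lambda>_ _. 0" "{}" w] hm[of f] by simp
  show add: "Y \<kappa> j (\<lambda>w. f w + g w) w = Y \<kappa> j f w + Y \<kappa> j g w" for f g
  proof -
    have s: "same_swap j l (\<lambda>w. f w + g w) w = same_swap j l f w + same_swap j l g w" for l by (simp add: same_swap_def)
    have o: "opp_swap j l (\<lambda>w. f w + g w) w = opp_swap j l f w + opp_swap j l g w" for l by (simp add: opp_swap_def)
    have g: "gam j (\<lambda>w. f w + g w) w = gam j f w + gam j g w" by (simp add: gam_def weight_def scale_right_distrib)
    show ?thesis by (simp add: Y_def h s o g sum.distrib scale_right_distrib)
  qed
  have hs: "hop j (\<lambda>w. scale t (f w)) w = scale t (hop j f w)" for t f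
    using hop_combination[OF j, of "\<lambda>_. 0" t f "\<lambda>_ _. 0" "{}" "\<lambda>_ _. 0" "{}" w] by (simp add: h0)
  have scale: "Y \<kappa> j (\<lambda>w. scale t (f w)) w = scale t (Y \<kappa> j f w)" for t f
  proof -
    have s: "same_swap j l (\<lambda>w. scale t (f w)) w = scale t (same_swap j l f w)" for l by (simp add: same_swap_def)
    have o: "opp_swap j l (\<lambda>w. scale t (f w)) w = scale t (opp_swap j l f w)" for l by (simp add: opp_swap_def)
    have g: "gam j (\<lambda>w. scale t (f w)) w = scale t (gam j f w)" by (simp add: gam_def weight_def scale_left_commute)
    show ?thesis
      by (simp add: Y_def hs s o g scale_right_distrib scale_right_diff_distrib scale_sum_right mult.commute)
  qed
  then show "Y \<kappa> j (\<lambda>w. scale t (f w)) w = scale t (Y \<kappa> j f w)" .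
  show "Y \<kappa> j (\<lambda>w. f w - g w) w = Y \<kappa> j f w - Y \<kappa> j g w"
    using add[of f "\<lambda>w. scale (- 1) (g w)"] scale[of "- 1" g] by simp
qed

lemma permute_twice: "permute \<sigma> (permute \<tau> f) = permute (\<sigma> \<circ> \<tau>) f"
  by (simp add: permute_def comp_assoc)

lemma transpose_triple:
  "(w \<circ> transpose i k) \<circ> transpose j l \<circ> transpose i k = w \<circ> transpose (transpose i k j) (transpose i k l)"
proof -
  have "transpose i k (transpose j l (transpose i k x)) = transpose (transpose i k j) (transpose i k l) x" for x
    by (auto simp: transpose_def)
  then show ?thesis by (simp add: fun_eq_iff)
qed

lemma Y_Suc:
  assumes i: "1 \<le> i" "i < n"
  shows "Y \<kappa> i (permute (transpose i (Suc i)) f) (w \<circ> transpose i (Suc i)) - f (w \<circ> transpose i (Suc i)) = Y \<kappa> (Suc i) f w"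
proof -
  let ?\<tau> = "transpose i (Suc i)"
  have V: "i \<in> V" "Suc i \<in> V" using i by (auto simp: in_V)
  have \<tau>: "?\<tau> permutes V" by (rule permutes_swap_id[OF V])
  have h: "hop i (permute ?\<tau> f) (w \<circ> ?\<tau>) = hop (Suc i) f w"
    using hop_permute[OF \<tau>, of i "permute ?\<tau> f" w] by (simp add: permute_twice) (simp add: permute_def)
  have g: "gam i (permute ?\<tau> f) (w \<circ> ?\<tau>) = gam (Suc i) f w"
    by (simp add: gam_def weight_def permute_def comp_assoc)
  have tt: "(w \<circ> ?\<tau>) \<circ> transpose i l \<circ> ?\<tau> = w \<circ> transpose (Suc i) l" if "l \<noteq> i" "l \<noteq> Suc i" for l
    unfolding transpose_triple using that by simp
  have s: "same_swap i l (permute ?\<tau> f) (w \<circ> ?\<tau>) = same_swap (Suc i) l f w" if "l \<noteq> i" "l \<noteq> Suc i" for l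
    using that by (simp add: same_swap_def permute_def tt)
  have o: "opp_swap i l (permute ?\<tau> f) (w \<circ> ?\<tau>) = opp_swap (Suc i) l f w" if "l \<noteq> i" "l \<noteq> Suc i" for l
    using that by (simp add: opp_swap_def permute_def tt)
  \<comment> \<open>The one term that changes type: removing the full swap from the swap of equal
    blocks leaves minus the swap of different blocks.\<close>
  have e: "same_swap i (Suc i) (permute ?\<tau> f) (w \<circ> ?\<tau>) - f (w \<circ> ?\<tau>) = - opp_swap (Suc i) i f w"
    by (auto simp: same_swap_def opp_swap_def permute_def comp_assoc transpose_commute[of "Suc i" i])
  have "{i<..n} = insert (Suc i) {Suc i<..n}" "{1..<Suc i} = insert i {1..<i}" using i by auto
  then have "(\<Sum>l\<in>{i<..n}. same_swap i l (permute ?\<tau> f) (w \<circ> ?\<tau>)) = same_swap i (Suc i) (permute ?\<tau> f) (w \<circ> ?\<tau>) + (\<Sum>l\<in>{Suc i<..n}. same_swap (Suc i) l f w)"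
    "(\<Sum>l\<in>{1..<Suc i}. opp_swap (Suc i) l f w) = opp_swap (Suc i) i f w + (\<Sum>l\<in>{1..<i}. opp_swap i l (permute ?\<tau> f) (w \<circ> ?\<tau>))"
    using s o by auto
  then show ?thesis unfolding Y_def h g using e by (simp add: algebra_simps)
qed

text \<open>As \<open>j\<close> differs from \<open>i\<close> and \<open>i + 1\<close>, the
  transposition permutes the index range of each of the two sums in \<open>Y\<close> or fixes it
  pointwise.\<close>

lemma Y_commute_swap:
  assumes i: "1 \<le> i" "i < n" and j: "j \<in> V" "j \<noteq> i" "j \<noteq> Suc i"
  shows "Y \<kappa> j f (w \<circ> transpose i (Suc i)) = Y \<kappa> j (permute (transpose i (Suc i)) f) w"
proof -
  let ?\<tau> = "transpose i (Suc i)"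
  have V: "i \<in> V" "Suc i \<in> V" using i by (auto simp: in_V)
  have \<tau>: "?\<tau> permutes V" by (rule permutes_swap_id[OF V])
  have \<tau>j: "?\<tau> j = j" using j by simp
  have h: "hop j f (w \<circ> ?\<tau>) = hop j (permute ?\<tau> f) w" using hop_permute[OF \<tau>, of j f w] \<tau>j by simp
  have g: "gam j f (w \<circ> ?\<tau>) = gam j (permute ?\<tau> f) w"
    by (simp add: gam_def weight_def permute_def \<tau>j)
  have tt: "(w \<circ> ?\<tau>) \<circ> transpose j (?\<tau> l) = w \<circ> transpose j l \<circ> ?\<tau>" for l
    using \<tau>j by (auto simp: fun_eq_iff transpose_def)
  have s: "same_swap j (?\<tau> l) f (w \<circ> ?\<tau>) = same_swap j l (permute ?\<tau> f) w" for l
    unfolding same_swap_def tt by (simp add: \<tau>j permute_def)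
  have o: "opp_swap j (?\<tau> l) f (w \<circ> ?\<tau>) = opp_swap j l (permute ?\<tau> f) w" for l
    unfolding opp_swap_def tt by (simp add: \<tau>j permute_def)
  have p1: "?\<tau> permutes {j<..n}" if "j < i" using that i by (intro permutes_swap_id) auto
  have p2: "?\<tau> permutes {1..<j}" if "Suc i < j" using that i by (intro permutes_swap_id) auto
  have S: "(\<Sum>l\<in>{j<..n}. same_swap j l f (w \<circ> ?\<tau>)) = (\<Sum>l\<in>{j<..n}. same_swap j l (permute ?\<tau> f) w)"
  proof (cases "j < i")
    case True
    then show ?thesis
      unfolding s[symmetric] using sum.permute[OF p1, of "\<lambda>l. same_swap j l f (w \<circ> ?\<tau>)"] by (simp only: comp_def)
  next
    case False
    show ?thesis
    proof (rule sum.cong[OF refl])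
      fix l assume "l \<in> {j<..n}"
      then have "?\<tau> l = l" using False j by (auto simp: transpose_def)
      then show "same_swap j l f (w \<circ> ?\<tau>) = same_swap j l (permute ?\<tau> f) w" using s[of l] by simp
    qed
  qed
  have O: "(\<Sum>l\<in>{1..<j}. opp_swap j l f (w \<circ> ?\<tau>)) = (\<Sum>l\<in>{1..<j}. opp_swap j l (permute ?\<tau> f) w)"
  proof (cases "Suc i < j")
    case True
    then show ?thesis
      unfolding o[symmetric] using sum.permute[OF p2, of "\<lambda>l. opp_swap j l f (w \<circ> ?\<tau>)"] by (simp only: comp_def)
  next
    case False
    show ?thesis
    proof (rule sum.cong[OF refl])
      fix l assume "l \<in> {1..<j}"
      then have "?\<tau> l = l" using False j by (auto simp: transpose_def)
      then show "opp_swap j l f (w \<circ> ?\<tau>) = opp_swap j l (permute ?\<tau> f) w" using o[of l] by simp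
    qed
  qed
  show ?thesis unfolding Y_def h g S O ..
qed

text \<open>\<open>gam n\<close> could interfere only at l = n, where \<open>same_swap j n\<close>
  requires equal blocks and so does not see which of the two factors carries the sign.\<close>

lemma Y_commute_gam:
  assumes j: "1 \<le> j" "j < n"
  shows "Y \<kappa> j (gam n f) w = gam n (Y \<kappa> j f) w"
proof -
  have jV: "j \<in> V" and jn: "j \<noteq> n" using j by (auto simp: in_V)
  have g: "gam j (gam n f) w = gam n (gam j f) w" by (simp add: gam_def weight_def mult.commute)
  have s: "same_swap j l (gam n f) w = gam n (same_swap j l f) w" for l
    using jn by (cases "l = n") (auto simp: same_swap_def gam_def weight_def transpose_def)
  have o: "opp_swap j l (gam n f) w = gam n (opp_swap j l f) w" if "l \<in> {1..<j}" for l
    using jn j that by (auto simp: opp_swap_def gam_def weight_def transpose_def)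
  show ?thesis
    unfolding Y_def gam_combination using jn by (simp add: hop_gam[OF jV] g s o)
qed

text \<open>\<open>gam n\<close> anticommutes with \<open>hop n\<close> and with each
  \<open>opp_swap n l\<close>, and there is no factor beyond \<open>n\<close>; only the term with
  coefficient \<kappa>/2 survives, twice.\<close>

lemma Y_gam_anticommute:
  assumes n: "1 \<le> n"
  shows "gam n (Y \<kappa> n f) w + Y \<kappa> n (gam n f) w = scale \<kappa> (f w)"
proof -
  have nV: "n \<in> V" using n by (auto simp: in_V)
  have g: "gam n (gam n f) w = f w" by (simp add: gam_def weight_def sg_def)
  have o: "opp_swap n l (gam n f) w = - gam n (opp_swap n l f) w" for l
    by (auto simp: opp_swap_def gam_def weight_def sg_def)
  have "scale (\<kappa> / 2) x + scale (\<kappa> / 2) x = scale \<kappa> x" for x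
    by (simp flip: scale_left_distrib)
  then show ?thesis
    unfolding Y_def gam_combination by (simp add: hop_gam[OF nV] g o sum_negf)
qed

text \<open>The swaps of equal blocks commute as Jucys-Murphy elements do. The commutator of the two
  hops is compensated by the products of \<open>opp_swap 1 2\<close> with \<open>gam 1\<close> and
  with the swaps of equal blocks.\<close>

lemma Y_1_2:
  assumes f: "f \<in> invariants" and n: "2 \<le> n"
  shows "Y kappa 1 (Y kappa 2 f) = Y kappa 2 (Y kappa 1 f)"
proof
  fix w
  note One_nat_def [simp del]
  have V: "1 \<in> V" "2 \<in> V" using n by (auto simp: in_V)
  let ?L = "{3..n}"
  have LV: "l \<in> V" "l \<noteq> 1" "l \<noteq> 2" if "l \<in> ?L" for l using that by (auto simp: in_V)
  show "Y kappa 1 (Y kappa 2 f) w = Y kappa 2 (Y kappa 1 f) w"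
  proof (cases "w \<in> MI")
    case False
    then show ?thesis using Y_outside[OF invariants_supported[OF Y_invariant[OF f V(2)]] V(1)]
      Y_outside[OF invariants_supported[OF Y_invariant[OF f V(1)]] V(2)] by simp
  next
    case w: True
    have i1: "{1<..n} = insert 2 ?L" "{1..<1} = ({} :: nat set)" "{2<..n} = ?L" "{1..<2} = {1::nat}" using n by auto
    have opp_comm: "opp_swap 2 1 = opp_swap 1 2"
      by (auto simp: opp_swap_def fun_eq_iff transpose_commute[of 2 1])
    have Y2: "Y kappa 2 f = (\<lambda>w. - hop 2 f w + scale (kappa / 2) (gam 2 f w) + (\<Sum>l\<in>?L. same_swap 2 l f w) - (\<Sum>l\<in>{1::nat}. opp_swap 1 2 f w))" for f
      unfolding Y_def i1 by (simp add: opp_comm)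
    have Y1: "Y kappa 1 f = (\<lambda>w. - hop 1 f w + scale (kappa / 2) (gam 1 f w) + (\<Sum>l\<in>insert 2 ?L. same_swap 1 l f w) - (\<Sum>l\<in>({}::nat set). opp_swap 1 l f w))" for f
      unfolding Y_def i1 ..
    have so: "same_swap 1 2 (opp_swap 1 2 f) w = 0" "opp_swap 1 2 (same_swap 1 2 f) w = 0"
      by (auto simp: same_swap_def opp_swap_def)
    have gg: "gam 1 (gam 2 f) w = gam 2 (gam 1 f) w" by (simp add: gam_def weight_def mult.commute)
    have gs: "gam 1 (same_swap 2 l f) w = same_swap 2 l (gam 1 f) w" "gam 2 (same_swap 1 l f) w = same_swap 1 l (gam 2 f) w" if "l \<in> ?L" for l
      using LV[OF that] by (auto simp: gam_def weight_def same_swap_def transpose_def)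
    have gs2: "gam 2 (same_swap 1 2 f) w = same_swap 1 2 (gam 2 f) w"
      by (auto simp: gam_def weight_def same_swap_def transpose_def)
    have go: "opp_swap 1 2 (gam 1 f) w = - gam 1 (opp_swap 1 2 f) w"
      by (auto simp: gam_def weight_def opp_swap_def sg_def transpose_def)
    have hh: "hop 1 (gam 2 f) w = gam 2 (hop 1 f) w" "hop 2 (gam 1 f) w = gam 1 (hop 2 f) w"
      using hop_gam V by simp_all
    have hs: "hop 1 (same_swap 2 l f) w = same_swap 2 l (hop 1 f) w" "hop 2 (same_swap 1 l f) w = same_swap 1 l (hop 2 f) w" if "l \<in> ?L" for l
      using hop_same_swap[of 1 2 l f] hop_same_swap[of 2 1 l f] V LV[OF that] by auto
    have ho: "hop 1 (opp_swap 1 2 f) w = same_swap 1 2 (hop 2 f) w" "hop 2 (same_swap 1 2 f) w = opp_swap 1 2 (hop 1 f) w"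
      using hop_opp_swap[OF V] by simp_all
    have ss: "same_swap 1 l (same_swap 2 m f) w = same_swap 2 m (same_swap 1 l f) w" if "l \<in> ?L" "m \<in> ?L" "l \<noteq> m" for l m
    proof -
      have "w \<circ> transpose 1 l \<circ> transpose 2 m = w \<circ> transpose 2 m \<circ> transpose 1 l"
        using that by (auto simp: fun_eq_iff transpose_def)
      then show ?thesis using LV[OF that(1)] LV[OF that(2)] that(3) by (simp add: same_swap_def)
    qed
    \<comment> \<open>The relation [s_12 + s_1m, s_2m] = 0 restricted to equal blocks; the two
      summands do not commute with s_2m separately.\<close>
    have s3: "same_swap 1 2 (same_swap 2 m f) w + same_swap 1 m (same_swap 2 m f) w = same_swap 2 m (same_swap 1 2 f) w + same_swap 2 m (same_swap 1 m f) w"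
      if "m \<in> ?L" for m
    proof -
      have "w \<circ> transpose 1 2 \<circ> transpose 2 m = w \<circ> transpose 2 m \<circ> transpose 1 m"
        "w \<circ> transpose 1 m \<circ> transpose 2 m = w \<circ> transpose 2 m \<circ> transpose 1 2"
        using that by (auto simp: fun_eq_iff transpose_def)
      then show ?thesis using LV[OF that] by (auto simp: same_swap_def)
    qed
    have dbl: "(\<Sum>m\<in>?L. same_swap 1 2 (same_swap 2 m f) w) + (\<Sum>l\<in>?L. \<Sum>m\<in>?L. same_swap 1 l (same_swap 2 m f) w)
      = (\<Sum>m\<in>?L. same_swap 2 m (same_swap 1 2 f) w) + (\<Sum>m\<in>?L. \<Sum>l\<in>?L. same_swap 2 m (same_swap 1 l f) w)"
    proof -
      have "(\<Sum>l\<in>?L. same_swap 1 l (same_swap 2 m f) w) + same_swap 1 2 (same_swap 2 m f) w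
         = (\<Sum>l\<in>?L. same_swap 2 m (same_swap 1 l f) w) + same_swap 2 m (same_swap 1 2 f) w" if m: "m \<in> ?L" for m
      proof -
        have "(\<Sum>l\<in>?L - {m}. same_swap 1 l (same_swap 2 m f) w) = (\<Sum>l\<in>?L - {m}. same_swap 2 m (same_swap 1 l f) w)"
          by (rule sum.cong) (use ss m in auto)
        then show ?thesis using s3[OF m] m by (simp add: sum.remove[of ?L m] algebra_simps)
      qed
      then have "(\<Sum>m\<in>?L. (\<Sum>l\<in>?L. same_swap 1 l (same_swap 2 m f) w) + same_swap 1 2 (same_swap 2 m f) w)
         = (\<Sum>m\<in>?L. (\<Sum>l\<in>?L. same_swap 2 m (same_swap 1 l f) w) + same_swap 2 m (same_swap 1 2 f) w)"
        by (rule sum.cong[OF refl])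
      then show ?thesis unfolding sum.distrib by (subst (asm) sum.swap) (simp add: add.commute)
    qed
    note comm = hop_commutator[OF f w n kappa_def]
    have k2: "scale (kappa / 2) x + scale (kappa / 2) x = scale kappa x" for x
      by (simp flip: scale_left_distrib)
    have Sgs: "(\<Sum>m\<in>?L. gam 1 (same_swap 2 m f) w) = (\<Sum>m\<in>?L. same_swap 2 m (gam 1 f) w)"
      "(\<Sum>m\<in>?L. gam 2 (same_swap 1 m f) w) = (\<Sum>m\<in>?L. same_swap 1 m (gam 2 f) w)"
      "(\<Sum>m\<in>?L. hop 1 (same_swap 2 m f) w) = (\<Sum>m\<in>?L. same_swap 2 m (hop 1 f) w)"
      "(\<Sum>m\<in>?L. hop 2 (same_swap 1 m f) w) = (\<Sum>m\<in>?L. same_swap 1 m (hop 2 f) w)"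
      by (rule sum.cong[OF refl], simp add: gs hs)+
    have fin2: "finite ?L" "2 \<notin> ?L" by auto
    have A: "Y kappa 1 (Y kappa 2 f) w = hop 1 (hop 2 f) w - scale (kappa / 2) (hop 1 (gam 2 f) w) - (\<Sum>m\<in>?L. hop 1 (same_swap 2 m f) w) + hop 1 (opp_swap 1 2 f) w
      + scale (kappa / 2) (- gam 1 (hop 2 f) w + scale (kappa / 2) (gam 1 (gam 2 f) w) + (\<Sum>m\<in>?L. gam 1 (same_swap 2 m f) w) - gam 1 (opp_swap 1 2 f) w)
      + (- same_swap 1 2 (hop 2 f) w + scale (kappa / 2) (same_swap 1 2 (gam 2 f) w) + (\<Sum>m\<in>?L. same_swap 1 2 (same_swap 2 m f) w) - same_swap 1 2 (opp_swap 1 2 f) w)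
      + (\<Sum>l\<in>?L. - same_swap 1 l (hop 2 f) w + scale (kappa / 2) (same_swap 1 l (gam 2 f) w) + (\<Sum>m\<in>?L. same_swap 1 l (same_swap 2 m f) w) - same_swap 1 l (opp_swap 1 2 f) w)"
      unfolding Y1[of "Y kappa 2 f"] unfolding Y2 hop_combination[OF V(1)] gam_combination same_swap_combination
      by (simp add: fin2)
    have B: "Y kappa 2 (Y kappa 1 f) w = hop 2 (hop 1 f) w - scale (kappa / 2) (hop 2 (gam 1 f) w) - hop 2 (same_swap 1 2 f) w - (\<Sum>m\<in>?L. hop 2 (same_swap 1 m f) w)
      + scale (kappa / 2) (- gam 2 (hop 1 f) w + scale (kappa / 2) (gam 2 (gam 1 f) w) + gam 2 (same_swap 1 2 f) w + (\<Sum>m\<in>?L. gam 2 (same_swap 1 m f) w))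
      + (\<Sum>m\<in>?L. - same_swap 2 m (hop 1 f) w + scale (kappa / 2) (same_swap 2 m (gam 1 f) w) + same_swap 2 m (same_swap 1 2 f) w + (\<Sum>l\<in>?L. same_swap 2 m (same_swap 1 l f) w))
      - (- opp_swap 1 2 (hop 1 f) w + scale (kappa / 2) (opp_swap 1 2 (gam 1 f) w) + opp_swap 1 2 (same_swap 1 2 f) w + (\<Sum>l\<in>?L. opp_swap 1 2 (same_swap 1 l f) w))"
      unfolding Y2[of "Y kappa 1 f"] unfolding Y1 hop_combination[OF V(2)] gam_combination same_swap_combination opp_swap_combination
      by (simp add: fin2 algebra_simps)
    have "Y kappa 1 (Y kappa 2 f) w - Y kappa 2 (Y kappa 1 f) w =
       (hop 1 (hop 2 f) w - hop 2 (hop 1 f) w) - scale kappa (gam 1 (opp_swap 1 2 f) w)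
       + ((\<Sum>k\<in>?L. opp_swap 1 2 (same_swap 1 k f) w) - (\<Sum>k\<in>?L. same_swap 1 k (opp_swap 1 2 f) w))
       + ((\<Sum>m\<in>?L. same_swap 1 2 (same_swap 2 m f) w) + (\<Sum>l\<in>?L. \<Sum>m\<in>?L. same_swap 1 l (same_swap 2 m f) w)
      - ((\<Sum>m\<in>?L. same_swap 2 m (same_swap 1 2 f) w) + (\<Sum>m\<in>?L. \<Sum>l\<in>?L. same_swap 2 m (same_swap 1 l f) w)))"
      unfolding A B sum.distrib sum_subtractf sum_negf Sgs so gg gs2 go hh ho scale_right_distrib scale_right_diff_distrib k2[symmetric] scale_minus_right scale_sum_right
      by (simp add: algebra_simps)
    also have "\<dots> = 0" unfolding comm dbl by (simp add: sum_subtractf)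
    finally show ?thesis by simp
  qed
qed

end

section \<open>The defining relations\<close>

context gl_family
begin

definition S :: "nat \<Rightarrow> 'm tensor \<Rightarrow> 'm tensor" where
  "S i = (if i = n then gam n else permute (transpose i (Suc i)))"

lemma S_invariant: "f \<in> invariants \<Longrightarrow> i \<in> V \<Longrightarrow> S i f \<in> invariants"
  unfolding S_def by (auto simp: in_V intro!: gam_invariant permute_invariant permutes_swap_id)

lemma gam_gam: "gam j (gam j f) = f"
  by (simp add: gam_def weight_def sg_def fun_eq_iff)

lemma permute_transpose_twice: "permute (transpose i j) (permute (transpose i j) f) = f"
  by (simp add: permute_def comp_assoc)

lemma S_S: "S i (S i f) = f"
  by (simp add: S_def gam_gam permute_transpose_twice)

lemma S_braid:
  assumes "1 \<le> i" "i + 2 \<le> n"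
  shows "S i (S (i + 1) (S i f)) = S (i + 1) (S i (S (i + 1) f))"
proof -
  have "w \<circ> transpose i (Suc i) \<circ> transpose (Suc i) (Suc (Suc i)) \<circ> transpose i (Suc i)
      = w \<circ> transpose (Suc i) (Suc (Suc i)) \<circ> transpose i (Suc i) \<circ> transpose (Suc i) (Suc (Suc i))" for w :: "nat \<Rightarrow> nat"
    by (auto simp: fun_eq_iff transpose_def)
  then show ?thesis using assms by (simp add: S_def permute_def)
qed

lemma gam_permute: "gam j (permute \<sigma> f) w = scale (sg (blk (w j))) (f (w \<circ> \<sigma>))"
  by (simp add: gam_def weight_def permute_def)

lemma permute_gam: "permute \<sigma> (gam j f) w = scale (sg (blk (w (\<sigma> j)))) (f (w \<circ> \<sigma>))"
  by (simp add: gam_def weight_def permute_def)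

lemma S_braid_B:
  assumes "2 \<le> n"
  shows "S (n - 1) (S n (S (n - 1) (S n f))) = S n (S (n - 1) (S n (S (n - 1) f)))"
proof -
  have n: "n - 1 \<noteq> n" "Suc (n - 1) = n" using assms by auto
  show ?thesis
    unfolding S_def using n by (simp add: fun_eq_iff gam_def weight_def permute_def comp_assoc)
qed

lemma S_commute:
  assumes "i \<in> V" "j \<in> V" "i + 1 < j \<or> j + 1 < i"
  shows "S i (S j f) = S j (S i f)"
proof -
  have *: "S i (S j f) = S j (S i f)" if "i \<in> V" "j \<in> V" "i + 1 < j" for i j
  proof -
    have i: "i \<noteq> n" using that by (auto simp: in_V)
    show ?thesis
    proof (cases "j = n")
      case True
      then show ?thesis using i that
        by (auto simp: S_def fun_eq_iff gam_permute permute_gam transpose_def)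
    next
      case False
      have "w \<circ> transpose i (Suc i) \<circ> transpose j (Suc j) = w \<circ> transpose j (Suc j) \<circ> transpose i (Suc i)" for w :: "nat \<Rightarrow> nat"
        using that by (auto simp: fun_eq_iff transpose_def)
      then show ?thesis using i False by (simp add: S_def permute_def)
    qed
  qed
  then show ?thesis using assms by metis
qed

lemma S_Y_commute:
  assumes "i \<in> V" "j \<in> V" "j \<noteq> i" "j \<noteq> i + 1"
  shows "S i (Y \<kappa> j f) = Y \<kappa> j (S i f)"
proof (cases "i = n")
  case True
  then show ?thesis using assms Y_commute_gam[of j] by (auto simp: S_def in_V fun_eq_iff)
next
  case False
  then show ?thesis using assms Y_commute_swap[of i j \<kappa> f] by (auto simp: S_def in_V fun_eq_iff permute_def)
qed

lemma S_Y_cross: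
  assumes "1 \<le> i" "i + 1 \<le> n"
  shows "S i (Y \<kappa> i f) w - Y \<kappa> (i + 1) (S i f) w = f w"
proof -
  have "i \<noteq> n" "i < n" using assms by auto
  then show ?thesis
    using Y_Suc[of i \<kappa> "permute (transpose i (Suc i)) f" w] assms
    unfolding permute_transpose_twice by (simp add: S_def permute_def comp_assoc algebra_simps)
qed

lemma S_Y_n: "1 \<le> n \<Longrightarrow> S n (Y \<kappa> n f) w + Y \<kappa> n (S n f) w = scale \<kappa> (f w)"
  using Y_gam_anticommute by (simp add: S_def)

lemma Y_Suc_S:
  assumes "1 \<le> i" "i < n"
  shows "Y \<kappa> (Suc i) f = (\<lambda>w. S i (Y \<kappa> i (S i f)) w - S i f w)"
  using Y_Suc[OF assms, of \<kappa> f] assms by (simp add: S_def permute_def fun_eq_iff)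

text \<open>The recursion \<open>Y_Suc_S\<close> expresses \<open>Y (i + 1)\<close> through
  \<open>S i\<close> and \<open>Y i\<close>, both of which commute with \<open>Y j\<close>.\<close>

lemma Y_commute_step:
  assumes i: "1 \<le> i" "i < n" and j: "j \<in> V" "j \<noteq> i" "j \<noteq> Suc i" and f: "f \<in> invariants"
    and comm: "\<And>g. g \<in> invariants \<Longrightarrow> Y \<kappa> j (Y \<kappa> i g) = Y \<kappa> i (Y \<kappa> j g)"
  shows "Y \<kappa> j (Y \<kappa> (Suc i) f) = Y \<kappa> (Suc i) (Y \<kappa> j f)"
proof -
  have iV: "i \<in> V" using i by (simp add: in_V)
  have c: "Y \<kappa> j (S i g) = S i (Y \<kappa> j g)" for g using S_Y_commute[OF iV j(1)] j by simp
  have d: "Y \<kappa> j (\<lambda>w. g w - h w) = (\<lambda>w. Y \<kappa> j g w - Y \<kappa> j h w)" for g h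
    using Y_linear(3)[OF j(1)] by blast
  have "Y \<kappa> j (Y \<kappa> (Suc i) f) = (\<lambda>w. S i (Y \<kappa> j (Y \<kappa> i (S i f))) w - S i (Y \<kappa> j f) w)"
    unfolding Y_Suc_S[OF i] d c ..
  also have "\<dots> = (\<lambda>w. S i (Y \<kappa> i (S i (Y \<kappa> j f))) w - S i (Y \<kappa> j f) w)"
    unfolding comm[OF S_invariant[OF f iV]] c ..
  finally show ?thesis unfolding Y_Suc_S[OF i] .
qed

text \<open>Starting from the pair (1, 2), the larger index is raised with 1 fixed and then the
  smaller one, each time by a transposition that avoids the other index.\<close>

lemma Y_commute_less:
  assumes "f \<in> invariants" "1 \<le> i" "i < j" "j \<le> n"
  shows "Y kappa i (Y kappa j f) = Y kappa j (Y kappa i f)"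
  using assms(2-4,1)
proof (induction i arbitrary: j f rule: nat_induct_at_least)
  case base
  have "2 \<le> j" using base by simp
  then show ?case using base(2,3)
  proof (induction j arbitrary: f rule: nat_induct_at_least)
    case base
    then show ?case using Y_1_2[of f] by simp
  next
    case (Suc j)
    then show ?case by (intro Y_commute_step) (auto simp: in_V)
  qed
next
  case (Suc i)
  have "Y kappa j (Y kappa (Suc i) f) = Y kappa (Suc i) (Y kappa j f)"
  proof (rule Y_commute_step)
    show "Y kappa j (Y kappa i g) = Y kappa i (Y kappa j g)" if "g \<in> invariants" for g
      using Suc.IH[of j g] Suc.prems that by simp
  qed (use Suc.prems Suc.hyps in \<open>simp_all add: in_V\<close>)
  then show ?case by (rule sym)
qed

lemma Y_commute:
  assumes "f \<in> invariants" "i \<in> V" "j \<in> V"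
  shows "Y kappa i (Y kappa j f) = Y kappa j (Y kappa i f)"
proof (cases i j rule: linorder_cases)
  case less
  then show ?thesis using Y_commute_less[of f i j] assms by (simp add: in_V)
next
  case greater
  then show ?thesis using Y_commute_less[of f j i] assms by (simp add: in_V)
qed simp

end

section \<open>From the generators to the full stability conditions\<close>

context irreducible_gl_family
begin

text \<open>Adjacent transpositions give all permutations, conjugates of the last generator give
  every gamma_k, and (1 + gamma_k)/2 and (1 - gamma_k)/2 are the block projections. Removing gamma
  and the swaps from \<open>Y r\<close> isolates \<open>hop r\<close>.\<close>

theorem generator_stable_trivial:
  assumes n: "1 \<le> n" and W: "module.subspace (tscale scale) W" "W \<subseteq> invariants"
    and S: "\<And>f i. f \<in> W \<Longrightarrow> i \<in> V \<Longrightarrow> S i f \<in> W"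
    and Y: "\<And>f i. f \<in> W \<Longrightarrow> i \<in> V \<Longrightarrow> Y \<kappa> i f \<in> W"
  shows "W = {0} \<or> W = invariants"
proof -
  interpret t: vector_space "tscale scale" by (rule vector_space_tscale)
  note sub = t.subspace_add[OF W(1)] t.subspace_diff[OF W(1)] t.subspace_scale[OF W(1)] t.subspace_sum[OF W(1)]
    t.subspace_neg[OF W(1)]
  have adj: "permute (transpose i (Suc i)) f \<in> W" if "f \<in> W" "1 \<le> i" "i < n" for f i
    using S[OF that(1), of i] that by (simp add: S_def in_V)
  \<comment> \<open>A transposition of distant positions is a shorter one conjugated by an adjacent
    one.\<close>
  have trans: "permute (transpose a (Suc (a + d))) f \<in> W" if "f \<in> W" "1 \<le> a" "a + d < n" for a d f
    using that
  proof (induction d arbitrary: f)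
    case 0
    then show ?case using adj by simp
  next
    case (Suc d)
    let ?b = "Suc (a + d)"
    have 1: "permute (transpose ?b (Suc ?b)) f \<in> W" by (rule adj) (use Suc.prems in auto)
    have 2: "permute (transpose a ?b) (permute (transpose ?b (Suc ?b)) f) \<in> W"
      by (rule Suc.IH[OF 1]) (use Suc.prems in auto)
    have "permute (transpose ?b (Suc ?b)) (permute (transpose a ?b) (permute (transpose ?b (Suc ?b)) f)) \<in> W"
      by (rule adj[OF 2]) (use Suc.prems in auto)
    moreover have "transpose ?b (Suc ?b) \<circ> (transpose a ?b \<circ> transpose ?b (Suc ?b)) = transpose a (Suc ?b)"
      by (auto simp: fun_eq_iff transpose_def)
    ultimately show ?case by (simp add: permute_twice)
  qed
  have trans': "permute (transpose a b) f \<in> W" if "f \<in> W" "a \<in> V" "b \<in> V" "a < b" for a b f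
    using trans[of f a "b - a - 1"] that by (auto simp: in_V)
  have swapW: "permute (transpose a b) f \<in> W" if "f \<in> W" "a \<in> V" "b \<in> V" for a b f
  proof (cases a b rule: linorder_cases)
    case less
    then show ?thesis using trans' that by blast
  next
    case equal
    then show ?thesis using that by (simp only: permute_def transpose_same comp_id)
  next
    case greater
    then show ?thesis using trans'[of f b a] that by (simp add: transpose_commute[of a b])
  qed
  have perm: "permute \<sigma> f \<in> W" if f: "f \<in> W" and \<sigma>: "\<sigma> permutes V" for \<sigma> f
    using \<sigma> finite_V
  proof (induction rule: permutes_induct)
    case id
    then show ?case using f by (simp only: permute_def comp_id)
  next
    case (swap a b p)
    show ?case unfolding permute_twice[symmetric] using swap by (intro swapW) auto
  qed
  have gam: "gam k f \<in> W" if f: "f \<in> W" and k: "k \<in> V" for k f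
  proof -
    have nV: "n \<in> V" using n by (simp add: in_V)
    have "permute (transpose k n) (S n (permute (transpose k n) f)) \<in> W"
      using f k nV by (intro swapW S)
    moreover have "permute (transpose k n) (S n (permute (transpose k n) f)) = gam k f"
      by (simp add: S_def gam_def weight_def permute_def comp_assoc fun_eq_iff)
    ultimately show ?thesis by simp
  qed
  have mask: "(\<lambda>w. if blk (w k) = e then f w else 0) \<in> W" if f: "f \<in> W" and k: "k \<in> V" for k e f
  proof -
    have "tscale scale (1/2) (f + tscale scale (sg e) (gam k f)) \<in> W"
      by (intro sub f gam k)
    moreover have "tscale scale (1/2) (f + tscale scale (sg e) (gam k f)) = (\<lambda>w. if blk (w k) = e then f w else 0)"
    proof
      fix w
      have "scale (1/2) (f w + f w) = f w" by (simp add: scale_right_distrib flip: scale_left_distrib)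
      then show "tscale scale (1/2) (f + tscale scale (sg e) (gam k f)) w = (if blk (w k) = e then f w else 0)"
        by (auto simp: tscale_def gam_def weight_def sg_def)
    qed
    ultimately show ?thesis by simp
  qed
  have blks: "(\<lambda>w. if \<forall>k\<in>T. blk (w k) = \<epsilon> k then f w else 0) \<in> W" if f: "f \<in> W" and "finite T" "T \<subseteq> V" for T \<epsilon> f
    using that(2,3)
  proof (induction T rule: finite_induct)
    case empty
    then show ?case using f by simp
  next
    case (insert k T)
    have "(\<lambda>w. if blk (w k) = \<epsilon> k then (if \<forall>k\<in>T. blk (w k) = \<epsilon> k then f w else 0) else 0) \<in> W"
      using mask[OF insert.IH, of k "\<epsilon> k"] insert.prems by simp
    moreover have "(\<lambda>w. if blk (w k) = \<epsilon> k then (if \<forall>k\<in>T. blk (w k) = \<epsilon> k then f w else 0) else 0)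
       = (\<lambda>w. if \<forall>k\<in>insert k T. blk (w k) = \<epsilon> k then f w else 0)"
      by (rule ext) simp
    ultimately show ?case by (simp only:)
  qed
  have same: "same_swap j l f \<in> W" "opp_swap j l f \<in> W" if f: "f \<in> W" and jl: "j \<in> V" "l \<in> V" for j l f
  proof -
    let ?g = "permute (transpose j l) f"
    have g: "?g \<in> W" by (rule swapW[OF f jl])
    have "tscale scale (1/2) (?g + gam j (gam l ?g)) \<in> W" "tscale scale (1/2) (?g - gam j (gam l ?g)) \<in> W"
      by (intro sub g gam jl)+
    moreover have "tscale scale (1/2) (?g + gam j (gam l ?g)) = same_swap j l f" "tscale scale (1/2) (?g - gam j (gam l ?g)) = opp_swap j l f"
    proof -
      have h: "scale (1/2) (x + x) = x" for x :: 'a by (simp add: scale_right_distrib flip: scale_left_distrib)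
      show "tscale scale (1/2) (?g + gam j (gam l ?g)) = same_swap j l f" "tscale scale (1/2) (?g - gam j (gam l ?g)) = opp_swap j l f"
        by (auto simp: fun_eq_iff tscale_def gam_def weight_def sg_def permute_def same_swap_def opp_swap_def h)
    qed
    ultimately show "same_swap j l f \<in> W" "opp_swap j l f \<in> W" by simp_all
  qed
  have sum_fun: "(\<Sum>l\<in>L. F l) w = (\<Sum>l\<in>L. F l w)" for L :: "nat set" and F :: "nat \<Rightarrow> 'a tensor" and w
    by (induction L rule: infinite_finite_induct) auto
  have hop: "hop r f \<in> W" if f: "f \<in> W" and r: "r \<in> V" for r f
  proof -
    have "tscale scale (\<kappa> / 2) (gam r f) + (\<Sum>l\<in>{r<..n}. same_swap r l f) - (\<Sum>l\<in>{1..<r}. opp_swap r l f) - Y \<kappa> r f \<in> W"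
      by (intro sub gam same Y f r) (use r in \<open>auto simp: in_V\<close>)
    moreover have "tscale scale (\<kappa> / 2) (gam r f) + (\<Sum>l\<in>{r<..n}. same_swap r l f) - (\<Sum>l\<in>{1..<r}. opp_swap r l f) - Y \<kappa> r f = hop r f"
    proof
      fix w
      show "(tscale scale (\<kappa> / 2) (gam r f) + (\<Sum>l\<in>{r<..n}. same_swap r l f) - (\<Sum>l\<in>{1..<r}. opp_swap r l f) - Y \<kappa> r f) w = hop r f w"
        by (simp add: Y_def tscale_def sum_fun)
    qed
    ultimately show ?thesis by simp
  qed
  interpret stable_subspace scale N n blk E cst W
  proof
    show "(\<lambda>w. f (w \<circ> \<sigma>)) \<in> W" if "f \<in> W" "\<sigma> permutes V" for f \<sigma>
      using perm[OF that] by (simp add: permute_def)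
    show "(\<lambda>w. if \<forall>k\<in>V. blk (w k) = \<epsilon> k then f w else 0) \<in> W" if "f \<in> W" for f \<epsilon>
      using blks[OF that finite_V subset_refl] .
  qed (use W hop in auto)
  show ?thesis by (rule stable_subspace_trivial)
qed

end

section \<open>Representations of algebras given by generators and relations\<close>

text \<open>Linearity is demanded on \<open>U\<close> alone, so later arguments keep all their
  vectors inside \<open>U\<close>.\<close>

locale generator_action = vector_space sc
  for sc :: "complex \<Rightarrow> 'v::ab_group_add \<Rightarrow> 'v" +
  fixes G :: "'g set" and U :: "'v set" and op :: "'g \<Rightarrow> 'v \<Rightarrow> 'v"
  assumes U: "subspace U"
    and op_closed: "g \<in> G \<Longrightarrow> v \<in> U \<Longrightarrow> op g v \<in> U"
    and op_add: "g \<in> G \<Longrightarrow> v \<in> U \<Longrightarrow> w \<in> U \<Longrightarrow> op g (v + w) = op g v + op g w"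
    and op_scale: "g \<in> G \<Longrightarrow> v \<in> U \<Longrightarrow> op g (sc c v) = sc c (op g v)"
begin

abbreviation "A \<equiv> free_algebra G"

lemma carrier_A: "f \<in> carrier A \<longleftrightarrow> (\<forall>w\<in>Poly_Mapping.keys f. set (letters w) \<subseteq> G)"
  by (simp add: free_algebra_def)

lemma A_ops: "f \<oplus>\<^bsub>A\<^esub> g = f + g" "f \<otimes>\<^bsub>A\<^esub> g = f * g" "\<zero>\<^bsub>A\<^esub> = 0" "\<one>\<^bsub>A\<^esub> = 1"
  by (simp_all add: free_algebra_def)

definition eval_word :: "'g list \<Rightarrow> 'v \<Rightarrow> 'v" where
  "eval_word gs v = foldr op gs v"

definition evaluate :: "('g fword \<Rightarrow>\<^sub>0 complex) \<Rightarrow> 'v \<Rightarrow> 'v" where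
  "evaluate f v = (\<Sum>w\<in>Poly_Mapping.keys f. sc (Poly_Mapping.lookup f w) (eval_word (letters w) v))"

lemma eval_word_closed: "set gs \<subseteq> G \<Longrightarrow> v \<in> U \<Longrightarrow> eval_word gs v \<in> U"
  unfolding eval_word_def by (induction gs) (auto intro: op_closed)

lemma eval_word_add: "set gs \<subseteq> G \<Longrightarrow> v \<in> U \<Longrightarrow> w \<in> U \<Longrightarrow> eval_word gs (v + w) = eval_word gs v + eval_word gs w"
proof (induction gs)
  case (Cons g gs)
  then show ?case using op_add[of g "eval_word gs v" "eval_word gs w"] eval_word_closed[of gs]
    by (simp add: eval_word_def)
qed (simp add: eval_word_def)

lemma eval_word_scale: "set gs \<subseteq> G \<Longrightarrow> v \<in> U \<Longrightarrow> eval_word gs (sc c v) = sc c (eval_word gs v)"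
proof (induction gs)
  case (Cons g gs)
  then show ?case using op_scale[of g "eval_word gs v" c] eval_word_closed[of gs]
    by (simp add: eval_word_def)
qed (simp add: eval_word_def)

lemma eval_word_sum:
  assumes gs: "set gs \<subseteq> G" and F: "\<And>x. x \<in> X \<Longrightarrow> F x \<in> U"
  shows "eval_word gs (sum F X) = (\<Sum>x\<in>X. eval_word gs (F x))"
proof -
  have z: "eval_word gs 0 = 0" using eval_word_scale[OF gs subspace_0[OF U], of 0] by simp
  show ?thesis using F
  proof (induction X rule: infinite_finite_induct)
    case (insert x X)
    then show ?case using eval_word_add[OF gs, of "F x" "sum F X"] subspace_sum[OF U, of X F] by simp
  qed (simp_all add: z)
qed

lemma evaluate_closed: "f \<in> carrier A \<Longrightarrow> v \<in> U \<Longrightarrow> evaluate f v \<in> U"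
  unfolding evaluate_def carrier_A using U
  by (intro subspace_sum subspace_scale) (auto intro: eval_word_closed)

lemma evaluate_vector:
  assumes "f \<in> carrier A" "v \<in> U"
  shows "w \<in> U \<Longrightarrow> evaluate f (v + w) = evaluate f v + evaluate f w"
    and "evaluate f (sc c v) = sc c (evaluate f v)"
  using assms unfolding evaluate_def carrier_A
  by (simp_all add: eval_word_add eval_word_scale scale_right_distrib sum.distrib scale_sum_right mult.commute)

lemma evaluate_add: "evaluate (f + g) v = evaluate f v + evaluate g v"
  unfolding evaluate_def by (rule setsum_keys_plus_distrib) (simp_all add: scale_left_distrib)

lemma evaluate_zero: "evaluate 0 v = 0" by (simp add: evaluate_def)

lemma evaluate_minus: "evaluate (- f) v = - evaluate f v"
  using evaluate_add[of f "- f" v] by (simp add: evaluate_zero add_eq_0_iff)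

lemma evaluate_diff: "evaluate (f - g) v = evaluate f v - evaluate g v"
  using evaluate_add[of f "- g" v] by (simp add: evaluate_minus)

lemma evaluate_sum: "evaluate (sum F X) v = (\<Sum>x\<in>X. evaluate (F x) v)"
  by (induction X rule: infinite_finite_induct) (simp_all add: evaluate_zero evaluate_add)

lemma evaluate_single: "evaluate (Poly_Mapping.single w c) v = sc c (eval_word (letters w) v)"
  by (simp add: evaluate_def)

lemma evaluate_letter: "evaluate (letter g) v = op g v"
  by (simp add: letter_def evaluate_single eval_word_def)

lemma evaluate_const: "evaluate (const c) v = sc c v"
  by (simp add: const_def evaluate_single eval_word_def zero_fword_def)

lemma evaluate_one: "evaluate 1 v = v"
  using evaluate_const[of 1 v] by (simp add: const_def)

lemma poly_mapping_sum_singles: "f = (\<Sum>w\<in>Poly_Mapping.keys f. Poly_Mapping.single w (Poly_Mapping.lookup f w))"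
proof (rule poly_mapping_eqI)
  fix k
  have "(\<Sum>w\<in>Poly_Mapping.keys f. Poly_Mapping.lookup (Poly_Mapping.single w (Poly_Mapping.lookup f w)) k)
    = (\<Sum>w\<in>Poly_Mapping.keys f. if w = k then Poly_Mapping.lookup f k else 0)"
    by (rule sum.cong) (auto simp: lookup_single)
  then show "Poly_Mapping.lookup f k = Poly_Mapping.lookup (\<Sum>w\<in>Poly_Mapping.keys f. Poly_Mapping.single w (Poly_Mapping.lookup f w)) k"
    by (simp add: lookup_sum in_keys_iff)
qed

text \<open>Both factors are expanded into words, on which concatenation is composition.
  Distributing a word of the left factor over the sum for the right one requires all summands to lie
  in \<open>U\<close>.\<close>

lemma evaluate_mult:
  assumes f: "f \<in> carrier A" and g: "g \<in> carrier A" and v: "v \<in> U"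
  shows "evaluate (f * g) v = evaluate f (evaluate g v)"
proof -
  let ?kf = "Poly_Mapping.keys f" and ?kg = "Poly_Mapping.keys g"
  let ?lf = "Poly_Mapping.lookup f" and ?lg = "Poly_Mapping.lookup g"
  have "f * g = (\<Sum>a\<in>?kf. \<Sum>b\<in>?kg. Poly_Mapping.single (a + b) (?lf a * ?lg b))"
    using arg_cong2[where f = "(*)", OF poly_mapping_sum_singles[of f] poly_mapping_sum_singles[of g]]
    by (simp add: sum_product mult_single)
  then have "evaluate (f * g) v = (\<Sum>a\<in>?kf. \<Sum>b\<in>?kg. sc (?lf a * ?lg b) (eval_word (letters a) (eval_word (letters b) v)))"
    by (simp add: evaluate_sum evaluate_single eval_word_def plus_fword_def)
  also have "\<dots> = (\<Sum>a\<in>?kf. sc (?lf a) (eval_word (letters a) (evaluate g v)))"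
  proof (rule sum.cong[OF refl])
    fix a assume "a \<in> ?kf"
    then have a: "set (letters a) \<subseteq> G" using f by (simp add: carrier_A)
    have b: "eval_word (letters b) v \<in> U" if "b \<in> ?kg" for b
      using that g v by (auto simp: carrier_A intro: eval_word_closed)
    then have b': "sc (?lg b) (eval_word (letters b) v) \<in> U" if "b \<in> ?kg" for b
      using that U by (simp add: subspace_scale)
    have "eval_word (letters a) (evaluate g v) = (\<Sum>b\<in>?kg. sc (?lg b) (eval_word (letters a) (eval_word (letters b) v)))"
      unfolding evaluate_def by (simp add: eval_word_sum[OF a b', of ?kg "\<lambda>b. b"] eval_word_scale[OF a b])
    then show "(\<Sum>b\<in>?kg. sc (?lf a * ?lg b) (eval_word (letters a) (eval_word (letters b) v))) = sc (?lf a) (eval_word (letters a) (evaluate g v))"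
      by (simp add: scale_sum_right)
  qed
  finally show ?thesis by (simp add: evaluate_def)
qed

text \<open>The elements acting by 0 on \<open>U\<close> form a two-sided ideal.\<close>

lemma evaluate_ideal:
  assumes R: "R \<subseteq> carrier A" and rel: "\<And>r v. r \<in> R \<Longrightarrow> v \<in> U \<Longrightarrow> evaluate r v = 0"
    and h: "h \<in> Idl\<^bsub>A\<^esub> R" and v: "v \<in> U"
  shows "evaluate h v = 0"
proof -
  interpret ring A by (rule ring_free_algebra)
  let ?K = "{f \<in> carrier A. \<forall>v\<in>U. evaluate f v = 0}"
  have "ideal ?K A"
  proof (rule idealI[OF ring_axioms])
    show "subgroup ?K (add_monoid A)"
    proof (rule add.subgroupI)
      show "?K \<noteq> {}" using zero_closed by (auto simp: A_ops evaluate_zero)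
      fix f assume f: "f \<in> ?K"
      have "- f \<in> carrier A" using f by (simp add: carrier_A in_keys_iff)
      moreover have "\<ominus>\<^bsub>A\<^esub> f = - f"
        by (rule minus_equality) (use f \<open>- f \<in> carrier A\<close> in \<open>auto simp: A_ops\<close>)
      ultimately show "\<ominus>\<^bsub>A\<^esub> f \<in> ?K" using f by (simp add: evaluate_minus)
      fix g assume "g \<in> ?K"
      then show "f \<oplus>\<^bsub>A\<^esub> g \<in> ?K" using f a_closed[of f g] by (simp add: A_ops evaluate_add)
    qed auto
    fix f g assume f: "f \<in> ?K" and g: "g \<in> carrier A"
    have z: "evaluate g 0 = 0" using evaluate_vector(2)[OF g subspace_0[OF U], of 0] by simp
    show "g \<otimes>\<^bsub>A\<^esub> f \<in> ?K" "f \<otimes>\<^bsub>A\<^esub> g \<in> ?K"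
      using f g m_closed[of g f] m_closed[of f g] evaluate_mult evaluate_closed[OF g] z by (auto simp: A_ops)
  qed
  moreover have "R \<subseteq> ?K" using R rel by auto
  ultimately have "Idl\<^bsub>A\<^esub> R \<subseteq> ?K" by (rule genideal_minimal)
  with h v show ?thesis by blast
qed

lemma letter_closed: "g \<in> G \<Longrightarrow> letter g \<in> carrier A"
  by (simp add: carrier_A letter_def)

lemma mult_closed: "f \<in> carrier A \<Longrightarrow> g \<in> carrier A \<Longrightarrow> f * g \<in> carrier A"
  using ring.ring_simprules(5)[OF ring_free_algebra, of f G g] by (simp add: A_ops)

lemma evaluate_letter_mult: "g \<in> G \<Longrightarrow> f \<in> carrier A \<Longrightarrow> v \<in> U \<Longrightarrow> evaluate (letter g * f) v = op g (evaluate f v)"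
  by (simp add: evaluate_mult letter_closed evaluate_letter)

theorem presented_representation:
  assumes R: "R \<subseteq> carrier A" and rel: "\<And>r v. r \<in> R \<Longrightarrow> v \<in> U \<Longrightarrow> evaluate r v = 0"
  defines "I \<equiv> Idl\<^bsub>A\<^esub> R"
  shows "\<exists>\<Phi>. algebra_representation sc (A Quot I) (\<lambda>c. I +>\<^bsub>A\<^esub> const c) U \<Phi> \<and>
    (\<forall>g\<in>G. \<forall>v\<in>U. \<Phi> (I +>\<^bsub>A\<^esub> letter g) v = op g v)"
proof -
  interpret ring A by (rule ring_free_algebra)
  interpret I: ideal I A unfolding I_def by (rule genideal_ideal[OF R])
  \<comment> \<open>A class acts through an arbitrary representative; \<open>evaluate_ideal\<close>
    makes the choice irrelevant on \<open>U\<close>.\<close>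
  define \<Phi> where "\<Phi> X = evaluate (SOME f. f \<in> X)" for X
  have \<Phi>: "\<Phi> (I +>\<^bsub>A\<^esub> f) v = evaluate f v" if f: "f \<in> carrier A" and v: "v \<in> U" for f v
  proof -
    have "f \<in> I +>\<^bsub>A\<^esub> f" by (rule I.a_rcos_self[OF f])
    then have "(SOME g. g \<in> I +>\<^bsub>A\<^esub> f) \<in> I +>\<^bsub>A\<^esub> f" by (rule someI)
    then obtain h where "h \<in> I" "(SOME g. g \<in> I +>\<^bsub>A\<^esub> f) = h \<oplus>\<^bsub>A\<^esub> f"
      by (auto simp: a_r_coset_def')
    then show ?thesis
      using evaluate_ideal[OF R rel _ v, of h] unfolding \<Phi>_def I_def by (simp add: A_ops evaluate_add)
  qed
  have carr: "\<exists>f\<in>carrier A. X = I +>\<^bsub>A\<^esub> f" if "X \<in> carrier (A Quot I)" for X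
    using that by (auto simp: FactRing_def A_RCOSETS_def')
  have const_carr: "const c \<in> carrier A" for c
    by (simp add: carrier_A const_def zero_fword_def)
  have "algebra_representation sc (A Quot I) (\<lambda>c. I +>\<^bsub>A\<^esub> const c) U \<Phi>"
  proof (unfold_locales, goal_cases)
    case 1 show ?case by (rule U)
  next
    case (2 a v) then show ?case using carr[of a] \<Phi> evaluate_closed by force
  next
    case (3 a v w) then show ?case using carr[of a] \<Phi> evaluate_vector subspace_add[OF U] by force
  next
    case (4 a v c) then show ?case using carr[of a] \<Phi> evaluate_vector subspace_scale[OF U] by force
  next
    case (5 a b v)
    obtain f g where fg: "f \<in> carrier A" "a = I +>\<^bsub>A\<^esub> f" "g \<in> carrier A" "b = I +>\<^bsub>A\<^esub> g"
      using carr 5 by metis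
    then have "a \<oplus>\<^bsub>A Quot I\<^esub> b = I +>\<^bsub>A\<^esub> (f + g)"
      using I.a_rcos_sum[of f g] by (simp add: FactRing_def A_ops)
    then show ?case using fg 5 \<Phi> a_closed[of f g] by (simp add: A_ops evaluate_add)
  next
    case (6 a b v)
    obtain f g where fg: "f \<in> carrier A" "a = I +>\<^bsub>A\<^esub> f" "g \<in> carrier A" "b = I +>\<^bsub>A\<^esub> g"
      using carr 6 by metis
    then have "a \<otimes>\<^bsub>A Quot I\<^esub> b = I +>\<^bsub>A\<^esub> (f * g)"
      using I.rcoset_mult_add[of f g] by (simp add: FactRing_def A_ops)
    then show ?case using fg 6 \<Phi> m_closed[of f g] evaluate_closed by (simp add: A_ops evaluate_mult)
  next
    case (7 v) then show ?case using \<Phi>[OF one_closed] by (simp add: FactRing_def A_ops evaluate_one)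
  next
    case (8 v c) then show ?case using \<Phi>[OF const_carr] by (simp add: evaluate_const)
  qed
  moreover have "\<Phi> (I +>\<^bsub>A\<^esub> letter g) v = op g v" if "g \<in> G" "v \<in> U" for g v
  proof -
    have "letter g \<in> carrier A" using that by (simp add: carrier_A letter_def)
    then show ?thesis using \<Phi> that by (simp add: evaluate_letter)
  qed
  ultimately show ?thesis by blast
qed

end

section \<open>The Etingof-Freund-Ma functor in coordinates\<close>

lemma matrix_unit_carrier [simp]: "matrix_unit N a b \<in> carrier_mat N N"
  by (simp add: matrix_unit_def)

lemma matrix_unit_index [simp]:
  "i < N \<Longrightarrow> j < N \<Longrightarrow> matrix_unit N a b $$ (i, j) = (if i = a \<and> j = b then 1 else 0)"
  by (simp add: matrix_unit_def)

lemma matrix_unit_mult: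
  assumes "a < N" "b < N" "c < N" "d < N"
  shows "matrix_unit N a b * matrix_unit N c d = (if b = c then matrix_unit N a d else 0\<^sub>m N N)"
proof (rule eq_matI)
  fix i j assume "i < dim_row (if b = c then matrix_unit N a d else 0\<^sub>m N N)"
    "j < dim_col (if b = c then matrix_unit N a d else 0\<^sub>m N N)"
  then have ij: "i < N" "j < N" by (auto simp: matrix_unit_def split: if_splits)
  have "(matrix_unit N a b * matrix_unit N c d) $$ (i, j) = (\<Sum>k<N. matrix_unit N a b $$ (i, k) * matrix_unit N c d $$ (k, j))"
    using ij by (simp add: matrix_unit_def scalar_prod_def atLeast0LessThan)
  also have "\<dots> = (\<Sum>k<N. if k = b then if i = a \<and> b = c \<and> j = d then 1 else 0 else 0)"
    by (rule sum.cong) (use ij in auto)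
  also have "\<dots> = (if b = c then matrix_unit N a d else 0\<^sub>m N N) $$ (i, j)"
    using ij assms by auto
  finally show "(matrix_unit N a b * matrix_unit N c d) $$ (i, j) = (if b = c then matrix_unit N a d else 0\<^sub>m N N) $$ (i, j)" .
qed (auto simp: matrix_unit_def)

context gl_module
begin

lemma rho_zero: "\<rho> (0\<^sub>m N N) m = 0"
proof -
  have "(0\<^sub>m N N :: complex mat) = 0 \<cdot>\<^sub>m 0\<^sub>m N N" by (intro eq_matI) auto
  then show ?thesis using scale_matrix[of "0\<^sub>m N N" 0 m] by simp
qed

lemma rho_minus:
  assumes "A \<in> carrier_mat N N" "B \<in> carrier_mat N N"
  shows "\<rho> (A - B) m = \<rho> A m - \<rho> B m"
proof -
  have "A - B = A + (-1) \<cdot>\<^sub>m B" using assms by (intro eq_matI) auto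
  then show ?thesis using add_matrix[of A "(-1) \<cdot>\<^sub>m B" m] scale_matrix[of B "-1" m] assms by simp
qed

text \<open>Additivity is applied entry by entry, over growing sets of index pairs.\<close>

lemma rho_expand:
  assumes A: "A \<in> carrier_mat N N"
  shows "\<rho> A m = (\<Sum>a<N. \<Sum>b<N. scale (A $$ (a, b)) (\<rho> (matrix_unit N a b) m))"
proof -
  let ?M = "\<lambda>S. mat N N (\<lambda>x. if x \<in> S then A $$ x else 0)"
  have "\<rho> (?M S) m = (\<Sum>x\<in>S. scale (A $$ x) (\<rho> (matrix_unit N (fst x) (snd x)) m))"
    if "finite S" "S \<subseteq> {..<N} \<times> {..<N}" for S
    using that
  proof (induction S rule: finite_induct)
    case empty
    have "?M {} = 0\<^sub>m N N" by (intro eq_matI) auto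
    then show ?case by (simp add: rho_zero)
  next
    case (insert x S)
    have "?M (insert x S) = A $$ x \<cdot>\<^sub>m matrix_unit N (fst x) (snd x) + ?M S"
      using insert by (intro eq_matI) (auto simp: matrix_unit_def)
    then show ?case using insert by (simp add: add_matrix scale_matrix)
  qed
  from this[of "{..<N} \<times> {..<N}"] have "\<rho> (?M ({..<N} \<times> {..<N})) m = (\<Sum>x\<in>{..<N} \<times> {..<N}. scale (A $$ x) (\<rho> (matrix_unit N (fst x) (snd x)) m))"
    by simp
  moreover have "?M ({..<N} \<times> {..<N}) = A" using A by (intro eq_matI) auto
  ultimately show ?thesis by (simp add: sum_pairs)
qed

lemma rho_matrix_unit_comm:
  assumes "a < N" "b < N" "c < N" "d < N"
  shows "\<rho> (matrix_unit N a b) (\<rho> (matrix_unit N c d) m) - \<rho> (matrix_unit N c d) (\<rho> (matrix_unit N a b) m)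
    = (if b = c then \<rho> (matrix_unit N a d) m else 0) - (if d = a then \<rho> (matrix_unit N c b) m else 0)"
proof -
  let ?P = "if b = c then matrix_unit N a d else 0\<^sub>m N N" and ?Q = "if d = a then matrix_unit N c b else 0\<^sub>m N N"
  have "?P \<in> carrier_mat N N" "?Q \<in> carrier_mat N N" by auto
  then have "\<rho> (?P - ?Q) m = \<rho> ?P m - \<rho> ?Q m" by (rule rho_minus)
  moreover have "\<rho> (?P - ?Q) m = \<rho> (matrix_unit N a b) (\<rho> (matrix_unit N c d) m) - \<rho> (matrix_unit N c d) (\<rho> (matrix_unit N a b) m)"
    using bracket[of "matrix_unit N a b" "matrix_unit N c d" m]
    unfolding matrix_unit_mult[OF assms] matrix_unit_mult[OF assms(3,4,1,2)] by simp
  ultimately show ?thesis by (auto simp: rho_zero)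
qed

end

text \<open>The scalar \<open>z\<close> of the identity matrix is part of the data because the shift
  is defined from it; Schur's lemma provides it.\<close>

locale efm_setup = gl_module "p + q" scale \<rho>
  for p q :: nat and scale :: "complex \<Rightarrow> 'm::ab_group_add \<Rightarrow> 'm" and \<rho> :: "complex mat \<Rightarrow> 'm \<Rightarrow> 'm" +
  fixes n :: nat and \<mu> z :: complex
  assumes n: "1 \<le> n" and p: "1 \<le> p" and q: "1 \<le> q"
    and fd: "finite_dimensional scale"
    and irr: "irreducible_under scale UNIV (\<rho> ` carrier_mat (p + q) (p + q))"
    and z: "\<rho> (1\<^sub>m (p + q)) m = scale z m"
begin

abbreviation "N \<equiv> p + q"

text \<open>The scalar shift makes the identity matrix act by \<open>1\<close>; it changes neither the commutators nor
  the off-diagonal units.\<close>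

definition unit_op :: "nat \<Rightarrow> nat \<Rightarrow> 'm \<Rightarrow> 'm" where
  "unit_op a b m = \<rho> (matrix_unit N a b) m + (if a = b then scale ((1 - z) / of_nat N) m else 0)"

text \<open>The value of the shifted E_aa on invariant tensors: \<mu> times \<chi>(E_aa), plus an
  equal share of the scalar 1 + n of the total identity, of which 1 comes from the module and n from
  the factors.\<close>

definition eigenvalue :: "bool \<Rightarrow> complex" where
  "eigenvalue e = \<mu> * (if e then of_nat q else - of_nat p) + (1 + of_nat n) / of_nat N"

lemma N_pos: "0 < N" "of_nat N \<noteq> (0 :: complex)"
proof -
  show "0 < N" using p by simp
  then show "of_nat N \<noteq> (0 :: complex)" by (simp only: of_nat_eq_0_iff)
qed

lemma rho_linear:
  assumes "A \<in> carrier_mat N N"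
  shows "\<rho> A (x + y) = \<rho> A x + \<rho> A y" "\<rho> A (scale c x) = scale c (\<rho> A x)" "\<rho> A 0 = 0" "\<rho> A (- x) = - \<rho> A x"
proof -
  interpret L: Vector_Spaces.linear scale scale "\<rho> A" by (rule linear_vector[OF assms])
  show "\<rho> A (x + y) = \<rho> A x + \<rho> A y" "\<rho> A (scale c x) = scale c (\<rho> A x)" "\<rho> A 0 = 0" "\<rho> A (- x) = - \<rho> A x"
    by (rule L.add L.scale L.zero L.neg)+
qed

lemma rho_from_unit_op: "\<rho> (matrix_unit N a b) m = unit_op a b m - (if a = b then scale ((1 - z) / of_nat N) m else 0)"
  by (simp add: unit_op_def)

sublocale G: gl_family scale N n "\<lambda>a. a < p" unit_op eigenvalue
proof (rule gl_family.intro[OF complex_vector_space_axioms], rule gl_family_axioms.intro)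
  fix a b c d m assume ab: "a < N" "b < N"
  show "Vector_Spaces.linear scale scale (unit_op a b)"
    unfolding Vector_Spaces.linear_iff
    by (auto simp: unit_op_def rho_linear scale_right_distrib scale_left_commute vector_space_axioms)
  assume cd: "c < N" "d < N"
  have "unit_op a b (unit_op c d m) - unit_op c d (unit_op a b m) =
    \<rho> (matrix_unit N a b) (\<rho> (matrix_unit N c d) m) - \<rho> (matrix_unit N c d) (\<rho> (matrix_unit N a b) m)"
    by (simp add: unit_op_def rho_linear scale_right_distrib scale_left_commute algebra_simps)
  also have "\<dots> = (if b = c then unit_op a d m else 0) - (if d = a then unit_op c b m else 0)"
    unfolding rho_matrix_unit_comm[OF ab cd] by (auto simp: unit_op_def)
  finally show "unit_op a b (unit_op c d m) - unit_op c d (unit_op a b m) = (if b = c then unit_op a d m else 0) - (if d = a then unit_op c b m else 0)" .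
qed

lemma sum_rho_diag: "(\<Sum>a<N. \<rho> (matrix_unit N a a) m) = scale z m"
proof -
  have "\<rho> (1\<^sub>m N) m = (\<Sum>a<N. \<Sum>b<N. if b = a then \<rho> (matrix_unit N a a) m else 0)"
    unfolding rho_expand[OF one_carrier_mat] by (intro sum.cong refl) auto
  then show ?thesis by (simp add: z)
qed

sublocale G: irreducible_gl_family scale N n "\<lambda>a. a < p" unit_op eigenvalue
proof (rule irreducible_gl_family.intro[OF G.gl_family_axioms], rule irreducible_gl_family_axioms.intro)
  fix m
  have "(\<Sum>a<N. unit_op a a m) = scale z m + scale (of_nat N * ((1 - z) / of_nat N)) m"
    by (simp add: unit_op_def sum.distrib sum_rho_diag sum_constant_scale del: of_nat_add)
  also have "\<dots> = m"
    using N_pos by (simp flip: scale_left_distrib del: of_nat_add)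
  finally show "(\<Sum>a<N. unit_op a a m) = m" .
next
  fix W assume W: "subspace W" and st: "\<And>a b m. a < N \<Longrightarrow> b < N \<Longrightarrow> m \<in> W \<Longrightarrow> unit_op a b m \<in> W"
  have u: "\<rho> (matrix_unit N a b) m \<in> W" if "a < N" "b < N" "m \<in> W" for a b m
    unfolding rho_from_unit_op using W st that by (auto intro!: subspace_diff subspace_scale subspace_0)
  have "\<rho> A m \<in> W" if "A \<in> carrier_mat N N" "m \<in> W" for A m
    unfolding rho_expand[OF that(1)] using W u that by (intro subspace_sum subspace_scale) auto
  then show "W = {0} \<or> W = UNIV" using irr W unfolding irreducible_under_def by blast
next
  fix Z assume Z: "Vector_Spaces.linear scale scale Z"
    and comm: "\<And>a b m. a < N \<Longrightarrow> b < N \<Longrightarrow> unit_op a b (Z m) = Z (unit_op a b m)"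
  interpret Z: Vector_Spaces.linear scale scale Z by (rule Z)
  have u: "\<rho> (matrix_unit N a b) (Z m) = Z (\<rho> (matrix_unit N a b) m)" if "a < N" "b < N" for a b m
    unfolding rho_from_unit_op using comm[OF that] by (simp add: Z.diff Z.scale Z.zero)
  show "\<exists>c. \<forall>m. Z m = scale c m"
  proof (rule schur[OF fd irr _ Z])
    fix t assume "t \<in> \<rho> ` carrier_mat N N"
    then obtain A where A: "A \<in> carrier_mat N N" "t = \<rho> A" by blast
    show "Vector_Spaces.linear scale scale t" unfolding A by (rule linear_vector[OF A(1)])
    show "t (Z m) = Z (t m)" for m
      unfolding A(2) rho_expand[OF A(1)] by (simp add: u Z.sum Z.scale)
  qed
qed

lemma tensor_space_eq: "(tensor_space N n :: 'm tensor set) = supported G.MI"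
  by (simp add: tensor_space_def supported_def multi_indices_def index_set_def G.V_def)

lemma multi_indices_eq: "multi_indices N n = G.MI"
  by (simp add: multi_indices_def index_set_def G.V_def)

definition total_unit :: "nat \<Rightarrow> nat \<Rightarrow> 'm tensor \<Rightarrow> 'm tensor" where
  "total_unit a b v w = \<rho> (matrix_unit N a b) (v w) + (\<Sum>k\<in>G.V. if w k = a then v (w(k := b)) else 0)"

lemma gl_action_expand:
  assumes A: "A \<in> carrier_mat N N" and w: "w \<in> G.MI"
  shows "gl_action N n scale \<rho> A v w = (\<Sum>a<N. \<Sum>b<N. scale (A $$ (a, b)) (total_unit a b v w))"
proof -
  have "(\<Sum>k\<in>{1..n}. on_factor N n scale k A v) w = (\<Sum>k\<in>G.V. on_factor N n scale k A v w)"
    unfolding G.V_def by (induction rule: finite_induct[OF finite_atLeastAtMost]) auto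
  also have "\<dots> = (\<Sum>k\<in>G.V. \<Sum>a<N. \<Sum>b<N. if w k = a then scale (A $$ (a, b)) (v (w(k := b))) else 0)"
  proof (rule sum.cong[OF refl])
    fix k assume k: "k \<in> G.V"
    have wk: "w k < N" using w k by (rule G.MI_lt)
    have "on_factor N n scale k A v w = (\<Sum>b<N. scale (A $$ (w k, b)) (v (w(k := b))))"
      using w by (simp add: on_factor_def multi_indices_eq)
    also have "\<dots> = (\<Sum>b<N. \<Sum>a<N. if a = w k then scale (A $$ (w k, b)) (v (w(k := b))) else 0)"
      using wk by simp
    also have "\<dots> = (\<Sum>a<N. \<Sum>b<N. if w k = a then scale (A $$ (a, b)) (v (w(k := b))) else 0)"
      by (subst sum.swap) (auto intro!: sum.cong)
    finally show "on_factor N n scale k A v w = (\<Sum>a<N. \<Sum>b<N. if w k = a then scale (A $$ (a, b)) (v (w(k := b))) else 0)" .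
  qed
  also have "\<dots> = (\<Sum>a<N. \<Sum>b<N. scale (A $$ (a, b)) (\<Sum>k\<in>G.V. if w k = a then v (w(k := b)) else 0))"
    by (subst sum_swap3) (auto simp: scale_sum_right intro!: sum.cong)
  finally show ?thesis
    by (simp add: gl_action_def on_zeroth_def rho_expand[OF A] total_unit_def scale_right_distrib sum.distrib)
qed

lemma gl_action_outside:
  assumes A: "A \<in> carrier_mat N N" and v: "v \<in> supported G.MI" and w: "w \<notin> G.MI"
  shows "gl_action N n scale \<rho> A v w = 0"
proof -
  have "(\<Sum>k\<in>{1..n}. on_factor N n scale k A v) w = (\<Sum>k\<in>{1..n}. on_factor N n scale k A v w)"
    by (induction rule: finite_induct[OF finite_atLeastAtMost]) auto
  then show ?thesis using assms by (simp add: gl_action_def on_zeroth_def on_factor_def multi_indices_eq supported_def rho_linear)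
qed

definition char_weight :: "nat \<Rightarrow> complex" where
  "char_weight a = (if a < p then of_nat q else - of_nat p)"

lemma sum_split_blocks: "(\<Sum>a<N. h a) = (\<Sum>a<p. h a) + (\<Sum>a<q. h (p + a))" for h :: "nat \<Rightarrow> complex"
proof -
  have "(\<Sum>a<N. h a) = (\<Sum>a\<in>{0..<p}. h a) + (\<Sum>a\<in>{p..<p+q}. h a)"
    by (simp add: sum.atLeastLessThan_concat flip: atLeast0LessThan)
  also have "(\<Sum>a\<in>{p..<p+q}. h a) = (\<Sum>a\<in>{0..<q}. h (a + p))"
    using sum.shift_bounds_nat_ivl[of h 0 p q] by (simp add: add.commute)
  finally show ?thesis by (simp add: atLeast0LessThan add.commute)
qed

lemma block_diag_facts:
  assumes S: "S \<in> carrier_mat p p" and T: "T \<in> carrier_mat q q"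
  shows "block_diag S T \<in> carrier_mat N N"
    and "\<And>a b. a < N \<Longrightarrow> b < N \<Longrightarrow> (a < p) \<noteq> (b < p) \<Longrightarrow> block_diag S T $$ (a, b) = 0"
    and "mtrace (block_diag S T) = (\<Sum>a<N. block_diag S T $$ (a, a))"
    and "chi p q S T = (\<Sum>a<N. char_weight a * block_diag S T $$ (a, a))"
  using assms
  by (auto simp: block_diag_def mtrace_def chi_def char_weight_def sum_split_blocks sum_distrib_left sum_negf)

lemma block_diag_exists:
  assumes A: "A \<in> carrier_mat N N" and off: "\<And>a b. a < N \<Longrightarrow> b < N \<Longrightarrow> (a < p) \<noteq> (b < p) \<Longrightarrow> A $$ (a, b) = 0"
  shows "\<exists>S\<in>carrier_mat p p. \<exists>T\<in>carrier_mat q q. block_diag S T = A"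
proof (intro bexI)
  show "block_diag (mat p p (\<lambda>(i, j). A $$ (i, j))) (mat q q (\<lambda>(i, j). A $$ (i + p, j + p))) = A"
    using A off by (intro eq_matI) (auto simp: block_diag_def)
qed auto

text \<open>Pairs of blocks are replaced by matrices vanishing off the blocks, so that elements can
  be prescribed entrywise.\<close>

lemma EFM_iff:
  "v \<in> EFM n p q \<mu> scale \<rho> \<longleftrightarrow> v \<in> supported G.MI \<and> (\<forall>A\<in>carrier_mat N N.
     (\<forall>a<N. \<forall>b<N. (a < p) \<noteq> (b < p) \<longrightarrow> A $$ (a, b) = 0) \<longrightarrow> (\<Sum>a<N. A $$ (a, a)) = 0 \<longrightarrow>
     (\<forall>w\<in>G.MI. (\<Sum>a<N. \<Sum>b<N. scale (A $$ (a, b)) (total_unit a b v w)) = scale (\<mu> * (\<Sum>a<N. char_weight a * A $$ (a, a))) (v w)))"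
    (is "_ \<longleftrightarrow> _ \<and> ?R v")
proof -
  have act: "gl_action N n scale \<rho> A v = tscale scale c v \<longleftrightarrow>
     (\<forall>w\<in>G.MI. (\<Sum>a<N. \<Sum>b<N. scale (A $$ (a, b)) (total_unit a b v w)) = scale c (v w))"
    if A: "A \<in> carrier_mat N N" and v: "v \<in> supported G.MI" for A :: "complex mat" and c
  proof
    assume L: "gl_action N n scale \<rho> A v = tscale scale c v"
    show "\<forall>w\<in>G.MI. (\<Sum>a<N. \<Sum>b<N. scale (A $$ (a, b)) (total_unit a b v w)) = scale c (v w)"
    proof
      fix w assume "w \<in> G.MI"
      from gl_action_expand[OF A this, of v]
      show "(\<Sum>a<N. \<Sum>b<N. scale (A $$ (a, b)) (total_unit a b v w)) = scale c (v w)"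
        by (simp only: L tscale_def)
    qed
  next
    assume R: "\<forall>w\<in>G.MI. (\<Sum>a<N. \<Sum>b<N. scale (A $$ (a, b)) (total_unit a b v w)) = scale c (v w)"
    show "gl_action N n scale \<rho> A v = tscale scale c v"
    proof
      fix w
      show "gl_action N n scale \<rho> A v w = tscale scale c v w"
        using R gl_action_expand[OF A, of w v] gl_action_outside[OF A v, of w] v
        by (cases "w \<in> G.MI") (auto simp: tscale_def supported_def)
    qed
  qed
  show ?thesis
  proof
    assume L: "v \<in> EFM n p q \<mu> scale \<rho>"
    then have v: "v \<in> supported G.MI" by (simp add: EFM_def tensor_space_eq)
    have "?R v"
    proof (intro ballI impI)
      fix A :: "complex mat" and w assume A: "A \<in> carrier_mat N N" and off: "\<forall>a<N. \<forall>b<N. (a < p) \<noteq> (b < p) \<longrightarrow> A $$ (a, b) = 0"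
        and tr: "(\<Sum>a<N. A $$ (a, a)) = 0" and w: "w \<in> G.MI"
      have "\<exists>S\<in>carrier_mat p p. \<exists>T\<in>carrier_mat q q. block_diag S T = A"
        by (rule block_diag_exists[OF A]) (use off in blast)
      then obtain S T where ST: "S \<in> carrier_mat p p" "T \<in> carrier_mat q q" "block_diag S T = A" by blast
      have "gl_action N n scale \<rho> A v = tscale scale (\<mu> * chi p q S T) v"
        using L ST tr block_diag_facts(3)[OF ST(1,2)] unfolding EFM_def by auto
      then show "(\<Sum>a<N. \<Sum>b<N. scale (A $$ (a, b)) (total_unit a b v w)) = scale (\<mu> * (\<Sum>a<N. char_weight a * A $$ (a, a))) (v w)"
        using act[OF A v] w block_diag_facts(4)[OF ST(1,2)] ST(3) by simp
    qed
    with v show "v \<in> supported G.MI \<and> ?R v" by blast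
  next
    assume "v \<in> supported G.MI \<and> ?R v"
    then have v: "v \<in> supported G.MI" and R: "?R v" by auto
    show "v \<in> EFM n p q \<mu> scale \<rho>"
      unfolding EFM_def tensor_space_eq
    proof (intro CollectI conjI v ballI impI)
      fix S T :: "complex mat" assume S: "S \<in> carrier_mat p p" and T: "T \<in> carrier_mat q q" and tr: "mtrace (block_diag S T) = 0"
      note F = block_diag_facts[OF S T]
      show "gl_action N n scale \<rho> (block_diag S T) v = tscale scale (\<mu> * chi p q S T) v"
        unfolding act[OF F(1) v] F(4) using R F(1,2) tr[unfolded F(3)] by blast
    qed
  qed
qed

text \<open>Restated for the original action: undoing the shift turns the share (1 + n)/N of the
  identity into (z + n)/N.\<close>

lemma invariants_iff:
  "v \<in> G.invariants \<longleftrightarrow> v \<in> supported G.MI \<and> (\<forall>a<N. \<forall>b<N. (a < p) = (b < p) \<longrightarrow> (\<forall>w\<in>G.MI.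
     total_unit a b v w = (if a = b then scale (\<mu> * char_weight a + (z + of_nat n) / of_nat N) (v w) else 0)))"
proof -
  have e: "eigenvalue (a < p) - (1 - z) / of_nat N = \<mu> * char_weight a + (z + of_nat n) / of_nat N" for a
    by (simp add: eigenvalue_def char_weight_def diff_divide_distrib add_divide_distrib del: of_nat_add)
  have "(unit_op a b (v w) = (if a = b then scale (eigenvalue (a < p)) (v w) else 0) - (\<Sum>k\<in>G.V. if w k = a then v (w(k := b)) else 0))
    \<longleftrightarrow> total_unit a b v w = (if a = b then scale (\<mu> * char_weight a + (z + of_nat n) / of_nat N) (v w) else 0)" for a b w
    unfolding e[symmetric] scale_left_diff_distrib unit_op_def total_unit_def by (auto simp: algebra_simps)
  then show ?thesis unfolding G.invariants_def by simp
qed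

lemma sum_total_diag:
  assumes "w \<in> G.MI"
  shows "(\<Sum>a<N. total_unit a a v w) = scale (z + of_nat n) (v w)"
proof -
  have "(\<Sum>a<N. \<Sum>k\<in>G.V. if w k = a then v (w(k := a)) else 0) = (\<Sum>k\<in>G.V. \<Sum>a<N. if a = w k then v w else 0)"
    by (subst sum.swap) (auto intro!: sum.cong)
  also have "\<dots> = (\<Sum>k\<in>G.V. v w)"
    by (rule sum.cong) (use G.MI_lt[OF assms] in auto)
  also have "\<dots> = scale (of_nat n) (v w)"
    by (simp add: sum_constant_scale G.V_def)
  finally show ?thesis by (simp add: total_unit_def sum.distrib sum_rho_diag scale_left_distrib)
qed

text \<open>The functor prescribes only traceless elements, but the identity acts on every tensor by
  z + n; together these determine each diagonal unit. Conversely the share of the identity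
  disappears on traceless matrices.\<close>

theorem EFM_eq_invariants: "EFM n p q \<mu> scale \<rho> = G.invariants"
proof (rule equalityI; rule subsetI)
  fix v assume "v \<in> G.invariants"
  note V = invariants_iff[THEN iffD1, OF this]
  from V have v: "v \<in> supported G.MI" by (rule conjunct1)
  have inv: "\<And>a b w. a < N \<Longrightarrow> b < N \<Longrightarrow> (a < p) = (b < p) \<Longrightarrow> w \<in> G.MI \<Longrightarrow>
     total_unit a b v w = (if a = b then scale (\<mu> * char_weight a + (z + of_nat n) / of_nat N) (v w) else 0)"
    by (rule V[THEN conjunct2, rule_format])
  show "v \<in> EFM n p q \<mu> scale \<rho>"
  proof (rule EFM_iff[THEN iffD2], rule conjI[OF v], rule ballI, rule impI, rule impI, rule ballI)
    fix A :: "complex mat" and w assume A: "A \<in> carrier_mat N N" and off: "\<forall>a<N. \<forall>b<N. (a < p) \<noteq> (b < p) \<longrightarrow> A $$ (a, b) = 0"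
      and tr: "(\<Sum>a<N. A $$ (a, a)) = 0" and w: "w \<in> G.MI"
    let ?c = "(z + of_nat n) / of_nat N"
    have "(\<Sum>a<N. \<Sum>b<N. scale (A $$ (a, b)) (total_unit a b v w))
        = (\<Sum>a<N. \<Sum>b<N. if b = a then scale (A $$ (a, a) * (\<mu> * char_weight a + ?c)) (v w) else 0)"
    proof (intro sum.cong refl)
      fix a b assume "a \<in> {..<N}" "b \<in> {..<N}"
      then have a: "a < N" and b: "b < N" by simp_all
      show "scale (A $$ (a, b)) (total_unit a b v w) = (if b = a then scale (A $$ (a, a) * (\<mu> * char_weight a + ?c)) (v w) else 0)"
      proof (cases "(a < p) = (b < p)")
        case True
        show ?thesis unfolding inv[OF a b True w] by (simp del: of_nat_add)
      next
        case False
        then have "A $$ (a, b) = 0" "b \<noteq> a" using off[rule_format, OF a b] by auto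
        then show ?thesis by simp
      qed
    qed
    also have "\<dots> = scale (\<Sum>a<N. A $$ (a, a) * (\<mu> * char_weight a + ?c)) (v w)"
      by (simp add: scale_sum_left)
    also have "(\<Sum>a<N. A $$ (a, a) * (\<mu> * char_weight a + ?c)) = \<mu> * (\<Sum>a<N. char_weight a * A $$ (a, a)) + (\<Sum>a<N. A $$ (a, a)) * ?c"
      by (simp only: distrib_left sum.distrib sum_distrib_left sum_distrib_right mult_ac)
    finally show "(\<Sum>a<N. \<Sum>b<N. scale (A $$ (a, b)) (total_unit a b v w)) = scale (\<mu> * (\<Sum>a<N. char_weight a * A $$ (a, a))) (v w)"
      using tr by simp
  qed
next
  fix v assume "v \<in> EFM n p q \<mu> scale \<rho>"
  note V = EFM_iff[THEN iffD1, OF this]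
  from V have v: "v \<in> supported G.MI" by (rule conjunct1)
  have R: "\<And>A w. A \<in> carrier_mat N N \<Longrightarrow>
     (\<And>a b. a < N \<Longrightarrow> b < N \<Longrightarrow> (a < p) \<noteq> (b < p) \<Longrightarrow> A $$ (a, b) = 0) \<Longrightarrow> (\<Sum>a<N. A $$ (a, a)) = 0 \<Longrightarrow> w \<in> G.MI \<Longrightarrow>
     (\<Sum>a<N. \<Sum>b<N. scale (A $$ (a, b)) (total_unit a b v w)) = scale (\<mu> * (\<Sum>a<N. char_weight a * A $$ (a, a))) (v w)"
    by (rule V[THEN conjunct2, rule_format])
  have unit_sum: "(\<Sum>c<N. \<Sum>d<N. scale (matrix_unit N a b $$ (c, d)) (h c d)) = h a b" if "a < N" "b < N" for a b and h :: "nat \<Rightarrow> nat \<Rightarrow> 'm"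
  proof -
    have "(\<Sum>c<N. \<Sum>d<N. scale (matrix_unit N a b $$ (c, d)) (h c d)) = (\<Sum>c<N. \<Sum>d<N. if d = b then if c = a then h a b else 0 else 0)"
      by (intro sum.cong refl) auto
    then show ?thesis using that by simp
  qed
  show "v \<in> G.invariants"
  proof (rule invariants_iff[THEN iffD2], intro conjI v allI impI ballI)
    fix a b w assume a: "a < N" and b: "b < N" and ab: "(a < p) = (b < p)" and w: "w \<in> G.MI"
    show "total_unit a b v w = (if a = b then scale (\<mu> * char_weight a + (z + of_nat n) / of_nat N) (v w) else 0)"
    proof (cases "a = b")
      case False
      have d: "matrix_unit N a b $$ (c, c) = 0" if "c < N" for c using that False by auto
      have "(\<Sum>c<N. \<Sum>d<N. scale (matrix_unit N a b $$ (c, d)) (total_unit c d v w)) = scale (\<mu> * (\<Sum>c<N. char_weight c * matrix_unit N a b $$ (c, c))) (v w)"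
        by (rule R) (use d ab w in auto)
      then show ?thesis using unit_sum[OF a b] d False by simp
    next
      case True
      \<comment> \<open>The traceless part of the diagonal unit; \<chi> does not see the subtracted
        multiple of the identity because q p - p q = 0.\<close>
      define B :: "complex mat" where "B = matrix_unit N a a - (1 / of_nat N) \<cdot>\<^sub>m 1\<^sub>m N"
      have B: "B \<in> carrier_mat N N"
        unfolding B_def by (intro minus_carrier_mat smult_carrier_mat one_carrier_mat)
      have A: "B $$ (c, d) = matrix_unit N a a $$ (c, d) - (if d = c then 1 / of_nat N else 0)" if "c < N" "d < N" for c d
        using that by (simp add: B_def matrix_unit_def del: of_nat_add)
      have s1: "(\<Sum>c<N. if c = a then h c else 0) = h a" for h :: "nat \<Rightarrow> complex" using a by simp
      have tr: "(\<Sum>c<N. B $$ (c, c)) = 0"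
      proof -
        have "(\<Sum>c<N. B $$ (c, c)) = (\<Sum>c<N. (if c = a then 1 else 0) - 1 / of_nat N)"
          by (rule sum.cong) (auto simp: A)
        then show ?thesis using a N_pos by (simp add: sum_subtractf del: of_nat_add)
      qed
      have ch: "(\<Sum>c<N. char_weight c * B $$ (c, c)) = char_weight a"
      proof -
        have "(\<Sum>c<N. char_weight c * B $$ (c, c)) = (\<Sum>c<N. (if c = a then char_weight c else 0) - char_weight c / of_nat N)"
          by (rule sum.cong) (auto simp: A algebra_simps)
        also have "\<dots> = char_weight a - (\<Sum>c<N. char_weight c) / of_nat N"
          unfolding sum_subtractf s1 by (simp add: sum_divide_distrib)
        also have "(\<Sum>c<N. char_weight c) = 0"
          unfolding sum_split_blocks by (simp add: char_weight_def)
        finally show ?thesis by simp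
      qed
      have "(\<Sum>c<N. \<Sum>d<N. scale (B $$ (c, d)) (total_unit c d v w)) = scale (\<mu> * (\<Sum>c<N. char_weight c * B $$ (c, c))) (v w)"
        by (rule R[OF B _ tr w]) (auto simp: A)
      moreover have "(\<Sum>c<N. \<Sum>d<N. scale (B $$ (c, d)) (total_unit c d v w)) = total_unit a a v w - scale ((z + of_nat n) / of_nat N) (v w)"
      proof -
        have "(\<Sum>c<N. \<Sum>d<N. scale (B $$ (c, d)) (total_unit c d v w)) =
          (\<Sum>c<N. \<Sum>d<N. scale (matrix_unit N a a $$ (c, d)) (total_unit c d v w)) - (\<Sum>c<N. \<Sum>d<N. if d = c then scale (1 / of_nat N) (total_unit c c v w) else 0)"
          unfolding sum_subtractf[symmetric] by (intro sum.cong refl) (auto simp: A scale_left_diff_distrib simp del: of_nat_add)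
        also have "\<dots> = total_unit a a v w - scale (1 / of_nat N) (\<Sum>c<N. total_unit c c v w)"
          unfolding unit_sum[OF a a] by (simp add: scale_sum_right)
        finally show ?thesis unfolding sum_total_diag[OF w] by simp
      qed
      ultimately show ?thesis unfolding ch using True by (simp add: scale_left_distrib algebra_simps)
    qed
  qed
qed

end

lemma sum_fun_apply: "(\<Sum>x\<in>X. F x) w = (\<Sum>x\<in>X. F x w)" for F :: "'a \<Rightarrow> 'b \<Rightarrow> 'c::comm_monoid_add"
  by (induction X rule: infinite_finite_induct) simp_all

section \<open>Agreement with the prescribed operators\<close>

context efm_setup
begin

text \<open>The common share (1 + n)/N cancels in the difference of eigenvalues, leaving - \<mu>(p +
  q); the block sizes contribute p - q.\<close>

lemma kappa_eq: "G.kappa = efm_kappa p q \<mu>"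
proof -
  have "{a. a < N \<and> (a < p) = True} = {..<p}" "{a. a < N \<and> (a < p) = False} = {p..<N}" by auto
  then show ?thesis
    by (simp add: G.kappa_def eigenvalue_def efm_kappa_def algebra_simps)
qed

lemma gam_supported: "f \<in> supported G.MI \<Longrightarrow> G.gam k f \<in> supported G.MI"
  by (simp add: supported_def G.gam_def G.weight_def)

lemma gamma_op_eq:
  assumes f: "f \<in> supported G.MI" and k: "k \<in> G.V"
  shows "gamma_op n p q scale k f = G.gam k f"
proof
  fix w
  show "gamma_op n p q scale k f w = G.gam k f w"
  proof (cases "w \<in> G.MI")
    case True
    then have wk: "w k < N" using k by (rule G.MI_lt)
    have "gamma_op n p q scale k f w = (\<Sum>j<N. scale (block_diag (1\<^sub>m p) (- 1\<^sub>m q) $$ (w k, j)) (f (w(k := j))))"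
      using True by (simp add: gamma_op_def on_factor_def multi_indices_eq)
    also have "\<dots> = (\<Sum>j<N. if j = w k then scale (G.sg (w k < p)) (f w) else 0)"
      by (rule sum.cong) (use wk in \<open>auto simp: block_diag_def G.sg_def\<close>)
    finally show ?thesis using wk by (simp add: G.gam_def G.weight_def)
  next
    case False
    then show ?thesis using f
      by (simp add: gamma_op_def on_factor_def multi_indices_eq G.gam_def G.weight_def supported_def)
  qed
qed

lemma exchange_eq: "exchange k l f = G.permute (transpose k l) f"
  by (simp add: exchange_def G.permute_def)

lemma s_op_eq:
  assumes "f \<in> supported G.MI" "i \<in> G.V"
  shows "s_op n p q scale i f = G.S i f"
  using assms by (auto simp: s_op_def G.S_def gamma_op_eq exchange_eq)

lemma S_supported:
  assumes "f \<in> supported G.MI" "i \<in> G.V"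
  shows "G.S i f \<in> supported G.MI"
proof (cases "i = n")
  case True
  then show ?thesis using assms by (simp add: G.S_def gam_supported)
next
  case False
  then have "Suc i \<in> G.V" using assms(2) by (simp add: G.in_V)
  then show ?thesis using False assms G.MI_transpose_iff[of i "Suc i"]
    by (simp add: G.S_def G.permute_def supported_def)
qed

text \<open>The unit E_t^s on factor 1 selects t = w(1) and replaces that label by s; off the
  diagonal the shifted and the original action coincide.\<close>

lemma matrix_unit_hop:
  assumes w: "w \<in> G.MI"
  shows "(\<Sum>(s, t)\<in>{..<p} \<times> {p..<p+q} \<union> {p..<p+q} \<times> {..<p}.
      \<rho> (matrix_unit N s t) (on_factor N n scale 1 (matrix_unit N t s) f w)) = G.hop 1 f w"
proof -
  note One_nat_def [simp del]
  have w1: "w 1 < N" using w by (rule G.MI_lt) (use n in \<open>simp add: G.in_V\<close>)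
  have P: "{..<p} \<times> {p..<p+q} \<union> {p..<p+q} \<times> {..<p} = {x \<in> {..<N} \<times> {..<N}. (fst x < p) \<noteq> (snd x < p)}"
    by (auto simp: set_eq_iff)
  have factor: "on_factor N n scale 1 (matrix_unit N t s) f w = (if t = w 1 then f (w(1 := s)) else 0)"
    if "s < N" "t < N" for s t
  proof -
    have "on_factor N n scale 1 (matrix_unit N t s) f w = (\<Sum>j<N. if j = s then if t = w 1 then f (w(1 := s)) else 0 else 0)"
      unfolding on_factor_def multi_indices_eq if_P[OF w] by (rule sum.cong) (use w1 that in auto)
    then show ?thesis using that by simp
  qed
  have "(\<Sum>(s, t)\<in>{..<p} \<times> {p..<p+q} \<union> {p..<p+q} \<times> {..<p}.
      \<rho> (matrix_unit N s t) (on_factor N n scale 1 (matrix_unit N t s) f w)) =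
    (\<Sum>s<N. \<Sum>t<N. if (s < p) \<noteq> (t < p) then \<rho> (matrix_unit N s t) (on_factor N n scale 1 (matrix_unit N t s) f w) else 0)"
    unfolding P by (subst sum.inter_filter) (auto simp: sum_pairs case_prod_beta)
  also have "\<dots> = (\<Sum>s<N. \<Sum>t<N. if t = w 1 then if (s < p) \<noteq> (w 1 < p) then unit_op s (w 1) (f (w(1 := s))) else 0 else 0)"
    by (intro sum.cong refl) (auto simp: factor rho_linear unit_op_def simp del: One_nat_def)
  also have "\<dots> = G.hop 1 f w"
    using w w1 by (simp add: G.hop_def)
  finally show ?thesis .
qed

lemma y1_op_eq:
  assumes f: "f \<in> supported G.MI"
  shows "y1_op n p q \<mu> scale \<rho> f = G.Y (efm_kappa p q \<mu>) 1 f"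
proof
  fix w
  note One_nat_def [simp del]
  have V1: "1 \<in> G.V" using n by (simp add: G.in_V)
  have hop: "(\<Sum>(s, t)\<in>{..<p} \<times> {p..<p+q} \<union> {p..<p+q} \<times> {..<p}.
      on_zeroth (\<rho> (matrix_unit N s t)) (on_factor N n scale 1 (matrix_unit N t s) f)) w = G.hop 1 f w"
  proof (cases "w \<in> G.MI")
    case True
    show ?thesis unfolding matrix_unit_hop[OF True, symmetric]
      by (simp add: sum_fun_apply on_zeroth_def case_prod_beta)
  next
    case False
    then show ?thesis
      by (simp add: sum_fun_apply on_zeroth_def case_prod_beta on_factor_def multi_indices_eq rho_linear G.hop_outside)
  qed
  \<comment> \<open>Half of s_1l plus half of s_1l gamma_1 gamma_l is the exchange restricted to
    equal blocks.\<close>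
  have swaps: "scale (1/2) (\<Sum>l\<in>{2..n}. exchange 1 l f w)
      + scale (1/2) (\<Sum>l\<in>{2..n}. exchange 1 l (gamma_op n p q scale 1 (gamma_op n p q scale l f)) w)
    = (\<Sum>l\<in>{1<..n}. G.same_swap 1 l f w)"
  proof -
    have "scale (1/2) (exchange 1 l f w) + scale (1/2) (exchange 1 l (gamma_op n p q scale 1 (gamma_op n p q scale l f)) w)
        = G.same_swap 1 l f w" if "l \<in> {2..n}" for l
    proof -
      have "l \<in> G.V" using that by (simp add: G.in_V)
      then have "gamma_op n p q scale 1 (gamma_op n p q scale l f) = G.gam 1 (G.gam l f)"
        using f V1 by (simp add: gamma_op_eq gam_supported)
      then show ?thesis
        by (simp add: exchange_def G.gam_def G.weight_def G.same_swap_def G.sg_def flip: scale_left_distrib)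
    qed
    moreover have "{1<..n} = {2..n}" by auto
    ultimately show ?thesis by (simp add: scale_sum_right flip: sum.distrib)
  qed
  show "y1_op n p q \<mu> scale \<rho> f w = G.Y (efm_kappa p q \<mu>) 1 f w"
  proof -
    have "y1_op n p q \<mu> scale \<rho> f w = - G.hop 1 f w + scale (efm_kappa p q \<mu> / 2) (G.gam 1 f w)
        + (scale (1/2) (\<Sum>l\<in>{2..n}. exchange 1 l f w)
        + scale (1/2) (\<Sum>l\<in>{2..n}. exchange 1 l (gamma_op n p q scale 1 (gamma_op n p q scale l f)) w))"
      unfolding hop[symmetric] y1_op_def tscale_def gamma_op_eq[OF f V1]
      by (simp add: sum_fun_apply add.assoc)
    then show ?thesis unfolding swaps by (simp add: G.Y_def)
  qed
qed

text \<open>The recursion defining y_k is satisfied by the closed form. The intermediate tensors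
  must be supported on valid indices, where the generators can be compared.\<close>

lemma y_op_eq:
  assumes "f \<in> supported G.MI" "Suc k \<le> n"
  shows "y_op n p q \<mu> scale \<rho> (Suc k) f = G.Y (efm_kappa p q \<mu>) (Suc k) f"
  using assms
proof (induction k arbitrary: f)
  case 0
  then show ?case using y1_op_eq by simp
next
  case (Suc k)
  let ?Y = "G.Y (efm_kappa p q \<mu>)"
  have k: "Suc k \<in> G.V" "1 \<le> Suc k" "Suc k < n" using Suc.prems by (simp_all add: G.in_V)
  have Sf: "G.S (Suc k) f \<in> supported G.MI" by (rule S_supported[OF Suc.prems(1) k(1)])
  have YSf: "?Y (Suc k) (G.S (Suc k) f) \<in> supported G.MI"
    using G.Y_outside[OF Sf k(1)] by (simp add: supported_def)
  have "y_op n p q \<mu> scale \<rho> (Suc (Suc k)) f = G.S (Suc k) (?Y (Suc k) (G.S (Suc k) f)) - G.S (Suc k) f"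
    using Suc.IH[OF Sf] k by (simp add: s_op_eq[OF Suc.prems(1) k(1)] s_op_eq[OF YSf k(1)])
  also have "\<dots> = ?Y (Suc (Suc k)) f"
    unfolding G.Y_Suc_S[OF k(2,3)] by (simp add: fun_eq_iff)
  finally show ?case .
qed

definition gen_op :: "daha_gen \<Rightarrow> 'm tensor \<Rightarrow> 'm tensor" where
  "gen_op g = (case g of GenS i \<Rightarrow> G.S i | GenY i \<Rightarrow> G.Y G.kappa i)"

lemma daha_gens_cases:
  assumes "g \<in> daha_gens n"
  obtains i where "i \<in> G.V" "g = GenS i" | i where "i \<in> G.V" "g = GenY i"
  using assms by (auto simp: daha_gens_def G.V_def)

sublocale R: generator_action "tscale scale" "daha_gens n" G.invariants gen_op
proof (rule generator_action.intro[OF vector_space_tscale], rule generator_action_axioms.intro)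
  interpret T: vector_space "tscale scale" by (rule vector_space_tscale)
  show "module.subspace (tscale scale) G.invariants"
    unfolding T.subspace_def
    using G.zero_invariant G.add_invariant G.scale_invariant
    by (auto simp: zero_fun_def plus_fun_def tscale_def)
next
  fix g v w c assume g: "g \<in> daha_gens n" and v: "v \<in> G.invariants"
  show "gen_op g v \<in> G.invariants"
    using g by (rule daha_gens_cases) (simp_all add: gen_op_def G.S_invariant G.Y_invariant v)
  show "gen_op g (tscale scale c v) = tscale scale c (gen_op g v)"
    using g by (rule daha_gens_cases)
      (simp_all add: gen_op_def tscale_def fun_eq_iff G.S_def G.gam_def G.weight_def G.permute_def scale_left_commute G.Y_linear)
  show "gen_op g (v + w) = gen_op g v + gen_op g w"
    using g by (rule daha_gens_cases)
      (simp_all add: gen_op_def plus_fun_def fun_eq_iff G.S_def G.gam_def G.weight_def G.permute_def scale_right_distrib G.Y_linear)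
qed

text \<open>After evaluation each family of relations is one of the operator identities for
  \<open>S\<close> and \<open>Y\<close>; invariance of \<open>v\<close> enters for the commuting y
  operators.\<close>

lemma relation_holds:
  assumes r: "r \<in> daha_relations n 1 G.kappa" and v: "v \<in> G.invariants"
  shows "R.evaluate r v = 0"
proof -
  let ?s = "\<lambda>i. letter (GenS i)" and ?y = "\<lambda>i. letter (GenY i)"
  have s: "GenS i \<in> daha_gens n" and y: "GenY i \<in> daha_gens n" if "1 \<le> i" "i \<le> n" for i
    using that by (auto simp: daha_gens_def)
  note ev = mult.assoc R.evaluate_diff R.evaluate_add R.evaluate_letter_mult R.evaluate_letter R.evaluate_const
    R.evaluate_one R.mult_closed R.letter_closed s y v gen_op_def
  note One_nat_def [simp del]
  from r show ?thesis
    unfolding daha_relations_def Let_def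
  proof (elim UnE)
    assume "r \<in> {?s i * ?s i - 1 |i. i \<in> {1..n}}"
    then show ?thesis by (auto simp: ev G.S_S)
  next
    assume "r \<in> {?s i * ?s (i + 1) * ?s i - ?s (i + 1) * ?s i * ?s (i + 1) |i. 1 \<le> i \<and> i + 2 \<le> n}"
    then obtain i where i: "1 \<le> i" "i + 2 \<le> n" and r: "r = ?s i * ?s (i + 1) * ?s i - ?s (i + 1) * ?s i * ?s (i + 1)"
      by blast
    show ?thesis unfolding r using i by (simp add: ev G.S_braid)
  next
    assume "r \<in> (if 2 \<le> n then {?s (n - 1) * ?s n * ?s (n - 1) * ?s n - ?s n * ?s (n - 1) * ?s n * ?s (n - 1)} else {})"
    then have n2: "2 \<le> n" and r: "r = ?s (n - 1) * ?s n * ?s (n - 1) * ?s n - ?s n * ?s (n - 1) * ?s n * ?s (n - 1)"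
      by (auto split: if_splits)
    have "1 \<le> n - 1" "n - 1 \<le> n" using n2 by auto
    then show ?thesis unfolding r using n G.S_braid_B[OF n2] by (simp add: ev)
  next
    assume "r \<in> {?s i * ?s j - ?s j * ?s i |i j. i \<in> {1..n} \<and> j \<in> {1..n} \<and> (i + 1 < j \<or> j + 1 < i)}"
    then obtain i j where i: "1 \<le> i" "i \<le> n" "1 \<le> j" "j \<le> n" "i + 1 < j \<or> j + 1 < i" and r: "r = ?s i * ?s j - ?s j * ?s i"
      by auto
    have "G.S i (G.S j v) = G.S j (G.S i v)" by (rule G.S_commute) (use i in \<open>simp_all add: G.in_V\<close>)
    then show ?thesis unfolding r using i by (simp add: ev)
  next
    assume "r \<in> {?y i * ?y j - ?y j * ?y i |i j. i \<in> {1..n} \<and> j \<in> {1..n}}"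
    then obtain i j where i: "1 \<le> i" "i \<le> n" "1 \<le> j" "j \<le> n" and r: "r = ?y i * ?y j - ?y j * ?y i"
      by auto
    have "G.Y G.kappa i (G.Y G.kappa j v) = G.Y G.kappa j (G.Y G.kappa i v)"
      by (rule G.Y_commute[OF v]) (use i in \<open>simp_all add: G.in_V\<close>)
    then show ?thesis unfolding r using i by (simp add: ev)
  next
    assume "r \<in> {?s i * ?y j - ?y j * ?s i |i j. i \<in> {1..n} \<and> j \<in> {1..n} \<and> j \<noteq> i \<and> j \<noteq> i + 1}"
    then obtain i j where i: "1 \<le> i" "i \<le> n" "1 \<le> j" "j \<le> n" "j \<noteq> i" "j \<noteq> i + 1" and r: "r = ?s i * ?y j - ?y j * ?s i"
      by auto
    have "G.S i (G.Y G.kappa j v) = G.Y G.kappa j (G.S i v)"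
      by (rule G.S_Y_commute) (use i in \<open>simp_all add: G.in_V\<close>)
    then show ?thesis unfolding r using i by (simp add: ev)
  next
    assume "r \<in> {?s i * ?y i - ?y (i + 1) * ?s i - const 1 |i. 1 \<le> i \<and> i + 1 \<le> n}"
    then obtain i where i: "1 \<le> i" "i + 1 \<le> n" and r: "r = ?s i * ?y i - ?y (i + 1) * ?s i - const 1"
      by blast
    have "G.S i (G.Y G.kappa i v) - G.Y G.kappa (i + 1) (G.S i v) = v"
      using G.S_Y_cross[OF i] by (simp add: fun_eq_iff)
    then show ?thesis unfolding r using i by (simp add: ev tscale_def)
  next
    assume "r \<in> {?s n * ?y n + ?y n * ?s n - const G.kappa}"
    moreover have "G.S n (G.Y G.kappa n v) + G.Y G.kappa n (G.S n v) = tscale scale G.kappa v"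
      using G.S_Y_n[OF n] by (simp add: fun_eq_iff tscale_def)
    ultimately show ?thesis using n by (simp add: ev)
  qed
qed

text \<open>A subspace stable under the algebra is stable under the classes of the generators, which
  already makes it trivial.\<close>

theorem EFM_irreducible:
  assumes nz: "EFM n p q \<mu> scale \<rho> \<noteq> {0}"
  shows "\<exists>\<Phi>. EFM_representation n p q \<mu> scale \<rho> \<Phi> \<and>
    irreducible_under (tscale scale) (EFM n p q \<mu> scale \<rho>) (\<Phi> ` carrier (daha n 1 (efm_kappa p q \<mu>)))"
proof -
  let ?R = "daha_relations n 1 G.kappa"
  from R.presented_representation[OF daha_relations_closed[OF n] relation_holds]
  obtain \<Phi> where rep: "algebra_representation (tscale scale) (daha n 1 G.kappa) (\<lambda>c. daha_class n 1 G.kappa (const c)) G.invariants \<Phi>"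
    and gen: "\<And>g v. g \<in> daha_gens n \<Longrightarrow> v \<in> G.invariants \<Longrightarrow> \<Phi> (daha_class n 1 G.kappa (letter g)) v = gen_op g v"
    unfolding daha_def daha_class_def by blast
  have s: "\<Phi> (daha_class n 1 G.kappa (letter (GenS i))) v = G.S i v"
    and y: "\<Phi> (daha_class n 1 G.kappa (letter (GenY i))) v = G.Y G.kappa i v"
    if "i \<in> G.V" "v \<in> G.invariants" for i v
    using gen[of "GenS i" v] gen[of "GenY i" v] that by (auto simp: daha_gens_def gen_op_def G.V_def)
  have carrier: "daha_class n 1 G.kappa (letter g) \<in> carrier (daha n 1 G.kappa)" if "g \<in> daha_gens n" for g
    using R.letter_closed[OF that] unfolding daha_def daha_class_def FactRing_def A_RCOSETS_def' by auto
  have "EFM_representation n p q \<mu> scale \<rho> \<Phi>"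
    unfolding EFM_representation_def EFM_eq_invariants kappa_eq[symmetric]
  proof (intro conjI ballI rep)
    fix i v assume i: "i \<in> {1..n}" and v: "v \<in> G.invariants"
    have iV: "i \<in> G.V" and i': "Suc (i - 1) = i" "i \<le> n" using i by (auto simp: G.V_def)
    note f = G.invariants_supported[OF v]
    show "\<Phi> (daha_class n 1 G.kappa (letter (GenS i))) v = s_op n p q scale i v"
      by (simp add: s[OF iV v] s_op_eq[OF f iV])
    show "\<Phi> (daha_class n 1 G.kappa (letter (GenY i))) v = y_op n p q \<mu> scale \<rho> i v"
      using y_op_eq[OF f, of "i - 1"] unfolding i' y[OF iV v] kappa_eq[symmetric] using i'(2) by simp
  qed
  moreover have "irreducible_under (tscale scale) (EFM n p q \<mu> scale \<rho>) (\<Phi> ` carrier (daha n 1 (efm_kappa p q \<mu>)))"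
    unfolding irreducible_under_def
  proof (intro conjI nz allI impI, elim conjE)
    fix W assume W: "module.subspace (tscale scale) W" "W \<subseteq> EFM n p q \<mu> scale \<rho>"
      and st: "\<forall>t\<in>\<Phi> ` carrier (daha n 1 (efm_kappa p q \<mu>)). t ` W \<subseteq> W"
    have WI: "W \<subseteq> G.invariants" using W(2) by (simp add: EFM_eq_invariants)
    have stable: "\<Phi> (daha_class n 1 G.kappa (letter g)) f \<in> W" if "g \<in> daha_gens n" "f \<in> W" for g f
      using st carrier[OF that(1)] that(2) unfolding kappa_eq by blast
    show "W = {0} \<or> W = EFM n p q \<mu> scale \<rho>"
      unfolding EFM_eq_invariants
    proof (rule G.generator_stable_trivial[OF n W(1) WI])
      fix f i assume f: "f \<in> W" and i: "i \<in> G.V"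
      have "GenS i \<in> daha_gens n" "GenY i \<in> daha_gens n" using i by (auto simp: daha_gens_def G.V_def)
      then show "G.S i f \<in> W" "G.Y G.kappa i f \<in> W"
        using stable[of _ f] f s[OF i, of f] y[OF i, of f] WI by fastforce+
    qed
  qed
  ultimately show ?thesis by blast
qed

end

theorem theorem9p2:
  fixes n p q :: nat and \<mu> :: complex
    and scale :: "complex \<Rightarrow> 'm::ab_group_add \<Rightarrow> 'm"
    and \<rho> :: "complex mat \<Rightarrow> 'm \<Rightarrow> 'm"
  assumes "n \<ge> 1" and "p \<ge> 1" and "q \<ge> 1"
    and "gl_module (p + q) scale \<rho>"
    and "finite_dimensional scale"
    and "irreducible_under scale UNIV (\<rho> ` carrier_mat (p + q) (p + q))"
    and "EFM n p q \<mu> scale \<rho> \<noteq> {0}"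
  shows "\<exists>\<Phi>. EFM_representation n p q \<mu> scale \<rho> \<Phi> \<and>
    irreducible_under (tscale scale) (EFM n p q \<mu> scale \<rho>)
      (\<Phi> ` carrier (daha n 1 (efm_kappa p q \<mu>)))"
proof -
  let ?N = "p + q"
  interpret gl_module ?N scale \<rho> by (rule assms(4))
  \<comment> \<open>The identity matrix is central, so Schur's lemma gives the scalar on which the
    shift rests.\<close>
  have "\<exists>z. \<forall>m. \<rho> (1\<^sub>m ?N) m = scale z m"
  proof (rule schur[OF assms(5,6) _ linear_vector[OF one_carrier_mat]])
    fix t m assume "t \<in> \<rho> ` carrier_mat ?N ?N"
    then obtain A where A: "A \<in> carrier_mat ?N ?N" "t = \<rho> A" by blast
    have "A * 1\<^sub>m ?N - 1\<^sub>m ?N * A = 0\<^sub>m ?N ?N" using A(1) by auto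
    then show "t (\<rho> (1\<^sub>m ?N) m) = \<rho> (1\<^sub>m ?N) (t m)"
      using bracket[OF A(1) one_carrier_mat, of m] by (simp add: A(2) rho_zero)
  next
    fix t assume "t \<in> \<rho> ` carrier_mat ?N ?N"
    then show "Vector_Spaces.linear scale scale t" using linear_vector by blast
  qed
  then obtain z where z: "\<rho> (1\<^sub>m ?N) m = scale z m" for m by blast
  interpret efm_setup p q scale \<rho> n \<mu> z
    by (rule efm_setup.intro[OF assms(4)], rule efm_setup_axioms.intro) (use assms z in simp_all)
  show ?thesis by (rule EFM_irreducible[OF assms(7)])
qed

end
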